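(* The dimension of $H^0(Y_t,S^m\Omega^1_{Y_t}\otimes K_{Y_t})$ is not necessarily invariant in a family $Y_t$ of smooth projective varieties: there exist a smooth family of smooth projective varieties $Y_t$, $t\in\Delta$, over the disc and an integer $m$ such that $\dim H^0(Y_t,S^m\Omega^1_{Y_t}\otimes K_{Y_t})$ is not constant in $t$.
   Context: Varieties are over $\mathbb{C}$; $K_{Y}$ is the canonical line bundle and $S^m$ is the $m$-th symmetric power. *)

theory Defs
  imports
    "HOL-Analysis.Analysis"
    "HOL-Library.Function_Algebras"
    "Jordan_Normal_Form.Determinant"
begin

section \<open>Holomorphic functions of several variables\<close>

text \<open>Dimensions have to be quantified over, so \<open>\<complex>\<^sup>n\<close> is the set of sequences vanishing from index
  \<open>n\<close> on (cf. \<^const>\<open>Euclidean_space\<close>). In particular \<open>\<complex>\<^sup>k \<subseteq> \<complex>\<^sup>n\<close> for \<open>k \<le> n\<close>, as the subspace where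
  the last \<open>n - k\<close> coordinates vanish. The topology is that of the function type, i.e. the
  product topology.\<close>

definition Cn :: "nat \<Rightarrow> (nat \<Rightarrow> complex) set" where
  "Cn n = {z. \<forall>i\<ge>n. z i = 0}"

definition partial :: "nat \<Rightarrow> ((nat \<Rightarrow> complex) \<Rightarrow> complex) \<Rightarrow> (nat \<Rightarrow> complex) \<Rightarrow> complex" where
  "partial i f z = deriv (\<lambda>w. f (z(i := w))) (z i)"

text \<open>To be used for \<open>U\<close> open in \<open>\<complex>\<^sup>n\<close>.\<close>

definition holo_on :: "nat \<Rightarrow> ((nat \<Rightarrow> complex) \<Rightarrow> complex) \<Rightarrow> (nat \<Rightarrow> complex) set \<Rightarrow> bool" where
  "holo_on n f U \<longleftrightarrow> continuous_on U f \<and>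
     (\<forall>z\<in>U. \<forall>i<n. (\<lambda>w. f (z(i := w))) field_differentiable at (z i))"


section \<open>Complex manifolds\<close>

text \<open>The second component of a chart is only relevant on its first component.\<close>

type_synonym 'a chart = "'a set \<times> ('a \<Rightarrow> nat \<Rightarrow> complex)"

abbreviation chart_dom :: "'a chart \<Rightarrow> 'a set" where "chart_dom \<equiv> fst"
abbreviation coord :: "'a chart \<Rightarrow> 'a \<Rightarrow> nat \<Rightarrow> complex" where "coord \<equiv> snd"

definition param :: "'a chart \<Rightarrow> (nat \<Rightarrow> complex) \<Rightarrow> 'a" where
  "param c = inv_into (chart_dom c) (coord c)"

definition transition :: "'a chart \<Rightarrow> 'a chart \<Rightarrow> (nat \<Rightarrow> complex) \<Rightarrow> nat \<Rightarrow> complex" where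
  "transition c d z = coord d (param c z)"

definition is_chart :: "nat \<Rightarrow> 'a topology \<Rightarrow> 'a chart \<Rightarrow> bool" where
  "is_chart n X c \<longleftrightarrow> openin X (chart_dom c) \<and>
     openin (top_of_set (Cn n)) (coord c ` chart_dom c) \<and>
     homeomorphic_map (subtopology X (chart_dom c)) (top_of_set (coord c ` chart_dom c)) (coord c)"

definition compatible :: "nat \<Rightarrow> 'a chart \<Rightarrow> 'a chart \<Rightarrow> bool" where
  "compatible n c d \<longleftrightarrow>
     (\<forall>i<n. holo_on n (\<lambda>z. transition c d z i) (coord c ` (chart_dom c \<inter> chart_dom d)) \<and>
            holo_on n (\<lambda>z. transition d c z i) (coord d ` (chart_dom c \<inter> chart_dom d)))"

record 'a manifold =
  mdim :: nat
  mtop :: "'a topology"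
  atlas :: "'a chart set"

definition complex_manifold :: "'a manifold \<Rightarrow> bool" where
  "complex_manifold M \<longleftrightarrow>
     Hausdorff_space (mtop M) \<and> second_countable (mtop M) \<and>
     (\<forall>c\<in>atlas M. is_chart (mdim M) (mtop M) c) \<and>
     topspace (mtop M) = (\<Union>c\<in>atlas M. chart_dom c) \<and>
     (\<forall>c\<in>atlas M. \<forall>d\<in>atlas M. compatible (mdim M) c d)"

definition maximal_atlas :: "'a manifold \<Rightarrow> 'a chart set" where
  "maximal_atlas M =
     {c. is_chart (mdim M) (mtop M) c \<and> (\<forall>d\<in>atlas M. compatible (mdim M) c d)}"

definition holo_map :: "'a manifold \<Rightarrow> 'b manifold \<Rightarrow> ('a \<Rightarrow> 'b) \<Rightarrow> bool" where
  "holo_map M N f \<longleftrightarrow> continuous_map (mtop M) (mtop N) f \<and>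
     (\<forall>c\<in>atlas M. \<forall>d\<in>atlas N. \<forall>i<mdim N.
        holo_on (mdim M) (\<lambda>z. coord d (f (param c z)) i)
          (coord c ` {x \<in> chart_dom c. f x \<in> chart_dom d}))"

definition biholomorphic :: "'a manifold \<Rightarrow> 'b manifold \<Rightarrow> bool" where
  "biholomorphic M N \<longleftrightarrow> mdim M = mdim N \<and>
     (\<exists>f g. homeomorphic_maps (mtop M) (mtop N) f g \<and> holo_map M N f \<and> holo_map N M g)"

text \<open>The manifold structure of a \<open>k\<close>-dimensional submanifold \<open>S\<close> of \<open>M\<close>: its charts are the
  restrictions of those charts of \<open>M\<close> which flatten \<open>S\<close> to \<open>\<complex>\<^sup>k\<close>.\<close>

definition restrict_manifold :: "'a manifold \<Rightarrow> nat \<Rightarrow> 'a set \<Rightarrow> 'a manifold" where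
  "restrict_manifold M k S =
     \<lparr>mdim = k, mtop = subtopology (mtop M) S,
      atlas = {(U \<inter> S, \<phi>) |U \<phi>. (U, \<phi>) \<in> maximal_atlas M \<and> \<phi> ` (U \<inter> S) = \<phi> ` U \<inter> Cn k}\<rparr>"

definition complex_submanifold :: "'a manifold \<Rightarrow> nat \<Rightarrow> 'a set \<Rightarrow> bool" where
  "complex_submanifold M k S \<longleftrightarrow> k \<le> mdim M \<and> S \<subseteq> topspace (mtop M) \<and>
     S \<subseteq> (\<Union>c\<in>atlas (restrict_manifold M k S). chart_dom c)"


section \<open>Smooth projective varieties\<close>

definition multi_indices :: "nat \<Rightarrow> nat \<Rightarrow> (nat \<Rightarrow> nat) set" where
  "multi_indices n d = {\<alpha>. (\<forall>i\<ge>n. \<alpha> i = 0) \<and> (\<Sum>i<n. \<alpha> i) = d}"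

definition monomial :: "nat \<Rightarrow> (nat \<Rightarrow> nat) \<Rightarrow> (nat \<Rightarrow> complex) \<Rightarrow> complex" where
  "monomial n \<alpha> v = (\<Prod>i<n. v i ^ \<alpha> i)"

definition homogeneous_poly :: "nat \<Rightarrow> nat \<Rightarrow> ((nat \<Rightarrow> complex) \<Rightarrow> complex) \<Rightarrow> bool" where
  "homogeneous_poly n d p \<longleftrightarrow>
     (\<exists>a. \<forall>v. p v = (\<Sum>\<alpha>\<in>multi_indices n d. a \<alpha> * monomial n \<alpha> v))"

text \<open>A point of \<open>\<pp>\<^sup>N\<close> is an orbit of \<open>\<complex>\<^sup>*\<close> on \<open>\<complex>\<^bsup>N+1\<^esup> - 0\<close>, and \<open>\<pp>\<^sup>N\<close> carries the quotient
  topology.\<close>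

definition proj_point :: "(nat \<Rightarrow> complex) \<Rightarrow> (nat \<Rightarrow> complex) set" where
  "proj_point v = {\<lambda>i. c * v i |c. c \<noteq> 0}"

definition proj_points :: "nat \<Rightarrow> (nat \<Rightarrow> complex) set set" where
  "proj_points N = proj_point ` (Cn (Suc N) - {0})"

definition proj_topology :: "nat \<Rightarrow> (nat \<Rightarrow> complex) set topology" where
  "proj_topology N = topology (\<lambda>W. W \<subseteq> proj_points N \<and>
     openin (top_of_set (Cn (Suc N) - {0})) {v \<in> Cn (Suc N) - {0}. proj_point v \<in> W})"

lemma openin_proj_topology:
  "openin (proj_topology N) W \<longleftrightarrow> W \<subseteq> proj_points N \<and>
     openin (top_of_set (Cn (Suc N) - {0})) {v \<in> Cn (Suc N) - {0}. proj_point v \<in> W}"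
proof -
  let ?X = "Cn (Suc N) - {0}"
  let ?Q = "\<lambda>W. W \<subseteq> proj_points N \<and> openin (top_of_set ?X) {v \<in> ?X. proj_point v \<in> W}"
  have Int: "?Q (S \<inter> T)" if "?Q S" "?Q T" for S T
  proof -
    have "{v \<in> ?X. proj_point v \<in> S \<inter> T} =
        {v \<in> ?X. proj_point v \<in> S} \<inter> {v \<in> ?X. proj_point v \<in> T}" by blast
    moreover have "openin (top_of_set ?X)
        ({v \<in> ?X. proj_point v \<in> S} \<inter> {v \<in> ?X. proj_point v \<in> T})"
      using that by (intro openin_Int) auto
    ultimately show ?thesis using that by auto
  qed
  have Union: "?Q (\<Union>\<K>)" if "\<forall>K\<in>\<K>. ?Q K" for \<K>
  proof -
    have "{v \<in> ?X. proj_point v \<in> \<Union>\<K>} = (\<Union>K\<in>\<K>. {v \<in> ?X. proj_point v \<in> K})" by blast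
    moreover have "openin (top_of_set ?X) (\<Union>K\<in>\<K>. {v \<in> ?X. proj_point v \<in> K})"
      using that by (intro openin_Union) auto
    moreover have "\<Union>\<K> \<subseteq> proj_points N" using that by blast
    ultimately show ?thesis by simp
  qed
  have "istopology ?Q"
    unfolding istopology_def
  proof (rule conjI)
    show "\<forall>S T. ?Q S \<longrightarrow> ?Q T \<longrightarrow> ?Q (S \<inter> T)"
      by (intro allI impI) (rule Int)
    show "\<forall>\<K>. (\<forall>K\<in>\<K>. ?Q K) \<longrightarrow> ?Q (\<Union>\<K>)"
      by (intro allI impI) (rule Union)
  qed
  from topology_inverse'[OF this] show ?thesis
    unfolding proj_topology_def by (rule fun_cong)
qed

text \<open>The affine chart \<open>[v\<^sub>0 : \<dots> : v\<^sub>N] \<mapsto> (v\<^sub>0/v\<^sub>i, \<dots>, v\<^sub>N/v\<^sub>i)\<close> with the \<open>i\<close>-th entry omitted.\<close>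

definition affine_chart :: "nat \<Rightarrow> nat \<Rightarrow> (nat \<Rightarrow> complex) set chart" where
  "affine_chart N i =
     ({L \<in> proj_points N. \<exists>v\<in>L. v i \<noteq> 0},
      \<lambda>L j. let v = (THE v. v \<in> L \<and> v i = 1) in if j < i then v j else v (Suc j))"

definition proj_space :: "nat \<Rightarrow> (nat \<Rightarrow> complex) set manifold" where
  "proj_space N = \<lparr>mdim = N, mtop = proj_topology N, atlas = affine_chart N ` {..N}\<rparr>"

definition proj_algebraic :: "nat \<Rightarrow> (nat \<Rightarrow> complex) set set \<Rightarrow> bool" where
  "proj_algebraic N S \<longleftrightarrow>
     (\<exists>F. (\<forall>p\<in>F. \<exists>d. homogeneous_poly (Suc N) d p) \<and>
          S = {L \<in> proj_points N. \<forall>p\<in>F. \<forall>v\<in>L. p v = 0})"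

text \<open>For a smooth variety, connected and irreducible are the same.\<close>

definition smooth_projective_variety :: "'a manifold \<Rightarrow> bool" where
  "smooth_projective_variety X \<longleftrightarrow> complex_manifold X \<and>
     (\<exists>N S. S \<noteq> {} \<and> proj_algebraic N S \<and> connectedin (mtop (proj_space N)) S \<and>
        complex_submanifold (proj_space N) (mdim X) S \<and>
        biholomorphic X (restrict_manifold (proj_space N) (mdim X) S))"


section \<open>Smooth families over the unit disc\<close>

definition holo_fun :: "'a manifold \<Rightarrow> ('a \<Rightarrow> complex) \<Rightarrow> bool" where
  "holo_fun M f \<longleftrightarrow> (\<forall>c\<in>atlas M. holo_on (mdim M) (\<lambda>z. f (param c z)) (coord c ` chart_dom c))"

definition submersive :: "'a manifold \<Rightarrow> ('a \<Rightarrow> complex) \<Rightarrow> bool" where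
  "submersive M f \<longleftrightarrow> (\<forall>c\<in>atlas M. \<forall>z\<in>coord c ` chart_dom c.
     \<exists>i<mdim M. partial i (\<lambda>w. f (param c w)) z \<noteq> 0)"

definition fibre :: "'a manifold \<Rightarrow> ('a \<Rightarrow> complex) \<Rightarrow> complex \<Rightarrow> 'a manifold" where
  "fibre M f t = restrict_manifold M (mdim M - 1) {x \<in> topspace (mtop M). f x = t}"

text \<open>A proper holomorphic submersion onto the disc. As complex manifolds are second countable, they
  have at most the cardinality of the continuum, so any type of points which is at least that large
  realises all families up to isomorphism.\<close>

definition smooth_projective_family :: "'a manifold \<Rightarrow> ('a \<Rightarrow> complex) \<Rightarrow> bool" where
  "smooth_projective_family Y \<pi> \<longleftrightarrow>
     complex_manifold Y \<and> holo_fun Y \<pi> \<and> submersive Y \<pi> \<and>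
     proper_map (mtop Y) (top_of_set (ball 0 1)) \<pi> \<and>
     (\<forall>t\<in>ball 0 1. smooth_projective_variety (fibre Y \<pi> t))"


section \<open>Global sections of \<open>S\<^sup>m\<Omega>\<^sup>1 \<otimes> K\<close>\<close>

definition jacobian :: "'a chart \<Rightarrow> 'a chart \<Rightarrow> (nat \<Rightarrow> complex) \<Rightarrow> nat \<Rightarrow> nat \<Rightarrow> complex" where
  "jacobian c d z i j = partial j (\<lambda>w. transition c d w i) z"

text \<open>A section is given by its local expressions
  \<open>(\<Sum>\<alpha>. a\<^sub>\<alpha>(z) dz\<^sup>\<alpha>) \<otimes> dz\<^sub>1 \<and> \<dots> \<and> dz\<^sub>n\<close> in all charts. The factor in \<open>S\<^sup>m\<Omega>\<^sup>1\<close> at \<open>z\<close> is viewed as the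
  homogeneous polynomial \<open>\<xi> \<mapsto> \<Sum>\<alpha>. a\<^sub>\<alpha>(z) \<xi>\<^sup>\<alpha>\<close> of degree \<open>m\<close> on the tangent space, \<open>dz\<^sub>i\<close> being the
  \<open>i\<close>-th coordinate of \<open>\<xi>\<close>. If \<open>h\<close> is the change of coordinates from \<open>z\<close> to \<open>w\<close>, then
  \<open>dw\<^sub>i\<close> pulls back to \<open>\<xi> \<mapsto> (Dh(z) \<xi>)\<^sub>i\<close> and \<open>dw\<^sub>1 \<and> \<dots> \<and> dw\<^sub>n\<close> to \<open>det Dh(z) dz\<^sub>1 \<and> \<dots> \<and> dz\<^sub>n\<close>.
  Values outside of the charts are set to \<open>0\<close>, so that equal sections are equal functions.\<close>

type_synonym 'a local_expressions =
  "'a chart \<Rightarrow> (nat \<Rightarrow> complex) \<Rightarrow> (nat \<Rightarrow> complex) \<Rightarrow> complex"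

definition H0_sym_cotangent_canonical :: "'a manifold \<Rightarrow> nat \<Rightarrow> 'a local_expressions set" where
  "H0_sym_cotangent_canonical M m = {s.
     (\<forall>c z. \<not> (c \<in> atlas M \<and> z \<in> coord c ` chart_dom c) \<longrightarrow> s c z = (\<lambda>\<xi>. 0)) \<and>
     (\<forall>c\<in>atlas M. \<exists>a.
        (\<forall>\<alpha>\<in>multi_indices (mdim M) m. holo_on (mdim M) (a \<alpha>) (coord c ` chart_dom c)) \<and>
        (\<forall>z\<in>coord c ` chart_dom c. \<forall>\<xi>.
           s c z \<xi> = (\<Sum>\<alpha>\<in>multi_indices (mdim M) m. a \<alpha> z * monomial (mdim M) \<alpha> \<xi>))) \<and>
     (\<forall>c\<in>atlas M. \<forall>d\<in>atlas M. \<forall>z\<in>coord c ` (chart_dom c \<inter> chart_dom d). \<forall>\<xi>.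
        s c z \<xi> =
          s d (transition c d z) (\<lambda>i. if i < mdim M then \<Sum>j<mdim M. jacobian c d z i j * \<xi> j else 0)
          * Determinant.det (Matrix.mat (mdim M) (mdim M) (\<lambda>(i, j). jacobian c d z i j)))}"

definition section_scale :: "complex \<Rightarrow> 'a local_expressions \<Rightarrow> 'a local_expressions" where
  "section_scale r s = (\<lambda>c z \<xi>. r * s c z \<xi>)"

lemma vector_space_section_scale: "vector_space section_scale"
  by unfold_locales (auto simp: section_scale_def fun_eq_iff algebra_simps)

lemma subspace_H0_sym_cotangent_canonical:
  "module.subspace section_scale (H0_sym_cotangent_canonical M m)"
proof -
  interpret vector_space section_scale by (rule vector_space_section_scale)
  let ?H = "H0_sym_cotangent_canonical M m" and ?n = "mdim M"
  show ?thesis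
  proof (rule subspaceI)
    show "0 \<in> ?H"
      by (auto simp: H0_sym_cotangent_canonical_def fun_eq_iff holo_on_def intro!: exI[of _ "\<lambda>_ _. 0"])
  next
    fix s t assume s: "s \<in> ?H" and t: "t \<in> ?H"
    have "\<exists>a. (\<forall>\<alpha>\<in>multi_indices ?n m. holo_on ?n (a \<alpha>) (coord c ` chart_dom c)) \<and>
        (\<forall>z\<in>coord c ` chart_dom c. \<forall>\<xi>.
           (s + t) c z \<xi> = (\<Sum>\<alpha>\<in>multi_indices ?n m. a \<alpha> z * monomial ?n \<alpha> \<xi>))"
      if c: "c \<in> atlas M" for c
    proof -
      from s c obtain a where
        "\<forall>\<alpha>\<in>multi_indices ?n m. holo_on ?n (a \<alpha>) (coord c ` chart_dom c)"
        "\<forall>z\<in>coord c ` chart_dom c. \<forall>\<xi>.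
           s c z \<xi> = (\<Sum>\<alpha>\<in>multi_indices ?n m. a \<alpha> z * monomial ?n \<alpha> \<xi>)"
        unfolding H0_sym_cotangent_canonical_def by blast
      moreover from t c obtain b where
        "\<forall>\<alpha>\<in>multi_indices ?n m. holo_on ?n (b \<alpha>) (coord c ` chart_dom c)"
        "\<forall>z\<in>coord c ` chart_dom c. \<forall>\<xi>.
           t c z \<xi> = (\<Sum>\<alpha>\<in>multi_indices ?n m. b \<alpha> z * monomial ?n \<alpha> \<xi>)"
        unfolding H0_sym_cotangent_canonical_def by blast
      ultimately show ?thesis
        by (intro exI[of _ "\<lambda>\<alpha> z. a \<alpha> z + b \<alpha> z"])
          (auto simp: holo_on_def distrib_right sum.distrib
            intro!: continuous_on_add field_differentiable_add)
    qed
    with s t show "s + t \<in> ?H"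
      unfolding H0_sym_cotangent_canonical_def by (simp add: distrib_right fun_eq_iff)
  next
    fix r s assume s: "s \<in> ?H"
    have "\<exists>a. (\<forall>\<alpha>\<in>multi_indices ?n m. holo_on ?n (a \<alpha>) (coord c ` chart_dom c)) \<and>
        (\<forall>z\<in>coord c ` chart_dom c. \<forall>\<xi>.
           section_scale r s c z \<xi> = (\<Sum>\<alpha>\<in>multi_indices ?n m. a \<alpha> z * monomial ?n \<alpha> \<xi>))"
      if c: "c \<in> atlas M" for c
    proof -
      from s c obtain a where
        "\<forall>\<alpha>\<in>multi_indices ?n m. holo_on ?n (a \<alpha>) (coord c ` chart_dom c)"
        "\<forall>z\<in>coord c ` chart_dom c. \<forall>\<xi>.
           s c z \<xi> = (\<Sum>\<alpha>\<in>multi_indices ?n m. a \<alpha> z * monomial ?n \<alpha> \<xi>)"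
        unfolding H0_sym_cotangent_canonical_def by blast
      then show ?thesis
        by (intro exI[of _ "\<lambda>\<alpha> z. r * a \<alpha> z"])
          (auto simp: holo_on_def section_scale_def sum_distrib_left mult.assoc
            intro!: continuous_on_mult_left field_differentiable_mult)
    qed
    with s show "section_scale r s \<in> ?H"
      unfolding H0_sym_cotangent_canonical_def by (simp add: section_scale_def fun_eq_iff)
  qed
qed

text \<open>\<open>vector_space.dim\<close> is \<open>0\<close> for spaces of infinite dimension; this does not occur for compact
  \<open>M\<close>.\<close>

definition h0_sym_cotangent_canonical :: "'a manifold \<Rightarrow> nat \<Rightarrow> nat" where
  "h0_sym_cotangent_canonical M m =
     vector_space.dim section_scale (H0_sym_cotangent_canonical M m)"

end

theory Submission
  imports Defs "HOL-Complex_Analysis.Complex_Analysis"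
begin

text \<open>Let \<open>F(p, q, s) = p\<^sup>4 + q\<^sup>4 + 4s\<^sup>4 - 16s\<^sup>2pq + 8p\<^sup>2q\<^sup>2\<close> and \<open>\<tau> = 21t/20\<close>. The fibre over \<open>t\<close> is the
  surface in \<open>\<pp>\<^sup>1 \<times> \<pp>\<^sup>3\<close> with equations \<open>y\<^sup>4 = F(p, q, s)\<close> and \<open>a\<^sup>2q - \<tau>abs + b\<^sup>2p = 0\<close>. For \<open>p = 1\<close> and
  \<open>z = b/a\<close> it is the fourfold cover \<open>y\<^sup>4 = F(1, \<tau>zs - z\<^sup>2, s)\<close> of the \<open>(z, s)\<close>-plane, and a section of
  \<open>\<Omega>\<^sup>1 \<otimes> K\<close> is \<open>(A dz + B ds) \<otimes> dz \<and> ds\<close>. For \<open>\<tau> = 0\<close>, \<open>dz \<otimes> dz \<and> ds / y\<^sup>3\<close> is a section.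

  For \<open>\<tau> = 1\<close> and \<open>s = z + u\<close> the equation becomes \<open>y\<^sup>4 = 1 + z\<^sup>4u\<^sup>4 + 4(z\<^sup>4 + u\<^sup>4)\<close>. The fibres over
  \<open>z\<^sup>4 = -1/4\<close> and \<open>z\<^sup>4 = -4\<close> consist of lines, on which \<open>B\<close> vanishes by Liouville's theorem. Summing over the
  four roots \<open>y\<close> turns the growth of \<open>B\<close> on a curve of constant \<open>u\<close> into a degree bound for polynomials with
  these eight zeros, so \<open>B = 0\<close>; then \<open>A = 0\<close> in the same way, from the zeros of \<open>y\<close>.

  As \<open>h\<^sup>0\<close> is \<open>0\<close> by convention for a space of infinite dimension, the dimension for \<open>\<tau> = 0\<close> has to
  be shown to be finite: the same argument proves that a section is determined by its values over a finite grid.\<close>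

text \<open>The equation a^2 q - \<tau> a b s + b^2 p = 0 is quadratic in z = b/a, so the base of
  the cover is a double plane branched along \<tau>^2 s^2 = 4pq. For \<tau> \<noteq> 0 it is P^1 x
  P^1, with the two roots z, u as coordinates; for \<tau> = 0 it is the resolved quadric cone, the
  Hirzebruch surface F_2. Let H be the pullback of a line and f a fibre of z. The canonical class of
  the cover is H (as -2H + 3H), and dz embeds O(-2f) into \<Omega>^1. The class H - 2f contains the
  negative curve p = q = 0 of F_2 but has bidegree (-1, 1) on P^1 x P^1, whence the jump. F is 1 +
  z^4 u^4 + 4(z^4 + u^4) written in q = zu and s = z + u, for p = 1. So the branch curve meets each
  of eight fibres of z in a single point of multiplicity four, one fibre more than the degree 7 that
  bounds the traces. The factor 21/20 puts \<tau> = 1 at the interior point t = 20/21 of the disc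
  and keeps all fibres smooth.\<close>

section \<open>Holomorphic functions of several variables\<close>

abbreviation openC :: "nat \<Rightarrow> (nat \<Rightarrow> complex) set \<Rightarrow> bool" where
  "openC n U \<equiv> openin (top_of_set (Cn n)) U"

section \<open>Polydiscs and open subsets of \<open>Cn n\<close>\<close>

definition polydisc :: "nat \<Rightarrow> (nat \<Rightarrow> complex) \<Rightarrow> real \<Rightarrow> (nat \<Rightarrow> complex) set" where
  "polydisc n p r = {w \<in> Cn n. \<forall>i<n. dist (w i) (p i) < r}"

lemma continuous_on_coord:
  "continuous_on S g \<Longrightarrow> continuous_on S (\<lambda>x. g x i)" for g :: "'a::topological_space \<Rightarrow> 'b \<Rightarrow> 'c::topological_space"
  by (rule continuous_on_product_then_coordinatewise)

lemma continuous_on_fun_upd: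
  fixes g :: "'a::topological_space \<Rightarrow> 'b \<Rightarrow> 'c::topological_space"
  assumes "continuous_on S g" "continuous_on S h"
  shows "continuous_on S (\<lambda>x. (g x)(i := h x))"
proof (rule continuous_on_coordinatewise_then_product)
  show "continuous_on S (\<lambda>x. ((g x)(i := h x)) j)" for j
    using assms by (cases "j = i") (auto intro: continuous_on_coord)
qed

lemma openC_polydisc: "openC n (polydisc n p r)"
proof -
  have "open (\<Inter>i\<in>{..<n}. {w :: nat \<Rightarrow> complex. dist (w i) (p i) < r})"
    by (intro open_INT ballI open_Collect_less continuous_intros continuous_on_product_coordinates) auto
  moreover have "polydisc n p r = Cn n \<inter> (\<Inter>i\<in>{..<n}. {w. dist (w i) (p i) < r})"
    by (auto simp: polydisc_def)
  ultimately show ?thesis by (simp only: openin_open_Int)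
qed

lemma openC_subset: "openC n U \<Longrightarrow> U \<subseteq> Cn n"
  by (rule openin_imp_subset)

text \<open>A basic open set of the product topology restricts only finitely many coordinates, and
  those from \<open>n\<close> on agree because they vanish in \<open>Cn n\<close>. So the least of
  finitely many radii works.\<close>

lemma openC_contains_polydisc:
  assumes U: "openC n U" and p: "p \<in> U"
  obtains r where "r > 0" "polydisc n p r \<subseteq> U"
proof -
  obtain T where T: "open T" "U = Cn n \<inter> T" using U by (auto simp: openin_open)
  then obtain X where X: "finite {i. X i \<noteq> UNIV}" "\<And>i. open (X i)" "p \<in> Pi\<^sub>E UNIV X" "Pi\<^sub>E UNIV X \<subseteq> T"
  proof -
    have "openin (product_topology (\<lambda>i. euclidean) UNIV) T"
      using T(1) by (simp add: euclidean_product_topology)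
    then have "\<exists>X. finite {i \<in> UNIV. X i \<noteq> topspace euclidean} \<and> (\<forall>i\<in>UNIV. openin euclidean (X i)) \<and>
        p \<in> Pi\<^sub>E UNIV X \<and> Pi\<^sub>E UNIV X \<subseteq> T"
      using p T(2) unfolding openin_product_topology_alt by blast
    then show ?thesis using that by auto
  qed
  have "\<exists>e>0. ball (p i) e \<subseteq> X i" for i
    using X(2)[of i] X(3) PiE_mem[of p UNIV X i] by (auto simp: open_contains_ball)
  then obtain e where e: "\<And>i. e i > 0" "\<And>i. ball (p i) (e i) \<subseteq> X i" by metis
  \<comment> \<open>The \<open>1\<close> keeps the minimum meaningful when no coordinate is
    restricted.\<close>
  define r where "r = Min (insert 1 (e ` {i. X i \<noteq> UNIV}))"
  have r: "r > 0" "\<And>i. X i \<noteq> UNIV \<Longrightarrow> r \<le> e i"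
    using X(1) e(1) by (auto simp: r_def intro: Min_le)
  have "polydisc n p r \<subseteq> U"
  proof
    fix w assume w: "w \<in> polydisc n p r"
    have pC: "p \<in> Cn n" using p openC_subset[OF U] by blast
    have "w i \<in> X i" for i
    proof (cases "X i = UNIV")
      case False
      have "dist (w i) (p i) < r"
      proof (cases "i < n")
        case True then show ?thesis using w by (simp add: polydisc_def)
      next
        case False then show ?thesis using w pC r(1) by (simp add: polydisc_def Cn_def)
      qed
      then show ?thesis using r(2)[OF False] e(2)[of i] by (auto simp: dist_commute subset_iff)
    qed auto
    then have "w \<in> T" using X(4) by auto
    then show "w \<in> U" using w T by (simp add: polydisc_def)
  qed
  with r(1) show ?thesis using that by blast
qed

lemma polydisc_mono: "r \<le> s \<Longrightarrow> polydisc n p r \<subseteq> polydisc n p s"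
  by (auto simp: polydisc_def intro: less_le_trans)

lemma Cn_fun_upd: "z \<in> Cn n \<Longrightarrow> i < n \<Longrightarrow> z(i := w) \<in> Cn n"
  by (simp add: Cn_def)

lemma polydisc_fun_upd: "w \<in> polydisc n p r \<Longrightarrow> i < n \<Longrightarrow> dist x (p i) < r \<Longrightarrow> w(i := x) \<in> polydisc n p r"
  by (simp add: polydisc_def Cn_fun_upd)

lemma self_in_polydisc: "p \<in> Cn n \<Longrightarrow> 0 < r \<Longrightarrow> p \<in> polydisc n p r"
  by (simp add: polydisc_def)

lemma polydisc_shift:
  assumes "w \<in> polydisc n p r" "i < n" "norm x < s"
  shows "w(i := w i + x) \<in> polydisc n p (r + s)"
proof -
  have "s > 0" using assms(3) by (meson norm_ge_zero le_less_trans)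
  moreover have "dist (w i + x) (p i) \<le> dist (w i) (p i) + norm x"
    by (simp add: dist_norm) (metis add_diff_eq add.commute diff_add_eq norm_triangle_ineq)
  ultimately have "dist (w i + x) (p i) < r + s" "\<And>j. j < n \<Longrightarrow> dist (w j) (p j) < r + s"
    using assms by (force simp: polydisc_def)+
  then show ?thesis using assms by (simp add: polydisc_def Cn_fun_upd)
qed

section \<open>Locality and algebra of holomorphic functions\<close>

lemma holo_on_subset: "holo_on n f U \<Longrightarrow> V \<subseteq> U \<Longrightarrow> holo_on n f V"
  unfolding holo_on_def by (meson continuous_on_subset subset_iff)

lemma holo_on_imp_continuous_on: "holo_on n f U \<Longrightarrow> continuous_on U f"
  by (simp add: holo_on_def)

lemma holo_on_partial:
  "holo_on n f U \<Longrightarrow> z \<in> U \<Longrightarrow> i < n \<Longrightarrow>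
    ((\<lambda>w. f (z(i := w))) has_field_derivative partial i f z) (at (z i))"
  by (simp add: holo_on_def partial_def field_differentiable_derivI)

lemma eventually_fun_upd:
  assumes U: "openC n U" and z: "z \<in> U" and i: "i < n"
  shows "eventually (\<lambda>w. z(i := w) \<in> U) (nhds (z i))"
proof -
  obtain r where r: "r > 0" "polydisc n z r \<subseteq> U" using openC_contains_polydisc[OF U z] .
  have "z \<in> Cn n" using z openC_subset[OF U] by blast
  then have "z(i := w) \<in> U" if "w \<in> ball (z i) r" for w
    using r polydisc_fun_upd[OF self_in_polydisc[of z n r] i, of w] that
    by (auto simp: dist_commute)
  with eventually_nhds_ball[OF r(1), of "z i"] show ?thesis by (rule eventually_mono)
qed

text \<open>Openness matters: differentiability at \<open>z\<close> looks at the points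
  \<open>z(i := w)\<close> beside \<open>z\<close>, which stay in \<open>U\<close> for
  \<open>w\<close> close to \<open>z i\<close>.\<close>

lemma holo_on_cong:
  assumes U: "openC n U" and f: "holo_on n f U" and eq: "\<And>z. z \<in> U \<Longrightarrow> f z = g z"
  shows "holo_on n g U"
  unfolding holo_on_def
proof (intro conjI ballI allI impI)
  show "continuous_on U g"
    using f by (intro continuous_on_eq[of U f g] eq) (simp_all add: holo_on_def)
  fix z i assume z: "z \<in> U" and i: "i < n"
  have ev: "eventually (\<lambda>w. f (z(i := w)) = g (z(i := w))) (nhds (z i))"
    by (rule eventually_mono[OF eventually_fun_upd[OF U z i]]) (rule eq)
  have "((\<lambda>w. f (z(i := w))) has_field_derivative partial i f z) (at (z i))"
    by (rule holo_on_partial[OF f z i])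
  then have "((\<lambda>w. g (z(i := w))) has_field_derivative partial i f z) (at (z i))"
    by (rule DERIV_cong_ev[OF refl ev refl, THEN iffD1])
  then show "(\<lambda>w. g (z(i := w))) field_differentiable at (z i)"
    unfolding field_differentiable_def by (rule exI)
qed

lemma partial_cong:
  assumes U: "openC n U" and z: "z \<in> U" and i: "i < n" and eq: "\<And>z. z \<in> U \<Longrightarrow> f z = g z"
  shows "partial i f z = partial i g z"
  unfolding partial_def
  by (rule deriv_cong_ev[OF eventually_mono[OF eventually_fun_upd[OF U z i]] refl]) (rule eq)

lemma holo_on_local:
  assumes "\<And>z. z \<in> U \<Longrightarrow> \<exists>V. openC n V \<and> z \<in> V \<and> holo_on n f V"
  shows "holo_on n f (U \<inter> Cn n)"
  unfolding holo_on_def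
proof (intro conjI ballI allI impI)
  show "continuous_on (U \<inter> Cn n) f"
    unfolding continuous_on_eq_continuous_within
  proof
    fix z assume z: "z \<in> U \<inter> Cn n"
    then obtain V where V: "openC n V" "z \<in> V" "holo_on n f V" using assms by blast
    then have "continuous (at z within V) f"
      by (simp add: holo_on_def continuous_on_eq_continuous_within)
    moreover have "at z within V = at z within Cn n"
    proof -
      obtain T where "open T" "V = Cn n \<inter> T" using V(1) by (auto simp: openin_open)
      then show ?thesis using V(2) by (intro at_within_nhd[of z T]) auto
    qed
    ultimately show "continuous (at z within U \<inter> Cn n) f"
      by (metis continuous_within_subset inf_le2)
  qed
  fix z i assume "z \<in> U \<inter> Cn n" "i < n"
  then show "(\<lambda>w. f (z(i := w))) field_differentiable at (z i)"
    using assms[of z] by (auto simp: holo_on_def)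
qed

lemma holo_on_openI:
  assumes "U \<subseteq> Cn n" "\<And>z. z \<in> U \<Longrightarrow> \<exists>V. openC n V \<and> z \<in> V \<and> holo_on n f V"
  shows "holo_on n f U"
  using holo_on_local[of U n f] assms by (simp add: inf.absorb1)

lemma holo_on_const [intro!, simp]: "holo_on n (\<lambda>z. c) U"
  by (simp add: holo_on_def)

lemma holo_on_coord [intro!, simp]: "holo_on n (\<lambda>z. z i) U"
proof -
  have "(\<lambda>w. (z(j := w)) i) field_differentiable at (z j)" for z :: "nat \<Rightarrow> complex" and j
    by (cases "i = j") auto
  then show ?thesis
    unfolding holo_on_def by (auto intro: continuous_on_product_coordinates continuous_on_subset)
qed

lemma holo_on_add [intro]: "holo_on n f U \<Longrightarrow> holo_on n g U \<Longrightarrow> holo_on n (\<lambda>z. f z + g z) U"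
  by (auto simp: holo_on_def intro!: continuous_intros field_differentiable_add)

lemma holo_on_diff [intro]: "holo_on n f U \<Longrightarrow> holo_on n g U \<Longrightarrow> holo_on n (\<lambda>z. f z - g z) U"
  by (auto simp: holo_on_def intro!: continuous_intros field_differentiable_diff)

lemma holo_on_uminus [intro]: "holo_on n f U \<Longrightarrow> holo_on n (\<lambda>z. - f z) U"
  by (auto simp: holo_on_def intro!: continuous_intros field_differentiable_minus)

lemma holo_on_mult [intro]: "holo_on n f U \<Longrightarrow> holo_on n g U \<Longrightarrow> holo_on n (\<lambda>z. f z * g z) U"
  by (auto simp: holo_on_def intro!: continuous_intros field_differentiable_mult)

lemma holo_on_power [intro]: "holo_on n f U \<Longrightarrow> holo_on n (\<lambda>z. f z ^ k) U"
  by (induction k) auto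

lemma holo_on_divide [intro]:
  assumes "holo_on n f U" "holo_on n g U" "\<And>z. z \<in> U \<Longrightarrow> g z \<noteq> 0"
  shows "holo_on n (\<lambda>z. f z / g z) U"
  using assms by (auto simp: holo_on_def intro!: continuous_intros field_differentiable_divide)

section \<open>Partial derivatives, the chain rule and implicit functions\<close>

text \<open>By Cauchy's inequality on a circle of radius \<open>r\<close> the difference of two
  partial derivatives is at most \<open>1 / r\<close> times the supremum of the difference of two
  slices of \<open>f\<close>. Joint continuity makes that supremum small, uniformly on the compact
  disc.\<close>

lemma continuous_on_partial:
  assumes V: "openC n V" and f: "holo_on n f V" and i: "i < n"
  shows "continuous_on V (partial i f)"
  unfolding continuous_on_eq_continuous_within
proof
  fix p assume p: "p \<in> V"
  obtain R where R: "R > 0" "polydisc n p R \<subseteq> V" using openC_contains_polydisc[OF V p] .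
  \<comment> \<open>Points of the polydisc of radius \<open>r\<close> are moved by less than
    \<open>2 * r\<close> below and stay within \<open>3 * r\<close>, so all slices are holomorphic
    on a disc larger than the one of Cauchy's inequality.\<close>
  define r where "r = R / 4"
  let ?D = "polydisc n p r"
  have r: "r > 0" using R by (simp add: r_def)
  have pD: "p \<in> ?D" using p openC_subset[OF V] r by (intro self_in_polydisc) auto
  have inV: "z(i := z i + x) \<in> V" if "z \<in> ?D" "norm x \<le> r" for z x
    using polydisc_shift[OF that(1) i, of x "2*r"] that(2) R r polydisc_mono[of "r + 2*r" R n p]
    by (auto simp: r_def)
  have cont: "continuous_on (?D \<times> cball 0 r) (\<lambda>(z, x). f (z(i := z i + x)))"
  proof -
    have fst: "continuous_on (?D \<times> cball 0 r) fst" by (intro continuous_intros)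
    have "continuous_on (?D \<times> cball 0 r) (\<lambda>y. (fst y)(i := fst y i + snd y))"
      by (intro continuous_on_fun_upd[OF fst] continuous_on_add continuous_on_coord[OF fst] continuous_on_snd continuous_on_id)
    moreover have "(\<lambda>y. (fst y)(i := fst y i + snd y)) ` (?D \<times> cball 0 r) \<subseteq> V"
      using inV by force
    ultimately have "continuous_on (?D \<times> cball 0 r) (\<lambda>y. f ((fst y)(i := fst y i + snd y)))"
      by (rule continuous_on_compose2[OF holo_on_imp_continuous_on[OF f]])
    then show ?thesis by (simp add: case_prod_beta)
  qed
  have hol: "(\<lambda>x. f (z(i := z i + x))) holomorphic_on ball 0 (2*r)" if z: "z \<in> ?D" for z
  proof (rule holomorphic_onI)
    fix x :: complex assume x: "x \<in> ball 0 (2*r)"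
    let ?z = "z(i := z i + x)"
    have "?z \<in> V"
      using polydisc_shift[OF z i, of x "2*r"] x R r polydisc_mono[of "r + 2*r" R n p]
      by (auto simp: r_def)
    then have "((\<lambda>w. f (?z(i := w))) has_field_derivative partial i f ?z) (at (z i + x))"
      using holo_on_partial[OF f _ i, of ?z] by simp
    then have "((\<lambda>x. f (z(i := x + z i))) has_field_derivative partial i f ?z) (at x)"
      using DERIV_shift[of "\<lambda>w. f (z(i := w))" _ x "z i"] by (simp add: add.commute)
    then show "(\<lambda>x. f (z(i := z i + x))) field_differentiable (at x within ball 0 (2*r))"
      by (simp add: add.commute field_differentiable_def) (blast intro: has_field_derivative_at_within)
  qed
  have der: "partial i f z = deriv (\<lambda>x. f (z(i := z i + x))) 0" if "z \<in> ?D" for z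
  proof -
    have "z \<in> V" using inV[OF that, of 0] r by simp
    then have "((\<lambda>w. f (z(i := w))) has_field_derivative partial i f z) (at (0 + z i))"
      using holo_on_partial[OF f _ i, of z] by simp
    then have "((\<lambda>x. f (z(i := x + z i))) has_field_derivative partial i f z) (at 0)"
      using DERIV_shift[of "\<lambda>w. f (z(i := w))" _ 0 "z i"] by simp
    then show ?thesis by (simp add: DERIV_imp_deriv add.commute)
  qed
  show "continuous (at p within V) (partial i f)"
    unfolding continuous_within
  proof (rule tendstoI)
    fix e :: real assume e: "e > 0"
    obtain X0 where X0: "p \<in> X0" "open X0"
      "\<forall>z\<in>X0 \<inter> ?D. \<forall>x\<in>cball 0 r. dist (f (z(i := z i + x))) (f (p(i := p i + x))) \<le> e / 2 * r"
      using continuous_on_prod_compactE[OF cont compact_cball pD mult_pos_pos[OF half_gt_zero[OF e] r]]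
      unfolding prod.case .
    have "dist (partial i f z) (partial i f p) < e" if z: "z \<in> X0 \<inter> ?D" for z
    proof -
      let ?h = "\<lambda>x. f (z(i := z i + x)) - f (p(i := p i + x))"
      have h: "?h holomorphic_on ball 0 (2*r)"
        using z pD by (intro holomorphic_on_diff hol) auto
      have "norm ((deriv ^^ 1) ?h 0) \<le> fact 1 * (e / 2 * r) / r ^ 1"
      proof (rule Cauchy_inequality)
        show "?h holomorphic_on ball 0 r" by (rule holomorphic_on_subset[OF h]) (use r in auto)
        show "continuous_on (cball 0 r) ?h"
          by (rule continuous_on_subset[OF holomorphic_on_imp_continuous_on[OF h]]) (use r in auto)
        show "norm (?h x) \<le> e / 2 * r" if "norm (0 - x) = r" for x
          using X0(3) z that by (auto simp: dist_norm)
      qed (rule r)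
      moreover have "deriv ?h 0 = partial i f z - partial i f p"
        using z pD r by (subst deriv_diff)
          (auto simp: der intro!: holomorphic_on_imp_differentiable_at[OF hol, of _ 0])
      ultimately have "norm (partial i f z - partial i f p) \<le> e / 2" using r by simp
      then show ?thesis using e by (simp add: dist_norm)
    qed
    moreover have "eventually (\<lambda>z. z \<in> X0 \<inter> ?D) (at p within V)"
    proof -
      obtain T where T: "open T" "?D = Cn n \<inter> T"
        using openC_polydisc[of n p r] by (auto simp: openin_open)
      have "open (X0 \<inter> T)" "p \<in> X0 \<inter> T" using X0(1,2) T pD by auto
      then show ?thesis
        unfolding eventually_at_topological using T openC_subset[OF V] by blast
    qed
    ultimately show "eventually (\<lambda>z. dist (partial i f z) (partial i f p) < e) (at p within V)"
      by (auto elim: eventually_mono)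
  qed
qed


text \<open>Continuity of the partial derivatives gives total differentiability: the path from
  \<open>p\<close> to \<open>w\<close> changes one coordinate at a time (\<open>h k\<close> has its
  first \<open>k\<close> entries from \<open>w\<close>), and the mean value inequality applies to
  each step.\<close>

lemma holo_on_increment:
  assumes V: "openC n V" and f: "holo_on n f V" and p: "p \<in> V" and e: "e > 0"
  obtains d where "d > 0" "polydisc n p d \<subseteq> V"
    "\<And>w. w \<in> polydisc n p d \<Longrightarrow>
      norm (f w - f p - (\<Sum>i<n. partial i f p * (w i - p i))) \<le> e * (\<Sum>i<n. norm (w i - p i))"
proof -
  obtain R where R: "R > 0" "polydisc n p R \<subseteq> V" using openC_contains_polydisc[OF V p] .
  have pC: "p \<in> Cn n" using p openC_subset[OF V] by blast
  have "\<exists>d>0. \<forall>w\<in>polydisc n p d. w \<in> V \<longrightarrow> norm (partial i f w - partial i f p) \<le> e" if i: "i < n" for i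
  proof -
    have "openC n (V \<inter> partial i f -` ball (partial i f p) e)"
      using continuous_on_partial[OF V f i] V
      by (meson continuous_openin_preimage_gen open_ball openin_trans)
    moreover have "p \<in> V \<inter> partial i f -` ball (partial i f p) e" using p e by simp
    ultimately obtain d where "d > 0" "polydisc n p d \<subseteq> V \<inter> partial i f -` ball (partial i f p) e"
      by (rule openC_contains_polydisc)
    then show ?thesis
      by (intro exI[of _ d]) (auto simp: dist_norm norm_minus_commute dest!: subsetD intro: less_imp_le)
  qed
  then obtain d' where d': "\<And>i. i < n \<Longrightarrow> d' i > 0"
    "\<And>i w. i < n \<Longrightarrow> w \<in> polydisc n p (d' i) \<Longrightarrow> w \<in> V \<Longrightarrow> norm (partial i f w - partial i f p) \<le> e"
    by metis
  define d where "d = Min (insert R (d' ` {..<n}))"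
  have d: "d > 0" "d \<le> R" "\<And>i. i < n \<Longrightarrow> d \<le> d' i"
    using R d'(1) by (auto simp: d_def intro: Min_le)
  have dV: "polydisc n p d \<subseteq> V" using polydisc_mono[OF d(2)] R(2) by blast
  have "norm (f w - f p - (\<Sum>i<n. partial i f p * (w i - p i))) \<le> e * (\<Sum>i<n. norm (w i - p i))"
    if w: "w \<in> polydisc n p d" for w
  proof -
    define h where "h k = (\<lambda>i. if i < k then w i else p i)" for k
    have hD: "(h k)(k := x) \<in> polydisc n p d" if "k < n" "dist x (p k) < d" for k x
      using w pC that d(1) by (auto simp: h_def polydisc_def Cn_def)
    have step: "norm (f (h (Suc k)) - f (h k) - partial k f p * (w k - p k)) \<le> e * norm (w k - p k)"
      if k: "k < n" for k
    proof -
      let ?g = "\<lambda>x. f ((h k)(k := x)) - partial k f p * x"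
      have "norm (?g (w k) - ?g (p k)) \<le> e * norm (w k - p k)"
      proof (rule field_differentiable_bound[where S = "ball (p k) d"])
        fix x assume "x \<in> ball (p k) d"
        then have x: "(h k)(k := x) \<in> polydisc n p d" using hD[OF k] by (simp add: dist_commute)
        have "((\<lambda>x. f ((h k)(k := x))) has_field_derivative partial k f ((h k)(k := x))) (at x)"
          using holo_on_partial[OF f subsetD[OF dV x] k] by simp
        then have "(?g has_field_derivative (partial k f ((h k)(k := x)) - partial k f p * 1)) (at x)"
          by (intro DERIV_diff DERIV_cmult DERIV_ident)
        then show "(?g has_field_derivative (partial k f ((h k)(k := x)) - partial k f p)) (at x within ball (p k) d)"
          by (simp add: has_field_derivative_at_within)
        show "norm (partial k f ((h k)(k := x)) - partial k f p) \<le> e"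
          using d'(2)[OF k subsetD[OF polydisc_mono[OF d(3)[OF k]] x] subsetD[OF dV x]] .
      qed (use w k d(1) in \<open>auto simp: polydisc_def dist_commute\<close>)
      moreover have "(h k)(k := w k) = h (Suc k)" "(h k)(k := p k) = h k"
        by (auto simp: h_def)
      ultimately show ?thesis by (simp add: algebra_simps)
    qed
    have "h n = w" using w pC by (auto simp: h_def polydisc_def Cn_def)
    moreover have "h 0 = p" by (simp add: h_def)
    ultimately have "f w - f p - (\<Sum>i<n. partial i f p * (w i - p i)) =
        (\<Sum>k<n. f (h (Suc k)) - f (h k) - partial k f p * (w k - p k))"
      using sum_lessThan_telescope[of "\<lambda>k. f (h k)" n] by (simp add: sum_subtractf)
    also have "norm \<dots> \<le> (\<Sum>k<n. e * norm (w k - p k))"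
      using step by (intro sum_norm_le) auto
    finally show ?thesis by (simp add: sum_distrib_left)
  qed
  with d(1) dV show ?thesis using that by blast
qed

lemma holo_on_chain_curve:
  assumes V: "openC n V" and f: "holo_on n f V"
    and \<gamma>: "\<gamma> w0 \<in> V" "eventually (\<lambda>w. \<gamma> w \<in> Cn n) (nhds w0)"
    and d: "\<And>i. i < n \<Longrightarrow> ((\<lambda>w. \<gamma> w i) has_field_derivative D i) (at w0)"
  shows "((\<lambda>w. f (\<gamma> w)) has_field_derivative (\<Sum>i<n. partial i f (\<gamma> w0) * D i)) (at w0)"
proof -
  let ?p = "\<gamma> w0"
  let ?Q = "\<lambda>i w. (\<gamma> w i - ?p i) / (w - w0)"
  have Q: "((?Q i) \<longlongrightarrow> D i) (at w0)" if "i < n" for i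
    using d[OF that] by (simp add: has_field_derivative_iff)
  define R where "R w = f (\<gamma> w) - f ?p - (\<Sum>i<n. partial i f ?p * (\<gamma> w i - ?p i))" for w
  have R0: "((\<lambda>w. R w / (w - w0)) \<longlongrightarrow> 0) (at w0)"
  proof (rule tendstoI)
    fix e :: real assume e: "e > 0"
    \<comment> \<open>\<open>S\<close> exceeds the limit of the sum of the norms of the difference
      quotients, so the bound with factor \<open>e / S\<close> ends strictly below
      \<open>e\<close>.\<close>
    define S where "S = (\<Sum>i<n. norm (D i)) + 1"
    have S: "S > 0" unfolding S_def by (simp add: add_nonneg_pos sum_nonneg)
    obtain r where r: "r > 0" "polydisc n ?p r \<subseteq> V"
      "\<And>w. w \<in> polydisc n ?p r \<Longrightarrow>
        norm (f w - f ?p - (\<Sum>i<n. partial i f ?p * (w i - ?p i))) \<le> e / S * (\<Sum>i<n. norm (w i - ?p i))"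
      by (rule holo_on_increment[OF V f \<gamma>(1) divide_pos_pos[OF e S]]) blast
    have "eventually (\<lambda>w. \<forall>i\<in>{..<n}. dist (\<gamma> w i) (?p i) < r) (at w0)"
    proof (rule eventually_ball_finite, simp, intro ballI)
      fix i assume "i \<in> {..<n}"
      then have "isCont (\<lambda>w. \<gamma> w i) w0" using d DERIV_isCont by auto
      then show "eventually (\<lambda>w. dist (\<gamma> w i) (?p i) < r) (at w0)"
        using r(1) by (simp add: isCont_def tendsto_iff)
    qed
    moreover have "eventually (\<lambda>w. \<gamma> w \<in> Cn n) (at w0)"
      using \<gamma>(2) eventually_nhds_conv_at by blast
    moreover have "eventually (\<lambda>w. (\<Sum>i<n. norm (?Q i w)) < S) (at w0)"
    proof (rule order_tendstoD)
      show "((\<lambda>w. \<Sum>i<n. norm (?Q i w)) \<longlongrightarrow> (\<Sum>i<n. norm (D i))) (at w0)"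
        using Q by (intro tendsto_sum tendsto_norm) auto
    qed (simp add: S_def)
    moreover have "eventually (\<lambda>w. w \<noteq> w0) (at w0)" by (simp add: eventually_at_filter)
    ultimately show "eventually (\<lambda>w. dist (R w / (w - w0)) 0 < e) (at w0)"
    proof eventually_elim
      case (elim w)
      then have "\<gamma> w \<in> polydisc n ?p r" by (simp add: polydisc_def)
      then have "norm (R w) \<le> e / S * (\<Sum>i<n. norm (\<gamma> w i - ?p i))" unfolding R_def by (rule r(3))
      also have "(\<Sum>i<n. norm (\<gamma> w i - ?p i)) = (\<Sum>i<n. norm (?Q i w)) * norm (w - w0)"
        using elim(4) by (simp add: norm_divide sum_distrib_right)
      finally have "norm (R w) / norm (w - w0) \<le> e / S * (\<Sum>i<n. norm (?Q i w))"
        using elim(4) by (simp add: pos_divide_le_eq mult.assoc)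
      also have "\<dots> < e / S * S"
        using elim(3) e S by (intro mult_strict_left_mono) auto
      finally show ?case using S by (simp add: norm_divide)
    qed
  qed
  have "((\<lambda>w. (\<Sum>i<n. partial i f ?p * ?Q i w) + R w / (w - w0)) \<longlongrightarrow> (\<Sum>i<n. partial i f ?p * D i) + 0) (at w0)"
    using Q R0 by (intro tendsto_add tendsto_sum tendsto_mult tendsto_const) auto
  moreover have "(\<Sum>i<n. partial i f ?p * ?Q i w) + R w / (w - w0) = (f (\<gamma> w) - f ?p) / (w - w0)" for w
    
  proof -
    have "(\<Sum>i<n. partial i f ?p * ?Q i w) = (\<Sum>i<n. partial i f ?p * (\<gamma> w i - ?p i)) / (w - w0)"
      by (simp add: sum_divide_distrib)
    then show ?thesis by (simp add: R_def diff_divide_distrib)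
  qed
  ultimately show ?thesis by (simp add: has_field_derivative_iff)
qed

text \<open>Both facts are the chain rule along the curve
  \<open>w \<mapsto> g (z(j := w))\<close>.\<close>

lemma
  assumes U: "openC m U" and V: "openC n V" and f: "holo_on n f V"
    and g: "\<And>i. i < n \<Longrightarrow> holo_on m (\<lambda>z. g z i) U" and gV: "g ` U \<subseteq> V"
  shows holo_on_compose: "holo_on m (\<lambda>z. f (g z)) U"
    and partial_compose: "\<And>z j. z \<in> U \<Longrightarrow> j < m \<Longrightarrow>
      partial j (\<lambda>z. f (g z)) z = (\<Sum>i<n. partial i f (g z) * partial j (\<lambda>z. g z i) z)"
proof -
  have der: "((\<lambda>w. f (g (z(j := w)))) has_field_derivative
      (\<Sum>i<n. partial i f (g z) * partial j (\<lambda>z. g z i) z)) (at (z j))" if z: "z \<in> U" and j: "j < m" for z j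
  proof -
    have "((\<lambda>w. f (g (z(j := w)))) has_field_derivative
      (\<Sum>i<n. partial i f (g (z(j := z j))) * partial j (\<lambda>z. g z i) z)) (at (z j))"
    proof (rule holo_on_chain_curve[OF V f])
      show "g (z(j := z j)) \<in> V" unfolding fun_upd_triv by (rule subsetD[OF gV imageI[OF z]])
      show "eventually (\<lambda>w. g (z(j := w)) \<in> Cn n) (nhds (z j))"
      proof (rule eventually_mono[OF eventually_fun_upd[OF U z j]])
        fix w assume "z(j := w) \<in> U"
        then have "g (z(j := w)) \<in> V" by (rule subsetD[OF gV imageI])
        then show "g (z(j := w)) \<in> Cn n" by (rule subsetD[OF openC_subset[OF V]])
      qed
      show "((\<lambda>w. g (z(j := w)) i) has_field_derivative partial j (\<lambda>z. g z i) z) (at (z j))" if "i < n" for i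
        by (rule holo_on_partial[OF g[OF that] z j])
    qed
    then show ?thesis by simp
  qed
  show "partial j (\<lambda>z. f (g z)) z = (\<Sum>i<n. partial i f (g z) * partial j (\<lambda>z. g z i) z)"
    if "z \<in> U" "j < m" for z j
    using der[OF that] unfolding partial_def[of j "\<lambda>z. f (g z)"] by (rule DERIV_imp_deriv)
  have "continuous_on U g"
  proof (rule continuous_on_coordinatewise_then_product)
    fix i
    show "continuous_on U (\<lambda>z. g z i)"
    proof (cases "i < n")
      case False
      then have "g z i = 0" if "z \<in> U" for z
        using subsetD[OF openC_subset[OF V] subsetD[OF gV imageI[OF that]]] by (simp add: Cn_def)
      then show ?thesis by (intro continuous_on_eq[OF continuous_on_const[of U "0 :: complex"]]) simp
    qed (use g in \<open>simp add: holo_on_def\<close>)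
  qed
  then have "continuous_on U (\<lambda>z. f (g z))"
    by (rule continuous_on_compose2[OF holo_on_imp_continuous_on[OF f] _ gV])
  then show "holo_on m (\<lambda>z. f (g z)) U"
    unfolding holo_on_def field_differentiable_def using der by blast
qed

text \<open>The unknown is the last coordinate \<open>n\<close>. Close to \<open>p\<close> the
  function \<open>h\<close> differs from \<open>a * w\<close> by a map with Lipschitz constant at
  most \<open>norm a / 2\<close> in \<open>w\<close>; this gives uniqueness and continuity of the
  solution. Both radii can be kept below a prescribed \<open>R\<close>.\<close>

lemma holo_implicit_function:
  assumes h: "holo_on (Suc n) h (Cn (Suc n))" and p: "p \<in> Cn (Suc n)" "h p = 0"
    and nz: "partial n h p \<noteq> 0" and R: "R > 0"
  obtains r d \<phi> where "0 < r" "r \<le> R" "0 < d" "d \<le> R" "holo_on n \<phi> (polydisc n p d)"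
    "\<And>x. x \<in> polydisc n p d \<Longrightarrow> dist (\<phi> x) (p n) < r \<and> h (x(n := \<phi> x)) = 0"
    "\<And>x w. x \<in> polydisc n p d \<Longrightarrow> dist w (p n) < r \<Longrightarrow> h (x(n := w)) = 0 \<Longrightarrow> w = \<phi> x"
proof -
  define a where "a = partial n h p"
  have a: "a \<noteq> 0" "norm a > 0" using nz by (simp_all add: a_def)
  have openC: "openC (Suc n) (Cn (Suc n))" by simp
  have "openC (Suc n) (Cn (Suc n) \<inter> partial n h -` ball a (norm a / 2))"
    using continuous_on_partial[OF openC h, of n] by (intro continuous_openin_preimage_gen) auto
  moreover have "p \<in> Cn (Suc n) \<inter> partial n h -` ball a (norm a / 2)" using p a by (simp add: a_def)
  ultimately obtain \<rho>' where \<rho>': "\<rho>' > 0" "polydisc (Suc n) p \<rho>' \<subseteq> Cn (Suc n) \<inter> partial n h -` ball a (norm a / 2)"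
    by (rule openC_contains_polydisc)
  define r where "r = min \<rho>' R / 2"
  have r: "r > 0" "2 * r \<le> \<rho>'" "r \<le> R" using \<rho>' R by (auto simp: r_def)
  have up: "x(n := w) \<in> Cn (Suc n)" if "x \<in> Cn n" for x w
    using that by (auto simp: Cn_def)
  have upD: "x(n := w) \<in> polydisc (Suc n) p s" if "x \<in> polydisc n p s" "dist w (p n) < s" for x w s
    using that up by (auto simp: polydisc_def less_Suc_eq)
  have bnd: "norm (partial n h (x(n := w)) - a) \<le> norm a / 2" if "x \<in> polydisc n p \<rho>'" "dist w (p n) < \<rho>'" for x w
    using upD[OF that] \<rho>'(2) by (auto simp: dist_norm norm_minus_commute dest!: subsetD)
  have low: "norm a / 2 * norm (w - w') \<le> norm (h (x(n := w)) - h (x(n := w')))"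
    if x: "x \<in> polydisc n p \<rho>'" and w: "dist w (p n) < \<rho>'" "dist w' (p n) < \<rho>'" for x w w'
  proof -
    let ?g = "\<lambda>w. h (x(n := w)) - a * w"
    have "norm (?g w - ?g w') \<le> norm a / 2 * norm (w - w')"
    proof (rule field_differentiable_bound[where S = "ball (p n) \<rho>'"])
      fix v assume "v \<in> ball (p n) \<rho>'"
      then have v: "dist v (p n) < \<rho>'" by (simp add: dist_commute)
      have "((\<lambda>w. h (x(n := w))) has_field_derivative partial n h (x(n := v))) (at v)"
        using holo_on_partial[OF h, of "x(n := v)" n] up x by (simp add: polydisc_def)
      then have "(?g has_field_derivative partial n h (x(n := v)) - a * 1) (at v)"
        by (intro DERIV_diff DERIV_cmult DERIV_ident)
      then show "(?g has_field_derivative partial n h (x(n := v)) - a) (at v within ball (p n) \<rho>')"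
        by (simp add: has_field_derivative_at_within)
      show "norm (partial n h (x(n := v)) - a) \<le> norm a / 2" by (rule bnd[OF x v])
    qed (use w in \<open>auto simp: dist_commute\<close>)
    moreover have "norm (a * (w - w')) \<le> norm (h (x(n := w)) - h (x(n := w'))) + norm (?g w - ?g w')"
      by (rule order_trans[OF _ norm_triangle_ineq4]) (simp add: algebra_simps)
    ultimately show ?thesis by (simp add: norm_mult)
  qed
  have contx: "continuous_on (Cn n) (\<lambda>x. h (x(n := w)))" for w
  proof (rule continuous_on_compose2[OF holo_on_imp_continuous_on[OF h]])
    show "continuous_on (Cn n) (\<lambda>x. x(n := w))"
      by (rule continuous_on_fun_upd[OF continuous_on_id continuous_on_const])
  qed (use up in auto)
  \<comment> \<open>\<open>p\<close> itself need not lie in \<open>Cn n\<close>; \<open>p0\<close>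
    drops its last entry without changing the polydiscs.\<close>
  define p0 where "p0 = p(n := 0)"
  have p0: "p0 \<in> Cn n" "p0(n := p n) = p" using p(1) by (auto simp: p0_def Cn_def)
  have pd: "polydisc n p s = polydisc n p0 s" for s by (auto simp: polydisc_def p0_def)
  have "openC n (Cn n \<inter> (\<lambda>x. h (x(n := p n))) -` ball 0 (norm a * r / 4))"
    using contx by (intro continuous_openin_preimage_gen) auto
  moreover have "p0 \<in> Cn n \<inter> (\<lambda>x. h (x(n := p n))) -` ball 0 (norm a * r / 4)"
    using p0 p(2) a r by simp
  ultimately obtain d' where d': "d' > 0" "polydisc n p0 d' \<subseteq> Cn n \<inter> (\<lambda>x. h (x(n := p n))) -` ball 0 (norm a * r / 4)"
    by (rule openC_contains_polydisc)
  define d where "d = min d' r"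
  have d: "d > 0" "d \<le> d'" "d \<le> R" "d \<le> \<rho>'" using d' r by (auto simp: d_def)
  let ?D = "polydisc n p d"
  have D\<rho>: "x \<in> polydisc n p \<rho>'" if "x \<in> ?D" for x using polydisc_mono[OF d(4)] that by blast
  have DC: "x \<in> Cn n" if "x \<in> ?D" for x using that by (simp add: polydisc_def)
  have ex: "\<exists>w. dist w (p n) < r \<and> h (x(n := w)) = 0" if x: "x \<in> ?D" for x
  proof -
    have small: "norm (h (x(n := p n))) < norm a * r / 4"
      using x polydisc_mono[OF d(2), of n p0] d'(2) by (auto simp: pd)
    have der: "((\<lambda>w. h (x(n := w))) has_field_derivative partial n h (x(n := w))) (at w)" for w
      using holo_on_partial[OF h, of "x(n := w)" n] up[OF DC[OF x]] by simp
    then have hol: "(\<lambda>w. h (x(n := w))) holomorphic_on UNIV"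
      by (auto simp: holomorphic_on_def field_differentiable_def)
    \<comment> \<open>Minimum modulus: \<open>h\<close> is smaller at the centre than on the whole
      circle, so it has a zero inside.\<close>
    show ?thesis
    proof (rule holomorphic_contract_to_zero[of "p n" r "\<lambda>w. h (x(n := w))"])
      show "continuous_on (cball (p n) r) (\<lambda>w. h (x(n := w)))"
        using holomorphic_on_imp_continuous_on[OF hol] continuous_on_subset by blast
      show "(\<lambda>w. h (x(n := w))) holomorphic_on ball (p n) r"
        using hol holomorphic_on_subset by blast
      fix w assume w: "norm (p n - w) = r"
      then have "norm a / 2 * r \<le> norm (h (x(n := w)) - h (x(n := p n)))"
        using low[OF D\<rho>[OF x], of w "p n"] r by (auto simp: dist_norm norm_minus_commute)
      also have "\<dots> \<le> norm (h (x(n := w))) + norm (h (x(n := p n)))" by (rule norm_triangle_ineq4)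
      finally show "norm (h (x(n := p n))) < norm (h (x(n := w)))" using small by simp
    next
      fix z assume "z \<in> ball (p n) r" "h (x(n := z)) = 0"
      then show ?thesis by (auto simp: dist_commute)
    qed (use r in auto)
  qed
  have uniq: "w = w'" if "x \<in> ?D" "dist w (p n) < r" "dist w' (p n) < r" "h (x(n := w)) = 0" "h (x(n := w')) = 0" for x w w'
    using low[OF D\<rho>[OF that(1)], of w w'] that r a by (simp add: mult_le_0_iff)
  define \<phi> where "\<phi> x = (SOME w. dist w (p n) < r \<and> h (x(n := w)) = 0)" for x
  have \<phi>: "dist (\<phi> x) (p n) < r" "h (x(n := \<phi> x)) = 0" if "x \<in> ?D" for x
    using someI_ex[OF ex[OF that]] by (simp_all add: \<phi>_def)
  have est: "norm (\<phi> x - \<phi> x0) \<le> 2 / norm a * norm (h (x(n := \<phi> x0)))" if "x \<in> ?D" "x0 \<in> ?D" for x x0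
  proof -
    have "norm a / 2 * norm (\<phi> x - \<phi> x0) \<le> norm (h (x(n := \<phi> x)) - h (x(n := \<phi> x0)))"
      using \<phi>(1)[OF that(1)] \<phi>(1)[OF that(2)] r by (intro low[OF D\<rho>[OF that(1)]]) auto
    then show ?thesis using \<phi>(2)[OF that(1)] a by (simp add: field_simps)
  qed
  have hol: "holo_on n \<phi> ?D"
    unfolding holo_on_def
  proof (intro conjI ballI allI impI)
    show "continuous_on ?D \<phi>"
      unfolding continuous_on_def
    proof
      fix x0 assume x0: "x0 \<in> ?D"
      have "continuous_on ?D (\<lambda>x. 2 / norm a * norm (h (x(n := \<phi> x0))))"
        using continuous_on_subset[OF contx, of ?D] DC by (intro continuous_intros) auto
      then have "((\<lambda>x. 2 / norm a * norm (h (x(n := \<phi> x0)))) \<longlongrightarrow> 2 / norm a * norm (h (x0(n := \<phi> x0)))) (at x0 within ?D)"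
        using x0 by (simp add: continuous_on_def)
      then have lim: "((\<lambda>x. 2 / norm a * norm (h (x(n := \<phi> x0)))) \<longlongrightarrow> 0) (at x0 within ?D)"
        using \<phi>(2)[OF x0] by simp
      have "((\<lambda>x. \<phi> x - \<phi> x0) \<longlongrightarrow> 0) (at x0 within ?D)"
        by (rule Lim_null_comparison[OF _ lim]) (use est x0 in \<open>simp add: eventually_at_filter\<close>)
      then show "(\<phi> \<longlongrightarrow> \<phi> x0) (at x0 within ?D)" by (rule LIM_zero_cancel)
    qed
  next
    fix x0 i assume x0: "x0 \<in> ?D" and i: "i < n"
    let ?P = "x0(n := \<phi> x0)" and ?X = "\<lambda>w. x0(i := w)"
    define b where "b = partial n h ?P"
    define c where "c = partial i h ?P"
    have P: "?P \<in> Cn (Suc n)" using up[OF DC[OF x0]] .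
    have b: "b \<noteq> 0"
      using bnd[OF D\<rho>[OF x0], of "\<phi> x0"] \<phi>(1)[OF x0] r a unfolding b_def by (auto simp: norm_minus_commute)
    have inD: "eventually (\<lambda>w. ?X w \<in> ?D) (at (x0 i))"
      using eventually_fun_upd[OF openC_polydisc x0 i] by (simp add: eventually_nhds_conv_at)
    have ne: "eventually (\<lambda>w. w \<noteq> x0 i) (at (x0 i))" by (simp add: eventually_at_filter)
    define Q where "Q w = (\<phi> (?X w) - \<phi> x0) / (w - x0 i)" for w
    have upd: "(?X w)(n := \<phi> x0) = ?P(i := w)" for w using i by auto
    have hc: "((\<lambda>w. h (?P(i := w))) has_field_derivative c) (at (x0 i))"
      using holo_on_partial[OF h P, of i] i by (simp add: c_def)
    have Pi: "?P(i := x0 i) = ?P" using i by auto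
    \<comment> \<open>Bound for the difference quotients \<open>Q\<close> of \<open>\<phi>\<close>:
      the factor \<open>2 / norm a\<close> comes from \<open>est\<close>, and
      \<open>norm c + 1\<close> from the quotients of \<open>h\<close> in direction
      \<open>i\<close>.\<close>
    define C where "C = 2 / norm a * (norm c + 1)"
    have Qb: "eventually (\<lambda>w. norm (Q w) \<le> C) (at (x0 i))"
    proof -
      have "((\<lambda>w. norm ((h (?P(i := w)) - h ?P) / (w - x0 i))) \<longlongrightarrow> norm c) (at (x0 i))"
        using hc unfolding has_field_derivative_iff Pi by (rule tendsto_norm)
      then have "eventually (\<lambda>w. norm ((h (?P(i := w)) - h ?P) / (w - x0 i)) < norm c + 1) (at (x0 i))"
        by (rule order_tendstoD) simp
      with inD ne show ?thesis
      proof eventually_elim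
        case (elim w)
        have "norm (\<phi> (?X w) - \<phi> x0) \<le> 2 / norm a * norm (h (?P(i := w)))"
          using est[OF elim(1) x0] unfolding upd .
        moreover have "norm (h (?P(i := w))) \<le> (norm c + 1) * norm (w - x0 i)"
          using elim(2,3) \<phi>(2)[OF x0] by (simp add: norm_divide pos_divide_less_eq)
        ultimately have "norm (\<phi> (?X w) - \<phi> x0) \<le> 2 / norm a * ((norm c + 1) * norm (w - x0 i))"
          using a by (meson mult_left_mono order_trans divide_nonneg_nonneg norm_ge_zero zero_le_numeral)
        then show ?case using elim(2) by (simp add: Q_def C_def norm_divide pos_divide_le_eq algebra_simps add_divide_distrib)
      qed
    qed
    have C: "C \<ge> 0" using a by (simp add: C_def)
    \<comment> \<open>The equation \<open>h = 0\<close> linearised at \<open>?P\<close> reads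
      \<open>c + b * Q = 0\<close>, up to an error that is small because \<open>Q\<close> is
      bounded. The limit of \<open>Q\<close> is therefore \<open>- c / b\<close>.\<close>
    have "((\<lambda>w. c + b * Q w) \<longlongrightarrow> 0) (at (x0 i))"
    proof (rule tendstoI)
      fix e :: real assume e: "e > 0"
      define e' where "e' = e / (2 * (1 + C))"
      have e': "e' > 0" using e C by (simp add: e'_def)
      obtain s where s: "s > 0"
        "\<And>w. w \<in> polydisc (Suc n) ?P s \<Longrightarrow>
          norm (h w - h ?P - (\<Sum>k<Suc n. partial k h ?P * (w k - ?P k))) \<le> e' * (\<Sum>k<Suc n. norm (w k - ?P k))"
        by (rule holo_on_increment[OF openC h P e']) blast
      define m where "m = min s (s / (C + 1))"
      have m: "m > 0" using s(1) C by (simp add: m_def)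
      have "eventually (\<lambda>w. dist w (x0 i) < m) (at (x0 i))"
        using m by (auto simp: eventually_at)
      with inD ne Qb show "eventually (\<lambda>w. dist (c + b * Q w) 0 < e) (at (x0 i))"
      proof eventually_elim
        case (elim w)
        let ?W = "(?X w)(n := \<phi> (?X w))"
        have "\<phi> (?X w) - \<phi> x0 = Q w * (w - x0 i)" using elim(2) by (simp add: Q_def)
        then have n1: "norm (\<phi> (?X w) - \<phi> x0) = norm (Q w) * norm (w - x0 i)" by (simp add: norm_mult)
        have "norm (Q w) * norm (w - x0 i) \<le> C * norm (w - x0 i)"
          using elim(3) by (rule mult_right_mono) simp
        also have "\<dots> \<le> (C + 1) * norm (w - x0 i)" by (rule mult_right_mono) auto
        also have "\<dots> < (C + 1) * (s / (C + 1))"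
          using elim(4) C by (intro mult_strict_left_mono) (auto simp: m_def dist_norm)
        finally have n2: "norm (\<phi> (?X w) - \<phi> x0) < s" using C n1 by simp
        have "?W \<in> Cn (Suc n)" using up[OF DC[OF elim(1)]] .
        then have "?W \<in> polydisc (Suc n) ?P s"
          using n2 elim(4) i s(1) by (auto simp: polydisc_def dist_norm less_Suc_eq m_def)
        from s(2)[OF this]
        have "norm (h ?W - h ?P - (\<Sum>k<Suc n. partial k h ?P * (?W k - ?P k))) \<le> e' * (\<Sum>k<Suc n. norm (?W k - ?P k))" .
        moreover have "(\<Sum>k<n. partial k h ?P * (?W k - ?P k)) = (\<Sum>k<n. if k = i then c * (w - x0 i) else 0)"
          by (rule sum.cong) (auto simp: c_def)
        moreover have "(\<Sum>k<n. norm (?W k - ?P k)) = (\<Sum>k<n. if k = i then norm (w - x0 i) else 0)"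
          by (rule sum.cong) auto
        moreover have "h ?W - h ?P = 0" using \<phi>(2)[OF elim(1)] \<phi>(2)[OF x0] by simp
        ultimately have "norm (- (c * (w - x0 i) + b * (\<phi> (?X w) - \<phi> x0))) \<le> e' * (norm (w - x0 i) + norm (\<phi> (?X w) - \<phi> x0))"
          using i by (simp add: b_def)
        then have "norm (c * (w - x0 i) + b * (\<phi> (?X w) - \<phi> x0)) \<le> e' * (norm (w - x0 i) + norm (\<phi> (?X w) - \<phi> x0))"
          unfolding norm_minus_cancel .
        also have "c * (w - x0 i) + b * (\<phi> (?X w) - \<phi> x0) = (c + b * Q w) * (w - x0 i)"
          using elim(2) by (simp add: Q_def field_simps)
        also have "norm (w - x0 i) + norm (\<phi> (?X w) - \<phi> x0) = (1 + norm (Q w)) * norm (w - x0 i)"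
          by (simp add: n1 distrib_right)
        finally have "norm (c + b * Q w) * norm (w - x0 i) \<le> e' * (1 + norm (Q w)) * norm (w - x0 i)"
          by (simp add: norm_mult mult.assoc)
        then have "norm (c + b * Q w) \<le> e' * (1 + norm (Q w))" using elim(2) by simp
        also have "\<dots> \<le> e' * (1 + C)" using elim(3) e' by (intro mult_left_mono) auto
        also have "e' * (1 + C) = e / 2" using C by (simp add: e'_def divide_simps)
        also have "\<dots> < e" using e by simp
        finally show ?case by simp
      qed
    qed
    then have "((\<lambda>w. (c + b * Q w - c) / b) \<longlongrightarrow> (0 - c) / b) (at (x0 i))"
      using b by (intro tendsto_divide tendsto_diff tendsto_const) auto
    then have "(Q \<longlongrightarrow> - c / b) (at (x0 i))" using b by simp
    then have "((\<lambda>w. \<phi> (?X w)) has_field_derivative - c / b) (at (x0 i))"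
      by (simp add: has_field_derivative_iff Q_def[abs_def])
    then show "(\<lambda>w. \<phi> (?X w)) field_differentiable at (x0 i)"
      unfolding field_differentiable_def by (rule exI)
  qed
  show ?thesis
  proof (rule that[OF r(1,3) d(1,3) hol])
    show "dist (\<phi> x) (p n) < r \<and> h (x(n := \<phi> x)) = 0" if "x \<in> ?D" for x
      using \<phi>[OF that] by simp
    show "w = \<phi> x" if "x \<in> ?D" "dist w (p n) < r" "h (x(n := w)) = 0" for x w
      using uniq[OF that(1,2) \<phi>(1)[OF that(1)] that(3) \<phi>(2)[OF that(1)]] .
  qed
qed

section \<open>Manifolds and submanifolds\<close>

lemma is_chart_openin: "is_chart n X c \<Longrightarrow> openin X (chart_dom c)"
  by (simp add: is_chart_def)

lemma is_chart_subset: "is_chart n X c \<Longrightarrow> chart_dom c \<subseteq> topspace X"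
  by (simp add: is_chart_def openin_subset)

lemma is_chart_image: "is_chart n X c \<Longrightarrow> openC n (coord c ` chart_dom c)"
  by (simp add: is_chart_def)

lemma is_chart_inj:
  assumes "is_chart n X c" shows "inj_on (coord c) (chart_dom c)"
proof -
  have "topspace (subtopology X (chart_dom c)) = chart_dom c"
    using is_chart_subset[OF assms] by auto
  moreover have "homeomorphic_map (subtopology X (chart_dom c)) (top_of_set (coord c ` chart_dom c)) (coord c)"
    using assms by (simp add: is_chart_def)
  ultimately show ?thesis using homeomorphic_imp_injective_map by metis
qed

lemma param_coord: "is_chart n X c \<Longrightarrow> x \<in> chart_dom c \<Longrightarrow> param c (coord c x) = x"
  unfolding param_def by (rule inv_into_f_f[OF is_chart_inj])

lemma coord_param: "z \<in> coord c ` chart_dom c \<Longrightarrow> coord c (param c z) = z"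
  unfolding param_def by (rule f_inv_into_f)

lemma param_in: "z \<in> coord c ` chart_dom c \<Longrightarrow> param c z \<in> chart_dom c"
  unfolding param_def by (rule inv_into_into)

lemma is_chart_open_image:
  assumes c: "is_chart n X c" and W: "openin X W"
  shows "openC n (coord c ` (chart_dom c \<inter> W))"
proof -
  have "openin (subtopology X (chart_dom c)) (chart_dom c \<inter> W)"
    using W by (metis inf_commute openin_subtopology_Int2)
  moreover have "open_map (subtopology X (chart_dom c)) (top_of_set (coord c ` chart_dom c)) (coord c)"
    using c by (simp add: is_chart_def homeomorphic_imp_open_map)
  ultimately have "openin (top_of_set (coord c ` chart_dom c)) (coord c ` (chart_dom c \<inter> W))"
    by (simp add: open_map_def)
  then show ?thesis using is_chart_image[OF c] by (rule openin_trans)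
qed

lemma complex_manifoldD:
  assumes "complex_manifold M"
  shows "c \<in> atlas M \<Longrightarrow> is_chart (mdim M) (mtop M) c"
    and "topspace (mtop M) = (\<Union>c\<in>atlas M. chart_dom c)"
    and "c \<in> atlas M \<Longrightarrow> d \<in> atlas M \<Longrightarrow> compatible (mdim M) c d"
  using assms by (auto simp: complex_manifold_def)

lemma atlas_subset_maximal: "complex_manifold M \<Longrightarrow> atlas M \<subseteq> maximal_atlas M"
  by (auto simp: maximal_atlas_def complex_manifold_def)

lemma maximal_atlasD:
  assumes "c \<in> maximal_atlas M"
  shows "is_chart (mdim M) (mtop M) c" and "d \<in> atlas M \<Longrightarrow> compatible (mdim M) c d"
  using assms by (auto simp: maximal_atlas_def)

lemma transition_image:
  assumes "is_chart n X c" and "A \<subseteq> chart_dom c \<inter> chart_dom d"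
  shows "transition c d ` coord c ` A = coord d ` A"
proof -
  have "transition c d (coord c x) = coord d x" if "x \<in> A" for x
    using assms that by (auto simp: transition_def param_coord[OF assms(1)])
  then show ?thesis by (simp add: image_image)
qed

text \<open>\<open>holo_map\<close> tests only the charts of the two atlases. Near a given point the
  local expression in other charts is composed of one in atlas charts and two holomorphic transition
  maps.\<close>

lemma holo_map_maximal:
  assumes M: "complex_manifold M" and N: "complex_manifold N" and F: "holo_map M N F"
    and c: "c \<in> maximal_atlas M" and d: "d \<in> maximal_atlas N" and i: "i < mdim N"
  shows "holo_on (mdim M) (\<lambda>z. coord d (F (param c z)) i) (coord c ` {x \<in> chart_dom c. F x \<in> chart_dom d})"
proof (rule holo_on_openI)
  let ?m = "mdim M" and ?n = "mdim N"
  note cc = maximal_atlasD(1)[OF c] and dd = maximal_atlasD(1)[OF d]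
  have Fc: "continuous_map (mtop M) (mtop N) F" using F by (simp add: holo_map_def)
  show "coord c ` {x \<in> chart_dom c. F x \<in> chart_dom d} \<subseteq> Cn ?m"
    using openC_subset[OF is_chart_image[OF cc]] by blast
  fix z assume "z \<in> coord c ` {x \<in> chart_dom c. F x \<in> chart_dom d}"
  then obtain x where x: "x \<in> chart_dom c" "F x \<in> chart_dom d" "z = coord c x" by blast
  have xM: "x \<in> topspace (mtop M)" using x(1) is_chart_subset[OF cc] by blast
  then obtain c' where c': "c' \<in> atlas M" "x \<in> chart_dom c'"
    using complex_manifoldD(2)[OF M] by blast
  have "F x \<in> topspace (mtop N)" using x(2) is_chart_subset[OF dd] by blast
  then obtain d' where d': "d' \<in> atlas N" "F x \<in> chart_dom d'"
    using complex_manifoldD(2)[OF N] by blast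
  note cc' = complex_manifoldD(1)[OF M c'(1)] and dd' = complex_manifoldD(1)[OF N d'(1)]
  \<comment> \<open>On \<open>O'\<close> all four charts are available: both around the point and
    both around its image.\<close>
  define O' where "O' = chart_dom c \<inter> (chart_dom c' \<inter> {x \<in> topspace (mtop M). F x \<in> chart_dom d \<inter> chart_dom d'})"
  have O': "openin (mtop M) O'"
    unfolding O'_def using is_chart_openin[OF cc] is_chart_openin[OF cc'] is_chart_openin[OF dd] is_chart_openin[OF dd']
    by (intro openin_Int openin_continuous_map_preimage[OF Fc]) auto
  have O'c: "O' \<subseteq> chart_dom c" "O' \<subseteq> chart_dom c'" "\<And>y. y \<in> O' \<Longrightarrow> F y \<in> chart_dom d \<and> F y \<in> chart_dom d'"
    by (auto simp: O'_def)
  let ?V = "coord c ` O'" and ?V' = "coord c' ` O'" and ?V'' = "coord d' ` (chart_dom d' \<inter> chart_dom d)"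
  have V: "openC ?m ?V" using is_chart_open_image[OF cc O'] O'c(1) by (simp add: inf.absorb2)
  have V': "openC ?m ?V'" using is_chart_open_image[OF cc' O'] O'c(2) by (simp add: inf.absorb2)
  have V'': "openC ?n ?V''" by (rule is_chart_open_image[OF dd' is_chart_openin[OF dd]])
  have T: "transition c c' ` ?V = ?V'" by (rule transition_image[OF cc]) (use O'c in auto)
  have t: "holo_on ?m (\<lambda>z. transition c c' z j) ?V" if "j < ?m" for j
    using maximal_atlasD(2)[OF c c'(1)] that O'c(1,2) unfolding compatible_def
    by (meson holo_on_subset image_mono le_inf_iff)
  have g: "holo_on ?m (\<lambda>w. coord d' (F (param c' w)) j) ?V'" if "j < ?n" for j
  proof -
    have "holo_on ?m (\<lambda>w. coord d' (F (param c' w)) j) (coord c' ` {x \<in> chart_dom c'. F x \<in> chart_dom d'})"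
      using F c'(1) d'(1) that by (simp add: holo_map_def)
    then show ?thesis by (rule holo_on_subset) (use O'c in blast)
  qed
  have G: "(\<lambda>w. coord d' (F (param c' w))) ` ?V' \<subseteq> ?V''"
  proof -
    have "coord d' (F (param c' (coord c' y))) \<in> ?V''" if "y \<in> O'" for y
      using that O'c param_coord[OF cc', of y] by auto
    then show ?thesis by blast
  qed
  have f: "holo_on ?n (\<lambda>w. transition d' d w i) ?V''"
    using maximal_atlasD(2)[OF d d'(1)] i unfolding compatible_def by (simp add: inf_commute)
  have "holo_on ?m (\<lambda>w. transition d' d (coord d' (F (param c' w))) i) ?V'"
    by (rule holo_on_compose[OF V' V'' f g G])
  then have "holo_on ?m (\<lambda>z. transition d' d (coord d' (F (param c' (transition c c' z)))) i) ?V"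
    by (rule holo_on_compose[OF V V' _ t]) (use T in auto)
  then have "holo_on ?m (\<lambda>z. coord d (F (param c z)) i) ?V"
  proof (rule holo_on_cong[OF V])
    fix z assume "z \<in> ?V"
    then obtain y where y: "y \<in> O'" "z = coord c y" by blast
    then have pz: "param c z = y" using O'c param_coord[OF cc, of y] by auto
    moreover have "param c' (transition c c' z) = y"
      using y O'c param_coord[OF cc', of y] pz by (auto simp: transition_def)
    moreover have "transition d' d (coord d' (F y)) = coord d (F y)"
      using O'c(3)[OF y(1)] param_coord[OF dd', of "F y"] by (simp add: transition_def)
    ultimately show "transition d' d (coord d' (F (param c' (transition c c' z)))) i = coord d (F (param c z)) i"
      by simp
  qed
  moreover have "z \<in> ?V" using x c' d' xM by (auto simp: O'_def)
  ultimately show "\<exists>V. openC ?m V \<and> z \<in> V \<and> holo_on ?m (\<lambda>z. coord d (F (param c z)) i) V"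
    using V by blast
qed

lemma holo_map_id: "complex_manifold M \<Longrightarrow> holo_map M M (\<lambda>x. x)"
proof -
  assume M: "complex_manifold M"
  have "coord c ` {x \<in> chart_dom c. x \<in> chart_dom d} = coord c ` (chart_dom c \<inter> chart_dom d)" for c d :: "'a chart"
    by auto
  then show ?thesis
    using complex_manifoldD(3)[OF M] by (auto simp: holo_map_def compatible_def transition_def)
qed

text \<open>The local expressions of the identity map are the transition maps.\<close>

lemma maximal_compatible:
  assumes M: "complex_manifold M" and c: "c \<in> maximal_atlas M" and d: "d \<in> maximal_atlas M"
  shows "compatible (mdim M) c d"
proof -
  have "{x \<in> chart_dom c. x \<in> chart_dom d} = chart_dom c \<inter> chart_dom d"
    "{x \<in> chart_dom d. x \<in> chart_dom c} = chart_dom c \<inter> chart_dom d" by auto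
  then show ?thesis
    using holo_map_maximal[OF M M holo_map_id[OF M] c d] holo_map_maximal[OF M M holo_map_id[OF M] d c]
    by (auto simp: compatible_def transition_def)
qed

lemma Cn_mono: "k \<le> n \<Longrightarrow> Cn k \<subseteq> Cn n"
  by (auto simp: Cn_def)

lemma openC_Int_Cn: "openC n A \<Longrightarrow> k \<le> n \<Longrightarrow> openC k (A \<inter> Cn k)"
  using Cn_mono[of k n] by (auto simp: openin_open)

text \<open>\<open>Cn k\<close> is literally a subset of \<open>Cn n\<close>, so restriction to it
  only drops conditions.\<close>

lemma holo_on_dim_mono: "holo_on n f A \<Longrightarrow> k \<le> n \<Longrightarrow> B \<subseteq> A \<Longrightarrow> holo_on k f B"
  unfolding holo_on_def by (meson continuous_on_subset less_le_trans subsetD)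

lemma restrict_manifold_simps [simp]:
  "mdim (restrict_manifold M k S) = k" "mtop (restrict_manifold M k S) = subtopology (mtop M) S"
  by (simp_all add: restrict_manifold_def)

lemma restrict_atlasE:
  assumes "c \<in> atlas (restrict_manifold M k S)"
  obtains U \<phi> where "c = (U \<inter> S, \<phi>)" "(U, \<phi>) \<in> maximal_atlas M" "\<phi> ` (U \<inter> S) = \<phi> ` U \<inter> Cn k"
  using assms by (auto simp: restrict_manifold_def)

lemma restrict_atlasI:
  "(U, \<phi>) \<in> maximal_atlas M \<Longrightarrow> \<phi> ` (U \<inter> S) = \<phi> ` U \<inter> Cn k \<Longrightarrow> (U \<inter> S, \<phi>) \<in> atlas (restrict_manifold M k S)"
  by (auto simp: restrict_manifold_def)

lemma param_restrict:
  assumes "is_chart n X (U, \<phi>)" and "z \<in> \<phi> ` (U \<inter> S)"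
  shows "param (U \<inter> S, \<phi>) z = param (U, \<phi>) z"
proof -
  have inj: "inj_on \<phi> U" using is_chart_inj[OF assms(1)] by simp
  obtain x where "x \<in> U \<inter> S" "z = \<phi> x" using assms(2) by blast
  then show ?thesis
    using inj inj_on_subset[OF inj, of "U \<inter> S"] by (auto simp: param_def inv_into_f_f)
qed

lemma is_chart_restrict:
  assumes c: "is_chart n X (U, \<phi>)" and k: "k \<le> n" and eq: "\<phi> ` (U \<inter> S) = \<phi> ` U \<inter> Cn k"
  shows "is_chart k (subtopology X S) (U \<inter> S, \<phi>)"
proof -
  have U: "openin X U" "U \<subseteq> topspace X" "openC n (\<phi> ` U)"
    using is_chart_openin[OF c] is_chart_subset[OF c] is_chart_image[OF c] by auto
  have "openC k (\<phi> ` (U \<inter> S))" unfolding eq by (rule openC_Int_Cn[OF U(3) k])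
  moreover have "homeomorphic_map (subtopology (subtopology X U) S) (subtopology (top_of_set (\<phi> ` U)) (Cn k)) \<phi>"
  proof (rule homeomorphic_map_subtopologies)
    show "homeomorphic_map (subtopology X U) (top_of_set (\<phi> ` U)) \<phi>" using c by (simp add: is_chart_def)
    show "\<phi> ` (topspace (subtopology X U) \<inter> S) = topspace (top_of_set (\<phi> ` U)) \<inter> Cn k"
      using eq U(2) by (simp add: inf.absorb2)
  qed
  then have "homeomorphic_map (subtopology (subtopology X S) (U \<inter> S)) (top_of_set (\<phi> ` (U \<inter> S))) \<phi>"
    by (simp add: subtopology_subtopology flip: eq) (simp add: inf_commute inf_left_commute eq)
  moreover have "openin (subtopology X S) (U \<inter> S)" using U(1) by (rule openin_subtopology_Int)
  ultimately show ?thesis by (simp add: is_chart_def)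
qed

text \<open>Transition maps between flattening charts are restrictions to \<open>Cn k\<close> of
  transition maps of \<open>M\<close>.\<close>

lemma complex_manifold_restrict:
  assumes M: "complex_manifold M" and S: "complex_submanifold M k S"
  shows "complex_manifold (restrict_manifold M k S)"
  unfolding complex_manifold_def restrict_manifold_simps
proof (intro conjI ballI)
  have k: "k \<le> mdim M" and SX: "S \<subseteq> topspace (mtop M)" using S by (auto simp: complex_submanifold_def)
  show "Hausdorff_space (subtopology (mtop M) S)"
    using M by (simp add: complex_manifold_def Hausdorff_space_subtopology)
  show "second_countable (subtopology (mtop M) S)"
    using M by (simp add: complex_manifold_def second_countable_subtopology)
  show "topspace (subtopology (mtop M) S) = (\<Union>c\<in>atlas (restrict_manifold M k S). chart_dom c)"
  proof
    show "topspace (subtopology (mtop M) S) \<subseteq> (\<Union>c\<in>atlas (restrict_manifold M k S). chart_dom c)"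
      using S by (auto simp: complex_submanifold_def)
    have "chart_dom c \<subseteq> S" if "c \<in> atlas (restrict_manifold M k S)" for c
      using that by (auto elim: restrict_atlasE)
    then show "(\<Union>c\<in>atlas (restrict_manifold M k S). chart_dom c) \<subseteq> topspace (subtopology (mtop M) S)"
      using SX by auto
  qed
  fix c assume "c \<in> atlas (restrict_manifold M k S)"
  then obtain U \<phi> where c: "c = (U \<inter> S, \<phi>)" "(U, \<phi>) \<in> maximal_atlas M" "\<phi> ` (U \<inter> S) = \<phi> ` U \<inter> Cn k"
    by (rule restrict_atlasE)
  note cU = maximal_atlasD(1)[OF c(2)]
  show "is_chart k (subtopology (mtop M) S) c"
    unfolding c(1) by (rule is_chart_restrict[OF cU k c(3)])
  fix d assume "d \<in> atlas (restrict_manifold M k S)"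
  then obtain V \<psi> where d: "d = (V \<inter> S, \<psi>)" "(V, \<psi>) \<in> maximal_atlas M" "\<psi> ` (V \<inter> S) = \<psi> ` V \<inter> Cn k"
    by (rule restrict_atlasE)
  have half: "holo_on k (\<lambda>z. transition (U \<inter> S, \<phi>) (V \<inter> S, \<psi>) z i) (\<phi> ` ((U \<inter> S) \<inter> (V \<inter> S)))"
    if U: "(U, \<phi>) \<in> maximal_atlas M" "\<phi> ` (U \<inter> S) = \<phi> ` U \<inter> Cn k" and V: "(V, \<psi>) \<in> maximal_atlas M" and i: "i < k"
    for U \<phi> V \<psi> i
  proof -
    note cU = maximal_atlasD(1)[OF U(1)] and cV = maximal_atlasD(1)[OF V]
    have "holo_on (mdim M) (\<lambda>z. transition (U, \<phi>) (V, \<psi>) z i) (\<phi> ` (U \<inter> V))"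
      using maximal_compatible[OF M U(1) V] i k by (simp add: compatible_def)
    then have h: "holo_on k (\<lambda>z. transition (U, \<phi>) (V, \<psi>) z i) (\<phi> ` ((U \<inter> S) \<inter> (V \<inter> S)))"
      by (rule holo_on_dim_mono[OF _ k]) auto
    have "openin (subtopology (mtop M) S) (V \<inter> S)"
      using is_chart_openin[OF cV] by (simp add: openin_subtopology_Int)
    from is_chart_open_image[OF is_chart_restrict[OF cU k U(2)] this]
    have "openC k (\<phi> ` ((U \<inter> S) \<inter> (V \<inter> S)))" by simp
    then show ?thesis
    proof (rule holo_on_cong[OF _ h])
      fix z assume "z \<in> \<phi> ` ((U \<inter> S) \<inter> (V \<inter> S))"
      then have "z \<in> \<phi> ` (U \<inter> S)" by blast
      then show "transition (U, \<phi>) (V, \<psi>) z i = transition (U \<inter> S, \<phi>) (V \<inter> S, \<psi>) z i"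
        by (simp add: transition_def param_restrict[OF cU])
    qed
  qed
  show "compatible k c d"
    unfolding compatible_def c(1) d(1) fst_conv snd_conv
    using half[OF c(2,3) d(2)] half[OF d(2,3) c(2)] by (simp add: inf_commute)
qed

lemma holo_map_restrict_source:
  assumes M: "complex_manifold M" and N: "complex_manifold N" and F: "holo_map M N F" and k: "k \<le> mdim M"
  shows "holo_map (restrict_manifold M k S) N F"
  unfolding holo_map_def restrict_manifold_simps
proof (intro conjI ballI allI impI)
  show "continuous_map (subtopology (mtop M) S) (mtop N) F"
    using F by (simp add: holo_map_def continuous_map_from_subtopology)
  fix c d i assume c: "c \<in> atlas (restrict_manifold M k S)" and d: "d \<in> atlas N" and i: "i < mdim N"
  from c obtain U \<phi> where c: "c = (U \<inter> S, \<phi>)" "(U, \<phi>) \<in> maximal_atlas M" "\<phi> ` (U \<inter> S) = \<phi> ` U \<inter> Cn k"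
    by (rule restrict_atlasE)
  note cU = maximal_atlasD(1)[OF c(2)]
  have Fc: "continuous_map (subtopology (mtop M) S) (mtop N) F"
    using F by (simp add: holo_map_def continuous_map_from_subtopology)
  have "holo_on (mdim M) (\<lambda>z. coord d (F (param (U, \<phi>) z)) i) (\<phi> ` {x \<in> U. F x \<in> chart_dom d})"
    using holo_map_maximal[OF M N F c(2) subsetD[OF atlas_subset_maximal[OF N] d] i] by simp
  then have h: "holo_on k (\<lambda>z. coord d (F (param (U, \<phi>) z)) i) (\<phi> ` {x \<in> U \<inter> S. F x \<in> chart_dom d})"
    by (rule holo_on_dim_mono[OF _ k]) auto
  have "openin (subtopology (mtop M) S) {x \<in> topspace (subtopology (mtop M) S). F x \<in> chart_dom d}"
    by (rule openin_continuous_map_preimage[OF Fc is_chart_openin[OF complex_manifoldD(1)[OF N d]]])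
  from is_chart_open_image[OF is_chart_restrict[OF cU k c(3)] this]
  have "openC k (\<phi> ` {x \<in> U \<inter> S. F x \<in> chart_dom d})"
  proof (rule back_subst[of "openC k"])
    show "coord (U \<inter> S, \<phi>) ` (chart_dom (U \<inter> S, \<phi>) \<inter> {x \<in> topspace (subtopology (mtop M) S). F x \<in> chart_dom d}) =
      \<phi> ` {x \<in> U \<inter> S. F x \<in> chart_dom d}"
      using is_chart_subset[OF cU] by auto
  qed
  then show "holo_on k (\<lambda>z. coord d (F (param c z)) i) (coord c ` {x \<in> chart_dom c. F x \<in> chart_dom d})"
    unfolding c(1) fst_conv snd_conv
  proof (rule holo_on_cong[OF _ h])
    fix z assume "z \<in> \<phi> ` {x \<in> U \<inter> S. F x \<in> chart_dom d}"
    then have "z \<in> \<phi> ` (U \<inter> S)" by blast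
    then show "coord d (F (param (U, \<phi>) z)) i = coord d (F (param (U \<inter> S, \<phi>) z)) i"
      by (simp add: param_restrict[OF cU])
  qed
qed

lemma holo_map_restrict_target:
  assumes M: "complex_manifold M" and N: "complex_manifold N" and F: "holo_map M N F" and k: "k \<le> mdim N"
    and S: "F ` topspace (mtop M) \<subseteq> S"
  shows "holo_map M (restrict_manifold N k S) F"
  unfolding holo_map_def restrict_manifold_simps
proof (intro conjI ballI allI impI)
  show "continuous_map (mtop M) (subtopology (mtop N) S) F"
    using F S by (auto simp: holo_map_def continuous_map_in_subtopology)
  fix c d i assume c: "c \<in> atlas M" and d: "d \<in> atlas (restrict_manifold N k S)" and i: "i < k"
  from d obtain U \<phi> where d: "d = (U \<inter> S, \<phi>)" "(U, \<phi>) \<in> maximal_atlas N" "\<phi> ` (U \<inter> S) = \<phi> ` U \<inter> Cn k"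
    by (rule restrict_atlasE)
  have "chart_dom c \<subseteq> topspace (mtop M)" using is_chart_subset[OF complex_manifoldD(1)[OF M c]] .
  then have "{x \<in> chart_dom c. F x \<in> U} = {x \<in> chart_dom c. F x \<in> U \<inter> S}" using S by blast
  then show "holo_on (mdim M) (\<lambda>z. coord d (F (param c z)) i) (coord c ` {x \<in> chart_dom c. F x \<in> chart_dom d})"
    using holo_map_maximal[OF M N F subsetD[OF atlas_subset_maximal[OF M] c] d(2), of i] i k
    by (simp add: d(1))
qed

section \<open>Projective space\<close>

lemma continuous_map_coordI:
  fixes f :: "'a \<Rightarrow> 'b \<Rightarrow> 'c::topological_space"
  assumes "\<And>i. continuous_map X euclidean (\<lambda>x. f x i)"
  shows "continuous_map X euclidean f"
proof -
  have "continuous_map X (product_topology (\<lambda>i. euclidean) UNIV) f"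
    using assms by (simp add: continuous_map_componentwise_UNIV)
  then show ?thesis by (simp add: euclidean_product_topology)
qed

lemma continuous_map_coordD:
  fixes f :: "'a \<Rightarrow> 'b \<Rightarrow> 'c::topological_space"
  assumes "continuous_map X euclidean f"
  shows "continuous_map X euclidean (\<lambda>x. f x i)"
proof -
  have "continuous_map X (product_topology (\<lambda>i. euclidean) UNIV) f"
    using assms by (simp add: euclidean_product_topology)
  then show ?thesis by (simp add: continuous_map_componentwise_UNIV)
qed

text \<open>An explicit inverse \<open>g\<close> settles the homeomorphism and also computes
  \<open>param\<close>, which is otherwise only an \<open>inv_into\<close>.\<close>

lemma is_chartI:
  assumes U: "openin X U" and V: "openC n V"
    and f: "continuous_map (subtopology X U) euclidean f" and fV: "\<And>x. x \<in> U \<Longrightarrow> f x \<in> V"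
    and g: "continuous_map (top_of_set V) X g" and gU: "\<And>z. z \<in> V \<Longrightarrow> g z \<in> U"
    and gf: "\<And>x. x \<in> U \<Longrightarrow> g (f x) = x" and fg: "\<And>z. z \<in> V \<Longrightarrow> f (g z) = z"
  shows "is_chart n X (U, f)" and "f ` U = V" and "\<And>z. z \<in> V \<Longrightarrow> param (U, f) z = g z"
proof -
  show im: "f ` U = V" using fV fg gU by force
  have UX: "U \<subseteq> topspace X" using U by (rule openin_subset)
  have "homeomorphic_maps (subtopology X U) (top_of_set V) f g"
    unfolding homeomorphic_maps_def
  proof (intro conjI ballI)
    show "continuous_map (subtopology X U) (top_of_set V) f"
      using f fV by (auto simp: continuous_map_in_subtopology)
    show "continuous_map (top_of_set V) (subtopology X U) g"
      using g gU by (auto simp: continuous_map_in_subtopology)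
  qed (use UX gf fg in auto)
  then have "homeomorphic_map (subtopology X U) (top_of_set V) f" by (rule homeomorphic_maps_imp_map)
  then show c: "is_chart n X (U, f)" using U V by (simp add: is_chart_def im)
  show "param (U, f) z = g z" if "z \<in> V" for z
    using param_coord[OF c, of "g z"] gU[OF that] fg[OF that] by simp
qed

lemma in_proj_point: "x \<in> proj_point v \<longleftrightarrow> (\<exists>c. c \<noteq> 0 \<and> x = (\<lambda>i. c * v i))"
  by (auto simp: proj_point_def)

lemma proj_point_eq_iff: "proj_point v = proj_point w \<longleftrightarrow> (\<exists>c. c \<noteq> 0 \<and> w = (\<lambda>i. c * v i))"
proof
  assume "proj_point v = proj_point w"
  moreover have "w \<in> proj_point w" unfolding proj_point_def by (auto intro!: exI[of _ 1])
  ultimately show "\<exists>c. c \<noteq> 0 \<and> w = (\<lambda>i. c * v i)" by (auto simp: proj_point_def)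
next
  assume "\<exists>c. c \<noteq> 0 \<and> w = (\<lambda>i. c * v i)"
  then obtain c where c: "c \<noteq> 0" "w = (\<lambda>i. c * v i)" by blast
  have "proj_point w \<subseteq> proj_point v"
  proof
    fix x assume "x \<in> proj_point w"
    then obtain d where d: "d \<noteq> 0" "x = (\<lambda>i. d * w i)" by (auto simp: proj_point_def)
    then have "x = (\<lambda>i. (d * c) * v i)" using c(2) by (simp add: mult.assoc)
    then show "x \<in> proj_point v" unfolding in_proj_point using d(1) c(1) by (intro exI[of _ "d * c"]) simp
  qed
  moreover have "proj_point v \<subseteq> proj_point w"
  proof
    fix x assume "x \<in> proj_point v"
    then obtain d where d: "d \<noteq> 0" "x = (\<lambda>i. d * v i)" by (auto simp: proj_point_def)
    then have "x = (\<lambda>i. (d / c) * w i)" using c by simp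
    then show "x \<in> proj_point w" unfolding in_proj_point using d(1) c(1) by (intro exI[of _ "d / c"]) simp
  qed
  ultimately show "proj_point v = proj_point w" by blast
qed

lemma self_in_proj_point: "v \<in> proj_point v"
  unfolding in_proj_point by (rule exI[of _ 1]) simp

lemma proj_pointsI: "v \<in> Cn (Suc N) \<Longrightarrow> v i \<noteq> 0 \<Longrightarrow> proj_point v \<in> proj_points N"
  unfolding proj_points_def by (rule imageI) auto

lemma proj_pointsE:
  assumes "L \<in> proj_points N"
  obtains v where "v \<in> Cn (Suc N)" "v \<noteq> 0" "L = proj_point v"
  using assms by (auto simp: proj_points_def)

text \<open>Homogeneous coordinates normalised by \<open>v i = 1\<close>; they make sense where the \<open>i\<close>-th one does not
  vanish.\<close>

definition hom_coord :: "nat \<Rightarrow> (nat \<Rightarrow> complex) set \<Rightarrow> nat \<Rightarrow> complex" where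
  "hom_coord i L = (THE v. v \<in> L \<and> v i = 1)"

lemma hom_coord: "v i \<noteq> 0 \<Longrightarrow> hom_coord i (proj_point v) j = v j / v i"
proof -
  assume v: "v i \<noteq> 0"
  have "hom_coord i (proj_point v) = (\<lambda>j. v j / v i)"
    unfolding hom_coord_def
  proof (rule the_equality)
    show "(\<lambda>j. v j / v i) \<in> proj_point v \<and> v i / v i = 1"
      using v by (auto simp: proj_point_def intro!: exI[of _ "inverse (v i)"] simp: field_simps)
    fix w assume "w \<in> proj_point v \<and> w i = 1"
    then show "w = (\<lambda>j. v j / v i)" using v by (auto simp: proj_point_def field_simps)
  qed
  then show ?thesis by simp
qed

definition aff_dom :: "nat \<Rightarrow> nat \<Rightarrow> (nat \<Rightarrow> complex) set set" where
  "aff_dom N i = chart_dom (affine_chart N i)"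

lemma proj_point_in_aff_dom: "v \<in> Cn (Suc N) \<Longrightarrow> proj_point v \<in> aff_dom N i \<longleftrightarrow> v i \<noteq> 0"
  using self_in_proj_point[of v]
  by (auto simp: aff_dom_def affine_chart_def proj_point_def intro!: proj_pointsI[unfolded proj_point_def])

lemma aff_domE:
  assumes "L \<in> aff_dom N i"
  obtains v where "v \<in> Cn (Suc N)" "v i \<noteq> 0" "L = proj_point v"
proof -
  have "L \<in> proj_points N" using assms by (simp add: aff_dom_def affine_chart_def)
  then show ?thesis using assms that by (metis proj_pointsE proj_point_in_aff_dom)
qed

lemma hom_coord_aff:
  assumes "L \<in> aff_dom N i"
  shows "hom_coord i L \<in> Cn (Suc N)" "hom_coord i L i = 1" "proj_point (hom_coord i L) = L"
proof -
  obtain v where v: "v \<in> Cn (Suc N)" "v i \<noteq> 0" "L = proj_point v" using assms by (rule aff_domE)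
  have eq: "hom_coord i L = (\<lambda>j. v j / v i)" using v by (simp add: hom_coord fun_eq_iff)
  show "hom_coord i L \<in> Cn (Suc N)" "hom_coord i L i = 1" using v(1,2) unfolding eq by (simp_all add: Cn_def)
  have "\<exists>c. c \<noteq> 0 \<and> v = (\<lambda>j. c * (v j / v i))" using v(2) by (intro exI[of _ "v i"]) simp
  then show "proj_point (hom_coord i L) = L" unfolding eq unfolding v(3) proj_point_eq_iff .
qed

text \<open>Position, among the homogeneous coordinates, of the affine coordinate \<open>j\<close>
  when entry \<open>i\<close> is omitted.\<close>

definition skip :: "nat \<Rightarrow> nat \<Rightarrow> nat" where
  "skip i j = (if j < i then j else Suc j)"

lemma coord_affine_chart: "coord (affine_chart N i) L j = hom_coord i L (skip i j)"
  by (simp add: affine_chart_def hom_coord_def skip_def Let_def)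

lemma quotient_proj_point: "quotient_map (top_of_set (Cn (Suc N) - {0})) (proj_topology N) proj_point"
proof -
  let ?X = "Cn (Suc N) - {0}"
  have ts: "topspace (proj_topology N) = proj_points N"
  proof -
    have "{v \<in> ?X. proj_point v \<in> proj_points N} = ?X" by (auto simp: proj_points_def)
    then have "openin (proj_topology N) (proj_points N)" by (simp add: openin_proj_topology)
    then show ?thesis using openin_proj_topology openin_subset openin_topspace by blast
  qed
  show ?thesis
    unfolding quotient_map_def ts by (auto simp: proj_points_def openin_proj_topology)
qed

lemma topspace_proj_topology [simp]: "topspace (proj_topology N) = proj_points N"
  using quotient_imp_surjective_map[OF quotient_proj_point[of N]] by (simp add: proj_points_def)

lemma openin_aff_dom: "openin (proj_topology N) (aff_dom N i)"
proof -
  have "open {v :: nat \<Rightarrow> complex. v i \<noteq> 0}"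
    by (intro open_Collect_neq continuous_on_product_coordinates continuous_on_const)
  moreover have "{v \<in> Cn (Suc N) - {0}. proj_point v \<in> aff_dom N i} = (Cn (Suc N) - {0}) \<inter> {v. v i \<noteq> 0}"
    using proj_point_in_aff_dom by auto
  moreover have "aff_dom N i \<subseteq> proj_points N" by (auto simp: aff_dom_def affine_chart_def)
  ultimately show ?thesis by (simp add: openin_proj_topology openin_open_Int)
qed

text \<open>Continuity is tested on the quotient map, which restricts to a quotient map over the
  open set \<open>aff_dom N i\<close>.\<close>

lemma continuous_map_hom_coord: "continuous_map (subtopology (proj_topology N) (aff_dom N i)) euclidean (hom_coord i)"
proof (rule continuous_compose_quotient_map)
  let ?U = "{v \<in> Cn (Suc N) - {0}. v i \<noteq> 0}"
  show "quotient_map (subtopology (top_of_set (Cn (Suc N) - {0})) ?U) (subtopology (proj_topology N) (aff_dom N i)) proj_point"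
    by (rule quotient_map_restriction[OF quotient_proj_point])
      (use openin_aff_dom proj_point_in_aff_dom in auto)
  have "continuous_on ?U (\<lambda>v j. v j / v i)"
    by (rule continuous_on_coordinatewise_then_product)
      (intro continuous_on_divide continuous_on_subset[OF continuous_on_product_coordinates subset_UNIV] ballI; simp)
  then have "continuous_on ?U (hom_coord i \<circ> proj_point)"
    by (rule continuous_on_eq) (auto simp: hom_coord fun_eq_iff)
  moreover have "(Cn (Suc N) - {0}) \<inter> ?U = ?U" by blast
  ultimately show "continuous_map (subtopology (top_of_set (Cn (Suc N) - {0})) ?U) euclidean (hom_coord i \<circ> proj_point)"
    unfolding subtopology_subtopology by (simp only: continuous_map_iff_continuous)
qed

lemma continuous_map_proj_point:
  assumes g: "continuous_on V g" and V: "\<And>x. x \<in> V \<Longrightarrow> g x \<in> Cn (Suc N)" "\<And>x. x \<in> V \<Longrightarrow> \<exists>i. g x i \<noteq> 0"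
  shows "continuous_map (top_of_set V) (proj_topology N) (\<lambda>x. proj_point (g x))"
proof -
  have "continuous_map (top_of_set V) (top_of_set (Cn (Suc N) - {0})) g"
    using g V by (fastforce simp: continuous_map_in_subtopology)
  from continuous_map_compose[OF this quotient_imp_continuous_map[OF quotient_proj_point]]
  show ?thesis by (simp add: o_def)
qed

definition unskip :: "nat \<Rightarrow> (nat \<Rightarrow> complex) \<Rightarrow> nat \<Rightarrow> complex" where
  "unskip i w = (\<lambda>l. if l < i then w l else if l = i then 1 else w (l - 1))"

lemma unskip_simps: "unskip i w i = 1" "unskip i w (skip i j) = w j"
  by (auto simp: unskip_def skip_def)

lemma unskip_Cn: "i \<le> N \<Longrightarrow> w \<in> Cn N \<Longrightarrow> unskip i w \<in> Cn (Suc N)"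
  by (auto simp: unskip_def Cn_def)

lemma skip_cases: "l = i \<or> (\<exists>j. l = skip i j)"
proof (cases "l < i")
  case False
  then show ?thesis by (cases l) (auto simp: skip_def intro!: exI[of _ "l - 1"])
qed (auto simp: skip_def)

lemma affine_chart_is_chart:
  assumes i: "i \<le> N"
  shows "is_chart N (proj_topology N) (affine_chart N i)"
    and "coord (affine_chart N i) ` aff_dom N i = Cn N"
    and "\<And>z. z \<in> Cn N \<Longrightarrow> param (affine_chart N i) z = proj_point (unskip i z)"
proof -
  let ?f = "coord (affine_chart N i)"
  have eq: "affine_chart N i = (aff_dom N i, ?f)" by (simp add: aff_dom_def)
  have 1: "continuous_map (subtopology (proj_topology N) (aff_dom N i)) euclidean ?f"
    by (rule continuous_map_coordI, unfold coord_affine_chart)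
      (rule continuous_map_coordD[OF continuous_map_hom_coord])
  have 2: "?f x \<in> Cn N" if "x \<in> aff_dom N i" for x
    using hom_coord_aff(1)[OF that] i by (auto simp: Cn_def coord_affine_chart skip_def)
  have "continuous_on (Cn N) (unskip i)"
  proof (rule continuous_on_coordinatewise_then_product)
    show "continuous_on (Cn N) (\<lambda>w. unskip i w l)" for l
      unfolding unskip_def
      by (cases "l < i"; cases "l = i") (simp_all add: continuous_on_product_coordinates continuous_on_subset[OF continuous_on_product_coordinates])
  qed
  then have 3: "continuous_map (top_of_set (Cn N)) (proj_topology N) (\<lambda>w. proj_point (unskip i w))"
    by (rule continuous_map_proj_point) (auto simp: unskip_Cn[OF i] intro: exI[of _ i] simp: unskip_simps)
  have 4: "proj_point (unskip i z) \<in> aff_dom N i" if "z \<in> Cn N" for z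
    using unskip_Cn[OF i that] by (simp add: proj_point_in_aff_dom unskip_simps)
  have 5: "proj_point (unskip i (?f x)) = x" if "x \<in> aff_dom N i" for x
  proof -
    have "unskip i (?f x) l = hom_coord i x l" for l
      using skip_cases[of l i] hom_coord_aff(2)[OF that] by (auto simp: unskip_simps coord_affine_chart)
    then have "unskip i (?f x) = hom_coord i x" by blast
    then show ?thesis using hom_coord_aff(3)[OF that] by simp
  qed
  have 6: "?f (proj_point (unskip i z)) = z" if "z \<in> Cn N" for z
    by (simp add: fun_eq_iff coord_affine_chart hom_coord unskip_simps)
  have 0: "openC N (Cn N)" by simp
  note c = is_chartI[OF openin_aff_dom 0 1 2 3 4 5 6]
  show "is_chart N (proj_topology N) (affine_chart N i)" "coord (affine_chart N i) ` aff_dom N i = Cn N"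
    "\<And>z. z \<in> Cn N \<Longrightarrow> param (affine_chart N i) z = proj_point (unskip i z)"
    using c by (simp_all flip: eq)
qed

lemma holo_on_unskip: "holo_on n (\<lambda>w. unskip i w l) U"
  unfolding unskip_def by (cases "l < i"; cases "l = i") simp_all

lemma affine_chart_compatible:
  assumes "i \<le> N" "j \<le> N" shows "compatible N (affine_chart N i) (affine_chart N j)"
proof -
  have "holo_on N (\<lambda>z. transition (affine_chart N i) (affine_chart N j) z l)
      (coord (affine_chart N i) ` (aff_dom N i \<inter> aff_dom N j))" (is "holo_on N _ ?V")
    if i: "i \<le> N" and j: "j \<le> N" for i j l
  proof -
    have V: "openC N ?V"
      using is_chart_open_image[OF affine_chart_is_chart(1)[OF i] openin_aff_dom[of N j]] by (simp add: aff_dom_def)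
    have z: "unskip i z j \<noteq> 0 \<and> transition (affine_chart N i) (affine_chart N j) z l = unskip i z (skip j l) / unskip i z j"
      if "z \<in> ?V" for z
    proof -
      have zC: "z \<in> Cn N" using openC_subset[OF V] that by blast
      have "param (affine_chart N i) z \<in> aff_dom N j"
        using that param_coord[OF affine_chart_is_chart(1)[OF i]] by (auto simp: aff_dom_def)
      then have "unskip i z j \<noteq> 0"
        using affine_chart_is_chart(3)[OF i zC] proj_point_in_aff_dom[OF unskip_Cn[OF i zC]] by simp
      then show ?thesis
        using affine_chart_is_chart(3)[OF i zC] by (simp add: transition_def coord_affine_chart hom_coord)
    qed
    have "holo_on N (\<lambda>z. unskip i z (skip j l) / unskip i z j) ?V"
      by (rule holo_on_divide) (use z holo_on_unskip in auto)
    then show ?thesis by (rule holo_on_cong[OF V]) (use z in auto)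
  qed
  from this[OF assms(1,2)] this[OF assms(2,1)] show ?thesis
    by (simp add: compatible_def aff_dom_def Int_commute)
qed

text \<open>The map \<open>E\<close> sends \<open>v\<close> to the matrix of the orthogonal
  projector onto its line. It is continuous, invariant under scaling, and determines the line, so it
  injects the space into a Hausdorff one.\<close>

lemma Hausdorff_proj_topology: "Hausdorff_space (proj_topology N)"
proof -
  define E where "E v = (\<lambda>jk. v (fst jk) * cnj (v (snd jk)) / of_real (\<Sum>l\<le>N. (norm (v l))\<^sup>2))" for v :: "nat \<Rightarrow> complex"
  define E' where "E' L = E (SOME v. v \<in> L)" for L
  have pos: "(\<Sum>l\<le>N. (norm (v l))\<^sup>2) \<noteq> 0" if "v \<in> Cn (Suc N)" "v \<noteq> 0" for v
  proof
    assume "(\<Sum>l\<le>N. (norm (v l))\<^sup>2) = 0"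
    then have "\<forall>l\<le>N. v l = 0" by (simp add: sum_nonneg_eq_0_iff)
    then have "v l = 0" for l using that(1) by (cases "l \<le> N") (auto simp: Cn_def)
    then show False using that(2) by (auto simp: fun_eq_iff)
  qed
  have scale: "E (\<lambda>i. c * v i) = E v" if "c \<noteq> 0" for c v
  proof -
    have "(c * a) * cnj (c * b) / of_real (\<Sum>l\<le>N. (norm (c * v l))\<^sup>2) = a * cnj b / of_real (\<Sum>l\<le>N. (norm (v l))\<^sup>2)" for a b
    proof -
      have "(\<Sum>l\<le>N. (norm (c * v l))\<^sup>2) = (norm c)\<^sup>2 * (\<Sum>l\<le>N. (norm (v l))\<^sup>2)"
        by (simp add: norm_mult power_mult_distrib sum_distrib_left)
      moreover have "(c * a) * cnj (c * b) = of_real ((norm c)\<^sup>2) * (a * cnj b)"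
        unfolding complex_norm_square by (simp add: mult_ac)
      ultimately have "(c * a) * cnj (c * b) / of_real (\<Sum>l\<le>N. (norm (c * v l))\<^sup>2) =
          of_real ((norm c)\<^sup>2) * (a * cnj b) / (of_real ((norm c)\<^sup>2) * of_real (\<Sum>l\<le>N. (norm (v l))\<^sup>2))"
        by (simp only: of_real_mult)
      then show ?thesis using that by (simp del: of_real_sum of_real_power)
    qed
    then show ?thesis by (simp add: E_def)
  qed
  have E': "E' (proj_point v) = E v" for v
  proof -
    have "(SOME w. w \<in> proj_point v) \<in> proj_point v" by (rule someI[of "\<lambda>w. w \<in> proj_point v"]) (rule self_in_proj_point)
    then obtain c where "c \<noteq> 0" "(SOME w. w \<in> proj_point v) = (\<lambda>i. c * v i)" by (auto simp: proj_point_def)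
    then show ?thesis using scale by (simp add: E'_def)
  qed
  have "continuous_map (proj_topology N) euclidean E'"
  proof (rule continuous_compose_quotient_map[OF quotient_proj_point])
    have "continuous_on (Cn (Suc N) - {0}) E"
      unfolding E_def
      by (rule continuous_on_coordinatewise_then_product)
        (intro continuous_intros continuous_on_subset[OF continuous_on_product_coordinates]; use pos in \<open>auto simp del: of_real_sum of_real_power\<close>)
    then show "continuous_map (top_of_set (Cn (Suc N) - {0})) euclidean (E' \<circ> proj_point)"
      by (simp add: o_def E')
  qed
  moreover have "inj_on E' (topspace (proj_topology N))"
  proof (rule inj_onI)
    fix L K assume "L \<in> topspace (proj_topology N)" "K \<in> topspace (proj_topology N)" and eq: "E' L = E' K"
    then have LK: "L \<in> proj_points N" "K \<in> proj_points N" by simp_all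
    from LK(1) obtain v where v: "v \<in> Cn (Suc N)" "v \<noteq> 0" "L = proj_point v" by (rule proj_pointsE)
    from LK(2) obtain w where w: "w \<in> Cn (Suc N)" "w \<noteq> 0" "K = proj_point w" by (rule proj_pointsE)
    define a b where "a = complex_of_real (\<Sum>l\<le>N. (norm (v l))\<^sup>2)" and "b = complex_of_real (\<Sum>l\<le>N. (norm (w l))\<^sup>2)"
    have ab: "a \<noteq> 0" "b \<noteq> 0" using pos[OF v(1,2)] pos[OF w(1,2)] by (simp_all only: a_def b_def of_real_eq_0_iff not_False_eq_True)
    have e: "v j * cnj (v k) / a = w j * cnj (w k) / b" for j k
    proof -
      have "E v (j, k) = E w (j, k)" using eq by (simp add: E' v(3) w(3))
      then show ?thesis by (simp add: E_def a_def b_def)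
    qed
    obtain k where k: "v k \<noteq> 0" using v(2) by (auto simp: fun_eq_iff)
    then have "w k * cnj (w k) / b \<noteq> 0" using e[of k k] ab by auto
    then have wk: "w k \<noteq> 0" by auto
    \<comment> \<open>Column \<open>k\<close> of the common projector is proportional to both
      vectors, which determines the factor.\<close>
    let ?c = "cnj (v k) * b / (a * cnj (w k))"
    have "w j = ?c * v j" for j
      using e[of j k] ab wk by (simp add: field_simps)
    moreover have "?c \<noteq> 0" using k wk ab by simp
    ultimately show "L = K" unfolding v(3) w(3) proj_point_eq_iff by blast
  qed
  ultimately show ?thesis using Hausdorff_space_injective_preimage[OF Hausdorff_space_euclidean] by blast
qed

lemma second_countable_euclidean: "second_countable (euclidean :: 'a::second_countable_topology topology)"
proof -
  obtain B :: "'a set set" where B: "countable B" "topological_basis B"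
    by (rule exE[OF ex_countable_basis]) (erule conjE)
  have "\<exists>V\<in>B. x \<in> V \<and> V \<subseteq> U" if "open U" "x \<in> U" for U x
    by (rule topological_basisE[OF B(2) that]) blast
  then show ?thesis
    unfolding second_countable_def using B topological_basis_open by (intro exI[of _ B]) auto
qed

lemma second_countable_prod:
  assumes "second_countable X" "second_countable Y" shows "second_countable (prod_topology X Y)"
proof -
  from assms(1)[unfolded second_countable_def]
  obtain A where A: "countable A" "\<forall>V\<in>A. openin X V"
    "\<forall>U x. openin X U \<and> x \<in> U \<longrightarrow> (\<exists>V\<in>A. x \<in> V \<and> V \<subseteq> U)"
    by (elim exE conjE)
  from assms(2)[unfolded second_countable_def]
  obtain B where B: "countable B" "\<forall>V\<in>B. openin Y V"
    "\<forall>U x. openin Y U \<and> x \<in> U \<longrightarrow> (\<exists>V\<in>B. x \<in> V \<and> V \<subseteq> U)"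
    by (elim exE conjE)
  show ?thesis
    unfolding second_countable_def
  proof (intro exI[of _ "(\<lambda>(U, V). U \<times> V) ` (A \<times> B)"] conjI ballI allI impI)
    show "countable ((\<lambda>(U, V). U \<times> V) ` (A \<times> B))" using A(1) B(1) by simp
    show "openin (prod_topology X Y) W" if "W \<in> (\<lambda>(U, V). U \<times> V) ` (A \<times> B)" for W
      using that A(2) B(2) by (auto simp: openin_prod_Times_iff)
    fix W z assume z: "openin (prod_topology X Y) W \<and> z \<in> W"
    obtain x y where xy: "z = (x, y)" by (cases z)
    obtain U V where UV: "openin X U" "openin Y V" "x \<in> U" "y \<in> V" "U \<times> V \<subseteq> W"
      using z unfolding xy openin_prod_topology_alt by blast
    obtain U' V' where "U' \<in> A" "x \<in> U'" "U' \<subseteq> U" "V' \<in> B" "y \<in> V'" "V' \<subseteq> V"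
      using A(3)[rule_format, OF conjI[OF UV(1,3)]] B(3)[rule_format, OF conjI[OF UV(2,4)]] by blast
    then show "\<exists>V\<in>(\<lambda>(U, V). U \<times> V) ` (A \<times> B). z \<in> V \<and> V \<subseteq> W"
      using UV(5) xy by (intro bexI[of _ "U' \<times> V'"] conjI) auto
  qed
qed

text \<open>Projection along a compact factor is closed, and the fibres are closed subsets of a copy
  of that factor.\<close>

lemma proper_map_fst_closed:
  assumes Y: "compact_space Y" and S: "closedin (prod_topology X Y) S"
  shows "proper_map (subtopology (prod_topology X Y) S) X fst"
proof -
  let ?P = "prod_topology X Y"
  have SS: "S \<subseteq> topspace ?P" using S by (rule closedin_subset)
  have "closed_map (subtopology ?P S) X fst"
    unfolding closed_map_def
  proof (intro allI impI)
    fix C assume "closedin (subtopology ?P S) C"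
    then have "closedin ?P C" using S closedin_trans_full by blast
    then show "closedin X (fst ` C)" using closed_map_fst[OF Y, of X] by (simp add: closed_map_def)
  qed
  moreover have "compactin (subtopology ?P S) {x \<in> topspace (subtopology ?P S). fst x = y}" if y: "y \<in> topspace X" for y
  proof -
    have "compactin ?P ({y} \<times> topspace Y)"
      using Y y by (simp add: compactin_Times compact_space_def)
    then have "compactin ?P (S \<inter> ({y} \<times> topspace Y))" by (rule closed_Int_compactin[OF S])
    moreover have "{x \<in> topspace (subtopology ?P S). fst x = y} = S \<inter> ({y} \<times> topspace Y)"
      using SS by auto
    ultimately show ?thesis by (simp add: compactin_subtopology)
  qed
  ultimately show ?thesis by (simp add: proper_map_def)
qed

text \<open>The saturation of an open set is the union of its multiples by nonzero scalars, each of
  them open.\<close>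

lemma open_map_proj_point: "open_map (top_of_set (Cn (Suc N) - {0})) (proj_topology N) proj_point"
  unfolding open_map_def
proof (intro allI impI)
  let ?X = "Cn (Suc N) - {0}"
  fix U assume U: "openin (top_of_set ?X) U"
  then have UX: "U \<subseteq> ?X" by (rule openin_imp_subset)
  have "openin (top_of_set ?X) (?X \<inter> (\<lambda>v i. c * v i) -` U)" if c: "c \<noteq> 0" for c
  proof (rule continuous_openin_preimage[OF _ _ U])
    show "continuous_on ?X (\<lambda>v i. c * v i)"
      by (rule continuous_on_coordinatewise_then_product)
        (intro continuous_on_mult continuous_on_const continuous_on_subset[OF continuous_on_product_coordinates subset_UNIV])
    show "(\<lambda>v i. c * v i) \<in> ?X \<rightarrow> ?X" using c by (auto simp: Cn_def fun_eq_iff)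
  qed
  then have "openin (top_of_set ?X) (\<Union>c\<in>-{0}. ?X \<inter> (\<lambda>v i. c * v i) -` U)" by blast
  moreover have "{v \<in> ?X. proj_point v \<in> proj_point ` U} = (\<Union>c\<in>-{0}. ?X \<inter> (\<lambda>v i. c * v i) -` U)"
    by (auto simp: proj_point_eq_iff image_iff)
  moreover have "proj_point ` U \<subseteq> proj_points N" using UX by (auto simp: proj_points_def)
  ultimately show "openin (proj_topology N) (proj_point ` U)" by (simp add: openin_proj_topology)
qed

lemma second_countable_proj_topology: "second_countable (proj_topology N)"
proof (rule second_countable_open_map_image[OF quotient_imp_continuous_map[OF quotient_proj_point] open_map_proj_point])
  show "second_countable (top_of_set (Cn (Suc N) - {0}))"
    by (rule second_countable_subtopology[OF second_countable_euclidean])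
qed (rule quotient_imp_surjective_map[OF quotient_proj_point])

text \<open>Division by an entry of largest norm moves every point into one of the finitely many
  compact sets \<open>K i\<close>.\<close>

lemma compact_space_proj_topology: "compact_space (proj_topology N)"
proof -
  define K where "K i = PiE UNIV (\<lambda>j. if j = i then {1} else if j \<le> N then cball (0::complex) 1 else {0})" for i :: nat
  have "compactin (proj_topology N) (proj_point ` K i)" if i: "i \<le> N" for i
  proof (rule image_compactin)
    have "compactin (product_topology (\<lambda>_. euclidean) UNIV) (K i)"
      unfolding K_def compactin_PiE by auto
    then have "compactin euclidean (K i)" by (simp only: euclidean_product_topology)
    then show "compactin (top_of_set (K i)) (K i)" by (simp add: compactin_subtopology)
    have "v i = 1 \<and> v \<in> Cn (Suc N)" if "v \<in> K i" for v
    proof -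
      have "v j \<in> (if j = i then {1} else if j \<le> N then cball (0::complex) 1 else {0})" for j
        using that unfolding K_def by (rule PiE_mem) simp
      note v = this
      have "v j = 0" if "j \<ge> Suc N" for j using v[of j] that i by (simp split: if_splits)
      then show ?thesis using v[of i] by (simp add: Cn_def)
    qed
    then show "continuous_map (top_of_set (K i)) (proj_topology N) proj_point"
      by (intro continuous_map_proj_point continuous_on_id) (blast, metis one_neq_zero)
  qed
  then have "compactin (proj_topology N) (\<Union>i\<le>N. proj_point ` K i)"
    by (intro compactin_Union) auto
  moreover have "proj_points N \<subseteq> (\<Union>i\<le>N. proj_point ` K i)"
  proof
    fix L assume "L \<in> proj_points N"
    then obtain v where v: "v \<in> Cn (Suc N)" "v \<noteq> 0" "L = proj_point v" by (rule proj_pointsE)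
    have "Max ((\<lambda>i. norm (v i)) ` {..N}) \<in> (\<lambda>i. norm (v i)) ` {..N}" by (rule Max_in) auto
    then obtain i where i: "Max ((\<lambda>i. norm (v i)) ` {..N}) = norm (v i)" "i \<in> {..N}" by (rule imageE)
    have le: "norm (v j) \<le> norm (v i)" if "j \<le> N" for j
      unfolding i(1)[symmetric] using that by (intro Max_ge) auto
    have "v i \<noteq> 0"
    proof
      assume "v i = 0"
      then have "v j = 0" for j using le[of j] v(1) by (cases "j \<le> N") (auto simp: Cn_def)
      then show False using v(2) by (auto simp: fun_eq_iff)
    qed
    then have "(\<lambda>j. v j / v i) \<in> K i"
      using le v(1) by (auto simp: K_def norm_divide divide_le_eq_1 Cn_def)
    moreover have "L = proj_point (\<lambda>j. v j / v i)"
      unfolding v(3) proj_point_eq_iff using \<open>v i \<noteq> 0\<close> by (intro exI[of _ "inverse (v i)"]) (simp add: field_simps)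
    ultimately show "L \<in> (\<Union>i\<le>N. proj_point ` K i)" using i(2) by blast
  qed
  ultimately have "compactin (proj_topology N) (proj_points N)"
    using compactin_subset_topspace by (metis antisym topspace_proj_topology)
  then show ?thesis by (simp add: compact_space_def)
qed

lemma proj_space_simps [simp]:
  "mdim (proj_space N) = N" "mtop (proj_space N) = proj_topology N"
  "atlas (proj_space N) = affine_chart N ` {..N}"
  by (simp_all add: proj_space_def)

lemma complex_manifold_proj_space: "complex_manifold (proj_space N)"
  unfolding complex_manifold_def proj_space_simps
proof (intro conjI ballI)
  show "topspace (proj_topology N) = (\<Union>c\<in>affine_chart N ` {..N}. chart_dom c)"
  proof
    show "topspace (proj_topology N) \<subseteq> (\<Union>c\<in>affine_chart N ` {..N}. chart_dom c)"
    proof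
      fix L assume "L \<in> topspace (proj_topology N)"
      then obtain v where v: "v \<in> Cn (Suc N)" "v \<noteq> 0" "L = proj_point v" by (auto elim: proj_pointsE)
      then obtain i where i: "v i \<noteq> 0" by (auto simp: fun_eq_iff)
      then have "i \<le> N" using v(1) by (auto simp: Cn_def not_less_eq_eq[symmetric])
      then show "L \<in> (\<Union>c\<in>affine_chart N ` {..N}. chart_dom c)"
        using proj_point_in_aff_dom[OF v(1), of i] i v(3) by (auto simp: aff_dom_def)
    qed
  qed (auto simp: affine_chart_def)
qed (auto simp: Hausdorff_proj_topology second_countable_proj_topology affine_chart_is_chart affine_chart_compatible)

definition trunc :: "nat \<Rightarrow> (nat \<Rightarrow> complex) \<Rightarrow> nat \<Rightarrow> complex" where
  "trunc k w = (\<lambda>j. if j < k then w j else 0)"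

lemma trunc_Cn: "trunc k w \<in> Cn k"
  by (simp add: trunc_def Cn_def)

lemma trunc_id: "w \<in> Cn k \<Longrightarrow> trunc k w = w"
  by (auto simp: trunc_def Cn_def)

lemma openin_vimage_Cn:
  assumes f: "continuous_map X euclidean f" and D: "openC k D" and C: "\<And>x. f x \<in> Cn k"
  shows "openin X {x \<in> topspace X. f x \<in> D}"
proof -
  obtain T where T: "open T" "D = Cn k \<inter> T" using D by (auto simp: openin_open)
  then have "{x \<in> topspace X. f x \<in> D} = {x \<in> topspace X. f x \<in> T}" using C by auto
  then show ?thesis using f T(1) openin_continuous_map_preimage[OF f, of T] by simp
qed

text \<open>\<open>S\<close> is locally the graph of the remaining coordinates over the first
  \<open>k\<close> affine coordinates, in the order given by \<open>e\<close>. Subtracting that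
  graph from the remaining coordinates is a chart that flattens \<open>S\<close>.\<close>

lemma graph_chart:
  assumes k: "k \<le> N" and i: "i \<le> N" and e: "bij_betw e {..<N} ({..N} - {i})"
    and D: "openC k D" and W: "openin (proj_topology N) W"
    and \<psi>: "\<And>x. x \<in> D \<Longrightarrow> \<psi> x \<in> Cn (Suc N) \<and> \<psi> x i = 1 \<and> (\<forall>j<k. \<psi> x (e j) = x j)"
    and hol: "\<And>l. holo_on k (\<lambda>x. \<psi> x l) D"
    and S: "S \<inter> W = (\<lambda>x. proj_point (\<psi> x)) ` D"
  obtains U \<eta> where "(U, \<eta>) \<in> maximal_atlas (proj_space N)" "S \<inter> W \<subseteq> U" "\<eta> ` (U \<inter> S) = \<eta> ` U \<inter> Cn k"
proof -
  let ?P = "proj_topology N"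
  define e' where "e' = inv_into {..<N} e"
  have inj: "inj_on e {..<N}" and im: "e ` {..<N} = {..N} - {i}" using e by (auto simp: bij_betw_def)
  have e'e: "e' (e j) = j" if "j < N" for j unfolding e'_def using inj that by (simp add: inv_into_f_f)
  have ee': "e (e' l) = l" "e' l < N" if "l \<le> N" "l \<noteq> i" for l
    unfolding e'_def using that im f_inv_into_f[of l e "{..<N}"] inv_into_into[of l e "{..<N}"] by auto
  have ee: "e j \<le> N" "e j \<noteq> i" if "j < N" for j using im that by auto
  define co where "co L = (\<lambda>j. hom_coord i L (e j))" for L
  define U where "U = {L \<in> W \<inter> aff_dom N i. trunc k (co L) \<in> D}"
  \<comment> \<open>\<open>\<eta>\<close> is the flattening chart; \<open>G\<close> lifts its
    inverse to homogeneous coordinates with entry \<open>i\<close> equal to 1.\<close>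
  define \<eta> where "\<eta> L = (\<lambda>j. if j < k then co L j else if j < N then co L j - \<psi> (trunc k (co L)) (e j) else 0)" for L
  define G where "G w = (\<lambda>l. if l = i then 1 else if l \<le> N then
    (if e' l < k then w (e' l) else w (e' l) + \<psi> (trunc k w) l) else 0)" for w
  define A where "A = {w \<in> Cn N. trunc k w \<in> D}"
  define V where "V = {w \<in> A. proj_point (G w) \<in> W}"
  have contk: "continuous_map (subtopology ?P (aff_dom N i)) euclidean (\<lambda>L. trunc k (co L))"
    unfolding trunc_def co_def
    by (rule continuous_map_coordI) (simp add: continuous_map_coordD[OF continuous_map_hom_coord])
  have topaff: "topspace (subtopology ?P (aff_dom N i)) = aff_dom N i"
    using openin_subset[OF openin_aff_dom[of N i]] by auto
  have "openin (subtopology ?P (aff_dom N i)) {L \<in> topspace (subtopology ?P (aff_dom N i)). trunc k (co L) \<in> D}"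
    by (rule openin_vimage_Cn[OF contk D trunc_Cn])
  then have "openin ?P {L \<in> aff_dom N i. trunc k (co L) \<in> D}"
    unfolding topaff using openin_aff_dom openin_trans_full by blast
  moreover have "U = W \<inter> {L \<in> aff_dom N i. trunc k (co L) \<in> D}" by (auto simp: U_def)
  ultimately have Uo: "openin ?P U" using W by auto
  have trunc_cont: "continuous_on (Cn N) (trunc k)"
  proof (rule continuous_on_coordinatewise_then_product)
    show "continuous_on (Cn N) (\<lambda>x. trunc k x j)" for j
      unfolding trunc_def
      by (cases "j < k") (simp_all add: continuous_on_subset[OF continuous_on_product_coordinates subset_UNIV])
  qed
  have "openin (top_of_set (Cn N)) {x \<in> topspace (top_of_set (Cn N)). trunc k x \<in> D}"
    by (rule openin_vimage_Cn[OF _ D trunc_Cn]) (simp add: trunc_cont)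
  then have Ao: "openC N A" by (simp add: A_def)
  have trunc_hol: "holo_on N (\<lambda>w. trunc k w j) A" for j
    by (cases "j < k") (simp_all add: trunc_def)
  have AD: "trunc k ` A \<subseteq> D" by (auto simp: A_def)
  have \<psi>hol: "holo_on N (\<lambda>w. \<psi> (trunc k w) l) A" for l
    by (rule holo_on_compose[OF Ao D hol trunc_hol AD])
  have Ghol: "holo_on N (\<lambda>w. G w l) A" for l
    unfolding G_def by (cases "l = i"; cases "l \<le> N"; cases "e' l < k") (auto intro!: \<psi>hol holo_on_add)
  have GC: "G w \<in> Cn (Suc N)" "G w i = 1" for w using i by (auto simp: G_def Cn_def)
  have Ge: "G w (e j) = (if j < k then w j else w j + \<psi> (trunc k w) (e j))" if "j < N" for w j
    using that ee[OF that] e'e[OF that] by (simp add: G_def)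
  have Gcont: "continuous_on A G"
    by (rule continuous_on_coordinatewise_then_product) (rule holo_on_imp_continuous_on[OF Ghol])
  have PG: "continuous_map (top_of_set A) ?P (\<lambda>w. proj_point (G w))"
    by (rule continuous_map_proj_point[OF Gcont GC(1)]) (use GC(2) in \<open>auto intro!: exI[of _ i]\<close>)
  have Vo: "openC N V"
  proof -
    have "openin (top_of_set A) {w \<in> topspace (top_of_set A). proj_point (G w) \<in> W}"
      by (rule openin_continuous_map_preimage[OF PG W])
    then have "openin (top_of_set A) V" by (simp add: V_def)
    then show ?thesis using Ao by (rule openin_trans)
  qed
  have hG: "hom_coord i (proj_point (G w)) l = G w l" for w l
    using GC(2)[of w] by (simp add: hom_coord)
  have coG: "co (proj_point (G w)) j = G w (e j)" for w j by (simp add: co_def hG)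
  have tr\<eta>: "trunc k (\<eta> L) = trunc k (co L)" for L by (auto simp: \<eta>_def trunc_def)
  have trG: "trunc k (co (proj_point (G w))) = trunc k w" for w
    using k by (auto simp: trunc_def co_def hG Ge)
  have \<eta>G: "\<eta> (proj_point (G w)) = w" if "w \<in> V" for w
  proof
    fix j
    have "w \<in> Cn N" using that by (simp add: V_def A_def)
    then show "\<eta> (proj_point (G w)) j = w j"
      using k by (auto simp: \<eta>_def trG coG Ge Cn_def)
  qed
  have GU: "proj_point (G w) \<in> U" if "w \<in> V" for w
    using that GC by (auto simp: U_def V_def A_def trG proj_point_in_aff_dom)
  have G\<eta>': "G (\<eta> L) = hom_coord i L" if L: "L \<in> U" for L
  proof
    fix l
    have La: "L \<in> aff_dom N i" using L by (simp add: U_def)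
    show "G (\<eta> L) l = hom_coord i L l"
    proof (cases "l = i \<or> l > N")
      case True
      then show ?thesis using hom_coord_aff(1,2)[OF La] i by (auto simp: G_def Cn_def)
    next
      case False
      then have l: "e (e' l) = l" "e' l < N" "l \<noteq> i" "l \<le> N" using ee'[of l] by auto
      then have "\<eta> L (e' l) = (if e' l < k then hom_coord i L l else hom_coord i L l - \<psi> (trunc k (co L)) l)"
        by (simp add: \<eta>_def co_def)
      then show ?thesis using l by (simp add: G_def tr\<eta>)
    qed
  qed
  have G\<eta>: "proj_point (G (\<eta> L)) = L" if "L \<in> U" for L
    using G\<eta>'[OF that] hom_coord_aff(3)[of L N i] that by (simp add: U_def)
  have \<eta>V: "\<eta> L \<in> V" if L: "L \<in> U" for L
    using L G\<eta>[OF L] by (auto simp: V_def A_def tr\<eta> U_def) (use k in \<open>auto simp: Cn_def \<eta>_def\<close>)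
  have \<eta>cont: "continuous_map (subtopology ?P U) euclidean \<eta>"
  proof (rule continuous_map_coordI)
    have sub: "continuous_map (subtopology ?P U) euclidean f" if "continuous_map (subtopology ?P (aff_dom N i)) euclidean f"
      for f :: "(nat \<Rightarrow> complex) set \<Rightarrow> 'z::topological_space"
      by (rule continuous_map_from_subtopology_mono[OF that]) (auto simp: U_def)
    have co: "continuous_map (subtopology ?P U) euclidean (\<lambda>L. co L j)" for j
      unfolding co_def by (rule sub[OF continuous_map_coordD[OF continuous_map_hom_coord]])
    have "continuous_map (subtopology ?P U) (top_of_set D) (\<lambda>L. trunc k (co L))"
      using sub[OF contk] by (auto simp: continuous_map_in_subtopology U_def)
    from continuous_map_compose[OF this, of euclidean "\<lambda>x. \<psi> x l" for l]
    have "continuous_map (subtopology ?P U) euclidean (\<lambda>L. \<psi> (trunc k (co L)) l)" for l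
      using holo_on_imp_continuous_on[OF hol, of l] by (simp add: o_def)
    then show "continuous_map (subtopology ?P U) euclidean (\<lambda>L. \<eta> L j)" for j
      unfolding \<eta>_def using co by (cases "j < k"; cases "j < N") (auto intro!: continuous_map_diff)
  qed
  have PGV: "continuous_map (top_of_set V) ?P (\<lambda>w. proj_point (G w))"
    by (rule continuous_map_from_subtopology_mono[OF PG]) (auto simp: V_def)
  note ch = is_chartI[OF Uo Vo \<eta>cont \<eta>V PGV GU G\<eta> \<eta>G]
  have "compatible N (U, \<eta>) (affine_chart N m)" if m: "m \<le> N" for m
    unfolding compatible_def fst_conv snd_conv
  proof (intro allI impI conjI)
    fix l assume "l < N"
    let ?B = "\<eta> ` (U \<inter> chart_dom (affine_chart N m))"
    have B: "openC N ?B"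
      using is_chart_open_image[OF ch(1) openin_aff_dom[of N m]] by (simp add: aff_dom_def)
    have BV: "?B \<subseteq> V" using ch(2) by auto
    have Bm: "G w m \<noteq> 0 \<and> transition (U, \<eta>) (affine_chart N m) w l = G w (skip m l) / G w m" if w: "w \<in> ?B" for w
    proof -
      obtain L where L: "L \<in> U" "L \<in> aff_dom N m" "w = \<eta> L" using w by (auto simp: aff_dom_def)
      have "G w m \<noteq> 0" using L(2) GC(1) G\<eta>[OF L(1)] proj_point_in_aff_dom[of "G w" N m] L(3) by simp
      then show ?thesis using ch(3)[of w] BV w by (auto simp: transition_def coord_affine_chart hom_coord)
    qed
    have "holo_on N (\<lambda>w. G w (skip m l) / G w m) ?B"
      by (intro holo_on_divide holo_on_subset[OF Ghol]) (use BV Bm in \<open>auto simp: V_def\<close>)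
    then show "holo_on N (\<lambda>z. transition (U, \<eta>) (affine_chart N m) z l) ?B"
      by (rule holo_on_cong[OF B]) (use Bm in auto)
    let ?C = "coord (affine_chart N m) ` (U \<inter> chart_dom (affine_chart N m))"
    have C: "openC N ?C"
      using is_chart_open_image[OF affine_chart_is_chart(1)[OF m] Uo] by (simp add: Int_commute)
    define R where "R z j = unskip m z j / unskip m z i" for z j
    have Cm: "unskip m z i \<noteq> 0 \<and> param (affine_chart N m) z \<in> U \<and> co (param (affine_chart N m) z) = (\<lambda>j. R z (e j))" if z: "z \<in> ?C" for z
    proof -
      have zC: "z \<in> Cn N" using openC_subset[OF C] z by blast
      have p: "param (affine_chart N m) z = proj_point (unskip m z)" by (rule affine_chart_is_chart(3)[OF m zC])
      have pU: "param (affine_chart N m) z \<in> U" using z param_coord[OF affine_chart_is_chart(1)[OF m]] by auto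
      then have "unskip m z i \<noteq> 0" using p proj_point_in_aff_dom[OF unskip_Cn[OF m zC]] by (auto simp: U_def)
      then show ?thesis using pU p by (simp add: co_def hom_coord R_def)
    qed
    have Rhol: "holo_on N (\<lambda>z. R z j) ?C" for j
      unfolding R_def by (intro holo_on_divide holo_on_unskip) (use Cm in auto)
    have thol: "holo_on N (\<lambda>z. trunc k (\<lambda>j. R z (e j)) j) ?C" for j
      by (cases "j < k") (simp_all add: trunc_def Rhol)
    have tD: "(\<lambda>z. trunc k (\<lambda>j. R z (e j))) ` ?C \<subseteq> D"
    proof (rule image_subsetI)
      fix z assume "z \<in> ?C"
      from Cm[OF this] show "trunc k (\<lambda>j. R z (e j)) \<in> D" by (auto simp: U_def)
    qed
    have "holo_on N (\<lambda>z. \<psi> (trunc k (\<lambda>j. R z (e j))) (e l)) ?C"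
      by (rule holo_on_compose[OF C D hol thol tD])
    then have "holo_on N (\<lambda>z. if l < k then R z (e l) else R z (e l) - \<psi> (trunc k (\<lambda>j. R z (e j))) (e l)) ?C"
      by (cases "l < k") (auto intro: Rhol)
    then show "holo_on N (\<lambda>z. transition (affine_chart N m) (U, \<eta>) z l) ?C"
      by (rule holo_on_cong[OF C]) (use Cm \<open>l < N\<close> in \<open>auto simp: transition_def \<eta>_def\<close>)
  qed
  then have max: "(U, \<eta>) \<in> maximal_atlas (proj_space N)" using ch(1) by (auto simp: maximal_atlas_def)
  have \<psi>L: "hom_coord i (proj_point (\<psi> x)) = \<psi> x" "trunc k (co (proj_point (\<psi> x))) = x" "proj_point (\<psi> x) \<in> U"
    if x: "x \<in> D" for x
  proof -
    show h: "hom_coord i (proj_point (\<psi> x)) = \<psi> x" using \<psi>[OF x] by (simp add: hom_coord fun_eq_iff)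
    have "x \<in> Cn k" using openC_subset[OF D] x by blast
    then show t: "trunc k (co (proj_point (\<psi> x))) = x"
      using \<psi>[OF x] by (auto simp: trunc_def co_def h Cn_def)
    have "proj_point (\<psi> x) \<in> W" using S x by blast
    then show "proj_point (\<psi> x) \<in> U" using \<psi>[OF x] x by (simp add: U_def t proj_point_in_aff_dom)
  qed
  have "\<eta> ` (U \<inter> S) = \<eta> ` U \<inter> Cn k"
  proof
    show "\<eta> ` (U \<inter> S) \<subseteq> \<eta> ` U \<inter> Cn k"
    proof (rule image_subsetI)
      fix L assume L: "L \<in> U \<inter> S"
      then have "L \<in> S \<inter> W" by (simp add: U_def)
      then obtain x where x: "x \<in> D" "L = proj_point (\<psi> x)" using S by auto
      then show "\<eta> L \<in> \<eta> ` U \<inter> Cn k"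
        using L \<psi>L[OF x(1)] by (auto simp: Cn_def \<eta>_def) (auto simp: co_def)
    qed
    show "\<eta> ` U \<inter> Cn k \<subseteq> \<eta> ` (U \<inter> S)"
    proof
      fix w assume w: "w \<in> \<eta> ` U \<inter> Cn k"
      then have wV: "w \<in> V" and wk: "w \<in> Cn k" using ch(2) by auto
      have wD: "w \<in> D" using wV trunc_id[OF wk] by (simp add: V_def A_def)
      have "G w = \<psi> w"
      proof
        fix l
        show "G w l = \<psi> w l"
        proof (cases "l = i \<or> l > N")
          case True
          then show ?thesis using \<psi>[OF wD] i by (auto simp: G_def Cn_def)
        next
          case False
          then have l: "l \<noteq> i" "l \<le> N" by auto
          show ?thesis
          proof (cases "e' l < k")
            case True
            then have "\<psi> w (e (e' l)) = w (e' l)" using \<psi>[OF wD] by simp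
            then show ?thesis using l True ee'[of l] by (simp add: G_def)
          next
            case False
            then have "w (e' l) = 0" using wk by (simp add: Cn_def)
            then show ?thesis using l False by (simp add: G_def trunc_id[OF wk])
          qed
        qed
      qed
      then have "proj_point (G w) \<in> S" using S wD by auto
      then show "w \<in> \<eta> ` (U \<inter> S)" using GU[OF wV] \<eta>G[OF wV] by (metis IntI image_eqI)
    qed
  qed
  moreover have "S \<inter> W \<subseteq> U" unfolding S using \<psi>L(3) by blast
  ultimately show ?thesis using that max by blast
qed


lemma complex_submanifold_projI:
  assumes k: "k \<le> N" and S: "S \<subseteq> proj_points N"
    and graph: "\<And>L. L \<in> S \<Longrightarrow> \<exists>i e D W \<psi>. i \<le> N \<and> bij_betw e {..<N} ({..N} - {i}) \<and> openC k D \<and>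
      openin (proj_topology N) W \<and> L \<in> W \<and>
      (\<forall>x\<in>D. \<psi> x \<in> Cn (Suc N) \<and> \<psi> x i = 1 \<and> (\<forall>j<k. \<psi> x (e j) = x j)) \<and>
      (\<forall>l. holo_on k (\<lambda>x. \<psi> x l) D) \<and> S \<inter> W = (\<lambda>x. proj_point (\<psi> x)) ` D"
  shows "complex_submanifold (proj_space N) k S"
  unfolding complex_submanifold_def
proof (intro conjI subsetI)
  fix L assume L: "L \<in> S"
  from graph[OF L] obtain i e D W \<psi> where g: "i \<le> N" "bij_betw e {..<N} ({..N} - {i})" "openC k D"
      "openin (proj_topology N) W" "L \<in> W"
      "\<forall>x\<in>D. \<psi> x \<in> Cn (Suc N) \<and> \<psi> x i = 1 \<and> (\<forall>j<k. \<psi> x (e j) = x j)"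
      "\<forall>l. holo_on k (\<lambda>x. \<psi> x l) D" "S \<inter> W = (\<lambda>x. proj_point (\<psi> x)) ` D"
    by (elim exE conjE)
  obtain U \<eta> where "(U, \<eta>) \<in> maximal_atlas (proj_space N)" "S \<inter> W \<subseteq> U" "\<eta> ` (U \<inter> S) = \<eta> ` U \<inter> Cn k"
    by (rule graph_chart[OF k g(1-4) g(6)[rule_format] g(7)[rule_format] g(8)])
  then have "(U \<inter> S, \<eta>) \<in> atlas (restrict_manifold (proj_space N) k S)" "L \<in> U \<inter> S"
    using L g(5) by (auto intro: restrict_atlasI)
  then show "L \<in> (\<Union>c\<in>atlas (restrict_manifold (proj_space N) k S). chart_dom c)" by force
qed (use k S in auto)

section \<open>Homogeneous polynomials\<close>

lemma finite_multi_indices: "finite (multi_indices n d)"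
proof -
  have "multi_indices n d \<subseteq> {\<alpha>. \<forall>x. (x \<in> {..<n} \<longrightarrow> \<alpha> x \<in> {..d}) \<and> (x \<notin> {..<n} \<longrightarrow> \<alpha> x = 0)}"
  proof
    fix \<alpha> assume \<alpha>: "\<alpha> \<in> multi_indices n d"
    then have "\<alpha> x \<le> d" if "x < n" for x
      using member_le_sum[of x "{..<n}" \<alpha>] that by (auto simp: multi_indices_def)
    then show "\<alpha> \<in> {\<alpha>. \<forall>x. (x \<in> {..<n} \<longrightarrow> \<alpha> x \<in> {..d}) \<and> (x \<notin> {..<n} \<longrightarrow> \<alpha> x = 0)}"
      using \<alpha> by (auto simp: multi_indices_def)
  qed
  then show ?thesis by (rule finite_subset) (rule finite_set_of_finite_funs; simp)
qed

lemma homogeneous_poly_coord: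
  assumes "i < n" shows "homogeneous_poly n 1 (\<lambda>v. v i)"
proof -
  let ?\<alpha> = "\<lambda>j. if j = i then 1 else (0::nat)"
  have "?\<alpha> \<in> multi_indices n 1" using assms by (auto simp: multi_indices_def)
  moreover have "monomial n ?\<alpha> v = v i" for v
  proof -
    have "monomial n ?\<alpha> v = (\<Prod>j<n. if j = i then v i else 1)"
      unfolding monomial_def by (rule prod.cong) auto
    then show ?thesis using assms by simp
  qed
  ultimately have "v i = (\<Sum>\<alpha>\<in>multi_indices n 1. (if \<alpha> = ?\<alpha> then 1 else 0) * monomial n \<alpha> v)" for v
    by (simp add: if_distrib[of "\<lambda>x. x * _"] finite_multi_indices cong: if_cong)
  then show ?thesis
    unfolding homogeneous_poly_def by (intro exI[of _ "\<lambda>\<alpha>. if \<alpha> = ?\<alpha> then 1 else 0"] allI)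
qed

lemma homogeneous_poly_add:
  assumes "homogeneous_poly n d p" "homogeneous_poly n d q"
  shows "homogeneous_poly n d (\<lambda>v. p v + q v)"
proof -
  obtain a b where "\<forall>v. p v = (\<Sum>\<alpha>\<in>multi_indices n d. a \<alpha> * monomial n \<alpha> v)"
    "\<forall>v. q v = (\<Sum>\<alpha>\<in>multi_indices n d. b \<alpha> * monomial n \<alpha> v)"
    using assms unfolding homogeneous_poly_def by blast
  then show ?thesis
    unfolding homogeneous_poly_def by (intro exI[of _ "\<lambda>\<alpha>. a \<alpha> + b \<alpha>"]) (simp add: sum.distrib distrib_right)
qed

lemma homogeneous_poly_cmult:
  assumes "homogeneous_poly n d p" shows "homogeneous_poly n d (\<lambda>v. c * p v)"
proof -
  obtain a where "\<forall>v. p v = (\<Sum>\<alpha>\<in>multi_indices n d. a \<alpha> * monomial n \<alpha> v)"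
    using assms unfolding homogeneous_poly_def by blast
  then show ?thesis
    unfolding homogeneous_poly_def by (intro exI[of _ "\<lambda>\<alpha>. c * a \<alpha>"]) (simp add: sum_distrib_left mult.assoc)
qed

lemma homogeneous_poly_diff:
  "homogeneous_poly n d p \<Longrightarrow> homogeneous_poly n d q \<Longrightarrow> homogeneous_poly n d (\<lambda>v. p v - q v)"
  using homogeneous_poly_add[of n d p "\<lambda>v. - 1 * q v"] homogeneous_poly_cmult[of n d q "- 1"] by simp

text \<open>The coefficients \<open>c\<close> of the product are the convolution, collected by the
  sum of the two multi-indices.\<close>

lemma homogeneous_poly_mult:
  assumes "homogeneous_poly n d p" "homogeneous_poly n d' q"
  shows "homogeneous_poly n (d + d') (\<lambda>v. p v * q v)"
proof -
  let ?A = "multi_indices n d" and ?B = "multi_indices n d'" and ?C = "multi_indices n (d + d')"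
  obtain a b where p: "\<And>v. p v = (\<Sum>\<alpha>\<in>?A. a \<alpha> * monomial n \<alpha> v)"
    and q: "\<And>v. q v = (\<Sum>\<alpha>\<in>?B. b \<alpha> * monomial n \<alpha> v)"
    using assms unfolding homogeneous_poly_def by blast
  let ?g = "\<lambda>x. (\<lambda>j. fst x j + snd x j)"
  define c where "c \<gamma> = (\<Sum>x\<in>{x \<in> ?A \<times> ?B. ?g x = \<gamma>}. a (fst x) * b (snd x))" for \<gamma>
  have mon: "monomial n (\<lambda>j. \<alpha> j + \<beta> j) v = monomial n \<alpha> v * monomial n \<beta> v" for \<alpha> \<beta> v
    by (simp add: monomial_def power_add prod.distrib)
  have "p v * q v = (\<Sum>\<gamma>\<in>?C. c \<gamma> * monomial n \<gamma> v)" for v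
  proof -
    have "p v * q v = (\<Sum>x\<in>?A \<times> ?B. (a (fst x) * b (snd x)) * monomial n (?g x) v)"
      unfolding p q by (simp add: sum_product sum.cartesian_product mon case_prod_beta mult_ac)
    also have "\<dots> = (\<Sum>\<gamma>\<in>?C. \<Sum>x\<in>{x \<in> ?A \<times> ?B. ?g x = \<gamma>}. (a (fst x) * b (snd x)) * monomial n (?g x) v)"
    proof (rule sum.group[symmetric])
      show "?g ` (?A \<times> ?B) \<subseteq> ?C" by (auto simp: multi_indices_def sum.distrib)
    qed (simp_all add: finite_multi_indices)
    also have "\<dots> = (\<Sum>\<gamma>\<in>?C. c \<gamma> * monomial n \<gamma> v)"
      unfolding c_def sum_distrib_right by (intro sum.cong refl) auto
    finally show ?thesis .
  qed
  then show ?thesis unfolding homogeneous_poly_def by blast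
qed

section \<open>The family of surfaces\<close>

definition quartic :: "complex \<Rightarrow> complex \<Rightarrow> complex \<Rightarrow> complex" where
  "quartic p q s = p ^ 4 + q ^ 4 + 4 * s ^ 4 - 16 * s\<^sup>2 * p * q + 8 * p\<^sup>2 * q\<^sup>2"

text \<open>The value of \<open>q\<close> forced by the equation quadratic in \<open>a\<close> and
  \<open>b\<close>, where \<open>a = 1\<close> and \<open>b = z\<close>.\<close>

definition qcoord :: "complex \<Rightarrow> complex \<Rightarrow> complex \<Rightarrow> complex \<Rightarrow> complex" where
  "qcoord \<tau> z p s = \<tau> * z * s - z\<^sup>2 * p"

definition branch :: "complex \<Rightarrow> complex \<Rightarrow> complex \<Rightarrow> complex \<Rightarrow> complex" where
  "branch \<tau> z p s = quartic p (qcoord \<tau> z p s) s"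

text \<open>The quartic is symmetric in \<open>p\<close> and \<open>q\<close>, so its derivative by
  \<open>q\<close> is \<open>quartic_p q p s\<close>.\<close>

definition quartic_p :: "complex \<Rightarrow> complex \<Rightarrow> complex \<Rightarrow> complex" where
  "quartic_p p q s = 4 * p ^ 3 - 16 * s\<^sup>2 * q + 16 * p * q\<^sup>2"

definition quartic_s :: "complex \<Rightarrow> complex \<Rightarrow> complex \<Rightarrow> complex" where
  "quartic_s p q s = 16 * s ^ 3 - 32 * s * p * q"

definition branch_z :: "complex \<Rightarrow> complex \<Rightarrow> complex \<Rightarrow> complex \<Rightarrow> complex" where
  "branch_z \<tau> z p s = quartic_p (qcoord \<tau> z p s) p s * (\<tau> * s - 2 * z * p)"

definition branch_p :: "complex \<Rightarrow> complex \<Rightarrow> complex \<Rightarrow> complex \<Rightarrow> complex" where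
  "branch_p \<tau> z p s = quartic_p p (qcoord \<tau> z p s) s - z\<^sup>2 * quartic_p (qcoord \<tau> z p s) p s"

definition branch_s :: "complex \<Rightarrow> complex \<Rightarrow> complex \<Rightarrow> complex \<Rightarrow> complex" where
  "branch_s \<tau> z p s = quartic_s p (qcoord \<tau> z p s) s + \<tau> * z * quartic_p (qcoord \<tau> z p s) p s"

lemmas branch_simps = branch_def branch_z_def branch_p_def branch_s_def quartic_def quartic_p_def
  quartic_s_def qcoord_def

lemma DERIV_branch:
  shows "((\<lambda>z. branch \<tau> z p s) has_field_derivative branch_z \<tau> z p s) (at z)"
    and "((\<lambda>p. branch \<tau> z p s) has_field_derivative branch_p \<tau> z p s) (at p)"
    and "((\<lambda>s. branch \<tau> z p s) has_field_derivative branch_s \<tau> z p s) (at s)"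
  unfolding branch_simps
  by (auto intro!: derivative_eq_intros simp: algebra_simps power2_eq_square power3_eq_cube)

text \<open>Euler's relation, as \<open>branch\<close> is homogeneous of degree 4 in
  \<open>p\<close> and \<open>s\<close>. It recovers the derivative by the variable that an affine
  piece sets to 1.\<close>

lemma branch_euler: "4 * branch \<tau> z p s = p * branch_p \<tau> z p s + s * branch_s \<tau> z p s"
  by (simp add: branch_simps algebra_simps power2_eq_square power3_eq_cube power4_eq_xxxx)

text \<open>The derivative by \<open>s\<close> gives \<open>s = 0\<close> or
  \<open>s\<^sup>2 = 2 * p * q\<close>. Once factors \<open>p\<close> and \<open>q\<close> are split
  off, the other two derivatives become linear equations for \<open>p\<^sup>2\<close> and
  \<open>q\<^sup>2\<close> with determinant -15.\<close>

lemma quartic_smooth: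
  assumes "quartic_p p q s = 0" "quartic_p q p s = 0" "quartic_s p q s = 0"
  shows "p = 0 \<and> q = 0 \<and> s = 0"
proof -
  have "4 * (p * (p\<^sup>2 + 4 * q\<^sup>2) - 4 * s\<^sup>2 * q) = 0" "4 * (q * (q\<^sup>2 + 4 * p\<^sup>2) - 4 * s\<^sup>2 * p) = 0"
    "16 * (s * (s\<^sup>2 - 2 * p * q)) = 0"
    using assms by (simp_all add: quartic_p_def quartic_s_def algebra_simps power2_eq_square power3_eq_cube)
  then have 1: "p * (p\<^sup>2 + 4 * q\<^sup>2) = 4 * s\<^sup>2 * q" "q * (q\<^sup>2 + 4 * p\<^sup>2) = 4 * s\<^sup>2 * p"
    and 2: "s * (s\<^sup>2 - 2 * p * q) = 0"
    by simp_all
  show ?thesis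
  proof (cases "s = 0")
    case True
    then have "p = 0 \<or> p\<^sup>2 + 4 * q\<^sup>2 = 0" "q = 0 \<or> q\<^sup>2 + 4 * p\<^sup>2 = 0" using 1 by simp_all
    moreover have "p = 0 \<and> q = 0" if "p\<^sup>2 + 4 * q\<^sup>2 = 0" "q\<^sup>2 + 4 * p\<^sup>2 = 0"
    proof -
      have "15 * p\<^sup>2 = 4 * (q\<^sup>2 + 4 * p\<^sup>2) - (p\<^sup>2 + 4 * q\<^sup>2)" by (simp add: algebra_simps)
      then have "p = 0" using that by simp
      then show ?thesis using that by simp
    qed
    ultimately show ?thesis using True by auto
  next
    case False
    then have s: "s\<^sup>2 = 2 * p * q" using 2 by simp
    then have pq: "p \<noteq> 0" "q \<noteq> 0" using False by auto
    have "p * (p\<^sup>2 - 4 * q\<^sup>2) = 0" "q * (q\<^sup>2 - 4 * p\<^sup>2) = 0"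
      using 1 unfolding s by (simp_all add: algebra_simps power2_eq_square)
    then have "p\<^sup>2 = 4 * q\<^sup>2" "q\<^sup>2 = 4 * p\<^sup>2" using pq by simp_all
    then have "15 * p\<^sup>2 = 0" by simp
    then show ?thesis using pq by simp
  qed
qed

text \<open>Smoothness of \<open>y\<^sup>4 = branch \<tau> z p s\<close> along \<open>y = 0\<close>. The discriminant of the family vanishes for some
  \<open>\<tau>\<close> with \<open>\<bar>\<tau>\<bar> > 1\<close> close to \<open>1\<close>, whence the bound.\<close>

lemma branch_smooth:
  assumes \<tau>: "norm \<tau> \<le> 21 / 20" and ps: "p \<noteq> 0 \<or> s \<noteq> 0"
    and 0: "branch_z \<tau> z p s = 0" "branch_p \<tau> z p s = 0" "branch_s \<tau> z p s = 0"
  shows False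
proof -
  let ?q = "qcoord \<tau> z p s"
  let ?Fq = "quartic_p ?q p s"
  have Fp: "quartic_p p ?q s = z\<^sup>2 * ?Fq" and Fs: "quartic_s p ?q s = - (\<tau> * z * ?Fq)"
    using 0(2,3) by (simp_all add: branch_p_def branch_s_def eq_neg_iff_add_eq_0)
  have "?Fq \<noteq> 0"
  proof
    assume "?Fq = 0"
    then have "quartic_p p ?q s = 0" "quartic_p ?q p s = 0" "quartic_s p ?q s = 0" using Fp Fs by simp_all
    from quartic_smooth[OF this] ps show False by simp
  qed
  \<comment> \<open>As \<open>?Fq\<close> does not vanish, the derivative by \<open>z\<close> is
    zero only where the two roots \<open>z\<close> coincide: the critical points lie over the conic
    \<tau>^2 s^2 = 4pq.\<close>
  then have t: "\<tau> * s = 2 * z * p" using 0(1) by (simp add: branch_z_def)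
  have br: "branch \<tau> z p s = 0" using branch_euler[of \<tau> z p s] 0 by simp
  have q: "?q = z\<^sup>2 * p" using t by (simp add: qcoord_def power2_eq_square algebra_simps)
  have "p \<noteq> 0"
  proof
    assume p: "p = 0"
    then have "s \<noteq> 0" using ps by simp
    then have "branch \<tau> z p s \<noteq> 0" using p q by (simp add: branch_def quartic_def)
    then show False using br by simp
  qed
  show False
  proof (cases "\<tau> = 0")
    case True
    then have "z = 0" using t \<open>p \<noteq> 0\<close> by simp
    then have "4 * p ^ 3 = 0" using Fp q by (simp add: quartic_p_def)
    then show False using \<open>p \<noteq> 0\<close> by simp
  next
    case False
    have s: "s = 2 * z * p / \<tau>" using t False by (simp add: field_simps)
    \<comment> \<open>Everything is now a multiple of a power of \<open>p\<close>, and the remaining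
      conditions are \<open>z ^ 8 = 1\<close> and
      \<open>2 + z ^ 4 * (64 / x\<^sup>2 - 64 / x + 8) = 0\<close>.\<close>
    define x where "x = \<tau>\<^sup>2"
    have x: "x \<noteq> 0" using False by (simp add: x_def)
    define w where "w = inverse x"
    have wx: "w * x = 1" using x by (simp add: w_def)
    have s2: "s\<^sup>2 = 4 * z\<^sup>2 * p\<^sup>2 * w"
      by (simp add: s x_def w_def power_divide power_mult_distrib field_simps)
    have "4 * p ^ 3 - 16 * s\<^sup>2 * (z\<^sup>2 * p) + 16 * p * (z\<^sup>2 * p)\<^sup>2 = z\<^sup>2 * (4 * (z\<^sup>2 * p) ^ 3 - 16 * s\<^sup>2 * p + 16 * (z\<^sup>2 * p) * p\<^sup>2)"
      using Fp unfolding q quartic_p_def .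
    then have "4 * p ^ 3 * (1 - z ^ 8) = 0"
      by (simp add: algebra_simps power_mult_distrib eval_nat_numeral)
    then have z8: "z ^ 8 = 1" using \<open>p \<noteq> 0\<close> by simp
    have "p ^ 4 + (z\<^sup>2 * p) ^ 4 + 4 * (s\<^sup>2)\<^sup>2 - 16 * s\<^sup>2 * p * (z\<^sup>2 * p) + 8 * p\<^sup>2 * (z\<^sup>2 * p)\<^sup>2 = 0"
      using br unfolding branch_def q quartic_def by (simp add: power_mult[symmetric])
    then have "p ^ 4 * (1 + z ^ 8 + z ^ 4 * (64 * w\<^sup>2 - 64 * w + 8)) = 0"
      unfolding s2 by (simp add: algebra_simps power_mult_distrib eval_nat_numeral)
    then have "2 + z ^ 4 * (64 * w\<^sup>2 - 64 * w + 8) = 0" using \<open>p \<noteq> 0\<close> z8 by simp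
    then have "x\<^sup>2 * (2 + z ^ 4 * (64 * w\<^sup>2 - 64 * w + 8)) = 0" by simp
    also have "x\<^sup>2 * (2 + z ^ 4 * (64 * w\<^sup>2 - 64 * w + 8)) = 2 * x\<^sup>2 + z ^ 4 * (64 * (w * x)\<^sup>2 - 64 * (w * x) * x + 8 * x\<^sup>2)"
      by (simp add: algebra_simps power2_eq_square)
    finally have "z ^ 4 * (64 - 64 * x + 8 * x\<^sup>2) = - (2 * x\<^sup>2)"
      unfolding wx by (simp add: eq_neg_iff_add_eq_0 add.commute)
    then have "norm (z ^ 4 * (64 - 64 * x + 8 * x\<^sup>2)) = 2 * norm (x\<^sup>2)" by (simp add: norm_mult)
    moreover have "norm (z ^ 4) = 1"
    proof -
      have "norm (z ^ 8) = 1" using z8 by simp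
      then have "norm z ^ 8 = 1" by (simp add: norm_power)
      then have "norm z = 1" using power_eq_iff_eq_base[of 8 "norm z" 1] by simp
      then show ?thesis by (simp add: norm_power)
    qed
    ultimately have eq: "norm (64 - 64 * x + 8 * x\<^sup>2) = 2 * norm (x\<^sup>2)" by (simp add: norm_mult)
    define T where "T = norm x"
    have T: "0 \<le> T" "T \<le> 441 / 400"
    proof -
      have "T = norm \<tau> * norm \<tau>" by (simp add: T_def x_def norm_mult power2_eq_square)
      also have "\<dots> \<le> (21 / 20) * (21 / 20)" using \<tau> by (intro mult_mono) auto
      finally show "T \<le> 441 / 400" by simp
    qed (simp add: T_def)
    \<comment> \<open>Completing the square turns the equation of norms into
      \<open>6 * T\<^sup>2 - 64 * T + 64 \<le> 0\<close>, which fails for \<open>T\<close> up to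
      about 1.117, beyond 441/400 = 1.1025.\<close>
    have "8 * (4 - T)\<^sup>2 \<le> norm (8 * (4 - x)\<^sup>2)"
    proof -
      have "4 - T \<le> norm (4 - x)" using norm_triangle_ineq2[of 4 x] by (simp add: T_def)
      then have "(4 - T)\<^sup>2 \<le> (norm (4 - x))\<^sup>2" using T by (intro power_mono) auto
      then show ?thesis by (simp add: norm_mult norm_power)
    qed
    also have "8 * (4 - x)\<^sup>2 = (64 - 64 * x + 8 * x\<^sup>2) + 64" by (simp add: power2_diff algebra_simps)
    also have "norm \<dots> \<le> norm (64 - 64 * x + 8 * x\<^sup>2) + 64"
      by (rule order_trans[OF norm_triangle_ineq]) simp
    finally have "8 * (4 - T)\<^sup>2 \<le> 2 * T\<^sup>2 + 64" using eq by (simp add: norm_power T_def)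
    then have "64 + 6 * T\<^sup>2 \<le> 64 * T" by (simp add: power2_diff algebra_simps)
    \<comment> \<open>The tangent of \<open>T\<^sup>2\<close> at 441/400 bounds it from below, so
      that linear arithmetic finishes.\<close>
    moreover have "T\<^sup>2 - (441 / 200 * T - 194481 / 160000) = (T - 441 / 400)\<^sup>2"
      by (simp add: power2_eq_square field_simps)
    then have "T\<^sup>2 - (441 / 200 * T - 194481 / 160000) \<ge> 0" by (simp only: zero_le_power2)
    ultimately show False using T by linarith
  qed
qed

section \<open>The surfaces in projective space\<close>

text \<open>Exchanging \<open>a\<close> with \<open>b\<close> and \<open>p\<close> with
  \<open>q\<close> preserves both equations. \<open>mir True\<close> is the permutation that this
  induces on the eight Segre coordinates
  \<open>a * p, b * p, a * q, b * q, a * s, b * s, a * y, b * y\<close>.\<close>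

definition mir :: "bool \<Rightarrow> nat \<Rightarrow> nat" where
  "mir \<mu> l = (if \<mu> \<and> l < 8 then [3, 2, 1, 0, 5, 4, 7, 6] ! l else l)"

text \<open>The Segre embedding of \<open>([1 : z], [p : q : s : y])\<close>.\<close>

definition segre :: "complex \<Rightarrow> complex \<Rightarrow> complex \<Rightarrow> complex \<Rightarrow> complex \<Rightarrow> nat \<Rightarrow> complex" where
  "segre z p q s y l = (if l < 8 then [p, z * p, q, z * q, s, z * s, y, z * y] ! l else 0)"

lemma less_8_cases:
  "l < (8::nat) \<longleftrightarrow> l = 0 \<or> l = 1 \<or> l = 2 \<or> l = 3 \<or> l = 4 \<or> l = 5 \<or> l = 6 \<or> l = 7"
  by auto

lemma segre_simps [simp]:
  "segre z p q s y 0 = p" "segre z p q s y (Suc 0) = z * p" "segre z p q s y 2 = q" "segre z p q s y 3 = z * q"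
  "segre z p q s y 4 = s" "segre z p q s y 5 = z * s" "segre z p q s y 6 = y" "segre z p q s y 7 = z * y"
  by (simp_all add: segre_def)

lemma mir_simps [simp]:
  "mir False l = l" "mir True 0 = 3" "mir True (Suc 0) = 2" "mir True 2 = Suc 0" "mir True 3 = 0"
  "mir True 4 = 5" "mir True 5 = 4" "mir True 6 = 7" "mir True 7 = 6"
  by (simp_all add: mir_def)

lemma mir_mir [simp]: "mir \<mu> (mir \<mu> l) = l"
  by (cases "l < 8"; cases \<mu>) (auto simp: less_8_cases, simp add: mir_def)

lemma mir_less: "l < 8 \<Longrightarrow> mir \<mu> l < 8"
  by (cases \<mu>) (auto simp: less_8_cases)

lemma mir_ge: "l \<ge> 8 \<Longrightarrow> mir \<mu> l = l"
  by (simp add: mir_def)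

lemma mir_inj: "mir \<mu> k = mir \<mu> l \<longleftrightarrow> k = l"
  by (metis mir_mir)

lemma segre_Cn: "segre z p q s y \<in> Cn 8"
  by (simp add: Cn_def segre_def)

lemma mir_Cn: "v \<in> Cn 8 \<Longrightarrow> (\<lambda>l. v (mir \<mu> l)) \<in> Cn 8"
  by (simp add: Cn_def mir_ge)

text \<open>Positions of the Segre coordinates with factor \<open>a\<close>; each is followed by its
  counterpart with factor \<open>b\<close>.\<close>

definition evens :: "nat set" where "evens = {0, 2, 4, 6}"

text \<open>The Segre minors, the equation quadratic in \<open>a\<close> and \<open>b\<close> times
  each of \<open>p\<close>, \<open>q\<close>, \<open>s\<close>, \<open>y\<close>, and the quartic
  equation times \<open>a ^ 4\<close>. The last one says nothing where \<open>a = 0\<close>, hence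
  the mirrored copy.\<close>

definition equations :: "complex \<Rightarrow> bool \<Rightarrow> ((nat \<Rightarrow> complex) \<Rightarrow> complex) set" where
  "equations \<tau> \<mu> =
     {\<lambda>v. v (mir \<mu> i) * v (mir \<mu> (Suc j)) - v (mir \<mu> (Suc i)) * v (mir \<mu> j) |i j. i \<in> evens \<and> j \<in> evens} \<union>
     {\<lambda>v. v (mir \<mu> 1) * v (mir \<mu> (Suc j)) - \<tau> * (v (mir \<mu> 5) * v (mir \<mu> j)) + v (mir \<mu> 2) * v (mir \<mu> j) |j. j \<in> evens} \<union>
     {\<lambda>v. v (mir \<mu> 6) ^ 4 - quartic (v (mir \<mu> 0)) (v (mir \<mu> 2)) (v (mir \<mu> 4))}"

lemma equations_zero_iff:
  "(\<forall>P\<in>equations \<tau> \<mu>. P v = 0) \<longleftrightarrow>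
     (\<forall>i\<in>evens. \<forall>j\<in>evens. v (mir \<mu> i) * v (mir \<mu> (Suc j)) - v (mir \<mu> (Suc i)) * v (mir \<mu> j) = 0) \<and>
     (\<forall>j\<in>evens. v (mir \<mu> 1) * v (mir \<mu> (Suc j)) - \<tau> * (v (mir \<mu> 5) * v (mir \<mu> j)) + v (mir \<mu> 2) * v (mir \<mu> j) = 0) \<and>
     v (mir \<mu> 6) ^ 4 - quartic (v (mir \<mu> 0)) (v (mir \<mu> 2)) (v (mir \<mu> 4)) = 0"
proof -
  have 1: "(\<forall>P\<in>A \<union> B \<union> {c}. P v = 0) \<longleftrightarrow> (\<forall>P\<in>A. P v = 0) \<and> (\<forall>P\<in>B. P v = 0) \<and> c v = 0"
    for A B and c :: "(nat \<Rightarrow> complex) \<Rightarrow> complex" by auto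
  have 2: "(\<forall>P\<in>{f i j |i j. i \<in> evens \<and> j \<in> evens}. P v = 0) \<longleftrightarrow> (\<forall>i\<in>evens. \<forall>j\<in>evens. f i j v = 0)"
    for f :: "nat \<Rightarrow> nat \<Rightarrow> (nat \<Rightarrow> complex) \<Rightarrow> complex" by auto
  have 3: "(\<forall>P\<in>{f j |j. j \<in> evens}. P v = 0) \<longleftrightarrow> (\<forall>j\<in>evens. f j v = 0)"
    for f :: "nat \<Rightarrow> (nat \<Rightarrow> complex) \<Rightarrow> complex" by auto
  show ?thesis unfolding equations_def 1 2 3 ..
qed

lemma equations_mir: "(\<forall>P\<in>equations \<tau> \<mu>. P v = 0) \<longleftrightarrow> (\<forall>P\<in>equations \<tau> False. P (\<lambda>l. v (mir \<mu> l)) = 0)"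
  unfolding equations_zero_iff by simp

definition on_surface :: "complex \<Rightarrow> (nat \<Rightarrow> complex) \<Rightarrow> bool" where
  "on_surface \<tau> v \<longleftrightarrow> (\<forall>\<mu>. \<forall>P\<in>equations \<tau> \<mu>. P v = 0)"

definition surface :: "complex \<Rightarrow> (nat \<Rightarrow> complex) set set" where
  "surface \<tau> = {L \<in> proj_points 7. \<forall>v\<in>L. on_surface \<tau> v}"

lemma equations_homogeneous:
  assumes "P \<in> equations \<tau> \<mu>" shows "\<exists>d. homogeneous_poly (Suc 7) d P"
proof -
  have c: "homogeneous_poly (Suc 7) 1 (\<lambda>v. v (mir \<mu> l))" if "l < 8" for l
    using homogeneous_poly_coord[of "mir \<mu> l" "Suc 7"] mir_less[OF that, of \<mu>] by simp
  note m = homogeneous_poly_mult and cm = homogeneous_poly_cmult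
  have cc: "homogeneous_poly (Suc 7) (1 + 1) (\<lambda>v. v (mir \<mu> i) * v (mir \<mu> j))" if "i < 8" "j < 8" for i j
    by (rule m[OF c[OF that(1)] c[OF that(2)]])
  have c4: "homogeneous_poly (Suc 7) ((1 + 1) + (1 + 1)) (\<lambda>v. (v (mir \<mu> i) * v (mir \<mu> j)) * (v (mir \<mu> k) * v (mir \<mu> l)))"
    if "i < 8" "j < 8" "k < 8" "l < 8" for i j k l
    by (rule m[OF cc[OF that(1,2)] cc[OF that(3,4)]])
  have ev: "j < 8 \<and> Suc j < 8" if "j \<in> evens" for j using that by (auto simp: evens_def)
  let ?v = "\<lambda>v l. v (mir \<mu> l) :: complex"
  from assms show ?thesis
    unfolding equations_def
  proof (elim UnE)
    assume "P \<in> {\<lambda>v. ?v v i * ?v v (Suc j) - ?v v (Suc i) * ?v v j |i j. i \<in> evens \<and> j \<in> evens}"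
    then obtain i j where ij: "i \<in> evens" "j \<in> evens" "P = (\<lambda>v. ?v v i * ?v v (Suc j) - ?v v (Suc i) * ?v v j)" by blast
    show ?thesis unfolding ij(3) by (rule exI, rule homogeneous_poly_diff, rule cc, use ev[OF ij(1)] ev[OF ij(2)] cc in auto)
  next
    assume "P \<in> {\<lambda>v. ?v v 1 * ?v v (Suc j) - \<tau> * (?v v 5 * ?v v j) + ?v v 2 * ?v v j |j. j \<in> evens}"
    then obtain j where j: "j \<in> evens" "P = (\<lambda>v. ?v v 1 * ?v v (Suc j) - \<tau> * (?v v 5 * ?v v j) + ?v v 2 * ?v v j)" by blast
    have "homogeneous_poly (Suc 7) (1 + 1) P"
      unfolding j(2) by (intro homogeneous_poly_diff homogeneous_poly_add cm cc) (use ev[OF j(1)] in auto)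
    then show ?thesis ..
  next
    assume "P \<in> {\<lambda>v. ?v v 6 ^ 4 - quartic (?v v 0) (?v v 2) (?v v 4)}"
    then have P: "P = (\<lambda>v. ?v v 6 ^ 4 - quartic (?v v 0) (?v v 2) (?v v 4))" by blast
    have "homogeneous_poly (Suc 7) ((1 + 1) + (1 + 1)) (\<lambda>v.
        (?v v 6 * ?v v 6) * (?v v 6 * ?v v 6) - ((?v v 0 * ?v v 0) * (?v v 0 * ?v v 0) + (?v v 2 * ?v v 2) * (?v v 2 * ?v v 2)
         + 4 * ((?v v 4 * ?v v 4) * (?v v 4 * ?v v 4)) - 16 * ((?v v 4 * ?v v 4) * (?v v 0 * ?v v 2))
         + 8 * ((?v v 0 * ?v v 0) * (?v v 2 * ?v v 2))))"
      by (intro homogeneous_poly_diff homogeneous_poly_add cm c4) simp_all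
    moreover have "P = (\<lambda>v.
        (?v v 6 * ?v v 6) * (?v v 6 * ?v v 6) - ((?v v 0 * ?v v 0) * (?v v 0 * ?v v 0) + (?v v 2 * ?v v 2) * (?v v 2 * ?v v 2)
         + 4 * ((?v v 4 * ?v v 4) * (?v v 4 * ?v v 4)) - 16 * ((?v v 4 * ?v v 4) * (?v v 0 * ?v v 2))
         + 8 * ((?v v 0 * ?v v 0) * (?v v 2 * ?v v 2))))"
      unfolding P by (simp add: quartic_def fun_eq_iff power4_eq_xxxx power2_eq_square mult_ac)
    ultimately show ?thesis by auto
  qed
qed

lemma proj_algebraic_surface: "proj_algebraic 7 (surface \<tau>)"
  unfolding proj_algebraic_def
proof (intro exI[of _ "\<Union>\<mu>. equations \<tau> \<mu>"] conjI)
  show "\<forall>P\<in>\<Union>\<mu>. equations \<tau> \<mu>. \<exists>d. homogeneous_poly (Suc 7) d P"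
    using equations_homogeneous by auto
qed (auto simp: surface_def on_surface_def)

text \<open>Some even entry is nonzero, and \<open>z\<close> is the ratio of the next entry to it;
  the minors make this the ratio for every pair. If \<open>p\<close> and \<open>s\<close> vanished,
  so would \<open>q\<close> and then \<open>y\<close>.\<close>

lemma on_surface_segre_iff:
  assumes "v \<in> Cn 8" and nz: "v 0 \<noteq> 0 \<or> v 2 \<noteq> 0 \<or> v 4 \<noteq> 0 \<or> v 6 \<noteq> 0"
    and eq: "\<forall>P\<in>equations \<tau> False. P v = 0"
  obtains z where "v = segre z (v 0) (qcoord \<tau> z (v 0) (v 4)) (v 4) (v 6)"
    "v 6 ^ 4 = branch \<tau> z (v 0) (v 4)" "v 0 \<noteq> 0 \<or> v 4 \<noteq> 0"
proof -
  from eq have e: "\<forall>i\<in>evens. \<forall>j\<in>evens. v i * v (Suc j) - v (Suc i) * v j = 0"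
    "\<forall>j\<in>evens. v 1 * v (Suc j) - \<tau> * (v 5 * v j) + v 2 * v j = 0" "v 6 ^ 4 - quartic (v 0) (v 2) (v 4) = 0"
    unfolding equations_zero_iff by simp_all
  have e1: "v i * v (Suc j) = v (Suc i) * v j" if "i \<in> evens" "j \<in> evens" for i j
    using e(1) that by simp
  have e2: "v 1 * v (Suc j) - \<tau> * (v 5 * v j) + v 2 * v j = 0" if "j \<in> evens" for j
    using e(2) that by simp
  have e3: "v 6 ^ 4 = quartic (v 0) (v 2) (v 4)" using e(3) by simp
  have evens: "0 \<in> evens" "2 \<in> evens" "4 \<in> evens" "6 \<in> evens" by (simp_all add: evens_def)
  obtain k where k: "k \<in> evens" "v k \<noteq> 0" using nz evens by blast
  define z where "z = v (Suc k) / v k"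
  have z: "v (Suc j) = z * v j" if "j \<in> evens" for j
    using e1[OF k(1) that] k(2) by (simp add: z_def field_simps)
  have z': "v 1 = z * v 0" "v 3 = z * v 2" "v 5 = z * v 4" "v 7 = z * v 6"
    using z[OF evens(1)] z[OF evens(2)] z[OF evens(3)] z[OF evens(4)] by (simp_all add: eval_nat_numeral)
  have "v k * (z\<^sup>2 * v 0 - \<tau> * z * v 4 + v 2) = 0"
    using e2[OF k(1)] unfolding z[OF k(1)] z' by (simp add: algebra_simps power2_eq_square)
  then have "z\<^sup>2 * v 0 - \<tau> * z * v 4 + v 2 = 0" using k(2) by simp
  then have q: "v 2 = qcoord \<tau> z (v 0) (v 4)" by (simp add: qcoord_def algebra_simps eq_diff_eq)
  have "v l = segre z (v 0) (qcoord \<tau> z (v 0) (v 4)) (v 4) (v 6) l" for l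
  proof (cases "l < 8")
    case True
    then show ?thesis using z' q by (auto simp: less_8_cases)
  next
    case False
    then show ?thesis using assms(1) by (simp add: Cn_def segre_def)
  qed
  moreover have "v 6 ^ 4 = branch \<tau> z (v 0) (v 4)" using e3 q by (simp add: branch_def)
  moreover have "v 0 \<noteq> 0 \<or> v 4 \<noteq> 0"
  proof (rule ccontr)
    assume "\<not> (v 0 \<noteq> 0 \<or> v 4 \<noteq> 0)"
    then have 0: "v 0 = 0" "v 4 = 0" by auto
    then have "v 2 = 0" using q by (simp add: qcoord_def)
    moreover have "v 6 = 0" using e3 0 \<open>v 2 = 0\<close> by (simp add: quartic_def)
    ultimately show False using 0 nz by simp
  qed
  ultimately show ?thesis using that by blast
qed

lemma on_surface_mir: "on_surface \<tau> (\<lambda>l. v (mir \<mu> l)) \<longleftrightarrow> on_surface \<tau> v"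
  using equations_mir[of \<tau> True v] equations_mir[of \<tau> True "\<lambda>l. v (mir \<mu> l)"]
  by (cases \<mu>) (auto simp: on_surface_def all_bool_eq)

lemma on_surface_segre:
  assumes "y ^ 4 = branch \<tau> z p s"
  shows "on_surface \<tau> (segre z p (qcoord \<tau> z p s) s y)"
proof -
  let ?v = "segre z p (qcoord \<tau> z p s) s y"
  have q: "qcoord \<tau> z p s * x = \<tau> * z * s * x - z\<^sup>2 * p * x" for x by (simp add: qcoord_def algebra_simps)
  have "\<forall>P\<in>equations \<tau> False. P ?v = 0"
    unfolding equations_zero_iff using assms
    by (auto simp: evens_def branch_def eval_nat_numeral(3)[symmetric] q algebra_simps power2_eq_square)
  moreover have "\<forall>P\<in>equations \<tau> True. P ?v = 0"
  proof -
    have "(z * y) ^ 4 = quartic (z * qcoord \<tau> z p s) (z * p) (z * s)"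
    proof -
      have "(z * y) ^ 4 = z ^ 4 * quartic p (qcoord \<tau> z p s) s" using assms by (simp add: branch_def power_mult_distrib)
      also have "\<dots> = quartic (z * qcoord \<tau> z p s) (z * p) (z * s)"
        by (simp add: quartic_def algebra_simps power2_eq_square power4_eq_xxxx)
      finally show ?thesis .
    qed
    then show ?thesis
      unfolding equations_zero_iff
      by (auto simp: evens_def eval_nat_numeral(3)[symmetric] q algebra_simps power2_eq_square)
  qed
  ultimately show ?thesis unfolding on_surface_def by (metis (full_types))
qed

lemma on_surface_scale:
  assumes "on_surface \<tau> v" shows "on_surface \<tau> (\<lambda>l. c * v l)"
proof -
  have q: "quartic (c * p) (c * q) (c * s) = c ^ 4 * quartic p q s" for p q s
    by (simp add: quartic_def algebra_simps power2_eq_square power4_eq_xxxx)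
  have 1: "(c * a) * (c * b) - (c * a') * (c * b') = c\<^sup>2 * (a * b - a' * b')" for a b a' b' :: complex
    by (simp add: algebra_simps power2_eq_square)
  have 2: "(c * a) * (c * b) - \<tau> * ((c * a') * (c * b')) + (c * a'') * (c * b'') = c\<^sup>2 * (a * b - \<tau> * (a' * b') + a'' * b'')"
    for a b a' b' a'' b'' :: complex by (simp add: algebra_simps power2_eq_square)
  have 3: "(c * a) ^ 4 - c ^ 4 * b = c ^ 4 * (a ^ 4 - b)" for a b by (simp add: algebra_simps power_mult_distrib)
  show ?thesis
    using assms unfolding on_surface_def equations_zero_iff q 1 2 3 by simp
qed

lemma surface_iff: "proj_point v \<in> surface \<tau> \<longleftrightarrow> proj_point v \<in> proj_points 7 \<and> on_surface \<tau> v"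
proof
  assume "proj_point v \<in> surface \<tau>"
  then show "proj_point v \<in> proj_points 7 \<and> on_surface \<tau> v"
    using self_in_proj_point[of v] by (simp add: surface_def)
next
  assume v: "proj_point v \<in> proj_points 7 \<and> on_surface \<tau> v"
  have "on_surface \<tau> w" if w: "w \<in> proj_point v" for w
  proof -
    obtain c where "w = (\<lambda>i. c * v i)" using w unfolding in_proj_point by blast
    then show ?thesis using on_surface_scale[of \<tau> v c] v by simp
  qed
  then show "proj_point v \<in> surface \<tau>" using v by (simp add: surface_def)
qed

lemma surface_subset: "surface \<tau> \<subseteq> proj_points 7"
  by (auto simp: surface_def)

text \<open>Four affine pieces cover the surface: \<open>\<mu>\<close> exchanges the two standard charts of the line, \<open>\<nu>\<close> decides
  between \<open>p = 1\<close> and \<open>s = 1\<close>, and \<open>v\<close> is the other one of these two coordinates.\<close>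

definition base :: "bool \<Rightarrow> bool \<Rightarrow> nat" where "base \<mu> \<nu> = mir \<mu> (if \<nu> then 0 else 4)"
definition iz :: "bool \<Rightarrow> bool \<Rightarrow> nat" where "iz \<mu> \<nu> = mir \<mu> (if \<nu> then 1 else 5)"
definition iv :: "bool \<Rightarrow> bool \<Rightarrow> nat" where "iv \<mu> \<nu> = mir \<mu> (if \<nu> then 4 else 0)"
definition iy :: "bool \<Rightarrow> nat" where "iy \<mu> = mir \<mu> 6"

lemmas index_defs = base_def iz_def iv_def iy_def

lemma index_distinct:
  "base \<mu> \<nu> \<noteq> iz \<mu> \<nu>" "base \<mu> \<nu> \<noteq> iv \<mu> \<nu>" "base \<mu> \<nu> \<noteq> iy \<mu>" "iz \<mu> \<nu> \<noteq> iv \<mu> \<nu>" "iz \<mu> \<nu> \<noteq> iy \<mu>" "iv \<mu> \<nu> \<noteq> iy \<mu>"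
  "base \<mu> \<nu> < 8" "iz \<mu> \<nu> < 8" "iv \<mu> \<nu> < 8" "iy \<mu> < 8"
  by (auto simp: index_defs mir_inj intro: mir_less)

definition piece :: "bool \<Rightarrow> bool \<Rightarrow> complex \<Rightarrow> complex \<Rightarrow> complex \<Rightarrow> complex \<Rightarrow> nat \<Rightarrow> complex" where
  "piece \<mu> \<nu> \<tau> z v y l =
     (if \<nu> then segre z 1 (qcoord \<tau> z 1 v) v y (mir \<mu> l) else segre z v (qcoord \<tau> z v 1) 1 y (mir \<mu> l))"

definition pbranch :: "bool \<Rightarrow> complex \<Rightarrow> complex \<Rightarrow> complex \<Rightarrow> complex" where
  "pbranch \<nu> \<tau> z v = (if \<nu> then branch \<tau> z 1 v else branch \<tau> z v 1)"

definition pbranch_z :: "bool \<Rightarrow> complex \<Rightarrow> complex \<Rightarrow> complex \<Rightarrow> complex" where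
  "pbranch_z \<nu> \<tau> z v = (if \<nu> then branch_z \<tau> z 1 v else branch_z \<tau> z v 1)"

definition pbranch_v :: "bool \<Rightarrow> complex \<Rightarrow> complex \<Rightarrow> complex \<Rightarrow> complex" where
  "pbranch_v \<nu> \<tau> z v = (if \<nu> then branch_s \<tau> z 1 v else branch_p \<tau> z v 1)"

lemma DERIV_pbranch:
  "((\<lambda>z. pbranch \<nu> \<tau> z v) has_field_derivative pbranch_z \<nu> \<tau> z v) (at z)"
  "((\<lambda>v. pbranch \<nu> \<tau> z v) has_field_derivative pbranch_v \<nu> \<tau> z v) (at v)"
  using DERIV_branch by (cases \<nu>; simp add: pbranch_def pbranch_z_def pbranch_v_def)+

lemma pbranch_smooth:
  assumes "norm \<tau> \<le> 21 / 20" "pbranch \<nu> \<tau> z v = 0"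
  shows "pbranch_z \<nu> \<tau> z v \<noteq> 0 \<or> pbranch_v \<nu> \<tau> z v \<noteq> 0"
proof (rule ccontr)
  assume "\<not> ?thesis"
  then have 0: "pbranch_z \<nu> \<tau> z v = 0" "pbranch_v \<nu> \<tau> z v = 0" by auto
  show False
  proof (cases \<nu>)
    case True
    with 0 assms(2) branch_euler[of \<tau> z 1 v] branch_smooth[OF assms(1), of 1 v z] show False
      by (simp add: pbranch_def pbranch_z_def pbranch_v_def)
  next
    case False
    with 0 assms(2) branch_euler[of \<tau> z v 1] branch_smooth[OF assms(1), of v 1 z] show False
      by (simp add: pbranch_def pbranch_z_def pbranch_v_def)
  qed
qed

lemma piece_simps:
  "piece \<mu> \<nu> \<tau> z v y (base \<mu> \<nu>) = 1" "piece \<mu> \<nu> \<tau> z v y (iz \<mu> \<nu>) = z"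
  "piece \<mu> \<nu> \<tau> z v y (iv \<mu> \<nu>) = v" "piece \<mu> \<nu> \<tau> z v y (iy \<mu>) = y"
  by (cases \<nu>; simp add: piece_def index_defs)+

lemma piece_Cn: "piece \<mu> \<nu> \<tau> z v y \<in> Cn (Suc 7)"
  using mir_Cn[OF segre_Cn, of _ _ _ _ _ \<mu>] by (cases \<nu>) (simp_all add: piece_def[abs_def])

lemma piece_aff: "proj_point (piece \<mu> \<nu> \<tau> z v y) \<in> aff_dom 7 (base \<mu> \<nu>)"
  using proj_point_in_aff_dom[OF piece_Cn] by (simp add: piece_simps)

lemma hom_coord_piece: "hom_coord (base \<mu> \<nu>) (proj_point (piece \<mu> \<nu> \<tau> z v y)) = piece \<mu> \<nu> \<tau> z v y"
  by (simp add: fun_eq_iff hom_coord piece_simps)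

lemma piece_surface:
  assumes "y ^ 4 = pbranch \<nu> \<tau> z v" shows "proj_point (piece \<mu> \<nu> \<tau> z v y) \<in> surface \<tau>"
proof -
  have "on_surface \<tau> (piece \<mu> \<nu> \<tau> z v y)"
  proof (cases \<nu>)
    case True
    then show ?thesis using on_surface_segre[of y \<tau> z 1 v] assms
      by (simp add: piece_def[abs_def] pbranch_def on_surface_mir)
  next
    case False
    then show ?thesis using on_surface_segre[of y \<tau> z v 1] assms
      by (simp add: piece_def[abs_def] pbranch_def on_surface_mir)
  qed
  moreover have "proj_point (piece \<mu> \<nu> \<tau> z v y) \<in> proj_points 7"
    using piece_aff by (simp add: aff_dom_def affine_chart_def)
  ultimately show ?thesis by (simp add: surface_iff)
qed

lemma surface_piece:
  assumes L: "L \<in> aff_dom 7 (base \<mu> \<nu>)" "L \<in> surface \<tau>"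
  defines "w \<equiv> hom_coord (base \<mu> \<nu>) L"
  shows "w = piece \<mu> \<nu> \<tau> (w (iz \<mu> \<nu>)) (w (iv \<mu> \<nu>)) (w (iy \<mu>))"
    and "w (iy \<mu>) ^ 4 = pbranch \<nu> \<tau> (w (iz \<mu> \<nu>)) (w (iv \<mu> \<nu>))"
proof -
  have w: "w \<in> Cn 8" "w (base \<mu> \<nu>) = 1" "proj_point w = L"
    using hom_coord_aff[OF L(1)] by (simp_all add: w_def)
  define u where "u l = w (mir \<mu> l)" for l
  have "on_surface \<tau> w" using L(2) surface_iff[of w \<tau>] w(3) by simp
  then have "on_surface \<tau> u" unfolding u_def on_surface_mir .
  then have eq: "\<forall>P\<in>equations \<tau> False. P u = 0" by (simp add: on_surface_def)
  have uC: "u \<in> Cn 8" unfolding u_def by (rule mir_Cn[OF w(1)])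
  have nz: "u 0 \<noteq> 0 \<or> u 2 \<noteq> 0 \<or> u 4 \<noteq> 0 \<or> u 6 \<noteq> 0"
    using w(2) by (cases \<nu>) (auto simp: u_def base_def)
  obtain z where z: "u = segre z (u 0) (qcoord \<tau> z (u 0) (u 4)) (u 4) (u 6)" "u 6 ^ 4 = branch \<tau> z (u 0) (u 4)"
    using on_surface_segre_iff[OF uC nz eq] by blast
  have u1: "u 1 = z * u 0" "u 5 = z * u 4" by (subst z(1), simp)+
  have wu: "w l = u (mir \<mu> l)" for l by (simp add: u_def)
  have "w l = piece \<mu> \<nu> \<tau> (w (iz \<mu> \<nu>)) (w (iv \<mu> \<nu>)) (w (iy \<mu>)) l \<and> w (iy \<mu>) ^ 4 = pbranch \<nu> \<tau> (w (iz \<mu> \<nu>)) (w (iv \<mu> \<nu>))" for l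
  proof (cases \<nu>)
    case True
    then have u0: "u 0 = 1" using w(2) by (simp add: u_def base_def)
    have "w l = segre z 1 (qcoord \<tau> z 1 (u 4)) (u 4) (u 6) (mir \<mu> l)"
      using fun_cong[OF z(1), of "mir \<mu> l"] unfolding wu u0 .
    moreover have "w (iz \<mu> \<nu>) = z" "w (iv \<mu> \<nu>) = u 4" "w (iy \<mu>) = u 6"
      using True u0 u1 by (simp_all add: wu index_defs)
    moreover have "u 6 ^ 4 = branch \<tau> z 1 (u 4)" using z(2) unfolding u0 .
    ultimately show ?thesis using True by (simp add: piece_def pbranch_def)
  next
    case False
    then have u0: "u 4 = 1" using w(2) by (simp add: u_def base_def)
    have "w l = segre z (u 0) (qcoord \<tau> z (u 0) 1) 1 (u 6) (mir \<mu> l)"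
      using fun_cong[OF z(1), of "mir \<mu> l"] unfolding wu u0 .
    moreover have "w (iz \<mu> \<nu>) = z" "w (iv \<mu> \<nu>) = u 0" "w (iy \<mu>) = u 6"
      using False u0 u1 by (simp_all add: wu index_defs)
    moreover have "u 6 ^ 4 = branch \<tau> z (u 0) 1" using z(2) unfolding u0 .
    ultimately show ?thesis using False by (simp add: piece_def pbranch_def)
  qed
  then show "w = piece \<mu> \<nu> \<tau> (w (iz \<mu> \<nu>)) (w (iv \<mu> \<nu>)) (w (iy \<mu>))"
    and "w (iy \<mu>) ^ 4 = pbranch \<nu> \<tau> (w (iz \<mu> \<nu>)) (w (iv \<mu> \<nu>))" by blast+
qed

text \<open>A nonzero coordinate is moved by \<open>mir\<close> to an even position, which means
  that \<open>a\<close> does not vanish.\<close>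

lemma surface_pieceE:
  assumes "L \<in> surface \<tau>"
  obtains \<mu> \<nu> z v y where "L = proj_point (piece \<mu> \<nu> \<tau> z v y)" "y ^ 4 = pbranch \<nu> \<tau> z v"
proof -
  have "L \<in> proj_points 7" using assms by (simp add: surface_def)
  then obtain w where w: "w \<in> Cn 8" "w \<noteq> 0" "L = proj_point w" by (auto elim: proj_pointsE)
  have "on_surface \<tau> w" using assms by (simp add: w(3) surface_iff)
  obtain l where l: "w l \<noteq> 0" using w(2) by (auto simp: fun_eq_iff)
  then have l8: "l < 8" using w(1) by (auto simp: Cn_def not_less[symmetric])
  have "\<exists>\<mu>. mir \<mu> l \<in> {0, 2, 4, 6}"
    using l8 unfolding less_8_cases by (auto simp: ex_bool_eq)
  then obtain \<mu> where \<mu>: "mir \<mu> l \<in> {0, 2, 4, 6}" by blast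
  define u where "u m = w (mir \<mu> m)" for m
  have "u (mir \<mu> l) \<noteq> 0" using l by (simp add: u_def)
  then have nz: "u 0 \<noteq> 0 \<or> u 2 \<noteq> 0 \<or> u 4 \<noteq> 0 \<or> u 6 \<noteq> 0" using \<mu> by auto
  have "on_surface \<tau> u" using \<open>on_surface \<tau> w\<close> unfolding u_def on_surface_mir .
  then have eq: "\<forall>P\<in>equations \<tau> False. P u = 0" by (simp add: on_surface_def)
  have uC: "u \<in> Cn 8" unfolding u_def by (rule mir_Cn[OF w(1)])
  have "u 0 \<noteq> 0 \<or> u 4 \<noteq> 0" using on_surface_segre_iff[OF uC nz eq] by blast
  then obtain \<nu> where "w (base \<mu> \<nu>) \<noteq> 0"
    by (metis (full_types) base_def u_def)
  then have La: "L \<in> aff_dom 7 (base \<mu> \<nu>)"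
    using w(1) by (simp add: w(3) proj_point_in_aff_dom)
  show ?thesis
    using that[of \<mu> \<nu>] surface_piece[OF La assms] hom_coord_aff(3)[OF La] by metis
qed

section \<open>The total space and its charts\<close>

definition tau :: "complex \<Rightarrow> complex" where "tau t = 21 / 20 * t"

lemma norm_tau: "t \<in> ball 0 1 \<Longrightarrow> norm (tau t) \<le> 21 / 20"
  by (simp add: tau_def norm_mult)

type_synonym point = "complex \<times> (nat \<Rightarrow> complex) set"

abbreviation ambient :: "point topology" where
  "ambient \<equiv> prod_topology (top_of_set (ball 0 1)) (proj_topology 7)"

definition family_points :: "(point) set" where
  "family_points = {(t, L). t \<in> ball 0 1 \<and> L \<in> surface (tau t)}"

definition family_top :: "(point) topology" where
  "family_top = subtopology ambient family_points"

lemma topspace_family_top [simp]: "topspace family_top = family_points"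
  using surface_subset by (auto simp: family_top_def family_points_def)

text \<open>The equations are polynomial in the parameter and the homogeneous coordinates, and on
  each affine piece \<open>hom_coord\<close> chooses the latter continuously.\<close>

lemma closedin_family_points: "closedin ambient family_points"
proof -
  define A where "A = {x :: complex \<times> (nat \<Rightarrow> complex). on_surface (tau (fst x)) (snd x)}"
  have c: "continuous_on UNIV (\<lambda>x :: complex \<times> (nat \<Rightarrow> complex). snd x l)" for l
    by (rule continuous_on_coord) (rule continuous_on_snd[OF continuous_on_id])
  have "closed A"
    unfolding A_def on_surface_def equations_zero_iff tau_def quartic_def
    by (intro closed_Collect_all closed_Collect_conj closed_Collect_eq closed_Collect_imp open_Collect_const
        continuous_intros c ballI | simp only: Ball_def)+
  have "openin ambient (topspace ambient - family_points)"
  proof (subst openin_subopen, intro ballI)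
    fix x assume x: "x \<in> topspace ambient - family_points"
    obtain t L where tL: "x = (t, L)" "t \<in> ball 0 1" "L \<in> proj_points 7" "L \<notin> surface (tau t)"
      using x by (cases x) (auto simp: family_points_def)
    obtain v where v: "v \<in> Cn (Suc 7)" "v \<noteq> 0" "L = proj_point v" using tL(3) by (rule proj_pointsE)
    obtain i where i: "v i \<noteq> 0" using v(2) by (auto simp: fun_eq_iff)
    let ?B = "ball 0 1 \<times> aff_dom 7 i"
    have B: "openin ambient ?B" by (simp add: openin_prod_Times_iff openin_aff_dom)
    have cm: "continuous_map (subtopology ambient ?B) euclidean (\<lambda>x. (fst x, hom_coord i (snd x)))"
    proof -
      have f: "continuous_map (subtopology ambient ?B) (top_of_set (ball 0 1)) fst"
        by (intro continuous_map_from_subtopology continuous_map_fst)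
      have "continuous_map (subtopology ambient ?B) (subtopology (proj_topology 7) (aff_dom 7 i)) snd"
        by (auto simp: continuous_map_in_subtopology intro: continuous_map_from_subtopology continuous_map_snd)
      from continuous_map_compose[OF this continuous_map_hom_coord]
      have "continuous_map (subtopology ambient ?B) euclidean (\<lambda>x. hom_coord i (snd x))" by (simp add: o_def)
      then show ?thesis
        unfolding euclidean_product_topology[symmetric] 
        using continuous_map_into_fulltopology[OF f]
        by (simp add: continuous_map_pairedI euclidean_product_topology flip: prod_topology_euclidean)
    qed
    have La: "K \<in> surface \<sigma> \<longleftrightarrow> on_surface \<sigma> (hom_coord i K)" if "K \<in> aff_dom 7 i" for K \<sigma>
    proof -
      have "K \<in> proj_points 7" using that by (simp add: aff_dom_def affine_chart_def)
      then show ?thesis using surface_iff[of "hom_coord i K" \<sigma>] hom_coord_aff(3)[OF that] by simp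
    qed
    have "openin (subtopology ambient ?B) {x \<in> topspace (subtopology ambient ?B). (fst x, hom_coord i (snd x)) \<in> - A}"
      by (rule openin_continuous_map_preimage[OF cm]) (use \<open>closed A\<close> in \<open>simp add: open_Compl\<close>)
    then have "openin ambient {x \<in> topspace (subtopology ambient ?B). (fst x, hom_coord i (snd x)) \<in> - A}"
      using B openin_trans_full by blast
    moreover have "x \<in> {x \<in> topspace (subtopology ambient ?B). (fst x, hom_coord i (snd x)) \<in> - A}"
      using tL v i La[of L "tau t"] by (simp add: A_def proj_point_in_aff_dom)
    moreover have "{x \<in> topspace (subtopology ambient ?B). (fst x, hom_coord i (snd x)) \<in> - A} \<subseteq> topspace ambient - family_points"
      using La by (auto simp: A_def family_points_def)
    ultimately show "\<exists>T. openin ambient T \<and> x \<in> T \<and> T \<subseteq> topspace ambient - family_points" by blast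
  qed
  then show ?thesis
    using surface_subset by (auto simp: closedin_def family_points_def)
qed

lemma Hausdorff_family_top: "Hausdorff_space family_top"
  unfolding family_top_def
  by (intro Hausdorff_space_subtopology)
    (simp add: Hausdorff_space_prod_topology Hausdorff_proj_topology Hausdorff_space_subtopology)

lemma second_countable_family_top: "second_countable family_top"
  unfolding family_top_def
  by (intro second_countable_subtopology second_countable_prod second_countable_euclidean second_countable_proj_topology)

lemma proper_family: "proper_map family_top (top_of_set (ball 0 1)) fst"
  unfolding family_top_def by (rule proper_map_fst_closed[OF compact_space_proj_topology closedin_family_points])

text \<open>The third coordinate vanishes exactly on the fibre over \<open>t0\<close>, so the chart
  already flattens that fibre to \<open>Cn 2\<close>.\<close>

definition fam_coord :: "nat \<Rightarrow> nat \<Rightarrow> nat \<Rightarrow> complex \<Rightarrow> point \<Rightarrow> nat \<Rightarrow> complex" where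
  "fam_coord i j k t0 x = (\<lambda>n. if n = 0 then hom_coord i (snd x) j else if n = 1 then hom_coord i (snd x) k
     else if n = 2 then fst x - t0 else 0)"

text \<open>\<open>\<psi>\<close> lifts the inverse of the chart to homogeneous coordinates with \<open>i\<close>-th entry \<open>1\<close>.\<close>

definition ratio_chart where
  "ratio_chart i j k t0 U D \<psi> \<longleftrightarrow> i < 8 \<and> j < 8 \<and> k < 8 \<and> i \<noteq> j \<and> i \<noteq> k \<and> j \<noteq> k \<and>
     openin family_top U \<and> openC 3 D \<and> (\<forall>l. holo_on 3 (\<lambda>x. \<psi> x l) D) \<and>
     (\<forall>x\<in>D. \<psi> x \<in> Cn 8 \<and> \<psi> x i = 1 \<and> \<psi> x j = x 0 \<and> \<psi> x k = x 1 \<and> (x 2 + t0, proj_point (\<psi> x)) \<in> U) \<and>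
     (\<forall>x\<in>U. snd x \<in> aff_dom 7 i \<and> fam_coord i j k t0 x \<in> D \<and> proj_point (\<psi> (fam_coord i j k t0 x)) = snd x)"

definition family :: "point manifold" where
  "family = \<lparr>mdim = 3, mtop = family_top,
     atlas = {(U, fam_coord i j k t0) |U i j k t0. \<exists>D \<psi>. ratio_chart i j k t0 U D \<psi>}\<rparr>"

lemma family_simps [simp]: "mdim family = 3" "mtop family = family_top"
  by (simp_all add: family_def)

lemma family_atlasE:
  assumes "c \<in> atlas family"
  obtains i j k t0 U D \<psi> where "c = (U, fam_coord i j k t0)" "ratio_chart i j k t0 U D \<psi>"
  using assms by (auto simp: family_def)

lemma family_atlasI: "ratio_chart i j k t0 U D \<psi> \<Longrightarrow> (U, fam_coord i j k t0) \<in> atlas family"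
  unfolding family_def by simp blast

lemma continuous_map_aff_coord:
  assumes U: "openin family_top U" "\<And>x. x \<in> U \<Longrightarrow> snd x \<in> aff_dom 7 i"
  shows "continuous_map (subtopology family_top U) euclidean (\<lambda>x. hom_coord i (snd x) j)"
    and "continuous_map (subtopology family_top U) euclidean fst"
proof -
  have s: "continuous_map (subtopology family_top U) (proj_topology 7) snd"
    unfolding family_top_def by (intro continuous_map_from_subtopology continuous_map_snd)
  then have "continuous_map (subtopology family_top U) (subtopology (proj_topology 7) (aff_dom 7 i)) snd"
    using U(2) by (auto simp: continuous_map_in_subtopology)
  from continuous_map_compose[OF this continuous_map_coordD[OF continuous_map_hom_coord]]
  show "continuous_map (subtopology family_top U) euclidean (\<lambda>x. hom_coord i (snd x) j)"
    by (simp add: o_def)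
  have "continuous_map (subtopology family_top U) (top_of_set (ball 0 1)) fst"
    unfolding family_top_def by (intro continuous_map_from_subtopology continuous_map_fst)
  then show "continuous_map (subtopology family_top U) euclidean fst"
    by (rule continuous_map_into_fulltopology)
qed

lemma continuous_map_fam_coord:
  assumes "openin family_top U" "\<And>x. x \<in> U \<Longrightarrow> snd x \<in> aff_dom 7 i"
  shows "continuous_map (subtopology family_top U) euclidean (fam_coord i j k t0)"
proof (rule continuous_map_coordI)
  have d: "continuous_map (subtopology family_top U) euclidean (\<lambda>x. fst x - t0)"
    by (intro continuous_map_diff continuous_map_aff_coord(2)[OF assms]) auto
  show "continuous_map (subtopology family_top U) euclidean (\<lambda>x. fam_coord i j k t0 x n)" for n
    unfolding fam_coord_def using continuous_map_aff_coord(1)[OF assms] d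
    by (cases "n = 0"; cases "n = 1"; cases "n = 2") simp_all
qed

lemma fam_coord_Cn: "fam_coord i j k t0 x \<in> Cn 3"
  by (auto simp: fam_coord_def Cn_def)

lemma continuous_map_lift:
  assumes D: "openC 3 D" and \<psi>: "\<And>l. holo_on 3 (\<lambda>x. \<psi> x l) D"
    and 1: "\<And>x. x \<in> D \<Longrightarrow> \<psi> x \<in> Cn 8 \<and> \<psi> x i = 1 \<and> (x 2 + t0, proj_point (\<psi> x)) \<in> family_points"
  shows "continuous_map (top_of_set D) family_top (\<lambda>x. (x 2 + t0, proj_point (\<psi> x)))"
proof -
  have "continuous_on D \<psi>"
    by (rule continuous_on_coordinatewise_then_product) (rule holo_on_imp_continuous_on[OF \<psi>])
  then have p: "continuous_map (top_of_set D) (proj_topology 7) (\<lambda>x. proj_point (\<psi> x))"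
    by (rule continuous_map_proj_point) (use 1 in \<open>auto intro!: exI[of _ i]\<close>)
  have "continuous_on D (\<lambda>x. x 2 + t0)"
    by (intro continuous_on_add continuous_on_const continuous_on_subset[OF continuous_on_product_coordinates subset_UNIV])
  moreover have "x 2 + t0 \<in> ball 0 1" if "x \<in> D" for x using 1[OF that] by (simp add: family_points_def)
  ultimately have "continuous_map (top_of_set D) (top_of_set (ball 0 1)) (\<lambda>x. x 2 + t0)"
    by (auto simp: continuous_map_in_subtopology)
  then have "continuous_map (top_of_set D) ambient (\<lambda>x. (x 2 + t0, proj_point (\<psi> x)))"
    using p by (rule continuous_map_pairedI)
  then show ?thesis using 1 by (auto simp: family_top_def continuous_map_in_subtopology)
qed

lemma ratio_chart_coord:
  assumes "ratio_chart i j k t0 U D \<psi>" "x \<in> D"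
  shows "hom_coord i (proj_point (\<psi> x)) = \<psi> x" "fam_coord i j k t0 (x 2 + t0, proj_point (\<psi> x)) = x"
proof -
  have \<psi>: "\<psi> x i = 1" "\<psi> x j = x 0" "\<psi> x k = x 1" and D: "openC 3 D"
    using assms by (auto simp: ratio_chart_def)
  show h: "hom_coord i (proj_point (\<psi> x)) = \<psi> x" using \<psi>(1) by (simp add: fun_eq_iff hom_coord)
  have "x \<in> Cn 3" using openC_subset[OF D] assms(2) by blast
  then show "fam_coord i j k t0 (x 2 + t0, proj_point (\<psi> x)) = x"
    using \<psi> by (auto simp: fam_coord_def h fun_eq_iff Cn_def)
qed

lemma ratio_chart_hom_coord:
  assumes r: "ratio_chart i j k t0 U D \<psi>" and x: "x \<in> U"
  shows "hom_coord i (snd x) = \<psi> (fam_coord i j k t0 x)"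
proof -
  have "fam_coord i j k t0 x \<in> D" "proj_point (\<psi> (fam_coord i j k t0 x)) = snd x"
    using r x by (auto simp: ratio_chart_def)
  then show ?thesis using ratio_chart_coord(1)[OF r, of "fam_coord i j k t0 x"] by simp
qed

lemma ratio_chart_is_chart:
  assumes r: "ratio_chart i j k t0 U D \<psi>"
  shows "is_chart 3 family_top (U, fam_coord i j k t0)"
    and "fam_coord i j k t0 ` U = D"
    and "\<And>x. x \<in> D \<Longrightarrow> param (U, fam_coord i j k t0) x = (x 2 + t0, proj_point (\<psi> x))"
proof -
  note rr = r[unfolded ratio_chart_def]
  have U: "openin family_top U" and D: "openC 3 D" using rr by blast+
  have UF: "U \<subseteq> family_points" using openin_subset[OF U] by simp
  have 1: "continuous_map (subtopology family_top U) euclidean (fam_coord i j k t0)"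
    by (rule continuous_map_fam_coord[OF U]) (use rr in blast)
  have 2: "fam_coord i j k t0 x \<in> D" if "x \<in> U" for x using rr that by blast
  have 3: "continuous_map (top_of_set D) family_top (\<lambda>x. (x 2 + t0, proj_point (\<psi> x)))"
    by (rule continuous_map_lift[OF D, of _ i]) (use rr UF in blast)+
  have 4: "(x 2 + t0, proj_point (\<psi> x)) \<in> U" if "x \<in> D" for x using rr that by blast
  have 5: "(fam_coord i j k t0 x 2 + t0, proj_point (\<psi> (fam_coord i j k t0 x))) = x" if "x \<in> U" for x
    using rr that by (auto simp: prod_eq_iff) (simp add: fam_coord_def)
  note c = is_chartI[OF U D 1 2 3 4 5 ratio_chart_coord(2)[OF r]]
  show "is_chart 3 family_top (U, fam_coord i j k t0)" "fam_coord i j k t0 ` U = D"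
    "\<And>x. x \<in> D \<Longrightarrow> param (U, fam_coord i j k t0) x = (x 2 + t0, proj_point (\<psi> x))"
    by (use c in blast)+
qed

lemma aff_dom_lift:
  "v \<in> Cn 8 \<Longrightarrow> proj_point v \<in> aff_dom 7 i \<longleftrightarrow> v i \<noteq> 0"
  using proj_point_in_aff_dom[of v 7 i] by simp

text \<open>Every coordinate of a chart is a ratio of entries of \<open>\<psi>\<close>, or the
  parameter up to a constant.\<close>

lemma ratio_chart_compatible_half:
  assumes r: "ratio_chart i j k t0 U D \<psi>" and r': "ratio_chart i' j' k' t0' U' D' \<psi>'"
  shows "holo_on 3 (\<lambda>x. transition (U, fam_coord i j k t0) (U', fam_coord i' j' k' t0') x n) (fam_coord i j k t0 ` (U \<inter> U'))"
    (is "holo_on 3 _ ?V")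
proof -
  note c = ratio_chart_is_chart[OF r] and c' = ratio_chart_is_chart[OF r']
  have U': "openin family_top U'" using r' by (simp add: ratio_chart_def)
  have V: "openC 3 ?V" using is_chart_open_image[OF c(1) U'] by simp
  have VD: "?V \<subseteq> D" using c(2) by auto
  have hol: "holo_on 3 (\<lambda>x. \<psi> x l) ?V" for l
    using r VD by (auto simp: ratio_chart_def intro: holo_on_subset)
  have nz: "\<psi> x i' \<noteq> 0" and tr: "transition (U, fam_coord i j k t0) (U', fam_coord i' j' k' t0') x =
      (\<lambda>n. if n = 0 then \<psi> x j' / \<psi> x i' else if n = 1 then \<psi> x k' / \<psi> x i' else if n = 2 then x 2 + t0 - t0' else 0)"
    if x: "x \<in> ?V" for x
  proof -
    obtain y where y: "y \<in> U" "y \<in> U'" "x = fam_coord i j k t0 y" using x by blast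
    have xD: "x \<in> D" using x VD by blast
    have p: "param (U, fam_coord i j k t0) x = (x 2 + t0, proj_point (\<psi> x))" by (rule c(3)[OF xD])
    have "param (U, fam_coord i j k t0) x = y" using param_coord[OF c(1), of y] y by simp
    then have "proj_point (\<psi> x) \<in> aff_dom 7 i'" using p y(2) r' by (auto simp: ratio_chart_def)
    then show "\<psi> x i' \<noteq> 0" using aff_dom_lift r xD by (auto simp: ratio_chart_def)
    then show "transition (U, fam_coord i j k t0) (U', fam_coord i' j' k' t0') x =
      (\<lambda>n. if n = 0 then \<psi> x j' / \<psi> x i' else if n = 1 then \<psi> x k' / \<psi> x i' else if n = 2 then x 2 + t0 - t0' else 0)"
      by (simp add: transition_def p fam_coord_def hom_coord fun_eq_iff)
  qed
  have "holo_on 3 (\<lambda>x. if n = 0 then \<psi> x j' / \<psi> x i' else if n = 1 then \<psi> x k' / \<psi> x i' else if n = 2 then x 2 + t0 - t0' else 0) ?V"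
    using hol nz by (cases "n = 0"; cases "n = 1"; cases "n = 2") (auto intro!: holo_on_divide holo_on_add holo_on_diff)
  then show ?thesis by (rule holo_on_cong[OF V]) (simp add: tr)
qed

text \<open>The unknown for which the equation \<open>y\<^sup>4 = pbranch \<nu> \<tau> z v\<close> is solved is \<open>y\<close>, \<open>v\<close>, \<open>z\<close> for
  \<open>c = 0, 1, 2\<close>; the other two, in this order, become coordinates.\<close>

definition sel_z :: "nat \<Rightarrow> (nat \<Rightarrow> complex) \<Rightarrow> complex \<Rightarrow> complex" where
  "sel_z c x w = (if c = 2 then w else x 0)"
definition sel_v :: "nat \<Rightarrow> (nat \<Rightarrow> complex) \<Rightarrow> complex \<Rightarrow> complex" where
  "sel_v c x w = (if c = 1 then w else if c = 2 then x 0 else x 1)"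
definition sel_y :: "nat \<Rightarrow> (nat \<Rightarrow> complex) \<Rightarrow> complex \<Rightarrow> complex" where
  "sel_y c x w = (if c = 0 then w else x 1)"
definition idx1 :: "bool \<Rightarrow> bool \<Rightarrow> nat \<Rightarrow> nat" where
  "idx1 \<mu> \<nu> c = (if c = 2 then iv \<mu> \<nu> else iz \<mu> \<nu>)"
definition idx2 :: "bool \<Rightarrow> bool \<Rightarrow> nat \<Rightarrow> nat" where
  "idx2 \<mu> \<nu> c = (if c = 0 then iv \<mu> \<nu> else iy \<mu>)"
definition idx3 :: "bool \<Rightarrow> bool \<Rightarrow> nat \<Rightarrow> nat" where
  "idx3 \<mu> \<nu> c = (if c = 0 then iy \<mu> else if c = 1 then iv \<mu> \<nu> else iz \<mu> \<nu>)"

definition solvable :: "nat \<Rightarrow> bool \<Rightarrow> complex \<Rightarrow> complex \<Rightarrow> complex \<Rightarrow> complex \<Rightarrow> bool" where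
  "solvable c \<nu> \<tau> z v y \<longleftrightarrow>
     (if c = 0 then y \<noteq> 0 else if c = 1 then pbranch_v \<nu> \<tau> z v \<noteq> 0 else pbranch_z \<nu> \<tau> z v \<noteq> 0)"

lemma solvable_exists:
  assumes "norm \<tau> \<le> 21 / 20" "y ^ 4 = pbranch \<nu> \<tau> z v"
  obtains c where "c < 3" "solvable c \<nu> \<tau> z v y"
proof -
  have "y \<noteq> 0 \<or> pbranch_v \<nu> \<tau> z v \<noteq> 0 \<or> pbranch_z \<nu> \<tau> z v \<noteq> 0"
    using pbranch_smooth[OF assms(1)] assms(2) by auto
  then show ?thesis using that[of 0] that[of 1] that[of 2] by (auto simp: solvable_def)
qed

lemma holo_on_pbranch:
  assumes "holo_on n T U" "holo_on n f U" "holo_on n g U"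
  shows "holo_on n (\<lambda>x. pbranch \<nu> (T x) (f x) (g x)) U"
  unfolding pbranch_def branch_def quartic_def qcoord_def
  by (cases \<nu>; simp; intro holo_on_add holo_on_diff holo_on_mult holo_on_power holo_on_const assms)

lemma holo_on_piece:
  assumes "holo_on n T U" "holo_on n f U" "holo_on n g U" "holo_on n h U"
  shows "holo_on n (\<lambda>x. piece \<mu> \<nu> (T x) (f x) (g x) (h x) l) U"
proof (cases "mir \<mu> l < 8")
  case True
  have q: "holo_on n (\<lambda>x. qcoord (T x) (f x) (a x) (b x)) U" if "holo_on n a U" "holo_on n b U" for a b
    unfolding qcoord_def by (intro holo_on_diff holo_on_mult holo_on_power assms that)
  have "holo_on n (\<lambda>x. segre (f x) (a x) (qcoord (T x) (f x) (a x) (b x)) (b x) (h x) (mir \<mu> l)) U"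
    if "holo_on n a U" "holo_on n b U" for a b
    using True unfolding less_8_cases by (elim disjE) (simp_all add: assms that q holo_on_mult)
  then show ?thesis unfolding piece_def using assms by (cases \<nu>) auto
qed (cases \<nu>; simp add: piece_def segre_def)

lemma sel_reassemble:
  assumes "c < 3"
  shows "\<phi> = w (idx3 \<mu> \<nu> c) \<Longrightarrow> x 0 = w (idx1 \<mu> \<nu> c) \<Longrightarrow> x 1 = w (idx2 \<mu> \<nu> c) \<Longrightarrow>
    sel_z c x \<phi> = w (iz \<mu> \<nu>) \<and> sel_v c x \<phi> = w (iv \<mu> \<nu>) \<and> sel_y c x \<phi> = w (iy \<mu>)"
  using assms by (auto simp: sel_z_def sel_v_def sel_y_def idx1_def idx2_def idx3_def)

lemma piece_idx:
  assumes "c < 3"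
  shows "piece \<mu> \<nu> \<tau> (sel_z c x w) (sel_v c x w) (sel_y c x w) (idx1 \<mu> \<nu> c) = x 0"
    "piece \<mu> \<nu> \<tau> (sel_z c x w) (sel_v c x w) (sel_y c x w) (idx2 \<mu> \<nu> c) = x 1"
    "piece \<mu> \<nu> \<tau> (sel_z c x w) (sel_v c x w) (sel_y c x w) (idx3 \<mu> \<nu> c) = w"
  using assms by (auto simp: sel_z_def sel_v_def sel_y_def idx1_def idx2_def idx3_def piece_simps)

text \<open>The implicit function theorem with three known quantities, namely the two chosen
  coordinates and \<open>t - t0\<close>, and the unknown of index \<open>idx3\<close> in the last
  place. The condition \<open>solvable\<close> amounts to a nonzero derivative by the
  unknown.\<close>

lemma ratio_chart_exists:
  assumes c: "c < 3" and W: "openin family_top W" and x: "(t, L) \<in> W" and La: "L \<in> aff_dom 7 (base \<mu> \<nu>)"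
    and sol: "solvable c \<nu> (tau t) (hom_coord (base \<mu> \<nu>) L (iz \<mu> \<nu>)) (hom_coord (base \<mu> \<nu>) L (iv \<mu> \<nu>)) (hom_coord (base \<mu> \<nu>) L (iy \<mu>))"
  obtains U D \<psi> where "ratio_chart (base \<mu> \<nu>) (idx1 \<mu> \<nu> c) (idx2 \<mu> \<nu> c) t0 U D \<psi>" "(t, L) \<in> U" "U \<subseteq> W"
proof -
  let ?i = "base \<mu> \<nu>" and ?j = "idx1 \<mu> \<nu> c" and ?k = "idx2 \<mu> \<nu> c" and ?l = "idx3 \<mu> \<nu> c"
  have WF: "W \<subseteq> family_points" using openin_subset[OF W] by simp
  then have tL: "t \<in> ball 0 1" "L \<in> surface (tau t)" using x by (auto simp: family_points_def)
  define a where "a = hom_coord ?i L"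
  note sp = surface_piece[OF La tL(2), folded a_def]
  define \<phi>c where "\<phi>c = fam_coord ?i ?j ?k t0"
  define h where "h X = sel_y c X (X 3) ^ 4 - pbranch \<nu> (tau (X 2 + t0)) (sel_z c X (X 3)) (sel_v c X (X 3))" for X
  define P where "P = (\<phi>c (t, L))(3 := a ?l)"
  have P012: "P 0 = a ?j" "P 1 = a ?k" "P 2 = t - t0" "P 3 = a ?l"
    by (simp_all add: P_def \<phi>c_def fam_coord_def a_def)
  have PC: "P \<in> Cn (Suc 3)" using fam_coord_Cn[of ?i ?j ?k t0 "(t, L)"] by (auto simp: P_def \<phi>c_def Cn_def)
  have selP: "sel_z c P (P 3) = a (iz \<mu> \<nu>)" "sel_v c P (P 3) = a (iv \<mu> \<nu>)" "sel_y c P (P 3) = a (iy \<mu>)"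
    using sel_reassemble[OF c, of "P 3" a \<mu> \<nu> P] P012 by auto
  have hol: "holo_on (Suc 3) h (Cn (Suc 3))"
    unfolding h_def[abs_def] tau_def sel_z_def sel_v_def sel_y_def
    by (intro holo_on_diff holo_on_power holo_on_pbranch holo_on_mult holo_on_add holo_on_const; (cases "c = 0"; cases "c = 1"; cases "c = 2"; simp)?)
  have h0: "h P = 0" unfolding h_def selP using sp(2) by (simp add: P012)
  have der: "partial 3 h P \<noteq> 0"
  proof -
    have \<tau>: "tau (P 2 + t0) = tau t" by (simp add: P012)
    consider "c = 0" | "c = 1" | "c = 2" using c by linarith
    then show ?thesis
    proof cases
      case 1
      have "((\<lambda>w. h (P(3 := w))) has_field_derivative 4 * (P 3) ^ 3) (at (P 3))"
        unfolding h_def sel_z_def sel_v_def sel_y_def using 1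
        by (auto intro!: derivative_eq_intros simp: eval_nat_numeral)
      then have "partial 3 h P = 4 * (P 3) ^ 3" unfolding partial_def by (rule DERIV_imp_deriv)
      then show ?thesis using sol selP(3) 1 by (simp add: solvable_def sel_y_def a_def)
    next
      case 2
      have "((\<lambda>w. h (P(3 := w))) has_field_derivative 0 - pbranch_v \<nu> (tau (P 2 + t0)) (P 0) (P 3)) (at (P 3))"
        unfolding h_def sel_z_def sel_v_def sel_y_def using 2 by (simp add: DERIV_diff[OF DERIV_const DERIV_pbranch(2)] del: diff_0)
      then have "partial 3 h P = 0 - pbranch_v \<nu> (tau (P 2 + t0)) (P 0) (P 3)" unfolding partial_def by (rule DERIV_imp_deriv)
      then show ?thesis using sol selP(1,2) 2 \<tau> by (simp add: solvable_def sel_z_def sel_v_def a_def)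
    next
      case 3
      have "((\<lambda>w. h (P(3 := w))) has_field_derivative 0 - pbranch_z \<nu> (tau (P 2 + t0)) (P 3) (P 0)) (at (P 3))"
        unfolding h_def sel_z_def sel_v_def sel_y_def using 3 by (simp add: DERIV_diff[OF DERIV_const DERIV_pbranch(1)] del: diff_0)
      then have "partial 3 h P = 0 - pbranch_z \<nu> (tau (P 2 + t0)) (P 3) (P 0)" unfolding partial_def by (rule DERIV_imp_deriv)
      then show ?thesis using sol selP(1,2) 3 \<tau> by (simp add: solvable_def sel_z_def sel_v_def a_def)
    qed
  qed
  \<comment> \<open>Radii below this bound keep \<open>x 2 + t0\<close> inside the unit
    disc.\<close>
  have R: "1 - norm t > 0" using tL(1) by simp
  obtain r d f where f: "0 < r" "r \<le> 1 - norm t" "0 < d" "d \<le> 1 - norm t" "holo_on 3 f (polydisc 3 P d)"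
    "\<And>x. x \<in> polydisc 3 P d \<Longrightarrow> dist (f x) (P 3) < r \<and> h (x(3 := f x)) = 0"
    "\<And>x w. x \<in> polydisc 3 P d \<Longrightarrow> dist w (P 3) < r \<Longrightarrow> h (x(3 := w)) = 0 \<Longrightarrow> w = f x"
    by (rule holo_implicit_function[OF hol PC h0 der R]) blast
  define \<psi> where "\<psi> x = piece \<mu> \<nu> (tau (x 2 + t0)) (sel_z c x (f x)) (sel_v c x (f x)) (sel_y c x (f x))" for x
  let ?B = "polydisc 3 P d"
  have hx: "h (x(3 := w)) = sel_y c x w ^ 4 - pbranch \<nu> (tau (x 2 + t0)) (sel_z c x w) (sel_v c x w)" for x w
    unfolding h_def by (simp add: sel_z_def sel_v_def sel_y_def)
  have \<psi>hol: "holo_on 3 (\<lambda>x. \<psi> x l) ?B" for l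
    unfolding \<psi>_def tau_def sel_z_def sel_v_def sel_y_def
    by (intro holo_on_piece holo_on_mult holo_on_add holo_on_const holo_on_coord; (cases "c = 0"; cases "c = 1"; cases "c = 2"; simp add: f(5))?)
  have \<psi>F: "\<psi> x \<in> Cn 8 \<and> \<psi> x ?i = 1 \<and> (x 2 + t0, proj_point (\<psi> x)) \<in> family_points" if xB: "x \<in> ?B" for x
  proof -
    have "dist (x 2) (P 2) < d" using xB by (simp add: polydisc_def)
    then have "norm (x 2 + t0 - t) < 1 - norm t" using f(4) by (simp add: P012 dist_norm algebra_simps)
    moreover have "norm (x 2 + t0) \<le> norm (x 2 + t0 - t) + norm t"
      using norm_triangle_ineq[of "x 2 + t0 - t" t] by simp
    ultimately have n: "x 2 + t0 \<in> ball 0 1" by simp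
    have "sel_y c x (f x) ^ 4 = pbranch \<nu> (tau (x 2 + t0)) (sel_z c x (f x)) (sel_v c x (f x))"
      using f(6)[OF xB] hx by simp
    from piece_surface[OF this] n show ?thesis
      using piece_Cn by (simp add: \<psi>_def piece_simps family_points_def)
  qed
  have cm: "continuous_map (top_of_set ?B) family_top (\<lambda>x. (x 2 + t0, proj_point (\<psi> x)))"
    by (rule continuous_map_lift[OF openC_polydisc \<psi>hol \<psi>F])
  define D where "D = {x \<in> ?B. (x 2 + t0, proj_point (\<psi> x)) \<in> W}"
  have "openin (top_of_set ?B) {x \<in> topspace (top_of_set ?B). (x 2 + t0, proj_point (\<psi> x)) \<in> W}"
    by (rule openin_continuous_map_preimage[OF cm W])
  then have D: "openC 3 D" using openin_trans[OF _ openC_polydisc] by (simp add: D_def)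
  define A where "A = {x \<in> W. snd x \<in> aff_dom 7 ?i}"
  have A: "openin family_top A"
  proof -
    have "continuous_map family_top (proj_topology 7) snd"
      unfolding family_top_def by (intro continuous_map_from_subtopology continuous_map_snd)
    from openin_continuous_map_preimage[OF this openin_aff_dom]
    have "openin family_top {x \<in> family_points. snd x \<in> aff_dom 7 ?i}" by simp
    from openin_Int[OF W this] have "openin family_top (W \<inter> {x \<in> family_points. snd x \<in> aff_dom 7 ?i})" .
    moreover have "W \<inter> {x \<in> family_points. snd x \<in> aff_dom 7 ?i} = A" using WF by (auto simp: A_def)
    ultimately show ?thesis by (simp only:)
  qed
  \<comment> \<open>The last condition confines the unknown to the ball in which the implicit
    function is the only solution.\<close>
  define U where "U = {x \<in> A. \<phi>c x \<in> ?B \<and> hom_coord ?i (snd x) ?l \<in> ball (P 3) r}"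
  have cmA: "continuous_map (subtopology family_top A) euclidean \<phi>c"
    unfolding \<phi>c_def by (rule continuous_map_fam_coord[OF A]) (simp add: A_def)
  have topA: "topspace (subtopology family_top A) = A" using openin_subset[OF A] by auto
  have "openin (subtopology family_top A) {x \<in> topspace (subtopology family_top A). \<phi>c x \<in> ?B}"
    by (rule openin_vimage_Cn[OF cmA openC_polydisc]) (simp add: \<phi>c_def fam_coord_Cn)
  then have o1: "openin family_top {x \<in> A. \<phi>c x \<in> ?B}" unfolding topA using A openin_trans_full by blast
  have cml: "continuous_map (subtopology family_top A) euclidean (\<lambda>x. hom_coord ?i (snd x) ?l)"
    by (rule continuous_map_aff_coord[OF A]) (simp add: A_def)
  have "openin (subtopology family_top A) {x \<in> topspace (subtopology family_top A). hom_coord ?i (snd x) ?l \<in> ball (P 3) r}"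
    by (rule openin_continuous_map_preimage[OF cml]) simp
  then have o2: "openin family_top {x \<in> A. hom_coord ?i (snd x) ?l \<in> ball (P 3) r}" unfolding topA using A openin_trans_full by blast
  have "U = {x \<in> A. \<phi>c x \<in> ?B} \<inter> {x \<in> A. hom_coord ?i (snd x) ?l \<in> ball (P 3) r}" by (auto simp: U_def)
  then have U: "openin family_top U" using o1 o2 by auto
  have "ratio_chart ?i ?j ?k t0 U D \<psi>"
    unfolding ratio_chart_def
  proof (intro conjI ballI allI)
    show "?i < 8" "?j < 8" "?k < 8" "?i \<noteq> ?j" "?i \<noteq> ?k" "?j \<noteq> ?k"
      using c by (auto simp: idx1_def idx2_def index_distinct)
    show "openin family_top U" by (rule U)
    show "openC 3 D" by (rule D)
    show "holo_on 3 (\<lambda>x. \<psi> x l) D" for l by (rule holo_on_subset[OF \<psi>hol]) (auto simp: D_def)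
  next
    fix x assume xD: "x \<in> D"
    then have xB: "x \<in> ?B" by (simp add: D_def)
    show "\<psi> x \<in> Cn 8" "\<psi> x ?i = 1" using \<psi>F[OF xB] by auto
    show x01: "\<psi> x ?j = x 0" "\<psi> x ?k = x 1" using piece_idx[OF c] by (simp_all add: \<psi>_def)
    have hc: "hom_coord ?i (proj_point (\<psi> x)) = \<psi> x" using hom_coord_piece by (simp add: \<psi>_def)
    have "\<phi>c (x 2 + t0, proj_point (\<psi> x)) = x"
      using x01 openC_subset[OF openC_polydisc] xB by (auto simp: \<phi>c_def fam_coord_def hc fun_eq_iff polydisc_def Cn_def)
    moreover have "\<psi> x ?l = f x" using piece_idx(3)[OF c] by (simp add: \<psi>_def)
    ultimately show "(x 2 + t0, proj_point (\<psi> x)) \<in> U"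
      using xD xB f(6)[OF xB] piece_aff by (auto simp: U_def A_def D_def hc dist_commute) (simp add: \<psi>_def)
  next
    fix y assume y: "y \<in> U"
    then show ya: "snd y \<in> aff_dom 7 ?i" by (simp add: U_def A_def)
    define w where "w = hom_coord ?i (snd y)"
    let ?x = "\<phi>c y"
    have xB: "?x \<in> ?B" using y by (simp add: U_def)
    have x: "?x 0 = w ?j" "?x 1 = w ?k" "?x 2 + t0 = fst y" by (simp_all add: \<phi>c_def fam_coord_def w_def)
    have "y \<in> family_points" using y WF by (auto simp: U_def A_def)
    then have ys: "snd y \<in> surface (tau (fst y))" by (auto simp: family_points_def)
    note spy = surface_piece[OF ya ys, folded w_def]
    have sel: "sel_z c ?x (w ?l) = w (iz \<mu> \<nu>)" "sel_v c ?x (w ?l) = w (iv \<mu> \<nu>)" "sel_y c ?x (w ?l) = w (iy \<mu>)"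
      using sel_reassemble[OF c, of "w ?l" w \<mu> \<nu> ?x] x by auto
    have "h (?x(3 := w ?l)) = 0" unfolding hx sel x(3) using spy(2) by simp
    moreover have "dist (w ?l) (P 3) < r" using y by (simp add: U_def w_def dist_commute)
    ultimately have wl: "w ?l = f ?x" using f(7)[OF xB] by blast
    have "\<psi> ?x = w" unfolding \<psi>_def wl[symmetric] sel x(3) using spy(1) by simp
    then have pp: "proj_point (\<psi> ?x) = snd y" using hom_coord_aff(3)[OF ya] by (simp add: w_def)
    then show "proj_point (\<psi> (fam_coord ?i ?j ?k t0 y)) = snd y" by (simp add: \<phi>c_def)
    have "(?x 2 + t0, proj_point (\<psi> ?x)) = y" unfolding pp x(3) by simp
    then show "fam_coord ?i ?j ?k t0 y \<in> D" using xB y by (simp add: D_def U_def A_def \<phi>c_def)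
  qed
  moreover have "(t, L) \<in> U"
  proof -
    have "\<phi>c (t, L) \<in> ?B"
      using f(3) fam_coord_Cn[of ?i ?j ?k t0 "(t, L)"] by (simp add: polydisc_def P_def \<phi>c_def)
    then show ?thesis using x La f(1) P012(4) by (simp add: U_def A_def a_def)
  qed
  moreover have "U \<subseteq> W" by (auto simp: U_def A_def)
  ultimately show ?thesis by (rule that)
qed

section \<open>Density and connectedness of the affine cover\<close>

lemma fourth_root_exists: "\<exists>r::complex. r ^ 4 = c"
proof -
  have "(csqrt (csqrt c)) ^ 4 = c"
    using power2_csqrt[of c] power2_csqrt[of "csqrt c"] by (simp add: power4_eq_xxxx power2_eq_square mult.assoc)
  then show ?thesis by blast
qed

lemma fourth_root_factor: "a ^ 4 - r ^ 4 = (a - r) * (a + r) * (a - \<i> * r) * (a + \<i> * r)" for a r :: complex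
  by (simp add: algebra_simps power4_eq_xxxx)

lemma fourth_root_cases: "a ^ 4 = r ^ 4 \<longleftrightarrow> a \<in> {r, - r, \<i> * r, - (\<i> * r)}" for a r :: complex
proof -
  have "a ^ 4 = r ^ 4 \<longleftrightarrow> (a - r) * (a + r) * (a - \<i> * r) * (a + \<i> * r) = 0"
    using fourth_root_factor[of a r] by (metis eq_iff_diff_eq_0)
  then show ?thesis by (simp add: eq_neg_iff_add_eq_0)
qed

text \<open>The product of the four distances from \<open>a\<close> to the roots is
  \<open>norm (a ^ 4 - c)\<close>, so one factor is below \<open>e\<close>.\<close>

lemma fourth_root_near:
  fixes a c :: complex assumes "norm (a ^ 4 - c) < e ^ 4" "e > 0"
  shows "\<exists>r. r ^ 4 = c \<and> dist a r < e"
proof (rule ccontr)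
  assume n: "\<not> ?thesis"
  obtain r :: complex where r: "r ^ 4 = c" using fourth_root_exists by blast
  have far: "e \<le> norm (a - x)" if "x ^ 4 = c" for x
    using n that by (auto simp: dist_norm not_less)
  have "e \<le> norm (a - r)" "e \<le> norm (a + r)" "e \<le> norm (a - \<i> * r)" "e \<le> norm (a + \<i> * r)"
    using far[of r] far[of "- r"] far[of "\<i> * r"] far[of "- (\<i> * r)"] r by (simp_all add: power_mult_distrib)
  then have "e * e * e * e \<le> norm (a - r) * norm (a + r) * norm (a - \<i> * r) * norm (a + \<i> * r)"
    using assms(2) by (intro mult_mono) auto
  also have "\<dots> = norm (a ^ 4 - c)" unfolding r[symmetric] fourth_root_factor norm_mult ..
  finally show False using assms(1) by (simp add: power4_eq_xxxx)
qed

lemma finite_avoid: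
  fixes z0 :: complex assumes "finite F" "e > 0"
  obtains z where "dist z z0 < e" "z \<notin> F"
proof -
  have "uncountable (ball z0 e)" using assms(2) by (rule uncountable_ball)
  then have "\<not> ball z0 e \<subseteq> F" using assms(1) by (meson countable_finite countable_subset)
  then obtain z where "z \<in> ball z0 e" "z \<notin> F" by blast
  then show ?thesis using that[of z] by (simp add: dist_commute)
qed

lemma dist_Pair_le: "dist (a, b) (a', b') \<le> dist a a' + dist b b'"
  by (simp add: dist_Pair_Pair sqrt_sum_squares_le_sum)

lemma continuous_on_piece: "continuous_on UNIV (\<lambda>x. piece \<mu> \<nu> \<tau> (fst x) (fst (snd x)) (snd (snd x)))"
proof (rule continuous_on_coordinatewise_then_product)
  fix l
  show "continuous_on UNIV (\<lambda>x. piece \<mu> \<nu> \<tau> (fst x) (fst (snd x)) (snd (snd x)) l)"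
  proof (cases "mir \<mu> l < 8")
    case True
    then show ?thesis
      unfolding less_8_cases piece_def
      by (elim disjE; cases \<nu>) (simp_all add: qcoord_def, (intro continuous_intros)+)
  qed (cases \<nu>; simp add: piece_def segre_def)
qed

lemma continuous_map_piece:
  "continuous_map euclidean (proj_topology 7) (\<lambda>x. proj_point (piece \<mu> \<nu> \<tau> (fst x) (fst (snd x)) (snd (snd x))))"
proof -
  have "\<exists>i. piece \<mu> \<nu> \<tau> z v y i \<noteq> 0" for z v y
    using piece_simps(1)[of \<mu> \<nu> \<tau> z v y] by (intro exI[of _ "base \<mu> \<nu>"]) simp
  then have "continuous_map (top_of_set UNIV) (proj_topology 7) (\<lambda>x. proj_point (piece \<mu> \<nu> \<tau> (fst x) (fst (snd x)) (snd (snd x))))"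
    by (intro continuous_map_proj_point continuous_on_piece piece_Cn) auto
  then show ?thesis by simp
qed

lemma continuous_on_pbranch: "continuous_on UNIV (\<lambda>x. pbranch \<nu> \<tau> (fst x) (snd x))"
  unfolding pbranch_def branch_def quartic_def qcoord_def by (cases \<nu>; simp; intro continuous_intros)

text \<open>Fourth roots move continuously with \<open>pbranch\<close>, so a point of
  \<open>T\<close> over \<open>x\<close> has neighbours in \<open>T\<close> over all points close to
  \<open>x\<close>.\<close>

lemma open_branch_projection:
  assumes T: "open T"
  shows "open {x. \<exists>y. y ^ 4 = pbranch \<nu> \<tau> (fst x) (snd x) \<and> (fst x, snd x, y) \<in> T}"
  unfolding open_dist
proof
  let ?P = "\<lambda>x. pbranch \<nu> \<tau> (fst x) (snd x)"
  fix x assume "x \<in> {x. \<exists>y. y ^ 4 = ?P x \<and> (fst x, snd x, y) \<in> T}"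
  then obtain y where y: "y ^ 4 = ?P x" "(fst x, snd x, y) \<in> T" by blast
  obtain e where e: "e > 0" "ball (fst x, snd x, y) e \<subseteq> T" using T y(2) open_contains_ball by blast
  have "continuous (at x) ?P"
    using continuous_on_pbranch[unfolded continuous_on_eq_continuous_at[OF open_UNIV]] by blast
  then obtain d where d: "d > 0" "\<And>x'. dist x' x < d \<Longrightarrow> dist (?P x') (?P x) < (e / 2) ^ 4"
    using e(1) unfolding continuous_at_eps_delta by (metis half_gt_zero zero_less_power)
  have "\<exists>y. y ^ 4 = ?P x' \<and> (fst x', snd x', y) \<in> T" if x': "dist x' x < min d (e / 2)" for x'
  proof -
    have "norm (y ^ 4 - ?P x') < (e / 2) ^ 4" using d(2)[of x'] x' by (simp add: y(1) dist_norm norm_minus_commute)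
    then obtain y' where y': "y' ^ 4 = ?P x'" "dist y y' < e / 2"
      using fourth_root_near[of y _ "e / 2"] e(1) by auto
    have "dist (fst x', snd x', y') (fst x, snd x, y) < e"
      using dist_Pair_le[of x' y' x y] x' y'(2) by (simp add: dist_prod_def dist_commute add.assoc)
    then show ?thesis using e(2) y'(1) by (auto simp: subset_iff dist_commute)
  qed
  then show "\<exists>e>0. \<forall>x'. dist x' x < e \<longrightarrow> x' \<in> {x. \<exists>y. y ^ 4 = ?P x \<and> (fst x, snd x, y) \<in> T}"
    using d(1) e(1) by (intro exI[of _ "min d (e / 2)"]) auto
qed

text \<open>The two vectors differ by the factor \<open>1 / v\<close>, which moves the entry 1 from
  \<open>p\<close> to \<open>s\<close> or back.\<close>

lemma piece_change_s:
  assumes "v \<noteq> 0"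
  shows "proj_point (piece \<mu> \<nu> \<tau> z v y) = proj_point (piece \<mu> (\<not> \<nu>) \<tau> z (1 / v) (y / v))"
    and "pbranch (\<not> \<nu>) \<tau> z (1 / v) = pbranch \<nu> \<tau> z v / v ^ 4"
proof -
  have "piece \<mu> (\<not> \<nu>) \<tau> z (1 / v) (y / v) l = 1 / v * piece \<mu> \<nu> \<tau> z v y l" for l
  proof (cases "mir \<mu> l < 8")
    case True
    then show ?thesis unfolding less_8_cases piece_def
      using assms by (elim disjE; cases \<nu>) (simp_all add: qcoord_def field_simps power2_eq_square)
  qed (cases \<nu>; simp add: piece_def segre_def)
  then show "proj_point (piece \<mu> \<nu> \<tau> z v y) = proj_point (piece \<mu> (\<not> \<nu>) \<tau> z (1 / v) (y / v))"
    unfolding proj_point_eq_iff using assms by (intro exI[of _ "1 / v"]) auto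
  show "pbranch (\<not> \<nu>) \<tau> z (1 / v) = pbranch \<nu> \<tau> z v / v ^ 4"
    using assms by (cases \<nu>)
      (simp_all add: pbranch_def branch_def quartic_def qcoord_def field_simps power2_eq_square power4_eq_xxxx)
qed

text \<open>Passage between \<open>[1 : z]\<close> and \<open>[1/z : 1]\<close>.\<close>

lemma piece_change_z:
  assumes z: "z \<noteq> 0" and q: "qcoord \<tau> z 1 s \<noteq> 0"
  defines "q \<equiv> qcoord \<tau> z 1 s"
  shows "proj_point (piece \<mu> True \<tau> z s y) = proj_point (piece (\<not> \<mu>) True \<tau> (1 / z) (s / q) (y / q))"
    and "pbranch True \<tau> (1 / z) (s / q) = pbranch True \<tau> z s / q ^ 4"
    and "qcoord \<tau> (1 / z) 1 (s / q) = 1 / q"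
proof -
  have q0: "q \<noteq> 0" using q by (simp add: q_def)
  have "z * z * qcoord \<tau> (1 / z) 1 (s / q) * q = \<tau> * z * s - q"
    using z q0 by (simp add: qcoord_def field_simps power2_eq_square)
  also have "\<dots> = z * z" by (simp add: q_def qcoord_def power2_eq_square)
  finally show q': "qcoord \<tau> (1 / z) 1 (s / q) = 1 / q" using z q0 by (simp add: field_simps)
  have m: "mir (\<not> \<mu>) l = mir True (mir \<mu> l)" for l by (cases \<mu>) simp_all
  have "piece (\<not> \<mu>) True \<tau> (1 / z) (s / q) (y / q) l = 1 / (z * q) * piece \<mu> True \<tau> z s y l" for l
  proof (cases "mir \<mu> l < 8")
    case True
    then show ?thesis unfolding less_8_cases piece_def m q'
      using z q0 by (elim disjE) (simp_all add: q_def[symmetric])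
  next
    case False
    then have "\<not> mir True (mir \<mu> l) < 8" by (simp add: mir_def)
    then show ?thesis using False by (simp add: piece_def m segre_def)
  qed
  then show "proj_point (piece \<mu> True \<tau> z s y) = proj_point (piece (\<not> \<mu>) True \<tau> (1 / z) (s / q) (y / q))"
    unfolding proj_point_eq_iff using z q0 by (intro exI[of _ "1 / (z * q)"]) auto
  have "quartic 1 (1 / q) (s / q) = quartic 1 q s / q ^ 4"
    using q0 by (simp add: quartic_def field_simps power2_eq_square power4_eq_xxxx)
  then show "pbranch True \<tau> (1 / z) (s / q) = pbranch True \<tau> z s / q ^ 4"
    by (simp add: pbranch_def branch_def q' q_def[symmetric])
qed

lemma finite_poly_zeros:
  fixes P :: "complex poly" assumes "\<And>x. f x = poly P x" "f a \<noteq> 0" shows "finite {x. f x = 0}"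
proof -
  have "P \<noteq> 0" using assms by auto
  then show ?thesis unfolding assms(1) by (rule poly_roots_finite)
qed

text \<open>The hypothesis is nonvanishing at \<open>s = 0\<close>, where \<tau> drops out.\<close>

lemma finite_branch_zeros:
  assumes "1 + 8 * z ^ 4 + z ^ 8 \<noteq> 0"
  shows "finite {s. pbranch True \<tau> z s = 0}"
proof (rule finite_poly_zeros)
  let ?q = "[:- z\<^sup>2, \<tau> * z:]" and ?s = "[:0, 1:]"
  show "pbranch True \<tau> z s = poly (1 + ?q ^ 4 + 4 * ?s ^ 4 - 16 * ?s\<^sup>2 * ?q + 8 * ?q\<^sup>2) s" for s
    by (simp add: pbranch_def branch_def quartic_def qcoord_def algebra_simps power2_eq_square)
  show "pbranch True \<tau> z 0 \<noteq> 0"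
    using assms by (simp add: pbranch_def branch_def quartic_def qcoord_def algebra_simps flip: power_mult)
qed

lemma finite_bad_z: "finite {z::complex. 1 + 8 * z ^ 4 + z ^ 8 = 0}"
proof (rule finite_poly_zeros)
  show "1 + 8 * z ^ 4 + z ^ 8 = poly (1 + 8 * [:0, 1:] ^ 4 + [:0, 1:] ^ 8) z" for z :: complex by simp
  show "1 + 8 * (0::complex) ^ 4 + 0 ^ 8 \<noteq> 0" by simp
qed

text \<open>The point is perturbed in the affine piece at hand, where the projection to
  \<open>(z, v)\<close> is open, and then rewritten in the piece \<open>False True\<close>. That
  change of coordinates is injective in \<open>v\<close> off a finite set, so finitely many values
  to be avoided pull back to finitely many.\<close>

lemma surface_dense:
  assumes L: "L \<in> surface \<tau>" and W: "openin (proj_topology 7) W" "L \<in> W"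
    and Z: "finite Z" and B: "\<And>z. z \<notin> Z \<Longrightarrow> finite (B z)"
  obtains z s y where "z \<notin> Z" "s \<notin> B z" "y \<noteq> 0" "y ^ 4 = pbranch True \<tau> z s"
    "proj_point (piece False True \<tau> z s y) \<in> W"
proof -
  obtain \<mu> \<nu> z0 v0 y0 where L0: "L = proj_point (piece \<mu> \<nu> \<tau> z0 v0 y0)" "y0 ^ 4 = pbranch \<nu> \<tau> z0 v0"
    using L by (rule surface_pieceE)
  let ?\<Phi> = "\<lambda>x. proj_point (piece \<mu> \<nu> \<tau> (fst x) (fst (snd x)) (snd (snd x)))"
  have "open {x. ?\<Phi> x \<in> W}"
    using openin_continuous_map_preimage[OF continuous_map_piece W(1), of \<mu> \<nu> \<tau>] by simp
  moreover have "(z0, v0, y0) \<in> {x. ?\<Phi> x \<in> W}" using W(2) L0(1) by simp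
  ultimately have "open {x. \<exists>y. y ^ 4 = pbranch \<nu> \<tau> (fst x) (snd x) \<and> ?\<Phi> (fst x, snd x, y) \<in> W}"
    "(z0, v0) \<in> {x. \<exists>y. y ^ 4 = pbranch \<nu> \<tau> (fst x) (snd x) \<and> ?\<Phi> (fst x, snd x, y) \<in> W}"
    using open_branch_projection[of "{x. ?\<Phi> x \<in> W}" \<nu> \<tau>] L0(2) by auto
  then obtain \<delta> where \<delta>: "\<delta> > 0"
    "ball (z0, v0) \<delta> \<subseteq> {x. \<exists>y. y ^ 4 = pbranch \<nu> \<tau> (fst x) (snd x) \<and> ?\<Phi> (fst x, snd x, y) \<in> W}"
    by (rule openE)
  have \<delta>2: "\<delta> / 2 > 0" using \<delta>(1) by simp
  define Z' where "Z' = Z \<union> {z. 1 + 8 * z ^ 4 + z ^ 8 = 0}"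
  have Z': "finite Z'" using Z finite_bad_z by (simp add: Z'_def)
  \<comment> \<open>Depending on \<open>\<mu>\<close> the final coordinate is \<open>z1\<close> or
    its inverse, so both must avoid \<open>Z'\<close>.\<close>
  have "finite (insert 0 (Z' \<union> inverse ` Z'))" using Z' by simp
  from this \<delta>2 obtain z1 where z1: "dist z1 z0 < \<delta> / 2" "z1 \<notin> insert 0 (Z' \<union> inverse ` Z')" by (rule finite_avoid)
  define z where "z = (if \<mu> then 1 / z1 else z1)"
  have "inverse z1 \<notin> Z'" using z1(2) by (metis UnCI imageI inverse_inverse_eq insertCI)
  then have zZ: "z \<notin> Z'" "z1 \<noteq> 0" "z \<noteq> 0" using z1(2) by (auto simp: z_def divide_inverse)
  define q where "q v = (if \<nu> then qcoord \<tau> z1 1 v else qcoord \<tau> z1 1 (1 / v))" for v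
  \<comment> \<open>\<open>\<sigma> v\<close> is the coordinate \<open>s\<close> of the same point
    in the piece \<open>False True\<close>.\<close>
  define \<sigma> where "\<sigma> v = (if \<mu> then (if \<nu> then v else 1 / v) / q v else if \<nu> then v else 1 / v)" for v
  define N where "N = {v. v \<noteq> 0 \<and> q v \<noteq> 0}"
  have finN: "finite (- N)"
  proof -
    have "- N \<subseteq> {0, z1 / \<tau>, \<tau> / z1}"
      using zZ(2) by (auto simp: N_def q_def qcoord_def power2_eq_square field_simps split: if_splits)
    then show ?thesis by (rule finite_subset) simp
  qed
  have inj: "inj_on \<sigma> N"
  proof (rule inj_onI)
    fix a b assume ab: "a \<in> N" "b \<in> N" "\<sigma> a = \<sigma> b"
    show "a = b"
    proof (cases \<mu>)
      case False
      then show ?thesis using ab by (cases \<nu>) (simp_all add: \<sigma>_def N_def)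
    next
      case True
      define f where "f v = (if \<nu> then v else 1 / v)" for v :: complex
      have "f a * qcoord \<tau> z1 1 (f b) = f b * qcoord \<tau> z1 1 (f a)"
        using ab True by (cases \<nu>) (simp_all add: \<sigma>_def N_def q_def f_def field_simps)
      then have "z1\<^sup>2 * f b = z1\<^sup>2 * f a" by (simp add: qcoord_def algebra_simps)
      then have "f a = f b" using zZ(2) by simp
      then show ?thesis using ab by (cases \<nu>) (simp_all add: f_def N_def)
    qed
  qed
  define B' where "B' = B z \<union> {s. pbranch True \<tau> z s = 0}"
  have "finite B'"
    unfolding B'_def using B[of z] finite_branch_zeros[of z \<tau>] zZ(1) by (simp add: Z'_def)
  then have "finite (\<sigma> -` B' \<inter> N)" using inj by (rule finite_vimage_IntI)
  then have "finite (- N \<union> (\<sigma> -` B' \<inter> N))" using finN by simp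
  from this \<delta>2 obtain v1 where v1: "dist v1 v0 < \<delta> / 2" "v1 \<notin> - N \<union> (\<sigma> -` B' \<inter> N)" by (rule finite_avoid)
  have v1N: "v1 \<in> N" "\<sigma> v1 \<notin> B'" using v1(2) by auto
  have "(z1, v1) \<in> ball (z0, v0) \<delta>" using dist_Pair_le[of z1 v1 z0 v0] z1(1) v1(1) by (simp add: dist_commute)
  then obtain y1 where y1: "y1 ^ 4 = pbranch \<nu> \<tau> z1 v1" and W1: "proj_point (piece \<mu> \<nu> \<tau> z1 v1 y1) \<in> W"
    using \<delta>(2) by (auto simp: subset_iff)
  have "\<exists>s2 y2. proj_point (piece \<mu> \<nu> \<tau> z1 v1 y1) = proj_point (piece \<mu> True \<tau> z1 s2 y2) \<and>
    y2 ^ 4 = pbranch True \<tau> z1 s2 \<and> s2 = (if \<nu> then v1 else 1 / v1)"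
  proof (cases \<nu>)
    case True
    then show ?thesis using y1 by (intro exI[of _ v1] exI[of _ y1]) simp
  next
    case False
    then show ?thesis
      using piece_change_s(1)[of v1 \<mu> False \<tau> z1 y1] piece_change_s(2)[of v1 False \<tau> z1] v1N(1) y1
      by (intro exI[of _ "1 / v1"] exI[of _ "y1 / v1"]) (simp add: N_def power_divide)
  qed
  then obtain s2 y2 where s2: "proj_point (piece \<mu> \<nu> \<tau> z1 v1 y1) = proj_point (piece \<mu> True \<tau> z1 s2 y2)"
    "y2 ^ 4 = pbranch True \<tau> z1 s2" "s2 = (if \<nu> then v1 else 1 / v1)" by blast
  have q2: "qcoord \<tau> z1 1 s2 = q v1" using s2(3) by (simp add: q_def)
  have "\<exists>y. proj_point (piece \<mu> True \<tau> z1 s2 y2) = proj_point (piece False True \<tau> z (\<sigma> v1) y) \<and>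
    y ^ 4 = pbranch True \<tau> z (\<sigma> v1)"
  proof (cases \<mu>)
    case False
    then show ?thesis using s2(2,3) by (intro exI[of _ y2]) (simp add: z_def \<sigma>_def)
  next
    case True
    have "qcoord \<tau> z1 1 s2 \<noteq> 0" using q2 v1N(1) by (simp add: N_def)
    from piece_change_z(1)[OF zZ(2) this, of True y2] piece_change_z(2)[OF zZ(2) this]
    have "proj_point (piece True True \<tau> z1 s2 y2) = proj_point (piece False True \<tau> (1 / z1) (s2 / q v1) (y2 / q v1))"
      "pbranch True \<tau> (1 / z1) (s2 / q v1) = pbranch True \<tau> z1 s2 / q v1 ^ 4" by (simp_all add: q2)
    moreover have "z = 1 / z1" "\<sigma> v1 = s2 / q v1" using True s2(3) by (simp_all add: z_def \<sigma>_def)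
    ultimately show ?thesis using True s2(2) by (intro exI[of _ "y2 / q v1"]) (simp add: power_divide)
  qed
  then obtain y where y: "proj_point (piece \<mu> True \<tau> z1 s2 y2) = proj_point (piece False True \<tau> z (\<sigma> v1) y)"
    "y ^ 4 = pbranch True \<tau> z (\<sigma> v1)" by blast
  have "y \<noteq> 0" using y(2) v1N(2) by (auto simp: B'_def)
  with that[of z "\<sigma> v1" y] zZ(1) v1N(2) y W1 s2(1) show ?thesis by (simp add: Z'_def B'_def)
qed

text \<open>The fourth roots of unity act on the cover. For a nonempty clopen \<open>A\<close> the
  complement of its projection is the projection of the points all of whose four rotations avoid
  \<open>A\<close>, so it is open too, and \<open>A\<close> projects onto the whole plane. A point
  with \<open>y = 0\<close> is alone in its fibre and hence lies in every nonempty clopen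
  set.\<close>

lemma connected_branch_cover: "connected {x. snd (snd x) ^ 4 = pbranch True \<tau> (fst x) (fst (snd x))}" (is "connected ?C")
proof -
  let ?P = "\<lambda>x. pbranch True \<tau> (fst x) (snd x)"
  define \<pi> where "\<pi> A = {x. \<exists>y. (fst x, snd x, y) \<in> A}" for A :: "(complex \<times> complex \<times> complex) set"
  have op: "open (\<pi> A)" if A: "openin (top_of_set ?C) A" for A
  proof -
    obtain T where T: "open T" "A = ?C \<inter> T" using A by (auto simp: openin_open)
    have "\<pi> A = {x. \<exists>y. y ^ 4 = ?P x \<and> (fst x, snd x, y) \<in> T}" unfolding T(2) \<pi>_def by auto
    then show ?thesis using open_branch_projection[OF T(1)] by simp
  qed
  have full: "\<pi> A = UNIV" if A: "openin (top_of_set ?C) A" "openin (top_of_set ?C) (?C - A)" "A \<noteq> {}" for A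
  proof -
    have AC: "A \<subseteq> ?C" using A(1) by (rule openin_imp_subset)
    let ?K = "{1, - 1, \<i>, - \<i>}" and ?m = "\<lambda>k x. (fst x, fst (snd x), k * snd (snd x))"
    have "openin (top_of_set ?C) (?C \<inter> ?m k -` (?C - A))" if "k \<in> ?K" for k :: complex
      by (rule continuous_openin_preimage[OF _ _ A(2)]) (use that in \<open>auto intro!: continuous_intros simp: power_mult_distrib\<close>)
    then have "openin (top_of_set ?C) (\<Inter>k\<in>?K. ?C \<inter> ?m k -` (?C - A))" by (intro openin_INT2) auto
    moreover have "\<pi> (\<Inter>k\<in>?K. ?C \<inter> ?m k -` (?C - A)) = - \<pi> A"
    proof (intro equalityI subsetI)
      fix x assume "x \<in> \<pi> (\<Inter>k\<in>?K. ?C \<inter> ?m k -` (?C - A))"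
      then obtain y where y: "y ^ 4 = ?P x" "\<forall>k\<in>?K. (fst x, snd x, k * y) \<notin> A" by (force simp: \<pi>_def)
      have "(fst x, snd x, w) \<notin> A" for w
      proof
        assume w: "(fst x, snd x, w) \<in> A"
        then have "w ^ 4 = y ^ 4" using AC y(1) by auto
        then show False using w y(2) unfolding fourth_root_cases by auto
      qed
      then show "x \<in> - \<pi> A" by (simp add: \<pi>_def)
    next
      fix x assume x: "x \<in> - \<pi> A"
      obtain r where "r ^ 4 = ?P x" using fourth_root_exists by blast
      then show "x \<in> \<pi> (\<Inter>k\<in>?K. ?C \<inter> ?m k -` (?C - A))" using x by (auto simp: \<pi>_def power_mult_distrib)
    qed
    ultimately have "open (- \<pi> A)" using op[of "\<Inter>k\<in>?K. ?C \<inter> ?m k -` (?C - A)"] by simp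
    moreover have "\<pi> A \<noteq> {}"
    proof -
      obtain x where x: "x \<in> A" using A(3) by blast
      then have "(fst x, fst (snd x)) \<in> \<pi> A" by (auto simp: \<pi>_def intro!: exI[of _ "snd (snd x)"])
      then show ?thesis by blast
    qed
    ultimately show ?thesis
      using op[OF A(1)] connected_UNIV[where 'a = "complex \<times> complex"] by (metis closed_open connected_clopen clopen)
  qed
  \<comment> \<open>At \<open>z = 0\<close> the branch polynomial is \<open>1 + 4 * s ^ 4\<close>
    for every \<tau>.\<close>
  obtain s0 :: complex where s0: "s0 ^ 4 = - 1 / 4" using fourth_root_exists by blast
  have P0: "pbranch True \<tau> 0 s0 = 0" using s0 by (simp add: pbranch_def branch_def quartic_def qcoord_def)
  have pt: "(0, s0, 0) \<in> A" if "openin (top_of_set ?C) A" "openin (top_of_set ?C) (?C - A)" "A \<noteq> {}" for A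
  proof -
    have "(0, s0) \<in> \<pi> A" using full[OF that] by simp
    then obtain y where y: "(0, s0, y) \<in> A" by (auto simp: \<pi>_def)
    then have "y ^ 4 = 0" using that(1) openin_imp_subset P0 by fastforce
    then show ?thesis using y by simp
  qed
  show ?thesis
    unfolding connected_clopen
  proof (intro allI impI)
    fix A assume A: "openin (top_of_set ?C) A \<and> closedin (top_of_set ?C) A"
    then have o: "openin (top_of_set ?C) A" "openin (top_of_set ?C) (?C - A)" by (auto simp: closedin_def)
    have AC: "A \<subseteq> ?C" using o(1) by (rule openin_imp_subset)
    show "A = {} \<or> A = ?C"
    proof (rule ccontr)
      assume n: "\<not> (A = {} \<or> A = ?C)"
      have "?C - (?C - A) = A" using AC by blast
      then have "(0, s0, 0) \<in> ?C - A" using pt[of "?C - A"] o n AC by auto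
      moreover have "(0, s0, 0) \<in> A" using pt[OF o] n by blast
      ultimately show False by blast
    qed
  qed
qed

text \<open>The image of the affine cover is connected and, by \<open>surface_dense\<close>, dense
  in the surface.\<close>

lemma connectedin_surface: "connectedin (proj_topology 7) (surface \<tau>)"
proof -
  let ?C = "{x. snd (snd x) ^ 4 = pbranch True \<tau> (fst x) (fst (snd x))}"
  let ?\<Phi> = "\<lambda>x. proj_point (piece False True \<tau> (fst x) (fst (snd x)) (snd (snd x)))"
  have "connectedin euclidean ?C" using connected_branch_cover by simp
  then have 1: "connectedin (proj_topology 7) (?\<Phi> ` ?C)"
    by (rule connectedin_continuous_map_image[OF continuous_map_piece])
  have 2: "?\<Phi> ` ?C \<subseteq> surface \<tau>" using piece_surface by force
  have 3: "surface \<tau> \<subseteq> proj_topology 7 closure_of (?\<Phi> ` ?C)"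
  proof
    fix L assume L: "L \<in> surface \<tau>"
    have "\<exists>y. y \<in> ?\<Phi> ` ?C \<and> y \<in> W" if W: "L \<in> W \<and> openin (proj_topology 7) W" for W
    proof -
      obtain z s y where "y ^ 4 = pbranch True \<tau> z s" "proj_point (piece False True \<tau> z s y) \<in> W"
        by (rule surface_dense[OF L, of W "{}" "\<lambda>_. {}"]) (use W in auto)
      then show ?thesis by (intro exI[of _ "?\<Phi> (z, s, y)"] conjI imageI) auto
    qed
    then show "L \<in> proj_topology 7 closure_of (?\<Phi> ` ?C)"
      using L surface_subset by (auto simp: in_closure_of)
  qed
  show ?thesis by (rule connectedin_intermediate_closure_of[OF 1 2 3])
qed

section \<open>The family and its fibres as manifolds\<close>

lemma family_chart_at:
  assumes x: "(t, L) \<in> family_points"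
  obtains i j k U D \<psi> where "ratio_chart i j k t0 U D \<psi>" "(t, L) \<in> U"
proof -
  have tL: "t \<in> ball 0 1" "L \<in> surface (tau t)" using x by (auto simp: family_points_def)
  obtain \<mu> \<nu> z v y where L: "L = proj_point (piece \<mu> \<nu> (tau t) z v y)" "y ^ 4 = pbranch \<nu> (tau t) z v"
    using tL(2) by (rule surface_pieceE)
  have La: "L \<in> aff_dom 7 (base \<mu> \<nu>)" by (simp add: L(1) piece_aff)
  have h: "hom_coord (base \<mu> \<nu>) L (iz \<mu> \<nu>) = z" "hom_coord (base \<mu> \<nu>) L (iv \<mu> \<nu>) = v" "hom_coord (base \<mu> \<nu>) L (iy \<mu>) = y"
    by (simp_all add: L(1) hom_coord_piece piece_simps)
  obtain c where c: "c < 3" "solvable c \<nu> (tau t) z v y" by (rule solvable_exists[OF norm_tau[OF tL(1)] L(2)])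
  obtain U D \<psi> where "ratio_chart (base \<mu> \<nu>) (idx1 \<mu> \<nu> c) (idx2 \<mu> \<nu> c) t0 U D \<psi>" "(t, L) \<in> U"
    by (rule ratio_chart_exists[OF c(1) openin_topspace _ La, unfolded h, OF _ c(2)]) (use x in simp)
  then show ?thesis by (rule that)
qed

lemma complex_manifold_family: "complex_manifold family"
  unfolding complex_manifold_def family_simps
proof (intro conjI ballI)
  show "topspace family_top = (\<Union>c\<in>atlas family. chart_dom c)"
  proof
    show "topspace family_top \<subseteq> (\<Union>c\<in>atlas family. chart_dom c)"
    proof
      fix x assume x: "x \<in> topspace family_top"
      obtain t L where tL: "x = (t, L)" by (cases x)
      have 1: "(t, L) \<in> family_points" using x tL by simp
      obtain i j k U D \<psi> where "ratio_chart i j k 0 U D \<psi>" "(t, L) \<in> U"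
        by (rule family_chart_at[OF 1])
      then show "x \<in> (\<Union>c\<in>atlas family. chart_dom c)" unfolding tL by (intro UN_I[OF family_atlasI]) simp_all
    qed
    have "chart_dom c \<subseteq> topspace family_top" if c: "c \<in> atlas family" for c
    proof -
      from c obtain i j k t0 U D \<psi> where cU: "c = (U, fam_coord i j k t0)" and r: "ratio_chart i j k t0 U D \<psi>" by (rule family_atlasE)
      have "openin family_top U" using r unfolding ratio_chart_def by blast
      from openin_subset[OF this] show ?thesis unfolding cU by simp
    qed
    then show "(\<Union>c\<in>atlas family. chart_dom c) \<subseteq> topspace family_top" by blast
  qed
  fix c assume "c \<in> atlas family"
  then obtain i j k t0 U D \<psi> where c: "c = (U, fam_coord i j k t0)" "ratio_chart i j k t0 U D \<psi>" by (rule family_atlasE)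
  show "is_chart 3 family_top c" unfolding c(1) by (rule ratio_chart_is_chart(1)[OF c(2)])
  fix d assume "d \<in> atlas family"
  then obtain i' j' k' t0' U' D' \<psi>' where d: "d = (U', fam_coord i' j' k' t0')" "ratio_chart i' j' k' t0' U' D' \<psi>'"
    by (rule family_atlasE)
  show "compatible 3 c d"
    unfolding compatible_def c(1) d(1) fst_conv snd_conv
    using ratio_chart_compatible_half[OF c(2) d(2)] ratio_chart_compatible_half[OF d(2) c(2)]
    by (simp add: Int_commute)
qed (simp_all add: Hausdorff_family_top second_countable_family_top)

lemma fst_param_ratio_chart:
  "ratio_chart i j k t0 U D \<psi> \<Longrightarrow> x \<in> D \<Longrightarrow> fst (param (U, fam_coord i j k t0) x) = x 2 + t0"
  using ratio_chart_is_chart(3) by fastforce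

lemma holo_fun_family: "holo_fun family fst"
  unfolding holo_fun_def family_simps
proof
  fix c assume "c \<in> atlas family"
  then obtain i j k t0 U D \<psi> where c: "c = (U, fam_coord i j k t0)" "ratio_chart i j k t0 U D \<psi>" by (rule family_atlasE)
  have D: "openC 3 D" using c(2) by (simp add: ratio_chart_def)
  have "holo_on 3 (\<lambda>x. x 2 + t0) D" by (intro holo_on_add holo_on_coord holo_on_const)
  then have "holo_on 3 (\<lambda>x. fst (param (U, fam_coord i j k t0) x)) D"
    by (rule holo_on_cong[OF D]) (simp add: fst_param_ratio_chart[OF c(2)])
  then show "holo_on 3 (\<lambda>x. fst (param c x)) (coord c ` chart_dom c)"
    using ratio_chart_is_chart(2)[OF c(2)] by (simp add: c(1))
qed

lemma submersive_family: "submersive family fst"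
  unfolding submersive_def family_simps
proof (intro ballI)
  fix c z assume "c \<in> atlas family" and z: "z \<in> coord c ` chart_dom c"
  then obtain i j k t0 U D \<psi> where c: "c = (U, fam_coord i j k t0)" "ratio_chart i j k t0 U D \<psi>" by (metis family_atlasE)
  have D: "openC 3 D" using c(2) by (simp add: ratio_chart_def)
  have zD: "z \<in> D" using z ratio_chart_is_chart(2)[OF c(2)] by (simp add: c(1))
  have "partial 2 (\<lambda>w. fst (param c w)) z = partial 2 (\<lambda>x. x 2 + t0) z"
    by (rule partial_cong[OF D zD]) (simp_all add: c(1) fst_param_ratio_chart[OF c(2)])
  also have "\<dots> = 1"
    unfolding partial_def by (rule DERIV_imp_deriv) (auto intro!: derivative_eq_intros)
  finally show "\<exists>i<3. partial i (\<lambda>w. fst (param c w)) z \<noteq> 0" by (intro exI[of _ 2]) simp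
qed

definition fib :: "complex \<Rightarrow> point set" where
  "fib t = {x \<in> family_points. fst x = t}"

lemma fibre_family: "fibre family fst t = restrict_manifold family 2 (fib t)"
  by (simp add: fibre_def fib_def)

lemma in_fib: "t \<in> ball 0 1 \<Longrightarrow> (t', L) \<in> fib t \<longleftrightarrow> t' = t \<and> L \<in> surface (tau t)"
  by (auto simp: fib_def family_points_def)

lemma fib_chart_image:
  assumes r: "ratio_chart i j k t U D \<psi>"
  shows "fam_coord i j k t ` (U \<inter> fib t) = fam_coord i j k t ` U \<inter> Cn 2"
proof -
  have U: "U \<subseteq> family_points" using r openin_subset[of family_top U] by (simp add: ratio_chart_def)
  have "fam_coord i j k t x \<in> Cn 2 \<longleftrightarrow> fst x = t" for x
    by (auto simp: fam_coord_def Cn_def)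
  then show ?thesis using U by (auto simp: fib_def)
qed

lemma fib_atlasI:
  assumes "ratio_chart i j k t U D \<psi>"
  shows "(U \<inter> fib t, fam_coord i j k t) \<in> atlas (fibre family fst t)"
  unfolding fibre_family
  by (rule restrict_atlasI[OF subsetD[OF atlas_subset_maximal[OF complex_manifold_family] family_atlasI[OF assms]]
        fib_chart_image[OF assms]])

lemma complex_submanifold_fib: "complex_submanifold family 2 (fib t)"
  unfolding complex_submanifold_def family_simps
proof (intro conjI subsetI)
  fix x assume x: "x \<in> fib t"
  obtain t' L where tL: "x = (t', L)" by (cases x)
  have 1: "(t', L) \<in> family_points" using x tL by (auto simp: fib_def)
  obtain i j k U D \<psi> where r: "ratio_chart i j k t U D \<psi>" "(t', L) \<in> U"
    by (rule family_chart_at[OF 1])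
  show "x \<in> (\<Union>c\<in>atlas (restrict_manifold family 2 (fib t)). chart_dom c)"
    using fib_atlasI[OF r(1)] r(2) x tL unfolding fibre_family by force
qed (auto simp: fib_def)

lemma complex_manifold_fibre: "complex_manifold (fibre family fst t)"
  unfolding fibre_family by (rule complex_manifold_restrict[OF complex_manifold_family complex_submanifold_fib])

text \<open>Supplies the order \<open>e\<close> of \<open>graph_chart\<close> with the two chart
  coordinates in front.\<close>

lemma exists_enumeration:
  assumes "i \<le> N" "j \<le> N" "k \<le> N" "i \<noteq> j" "i \<noteq> k" "j \<noteq> (k::nat)"
  obtains e where "bij_betw e {..<N} ({..N} - {i})" "e 0 = j" "e 1 = k"
proof -
  have N: "N \<ge> 2" using assms by presburger
  have "card {2..<N} = card ({..N} - {i, j, k})" using assms by (simp add: card_Diff_subset)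
  then obtain g where g: "bij_betw g {2..<N} ({..N} - {i, j, k})"
    using bij_betw_iff_card[of "{2..<N}" "{..N} - {i, j, k}"] by auto
  define e where "e n = (if n = 0 then j else if n = 1 then k else g n)" for n
  have "bij_betw e {2..<N} ({..N} - {i, j, k})"
    using g by (rule bij_betw_cong[THEN iffD1, rotated]) (simp add: e_def)
  moreover have "bij_betw e {0, 1} {j, k}" using assms(6) by (auto simp: bij_betw_def e_def)
  ultimately have "bij_betw e ({2..<N} \<union> {0, 1}) (({..N} - {i, j, k}) \<union> {j, k})"
    by (rule bij_betw_combine) auto
  moreover have "{2..<N} \<union> {0, 1} = {..<N}" using N by auto
  moreover have "({..N} - {i, j, k}) \<union> {j, k} = {..N} - {i}" using assms by auto
  ultimately show ?thesis using that[of e] by (simp add: e_def)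
qed

text \<open>A chart of the family with \<open>t0 = t\<close>, restricted to vanishing third
  coordinate, presents the surface as the graph that \<open>complex_submanifold_projI\<close> asks
  for.\<close>

lemma complex_submanifold_surface:
  assumes t: "t \<in> ball 0 1" shows "complex_submanifold (proj_space 7) 2 (surface (tau t))"
proof (rule complex_submanifold_projI)
  fix L assume L: "L \<in> surface (tau t)"
  have 1: "(t, L) \<in> family_points" using t L by (simp add: family_points_def)
  obtain i j k U D \<psi> where r: "ratio_chart i j k t U D \<psi>" and LU: "(t, L) \<in> U"
    by (rule family_chart_at[OF 1])
  note rr = r[unfolded ratio_chart_def]
  have ijk: "i < 8" "j < 8" "k < 8" "i \<noteq> j" "i \<noteq> k" "j \<noteq> k" and Uo: "openin family_top U" using rr by blast+
  then have le: "i \<le> 7" "j \<le> 7" "k \<le> 7" by simp_all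
  obtain e :: "nat \<Rightarrow> nat" where e: "bij_betw e {..<7} ({..7} - {i})" "e 0 = j" "e 1 = k"
    by (rule exists_enumeration[OF le ijk(4-6)])
  from Uo obtain Ob where Ob: "openin ambient Ob" "U = Ob \<inter> family_points"
    by (auto simp: family_top_def openin_subtopology)
  define W where "W = {L \<in> proj_points 7. (t, L) \<in> Ob}"
  have "continuous_map (proj_topology 7) ambient (\<lambda>L. (t, L))"
    using t by (intro continuous_map_pairedI continuous_map_const[THEN iffD2] continuous_map_id[unfolded id_def]) auto
  from openin_continuous_map_preimage[OF this Ob(1)] have W: "openin (proj_topology 7) W" by (simp add: W_def)
  have D2: "x 2 = 0" if "x \<in> D \<inter> Cn 2" for x using that by (simp add: Cn_def)
  have "surface (tau t) \<inter> W = (\<lambda>x. proj_point (\<psi> x)) ` (D \<inter> Cn 2)"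
  proof
    show "surface (tau t) \<inter> W \<subseteq> (\<lambda>x. proj_point (\<psi> x)) ` (D \<inter> Cn 2)"
    proof
      fix K assume K: "K \<in> surface (tau t) \<inter> W"
      then have KU: "(t, K) \<in> U" using t by (simp add: Ob(2) W_def family_points_def)
      let ?x = "fam_coord i j k t (t, K)"
      have "?x \<in> D" "proj_point (\<psi> ?x) = K" using rr KU by fastforce+
      moreover have "?x \<in> Cn 2" by (simp add: Cn_def fam_coord_def)
      ultimately show "K \<in> (\<lambda>x. proj_point (\<psi> x)) ` (D \<inter> Cn 2)" by (metis IntI image_eqI)
    qed
    show "(\<lambda>x. proj_point (\<psi> x)) ` (D \<inter> Cn 2) \<subseteq> surface (tau t) \<inter> W"
    proof (rule image_subsetI)
      fix x assume x: "x \<in> D \<inter> Cn 2"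
      then have "(x 2 + t, proj_point (\<psi> x)) \<in> U" using rr by blast
      then have "(t, proj_point (\<psi> x)) \<in> U" using D2[OF x] by simp
      then show "proj_point (\<psi> x) \<in> surface (tau t) \<inter> W"
        using surface_subset by (auto simp: Ob(2) W_def family_points_def)
    qed
  qed
  moreover have "openC 2 (D \<inter> Cn 2)" using openC_Int_Cn[of 3 D 2] rr by simp
  moreover have "\<forall>l. holo_on 2 (\<lambda>x. \<psi> x l) (D \<inter> Cn 2)"
    using rr holo_on_dim_mono[of 3 _ D 2 "D \<inter> Cn 2"] by auto
  moreover have "\<forall>x\<in>D \<inter> Cn 2. \<psi> x \<in> Cn (Suc 7) \<and> \<psi> x i = 1 \<and> (\<forall>j<2. \<psi> x (e j) = x j)"
  proof
    fix x assume "x \<in> D \<inter> Cn 2"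
    then have "\<psi> x \<in> Cn 8 \<and> \<psi> x i = 1 \<and> \<psi> x j = x 0 \<and> \<psi> x k = x 1" using rr by blast
    then show "\<psi> x \<in> Cn (Suc 7) \<and> \<psi> x i = 1 \<and> (\<forall>j<2. \<psi> x (e j) = x j)"
      using e(2,3) by (auto simp: less_2_cases_iff)
  qed
  moreover have "L \<in> W" using LU Ob(2) subsetD[OF surface_subset L] by (simp add: W_def)
  moreover have "i \<le> 7" using ijk by simp
  ultimately show "\<exists>i e D W \<psi>. i \<le> 7 \<and> bij_betw e {..<7} ({..7} - {i}) \<and> openC 2 D \<and>
      openin (proj_topology 7) W \<and> L \<in> W \<and>
      (\<forall>x\<in>D. \<psi> x \<in> Cn (Suc 7) \<and> \<psi> x i = 1 \<and> (\<forall>j<2. \<psi> x (e j) = x j)) \<and>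
      (\<forall>l. holo_on 2 (\<lambda>x. \<psi> x l) D) \<and> surface (tau t) \<inter> W = (\<lambda>x. proj_point (\<psi> x)) ` D"
    using e(1) W by blast
qed (use surface_subset in auto)

lemma holo_map_snd: "holo_map family (proj_space 7) snd"
  unfolding holo_map_def family_simps proj_space_simps
proof (intro conjI ballI allI impI)
  show snd: "continuous_map family_top (proj_topology 7) snd"
    unfolding family_top_def by (intro continuous_map_from_subtopology continuous_map_snd)
  fix c d n assume "c \<in> atlas family" and "d \<in> affine_chart 7 ` {..7}" and n: "n < (7::nat)"
  then obtain i j k t0 U D \<psi> m where c: "c = (U, fam_coord i j k t0)" "ratio_chart i j k t0 U D \<psi>"
    and m: "m \<le> 7" "d = affine_chart 7 m" by (metis atMost_iff family_atlasE image_iff)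
  note cc = ratio_chart_is_chart[OF c(2)]
  let ?V = "coord c ` {x \<in> chart_dom c. snd x \<in> chart_dom d}"
  have "openin family_top {x \<in> topspace family_top. snd x \<in> aff_dom 7 m}"
    by (rule openin_continuous_map_preimage[OF snd openin_aff_dom])
  from is_chart_open_image[OF cc(1) this]
  have V: "openC 3 ?V"
  proof (rule back_subst[of "openC 3"])
    show "coord (U, fam_coord i j k t0) ` (chart_dom (U, fam_coord i j k t0) \<inter> {x \<in> topspace family_top. snd x \<in> aff_dom 7 m}) = ?V"
      using is_chart_subset[OF cc(1)] by (auto simp: c(1) m(2) aff_dom_def)
  qed
  have p: "x \<in> D \<and> \<psi> x m \<noteq> 0 \<and> coord d (snd (param c x)) n = \<psi> x (skip m n) / \<psi> x m" if x: "x \<in> ?V" for x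
  proof -
    obtain y where y: "y \<in> U" "snd y \<in> aff_dom 7 m" "x = fam_coord i j k t0 y"
      using x by (auto simp: c(1) m(2) aff_dom_def)
    have xD: "x \<in> D" using y cc(2) by blast
    have "param c x = y" using param_coord[OF cc(1), of y] y by (simp add: c(1))
    moreover have px: "param c x = (x 2 + t0, proj_point (\<psi> x))" unfolding c(1) by (rule cc(3)[OF xD])
    ultimately have "proj_point (\<psi> x) \<in> aff_dom 7 m" using y(2) by auto
    then have "\<psi> x m \<noteq> 0" using aff_dom_lift c(2) xD by (auto simp: ratio_chart_def)
    then show ?thesis using xD by (simp add: px m(2) coord_affine_chart hom_coord)
  qed
  have hol: "holo_on 3 (\<lambda>x. \<psi> x l) ?V" for l
  proof -
    have "holo_on 3 (\<lambda>x. \<psi> x l) D" using c(2) unfolding ratio_chart_def by blast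
    moreover have "?V \<subseteq> D" using p by blast
    ultimately show ?thesis by (rule holo_on_subset)
  qed
  have "holo_on 3 (\<lambda>x. \<psi> x (skip m n) / \<psi> x m) ?V"
    by (rule holo_on_divide[OF hol hol]) (use p in blast)
  then show "holo_on 3 (\<lambda>x. coord d (snd (param c x)) n) ?V"
    by (rule holo_on_cong[OF V]) (use p in simp)
qed

lemma biholomorphic_fibre:
  assumes t: "t \<in> ball 0 1"
  shows "biholomorphic (fibre family fst t) (restrict_manifold (proj_space 7) 2 (surface (tau t)))"
proof -
  let ?S = "surface (tau t)" and ?M = "fibre family fst t"
  let ?N = "restrict_manifold (proj_space 7) 2 ?S"
  note P = complex_manifold_proj_space[of 7]
  have N: "complex_manifold ?N" by (rule complex_manifold_restrict[OF P complex_submanifold_surface[OF t]])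
  have topM: "topspace (mtop ?M) = fib t"
    unfolding fibre_family by (auto simp: fib_def)
  have topN: "topspace (mtop ?N) = ?S" using surface_subset by auto
  have 1: "holo_map ?M ?N snd"
  proof (rule holo_map_restrict_target[OF complex_manifold_fibre P])
    show "holo_map ?M (proj_space 7) snd"
      unfolding fibre_family by (rule holo_map_restrict_source[OF complex_manifold_family P holo_map_snd]) simp
    show "snd ` topspace (mtop ?M) \<subseteq> ?S" unfolding topM by (auto simp: fib_def family_points_def)
  qed simp
  have pair: "holo_map ?N family (\<lambda>L. (t, L))"
    unfolding holo_map_def restrict_manifold_simps family_simps proj_space_simps
  proof (intro conjI ballI allI impI)
    have "continuous_map (subtopology (proj_topology 7) ?S) ambient (\<lambda>L. (t, L))"
      using t by (intro continuous_map_pairedI continuous_map_const[THEN iffD2] continuous_map_from_subtopology continuous_map_id[unfolded id_def]) auto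
    then show cp: "continuous_map (subtopology (proj_topology 7) ?S) family_top (\<lambda>L. (t, L))"
      using t by (auto simp: family_top_def continuous_map_in_subtopology family_points_def)
    fix c d n assume cN: "c \<in> atlas ?N" and "d \<in> atlas family" and n: "n < (3::nat)"
    obtain V \<eta> where c: "c = (V \<inter> ?S, \<eta>)" "(V, \<eta>) \<in> maximal_atlas (proj_space 7)" "\<eta> ` (V \<inter> ?S) = \<eta> ` V \<inter> Cn 2"
      using cN by (rule restrict_atlasE)
    obtain i j k t0 U D \<psi> where d: "d = (U, fam_coord i j k t0)" "ratio_chart i j k t0 U D \<psi>"
      using \<open>d \<in> atlas family\<close> by (rule family_atlasE)
    note cV = maximal_atlasD(1)[OF c(2), unfolded proj_space_simps]
    note cS = is_chart_restrict[OF cV _ c(3)]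
    let ?V = "coord c ` {x \<in> chart_dom c. (t, x) \<in> chart_dom d}"
    have Uo: "openin family_top U" and Ua: "\<And>x. x \<in> U \<Longrightarrow> snd x \<in> aff_dom 7 i" and ij: "i < 8" "j < 8" "k < 8" "i \<noteq> j" "i \<noteq> k"
      using d(2) unfolding ratio_chart_def by blast+
    have "openin (subtopology (proj_topology 7) ?S) {x \<in> topspace (subtopology (proj_topology 7) ?S). (t, x) \<in> U}"
      by (rule openin_continuous_map_preimage[OF cp Uo])
    from is_chart_open_image[OF cS this]
    have Vo: "openC 2 ?V"
    proof (rule back_subst[of "openC 2"])
      show "coord (V \<inter> ?S, \<eta>) ` (chart_dom (V \<inter> ?S, \<eta>) \<inter> {x \<in> topspace (subtopology (proj_topology 7) ?S). (t, x) \<in> U}) = ?V"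
        using surface_subset by (auto simp: c(1) d(1))
    qed simp
    \<comment> \<open>A chart of the embedded surface comes from the maximal atlas, so its
      transition to the affine chart \<open>i\<close> is holomorphic, and the coordinates of the
      latter are the ratios needed.\<close>
    have comp: "holo_on 2 (\<lambda>z. hom_coord i (param c z) l) ?V" if l: "l < 8" "l \<noteq> i" for l
    proof -
      obtain l' where l': "l = skip i l'" using skip_cases[of l i] l(2) by blast
      then have "l' < 7" using l(1) ij(1) by (auto simp: skip_def split: if_splits)
      moreover have "affine_chart 7 i \<in> atlas (proj_space 7)" using ij(1) by simp
      ultimately have "holo_on 7 (\<lambda>z. transition (V, \<eta>) (affine_chart 7 i) z l') (\<eta> ` (V \<inter> chart_dom (affine_chart 7 i)))"
        using maximal_atlasD(2)[OF c(2)] by (simp add: compatible_def)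
      then have "holo_on 2 (\<lambda>z. transition (V, \<eta>) (affine_chart 7 i) z l') ?V"
        by (rule holo_on_dim_mono) (use Ua in \<open>auto simp: c(1) d(1) aff_dom_def\<close>)
      then show ?thesis
      proof (rule holo_on_cong[OF Vo])
        fix z assume "z \<in> ?V"
        then have "z \<in> \<eta> ` (V \<inter> ?S)" by (auto simp: c(1))
        then show "transition (V, \<eta>) (affine_chart 7 i) z l' = hom_coord i (param c z) l"
          by (simp add: transition_def coord_affine_chart l' c(1) param_restrict[OF cV])
      qed
    qed
    have "n = 0 \<or> n = 1 \<or> n = 2" using n by auto
    then show "holo_on 2 (\<lambda>z. coord d (t, param c z) n) ?V"
      using comp[of j] comp[of k] ij by (auto simp: d(1) fam_coord_def)
  qed
  have 2: "holo_map ?N ?M (\<lambda>L. (t, L))"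
    unfolding fibre_family
    by (rule holo_map_restrict_target[OF N complex_manifold_family pair]) (use t in \<open>auto simp: in_fib\<close>)
  have "homeomorphic_maps (mtop ?M) (mtop ?N) snd (\<lambda>L. (t, L))"
    unfolding homeomorphic_maps_def topM topN using 1 2 by (auto simp: holo_map_def fib_def)
  then show ?thesis
    unfolding biholomorphic_def using 1 2 by (auto simp: fibre_family)
qed

lemma smooth_projective_variety_fibre:
  assumes t: "t \<in> ball 0 1" shows "smooth_projective_variety (fibre family fst t)"
  unfolding smooth_projective_variety_def
proof (intro conjI exI)
  show "complex_manifold (fibre family fst t)" by (rule complex_manifold_fibre)
  obtain y :: complex where "y ^ 4 = pbranch True (tau t) 0 0" using fourth_root_exists by blast
  from piece_surface[OF this] show "surface (tau t) \<noteq> {}" by blast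
  show "proj_algebraic 7 (surface (tau t))" by (rule proj_algebraic_surface)
  show "connectedin (mtop (proj_space 7)) (surface (tau t))" by (simp add: connectedin_surface)
  show "complex_submanifold (proj_space 7) (mdim (fibre family fst t)) (surface (tau t))"
    using complex_submanifold_surface[OF t] by (simp add: fibre_family)
  show "biholomorphic (fibre family fst t) (restrict_manifold (proj_space 7) (mdim (fibre family fst t)) (surface (tau t)))"
    using biholomorphic_fibre[OF t] by (simp add: fibre_family)
qed

lemma smooth_projective_family_family: "smooth_projective_family family fst"
  unfolding smooth_projective_family_def
  using complex_manifold_family holo_fun_family submersive_family proper_family smooth_projective_variety_fibre by simp

section \<open>Sections on surfaces\<close>

text \<open>The difference quotients \<open>q m\<close> in direction \<open>j\<close> are
  holomorphic in coordinate \<open>i\<close> and converge locally uniformly to the partial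
  derivative, which is then holomorphic in that coordinate by Weierstrass.\<close>

lemma holo_on_partialI:
  assumes V: "openC n V" and f: "holo_on n f V" and j: "j < n"
  shows "holo_on n (partial j f) V"
  unfolding holo_on_def
proof (intro conjI ballI allI impI)
  show cont: "continuous_on V (partial j f)" by (rule continuous_on_partial[OF V f j])
  fix z i assume z: "z \<in> V" and i: "i < n"
  obtain R where R: "R > 0" "polydisc n z R \<subseteq> V" using openC_contains_polydisc[OF V z] .
  have zC: "z \<in> Cn n" using z openC_subset[OF V] by blast
  \<comment> \<open>\<open>x\<close> is added to coordinate \<open>j\<close> after coordinate
    \<open>i\<close> has been set, which also covers \<open>i = j\<close>.\<close>
  define P where "P w x = z(i := w, j := (z(i := w)) j + x)" for w x
  have PV: "P w x \<in> V" if "dist w (z i) < R / 2" "norm x < R / 2" for w x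
  proof -
    have "z(i := w) \<in> polydisc n z (R / 2)" using that(1) R(1) zC i by (intro polydisc_fun_upd self_in_polydisc) auto
    from polydisc_shift[OF this j that(2)] have "P w x \<in> polydisc n z (R / 2 + R / 2)" by (simp only: P_def)
    then show ?thesis using R(2) by auto
  qed
  have der: "((\<lambda>x. f (P w x)) has_field_derivative partial j f (P w x)) (at x)"
    if "dist w (z i) < R / 2" "norm x < R / 2" for w x
  proof -
    have "((\<lambda>u. f ((P w x)(j := u))) has_field_derivative partial j f (P w x)) (at ((z(i := w)) j + x))"
      using holo_on_partial[OF f PV[OF that] j] by (simp add: P_def)
    from this[unfolded add.commute[of _ x], THEN DERIV_shift[THEN iffD1]]
    show ?thesis by (simp add: P_def add.commute)
  qed
  define r where "r = R / 4"
  have r: "r > 0" using R by (simp add: r_def)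
  define h where "h m = r / (2 * real (Suc m))" for m
  have h: "h m > 0" "h m < r" for m using r by (simp_all add: h_def field_simps add_pos_nonneg)
  have nh: "norm (of_real (h m) :: complex) = h m" for m using h(1)[of m] by simp
  define q where "q m w = (f (P w (of_real (h m))) - f (P w 0)) / of_real (h m)" for m w
  have P0: "P w 0 = z(i := w)" for w by (auto simp: P_def)
  have "(\<lambda>w. partial j f (P w 0)) holomorphic_on ball (z i) r"
  proof (rule holomorphic_uniform_sequence)
    fix m
    show "q m holomorphic_on ball (z i) r"
    proof (rule holomorphic_onI)
      fix w assume w: "w \<in> ball (z i) r"
      let ?x = "of_real (h m) :: complex"
      have x: "norm ?x < R / 2" using h(2)[of m] R(1) unfolding nh by (simp add: r_def)
      have w': "dist w (z i) < R / 2" using w R(1) by (simp add: r_def dist_commute)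
      have d: "(\<lambda>w. f (P w x)) field_differentiable at w" if x: "norm x < R / 2" for x
      proof (cases "i = j")
        case False
        have "((\<lambda>u. f ((P w x)(i := u))) has_field_derivative partial i f (P w x)) (at (P w x i))"
          by (rule holo_on_partial[OF f PV[OF w' x] i])
        moreover have "(P w x)(i := u) = P u x" for u using False by (auto simp: P_def fun_upd_twist)
        moreover have "P w x i = w" using False by (simp add: P_def)
        ultimately show ?thesis by (auto simp: field_differentiable_def)
      next
        case True
        have "((\<lambda>u. f ((P w x)(i := u))) has_field_derivative partial i f (P w x)) (at (w + x))"
          using holo_on_partial[OF f PV[OF w' x] i] True by (simp add: P_def)
        from this[unfolded DERIV_shift]
        have "((\<lambda>u. f ((P w x)(i := u + x))) has_field_derivative partial i f (P w x)) (at w)" .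
        moreover have "(P w x)(i := u + x) = P u x" for u using True by (auto simp: P_def)
        ultimately show ?thesis by (auto simp: field_differentiable_def)
      qed
      have "q m field_differentiable at w"
        unfolding q_def[abs_def] using d[OF x] d[of 0] R(1) h(1)[of m]
        by (intro field_differentiable_divide field_differentiable_diff field_differentiable_const) auto
      then show "q m field_differentiable at w within ball (z i) r" by (rule field_differentiable_at_within)
    qed
  next
    fix w0 assume w0: "w0 \<in> ball (z i) r"
    then obtain d where d: "d > 0" "cball w0 d \<subseteq> ball (z i) r" using open_contains_cball open_ball by blast
    have "uniform_limit (cball w0 d) q (\<lambda>w. partial j f (P w 0)) sequentially"
      unfolding uniform_limit_iff
    proof (intro allI impI)
      fix e :: real assume e: "e > 0"
      have c: "continuous_on (ball 0 r \<times> cball w0 d) (\<lambda>(x, w). partial j f (P w x))"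
      proof -
        have s: "continuous_on (ball 0 r \<times> cball w0 d) snd" and t: "continuous_on (ball 0 r \<times> cball w0 d) fst"
          by (intro continuous_intros)+
        have u: "continuous_on (ball 0 r \<times> cball w0 d) (\<lambda>y. z(i := snd y))"
          by (intro continuous_on_fun_upd continuous_on_const s)
        have "continuous_on (ball 0 r \<times> cball w0 d) (\<lambda>y. P (snd y) (fst y))"
          unfolding P_def by (intro continuous_on_fun_upd[OF u] continuous_on_add continuous_on_coord[OF u] t)
        moreover have "(\<lambda>y. P (snd y) (fst y)) ` (ball 0 r \<times> cball w0 d) \<subseteq> V"
        proof (rule image_subsetI)
          fix y assume "y \<in> ball (0::complex) r \<times> cball w0 d"
          then have 1: "norm (fst y) < r" and 2: "snd y \<in> cball w0 d" by auto
          have "snd y \<in> ball (z i) r" using d(2) 2 by blast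
          then show "P (snd y) (fst y) \<in> V" using 1 R(1) by (intro PV) (auto simp: r_def dist_commute)
        qed
        ultimately have "continuous_on (ball 0 r \<times> cball w0 d) (\<lambda>y. partial j f (P (snd y) (fst y)))"
          by (rule continuous_on_compose2[OF cont])
        then show ?thesis by (simp add: case_prod_beta)
      qed
      obtain X0 where X0: "0 \<in> X0" "open X0"
        "\<forall>x\<in>X0 \<inter> ball 0 r. \<forall>w\<in>cball w0 d. dist (partial j f (P w x)) (partial j f (P w 0)) \<le> e / 2"
        using continuous_on_prod_compactE[OF c compact_cball _ half_gt_zero[OF e], of 0] r
        unfolding prod.case by auto
      obtain \<delta> where \<delta>: "\<delta> > 0" "ball 0 \<delta> \<subseteq> X0" using X0(1,2) open_contains_ball by blast
      obtain N where N: "r / (2 * \<delta>) < real N" using reals_Archimedean2 by blast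
      have "dist (q m w) (partial j f (P w 0)) < e" if m: "m \<ge> N" and w: "w \<in> cball w0 d" for m w
      proof -
        let ?x = "of_real (h m) :: complex"
        have "r / (2 * \<delta>) < real (Suc m)" using N m by linarith
        then have hd: "h m < \<delta>" using \<delta>(1) by (simp add: h_def field_simps)
        let ?g = "\<lambda>x. f (P w x) - x * partial j f (P w 0)"
        have wz: "dist w (z i) < R / 2" using w d(2) R(1) by (force simp: r_def dist_commute)
        have "norm (?g ?x - ?g 0) \<le> e / 2 * norm (?x - 0)"
        proof (rule field_differentiable_bound[of "closed_segment 0 ?x"])
          fix u assume u: "u \<in> closed_segment 0 ?x"
          then obtain c where c: "0 \<le> c" "c \<le> 1" "u = c *\<^sub>R ?x" by (auto simp: in_segment)
          have "norm u = c * h m" using c(1) h(1)[of m] by (simp add: c(3) scaleR_conv_of_real norm_mult)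
          then have "norm u \<le> h m" using mult_right_mono[OF c(2), of "h m"] h(1)[of m] by simp
          then have "norm u < r" "norm u < \<delta>" and u2: "norm u < R / 2"
            using h(2)[of m] hd R(1) by (simp_all add: r_def)
          then have "u \<in> X0 \<inter> ball 0 r" using \<delta>(2) by auto
          then have uR: "dist (partial j f (P w u)) (partial j f (P w 0)) \<le> e / 2" using X0(3) w by blast
          show "(?g has_field_derivative partial j f (P w u) - 1 * partial j f (P w 0)) (at u within closed_segment 0 ?x)"
            by (rule has_field_derivative_at_within) (intro DERIV_diff der[OF wz u2] DERIV_cmult_right DERIV_ident)
          show "norm (partial j f (P w u) - 1 * partial j f (P w 0)) \<le> e / 2"
            using uR by (simp add: dist_norm)
        qed auto
        then have "norm (?g ?x - ?g 0) \<le> h m * (e / 2)" using nh[of m] by (simp add: mult.commute)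
        moreover have "?x * q m w = f (P w ?x) - f (P w 0)" using h(1)[of m] by (simp add: q_def)
        then have "?g ?x - ?g 0 = ?x * (q m w - partial j f (P w 0))" by (simp add: right_diff_distrib)
        ultimately have "h m * norm (q m w - partial j f (P w 0)) \<le> h m * (e / 2)"
          by (simp only: norm_mult nh)
        then have "norm (q m w - partial j f (P w 0)) \<le> e / 2" using h(1)[of m] by (simp only: mult_le_cancel_left_pos)
        then show ?thesis using e by (simp add: dist_norm)
      qed
      then show "\<forall>\<^sub>F m in sequentially. \<forall>w\<in>cball w0 d. dist (q m w) (partial j f (P w 0)) < e"
        unfolding eventually_sequentially by blast
    qed
    then show "\<exists>d>0. cball w0 d \<subseteq> ball (z i) r \<and> uniform_limit (cball w0 d) q (\<lambda>w. partial j f (P w 0)) sequentially"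
      using d by blast
  qed simp
  then show "(\<lambda>w. partial j f (z(i := w))) field_differentiable at (z i)"
    unfolding P0 using r by (auto intro: holomorphic_on_imp_differentiable_at)
qed

definition vec2 :: "complex \<Rightarrow> complex \<Rightarrow> nat \<Rightarrow> complex" where
  "vec2 a b i = (if i = 0 then a else if i = 1 then b else 0)"

lemma vec2_simps [simp]: "vec2 a b 0 = a" "vec2 a b (Suc 0) = b" "i \<ge> 2 \<Longrightarrow> vec2 a b i = 0"
  by (auto simp: vec2_def)

lemma vec2_Cn: "vec2 a b \<in> Cn 2"
  by (simp add: Cn_def)

text \<open>Pullback of \<open>\<phi> \<otimes> dw\<^sub>0 \<and> dw\<^sub>1\<close>, where \<open>\<phi>\<close> is linear, along a map with Jacobian \<open>J\<close>.\<close>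

definition pull2 :: "((nat \<Rightarrow> complex) \<Rightarrow> complex) \<Rightarrow> (nat \<Rightarrow> nat \<Rightarrow> complex) \<Rightarrow> (nat \<Rightarrow> complex) \<Rightarrow> complex" where
  "pull2 \<phi> J \<xi> = \<phi> (vec2 (J 0 0 * \<xi> 0 + J 0 1 * \<xi> 1) (J 1 0 * \<xi> 0 + J 1 1 * \<xi> 1)) * (J 0 0 * J 1 1 - J 0 1 * J 1 0)"

text \<open>The chain rule for the linear factor and multiplicativity of the determinant.\<close>

lemma pull2_pull2:
  assumes "\<And>i k. i < 2 \<Longrightarrow> k < 2 \<Longrightarrow> L i k = J i 0 * K 0 k + J i 1 * K 1 k"
  shows "pull2 (pull2 \<phi> J) K = pull2 \<phi> L"
proof
  fix \<xi> :: "nat \<Rightarrow> complex"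
  have "vec2 (J 0 0 * (K 0 0 * \<xi> 0 + K 0 1 * \<xi> 1) + J 0 1 * (K 1 0 * \<xi> 0 + K 1 1 * \<xi> 1))
      (J 1 0 * (K 0 0 * \<xi> 0 + K 0 1 * \<xi> 1) + J 1 1 * (K 1 0 * \<xi> 0 + K 1 1 * \<xi> 1)) =
    vec2 (L 0 0 * \<xi> 0 + L 0 1 * \<xi> 1) (L 1 0 * \<xi> 0 + L 1 1 * \<xi> 1)"
    using assms by (simp add: algebra_simps)
  then show "pull2 (pull2 \<phi> J) K \<xi> = pull2 \<phi> L \<xi>"
    using assms by (simp add: pull2_def algebra_simps)
qed

lemma det_mat_2: "Determinant.det (Matrix.mat 2 2 (\<lambda>(i, j). J i j)) = J 0 0 * J 1 1 - J 0 1 * J 1 (0::nat)"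
  for J :: "nat \<Rightarrow> nat \<Rightarrow> complex"
proof -
  let ?A = "Matrix.mat 2 2 (\<lambda>(i, j). J i j)"
  have "Determinant.det ?A = (\<Sum>j<2. ?A $$ (0, j) * cofactor ?A 0 j)"
    by (rule laplace_expansion_row[of _ 2]) auto
  also have "\<dots> = J 0 0 * cofactor ?A 0 0 + J 0 1 * cofactor ?A 0 1"
    by (simp add: lessThan_Suc numeral_2_eq_2)
  also have "cofactor ?A 0 0 = J 1 1" 
    by (simp add: cofactor_def mat_delete_def det_single)
  also have "cofactor ?A 0 1 = - J 1 0"
    by (simp add: cofactor_def mat_delete_def det_single)
  finally show ?thesis by simp
qed

definition idx :: "nat \<Rightarrow> nat \<Rightarrow> nat" where "idx k = (\<lambda>i. if i = k then 1 else 0)"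

lemma multi_indices_2_1: "multi_indices 2 1 = {idx 0, idx 1}" and idx_neq: "idx 0 \<noteq> idx 1"
proof -
  show "idx 0 \<noteq> idx 1" by (auto simp: idx_def fun_eq_iff)
  have "\<alpha> = idx 0 \<or> \<alpha> = idx 1" if "\<forall>i\<ge>2. \<alpha> i = 0" "\<alpha> 0 + \<alpha> 1 = 1" for \<alpha> :: "nat \<Rightarrow> nat"
  proof -
    have "\<alpha> i = (if i = 0 then \<alpha> 0 else if i = 1 then \<alpha> 1 else 0)" for i
      using that(1) by (cases "i = 0"; cases "i = 1") auto
    then have e: "\<alpha> = (\<lambda>i. if i = 0 then \<alpha> 0 else if i = 1 then \<alpha> 1 else 0)" by blast
    have "\<alpha> 0 = 1 \<and> \<alpha> 1 = 0 \<or> \<alpha> 0 = 0 \<and> \<alpha> 1 = 1" using that(2) by presburger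
    then show ?thesis by (elim disjE) (subst e; simp add: idx_def fun_eq_iff)+
  qed
  moreover have "\<alpha> \<in> multi_indices 2 1 \<longleftrightarrow> (\<forall>i\<ge>2. \<alpha> i = 0) \<and> \<alpha> 0 + \<alpha> 1 = 1" for \<alpha> :: "nat \<Rightarrow> nat"
    by (simp add: multi_indices_def numeral_2_eq_2)
  moreover have "idx 0 \<in> multi_indices 2 1" "idx 1 \<in> multi_indices 2 1"
    by (simp_all add: multi_indices_def idx_def numeral_2_eq_2)
  ultimately show "multi_indices 2 1 = {idx 0, idx 1}" by blast
qed

text \<open>The local condition on a section for \<open>m = 1\<close> in dimension 2;
  \<open>H0_iff\<close> is the translation.\<close>

definition holo_form :: "((nat \<Rightarrow> complex) \<Rightarrow> (nat \<Rightarrow> complex) \<Rightarrow> complex) \<Rightarrow> (nat \<Rightarrow> complex) set \<Rightarrow> bool" where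
  "holo_form f U \<longleftrightarrow> (\<exists>a b. holo_on 2 a U \<and> holo_on 2 b U \<and> (\<forall>z\<in>U. \<forall>\<xi>. f z \<xi> = a z * \<xi> 0 + b z * \<xi> 1))"

lemma H0_iff:
  assumes M: "mdim M = 2"
  shows "s \<in> H0_sym_cotangent_canonical M 1 \<longleftrightarrow>
    (\<forall>c z. \<not> (c \<in> atlas M \<and> z \<in> coord c ` chart_dom c) \<longrightarrow> s c z = (\<lambda>\<xi>. 0)) \<and>
    (\<forall>c\<in>atlas M. holo_form (s c) (coord c ` chart_dom c)) \<and>
    (\<forall>c\<in>atlas M. \<forall>d\<in>atlas M. \<forall>z\<in>coord c ` (chart_dom c \<inter> chart_dom d).
       s c z = pull2 (s d (transition c d z)) (jacobian c d z))"
proof -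
  have 1: "(\<lambda>i. if i < 2 then \<Sum>j<2. J i j * \<xi> j else 0) = vec2 (J 0 0 * \<xi> 0 + J 0 1 * \<xi> 1) (J 1 0 * \<xi> 0 + J 1 1 * \<xi> 1)"
    for J :: "nat \<Rightarrow> nat \<Rightarrow> complex" and \<xi>
    by (auto simp: fun_eq_iff vec2_def numeral_2_eq_2 less_Suc_eq)
  have mono: "monomial 2 (idx 0) \<xi> = \<xi> 0" "monomial 2 (idx 1) \<xi> = \<xi> 1" for \<xi>
    by (simp_all add: monomial_def idx_def numeral_2_eq_2)
  have 2: "(\<Sum>\<alpha>\<in>multi_indices 2 1. a \<alpha> * monomial 2 \<alpha> \<xi>) = a (idx 0) * \<xi> 0 + a (idx 1) * \<xi> 1" for a \<xi>
    unfolding multi_indices_2_1 using idx_neq by (simp add: mono del: One_nat_def)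
  have 3: "(\<exists>a. (\<forall>\<alpha>\<in>multi_indices 2 1. holo_on 2 (a \<alpha>) U) \<and>
        (\<forall>z\<in>U. \<forall>\<xi>. f z \<xi> = (\<Sum>\<alpha>\<in>multi_indices 2 1. a \<alpha> z * monomial 2 \<alpha> \<xi>))) \<longleftrightarrow> holo_form f U" (is "?L \<longleftrightarrow> ?R") for f U
  proof
    assume ?L
    then obtain a where a: "\<forall>\<alpha>\<in>multi_indices 2 1. holo_on 2 (a \<alpha>) U" "\<forall>z\<in>U. \<forall>\<xi>. f z \<xi> = a (idx 0) z * \<xi> 0 + a (idx 1) z * \<xi> 1"
      unfolding 2 by blast
    then show ?R unfolding multi_indices_2_1 holo_form_def by blast
  next
    assume ?R
    then obtain a b where "holo_on 2 a U" "holo_on 2 b U" "\<forall>z\<in>U. \<forall>\<xi>. f z \<xi> = a z * \<xi> 0 + b z * \<xi> 1" unfolding holo_form_def by blast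
    then show ?L unfolding 2 multi_indices_2_1
      using idx_neq by (intro exI[of _ "\<lambda>\<alpha>. if \<alpha> = idx 0 then a else b"]) (simp add: mono del: One_nat_def)
  qed
  show ?thesis
    unfolding H0_sym_cotangent_canonical_def M mem_Collect_eq 3 1 det_mat_2 by (simp only: pull2_def fun_eq_iff)
qed

lemma jacobian_refl:
  assumes c: "is_chart n X c" and z: "z \<in> coord c ` chart_dom c" and k: "k < n"
  shows "jacobian c c z i k = (if i = k then 1 else 0)"
proof -
  have "partial k (\<lambda>w. transition c c w i) z = partial k (\<lambda>w. w i) z"
    by (rule partial_cong[OF is_chart_image[OF c] z k]) (simp add: transition_def coord_param)
  also have "\<dots> = (if i = k then 1 else 0)"
    unfolding partial_def by (rule DERIV_imp_deriv) (auto intro!: derivative_eq_intros)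
  finally show ?thesis by (simp add: jacobian_def)
qed

lemma jacobian_cocycle:
  assumes M: "complex_manifold M" "c \<in> atlas M" "d \<in> atlas M" "e \<in> atlas M"
    and x: "x \<in> chart_dom c" "x \<in> chart_dom d" "x \<in> chart_dom e" and i: "i < mdim M" "k < mdim M"
  shows "jacobian c e (coord c x) i k = (\<Sum>j<mdim M. jacobian d e (coord d x) i j * jacobian c d (coord c x) j k)"
proof -
  let ?n = "mdim M"
  note C = complex_manifoldD(1)[OF M(1)]
  let ?U = "coord c ` (chart_dom c \<inter> (chart_dom d \<inter> chart_dom e))" and ?V = "coord d ` (chart_dom d \<inter> chart_dom e)"
  have U: "openC ?n ?U"
    using is_chart_open_image[OF C[OF M(2)] openin_Int[OF is_chart_openin[OF C[OF M(3)]] is_chart_openin[OF C[OF M(4)]]]] .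
  have V: "openC ?n ?V" by (rule is_chart_open_image[OF C[OF M(3)] is_chart_openin[OF C[OF M(4)]]])
  have f: "holo_on ?n (\<lambda>w. transition d e w i) ?V"
    using complex_manifoldD(3)[OF M(1) M(3,4)] i(1) unfolding compatible_def by blast
  have g: "holo_on ?n (\<lambda>w. transition c d w j) ?U" if j: "j < ?n" for j
  proof -
    have "holo_on ?n (\<lambda>w. transition c d w j) (coord c ` (chart_dom c \<inter> chart_dom d))"
      using complex_manifoldD(3)[OF M(1) M(2,3)] j unfolding compatible_def by blast
    then show ?thesis by (rule holo_on_subset) blast
  qed
  have tr: "transition c d (coord c y) = coord d y" if "y \<in> chart_dom c" for y and d :: "'a chart"
    using param_coord[OF C[OF M(2)] that] by (simp add: transition_def)
  have tr': "transition d e (coord d y) = coord e y" if "y \<in> chart_dom d" for y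
    using param_coord[OF C[OF M(3)] that] by (simp add: transition_def)
  have gV: "transition c d ` ?U \<subseteq> ?V"
  proof (rule image_subsetI)
    fix w assume "w \<in> ?U"
    then obtain y where y: "y \<in> chart_dom c" "y \<in> chart_dom d" "y \<in> chart_dom e" "w = coord c y" by blast
    then show "transition c d w \<in> ?V" using tr[OF y(1), of d] by auto
  qed
  have z: "coord c x \<in> ?U" using x by blast
  have "jacobian c e (coord c x) i k = partial k (\<lambda>w. transition d e (transition c d w) i) (coord c x)"
    unfolding jacobian_def
  proof (rule partial_cong[OF U z i(2)])
    fix w assume "w \<in> ?U"
    then obtain y where y: "y \<in> chart_dom c" "y \<in> chart_dom d" "y \<in> chart_dom e" "w = coord c y" by blast
    then show "transition c e w i = transition d e (transition c d w) i" using tr[OF y(1)] tr'[OF y(2)] by simp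
  qed
  also have "\<dots> = (\<Sum>j<?n. partial j (\<lambda>w. transition d e w i) (transition c d (coord c x)) * partial k (\<lambda>w. transition c d w j) (coord c x))"
    by (rule partial_compose[OF U V f g gV z i(2)])
  also have "\<dots> = (\<Sum>j<?n. jacobian d e (coord d x) i j * jacobian c d (coord c x) j k)"
    unfolding jacobian_def tr[OF x(1)] ..
  finally show ?thesis .
qed

lemma is_chart_vimage:
  assumes c: "is_chart n X c" and N: "openC n N"
  shows "openin X {x \<in> chart_dom c. coord c x \<in> N}"
proof -
  have hm: "homeomorphic_map (subtopology X (chart_dom c)) (top_of_set (coord c ` chart_dom c)) (coord c)"
    using c by (simp add: is_chart_def)
  have "openin (top_of_set (coord c ` chart_dom c)) (coord c ` chart_dom c \<inter> N)"
    using N openC_subset[OF is_chart_image[OF c]] by (auto simp: openin_open)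
  from openin_continuous_map_preimage[OF homeomorphic_imp_continuous_map[OF hm] this]
  have "openin (subtopology X (chart_dom c)) {x \<in> topspace (subtopology X (chart_dom c)). coord c x \<in> coord c ` chart_dom c \<inter> N}" .
  moreover have "{x \<in> topspace (subtopology X (chart_dom c)). coord c x \<in> coord c ` chart_dom c \<inter> N} = {x \<in> chart_dom c. coord c x \<in> N}"
    using is_chart_subset[OF c] by auto
  ultimately show ?thesis using openin_trans_full[OF _ is_chart_openin[OF c]] by simp
qed

lemma holo_form_subset: "holo_form f U \<Longrightarrow> V \<subseteq> U \<Longrightarrow> holo_form f V"
  unfolding holo_form_def using holo_on_subset by (meson subsetD)

lemma holo_form_at: "holo_form f U \<Longrightarrow> holo_on 2 (\<lambda>z. f z \<xi>) U" if "openC 2 U"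
proof -
  assume "holo_form f U"
  then obtain a b where ab: "holo_on 2 a U" "holo_on 2 b U" "\<forall>z\<in>U. \<forall>\<xi>. f z \<xi> = a z * \<xi> 0 + b z * \<xi> 1"
    unfolding holo_form_def by blast
  have "holo_on 2 (\<lambda>z. a z * \<xi> 0 + b z * \<xi> 1) U" by (intro holo_on_add holo_on_mult ab holo_on_const)
  then show ?thesis by (rule holo_on_cong[OF that]) (use ab(3) in simp)
qed

lemma holo_form_pull2:
  assumes U: "openC 2 U" and V: "openC 2 V" and f: "holo_form f V"
    and g: "\<And>i. i < 2 \<Longrightarrow> holo_on 2 (\<lambda>z. g z i) U" "g ` U \<subseteq> V"
  shows "holo_form (\<lambda>z. pull2 (f (g z)) (\<lambda>i j. partial j (\<lambda>w. g w i) z)) U"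
proof -
  obtain a b where ab: "holo_on 2 a V" "holo_on 2 b V" "\<And>z \<xi>. z \<in> V \<Longrightarrow> f z \<xi> = a z * \<xi> 0 + b z * \<xi> 1"
    using f unfolding holo_form_def by blast
  let ?J = "\<lambda>z i j. partial j (\<lambda>w. g w i) z"
  let ?det = "\<lambda>z. ?J z 0 0 * ?J z 1 1 - ?J z 0 1 * ?J z 1 0"
  have J: "holo_on 2 (\<lambda>z. ?J z i j) U" if "i < 2" "j < 2" for i j
    by (rule holo_on_partialI[OF U g(1)[OF that(1)] that(2)])
  have D: "holo_on 2 ?det U" by (intro holo_on_diff holo_on_mult J) simp_all
  have A: "holo_on 2 (\<lambda>z. a (g z)) U" and B: "holo_on 2 (\<lambda>z. b (g z)) U"
    using holo_on_compose[OF U V _ g] ab by blast+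
  have H: "holo_on 2 (\<lambda>z. (a (g z) * ?J z 0 k + b (g z) * ?J z 1 k) * ?det z) U" if "k < 2" for k
    by (intro holo_on_mult holo_on_add A B D J that) simp_all
  have "pull2 (f (g z)) (?J z) \<xi> = (a (g z) * ?J z 0 0 + b (g z) * ?J z 1 0) * ?det z * \<xi> 0 + (a (g z) * ?J z 0 1 + b (g z) * ?J z 1 1) * ?det z * \<xi> 1"
    if "z \<in> U" for z \<xi>
  proof -
    have "g z \<in> V" using g(2) that by blast
    then show ?thesis unfolding pull2_def by (simp add: ab(3) algebra_simps)
  qed
  then show ?thesis unfolding holo_form_def using H[of 0] H[of 1] by fastforce
qed

locale complex_surface =
  fixes M :: "'a manifold"
  assumes M: "complex_manifold M" and dim: "mdim M = 2"
begin

lemma chart: "c \<in> atlas M \<Longrightarrow> is_chart 2 (mtop M) c"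
  using complex_manifoldD(1)[OF M] dim by simp

lemma overlap_open: "c \<in> atlas M \<Longrightarrow> d \<in> atlas M \<Longrightarrow> openC 2 (coord c ` (chart_dom c \<inter> chart_dom d))"
  by (rule is_chart_open_image[OF chart is_chart_openin[OF chart]])

lemma transition_holo:
  "c \<in> atlas M \<Longrightarrow> d \<in> atlas M \<Longrightarrow> i < 2 \<Longrightarrow> holo_on 2 (\<lambda>z. transition c d z i) (coord c ` (chart_dom c \<inter> chart_dom d))"
  using complex_manifoldD(3)[OF M, of c d] unfolding compatible_def dim by blast

lemma transition_coord: "c \<in> atlas M \<Longrightarrow> x \<in> chart_dom c \<Longrightarrow> transition c d (coord c x) = coord d x"
  by (simp add: transition_def param_coord[OF chart])

lemma pull2_refl:
  assumes "c \<in> atlas M" "x \<in> chart_dom c" "holo_form f (coord c ` chart_dom c)"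
  shows "pull2 (f (coord c x)) (jacobian c c (coord c x)) = f (coord c x)"
proof -
  obtain a b where ab: "\<And>\<xi>. f (coord c x) \<xi> = a * \<xi> 0 + b * \<xi> 1"
    using assms(2,3) unfolding holo_form_def by blast
  have J: "jacobian c c (coord c x) i k = (if i = k then 1 else 0)" if "k < 2" for i k
    by (rule jacobian_refl[OF chart[OF assms(1)] imageI[OF assms(2)] that])
  show ?thesis by (simp add: pull2_def J ab fun_eq_iff)
qed

lemma pull2_cocycle:
  assumes "c \<in> atlas M" "d \<in> atlas M" "e \<in> atlas M" "x \<in> chart_dom c" "x \<in> chart_dom d" "x \<in> chart_dom e"
  shows "pull2 (pull2 \<phi> (jacobian d e (coord d x))) (jacobian c d (coord c x)) = pull2 \<phi> (jacobian c e (coord c x))"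
  by (rule pull2_pull2) (simp add: jacobian_cocycle[OF M assms] dim numeral_2_eq_2)

lemma pull2_holo_form:
  assumes "c \<in> atlas M" "d \<in> atlas M" "holo_form f (coord d ` chart_dom d)"
  shows "holo_form (\<lambda>z. pull2 (f (transition c d z)) (jacobian c d z)) (coord c ` (chart_dom c \<inter> chart_dom d))"
proof -
  have "transition c d ` coord c ` (chart_dom c \<inter> chart_dom d) \<subseteq> coord d ` chart_dom d"
    using transition_image[OF chart[OF assms(1)], of "chart_dom c \<inter> chart_dom d" d] by auto
  from holo_form_pull2[OF overlap_open[OF assms(1,2)] is_chart_image[OF chart[OF assms(2)]] assms(3) transition_holo[OF assms(1,2)] this]
  show ?thesis by (simp add: jacobian_def[abs_def])
qed

text \<open>The set where the two forms differ is open, so if nonempty it would contain a point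
  satisfying \<open>Q\<close>.\<close>

lemma dense_eq:
  assumes c: "c \<in> atlas M" and V: "openC 2 V" "V \<subseteq> coord c ` chart_dom c"
    and f: "holo_form f V" "holo_form g V"
    and dense: "\<And>W. openin (mtop M) W \<Longrightarrow> W \<noteq> {} \<Longrightarrow> \<exists>x\<in>W. Q x"
    and Q: "\<And>x. x \<in> chart_dom c \<Longrightarrow> Q x \<Longrightarrow> coord c x \<in> V \<Longrightarrow> f (coord c x) = g (coord c x)"
    and z: "z \<in> V"
  shows "f z = g z"
proof (rule ccontr)
  assume "f z \<noteq> g z"
  then obtain \<xi> where \<xi>: "f z \<xi> \<noteq> g z \<xi>" by (auto simp: fun_eq_iff)
  let ?N = "V \<inter> (\<lambda>z. f z \<xi> - g z \<xi>) -` (- {0})"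
  have "continuous_on V (\<lambda>z. f z \<xi> - g z \<xi>)"
    by (intro continuous_on_diff holo_on_imp_continuous_on[OF holo_form_at[OF V(1)]] f)
  then have "openin (top_of_set V) ?N" by (rule continuous_openin_preimage_gen) auto
  then have N: "openC 2 ?N" using V(1) openin_trans by blast
  have "param c z \<in> {x \<in> chart_dom c. coord c x \<in> ?N}"
    using param_in[OF subsetD[OF V(2) z]] coord_param[OF subsetD[OF V(2) z]] z \<xi> by auto
  then obtain x where "x \<in> chart_dom c" "coord c x \<in> ?N" "Q x"
    using dense[OF is_chart_vimage[OF chart[OF c] N]] by blast
  then show False using Q[of x] by simp
qed

text \<open>Vanishing at a point in one chart passes to all charts by the transition rule, so
  \<open>dense_eq\<close> applies in each of them.\<close>

lemma H0_eq_zeroI: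
  assumes s: "s \<in> H0_sym_cotangent_canonical M 1"
    and dense: "\<And>W. openin (mtop M) W \<Longrightarrow> W \<noteq> {} \<Longrightarrow>
      \<exists>x\<in>W. \<exists>d\<in>atlas M. x \<in> chart_dom d \<and> s d (coord d x) = (\<lambda>\<xi>. 0)"
  shows "s = (\<lambda>c z \<xi>. 0)"
proof (intro ext)
  note s' = s[unfolded H0_iff[OF dim]]
  fix c z \<xi>
  show "s c z \<xi> = 0"
  proof (cases "c \<in> atlas M \<and> z \<in> coord c ` chart_dom c")
    case True
    then have c: "c \<in> atlas M" and z: "z \<in> coord c ` chart_dom c" by auto
    have "s c z = (\<lambda>z \<xi>. 0) z"
    proof (rule dense_eq[OF c is_chart_image[OF chart[OF c]] subset_refl _ _ dense _ z])
      show "holo_form (s c) (coord c ` chart_dom c)" using s' c by blast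
      show "holo_form (\<lambda>z \<xi>. 0) (coord c ` chart_dom c)"
        unfolding holo_form_def by (intro exI[of _ "\<lambda>z. 0"]) simp
      fix x assume x: "x \<in> chart_dom c" and "\<exists>d\<in>atlas M. x \<in> chart_dom d \<and> s d (coord d x) = (\<lambda>\<xi>. 0)"
      then obtain d where d: "d \<in> atlas M" "x \<in> chart_dom d" "s d (coord d x) = (\<lambda>\<xi>. 0)" by blast
      have "s c (coord c x) = pull2 (s d (transition c d (coord c x))) (jacobian c d (coord c x))"
        using s' c d(1,2) x by blast
      then show "s c (coord c x) = (\<lambda>\<xi>. 0)"
        unfolding transition_coord[OF c x] d(3) by (simp add: pull2_def fun_eq_iff)
    qed
    then show ?thesis by simp
  next
    case False
    then have "s c z = (\<lambda>\<xi>. 0)" using s' by blast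
    then show ?thesis by simp
  qed
qed

text \<open>Compatible forms on a covering family of charts are pulled back to every chart of the
  atlas; \<open>pull2_cocycle\<close> makes the result independent of the index \<open>k x\<close>
  chosen at each point.\<close>

lemma H0_glue:
  assumes ch: "\<And>i. i \<in> I \<Longrightarrow> ch i \<in> atlas M"
    and cover: "\<And>x. x \<in> topspace (mtop M) \<Longrightarrow> \<exists>i\<in>I. x \<in> chart_dom (ch i)"
    and \<sigma>: "\<And>i. i \<in> I \<Longrightarrow> holo_form (\<sigma> i) (coord (ch i) ` chart_dom (ch i))"
    and compat: "\<And>i j x. i \<in> I \<Longrightarrow> j \<in> I \<Longrightarrow> x \<in> chart_dom (ch i) \<Longrightarrow> x \<in> chart_dom (ch j) \<Longrightarrow>
      \<sigma> i (coord (ch i) x) = pull2 (\<sigma> j (coord (ch j) x)) (jacobian (ch i) (ch j) (coord (ch i) x))"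
  obtains s where "s \<in> H0_sym_cotangent_canonical M 1"
    "\<And>i x. i \<in> I \<Longrightarrow> x \<in> chart_dom (ch i) \<Longrightarrow> s (ch i) (coord (ch i) x) = \<sigma> i (coord (ch i) x)"
proof -
  define k where "k x = (SOME i. i \<in> I \<and> x \<in> chart_dom (ch i))" for x
  define s where "s c z = (if c \<in> atlas M \<and> z \<in> coord c ` chart_dom c
    then let i = k (param c z) in pull2 (\<sigma> i (transition c (ch i) z)) (jacobian c (ch i) z) else (\<lambda>\<xi>. 0))" for c z
  have k: "k x \<in> I" "x \<in> chart_dom (ch (k x))" if "c \<in> atlas M" "x \<in> chart_dom c" for c x
  proof -
    have "x \<in> topspace (mtop M)" using complex_manifoldD(2)[OF M] that by blast
    then have "\<exists>i. i \<in> I \<and> x \<in> chart_dom (ch i)" using cover by blast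
    from someI_ex[OF this] show "k x \<in> I" "x \<in> chart_dom (ch (k x))" unfolding k_def by blast+
  qed
  have s: "s c (coord c x) = pull2 (\<sigma> i (coord (ch i) x)) (jacobian c (ch i) (coord c x))"
    if c: "c \<in> atlas M" and x: "x \<in> chart_dom c" and i: "i \<in> I" "x \<in> chart_dom (ch i)" for c x i
  proof -
    let ?j = "k x"
    note j = k[OF c x]
    have "s c (coord c x) = pull2 (\<sigma> ?j (coord (ch ?j) x)) (jacobian c (ch ?j) (coord c x))"
      using c x by (simp add: s_def Let_def param_coord[OF chart[OF c]] transition_coord)
    also have "\<dots> = pull2 (pull2 (\<sigma> i (coord (ch i) x)) (jacobian (ch ?j) (ch i) (coord (ch ?j) x))) (jacobian c (ch ?j) (coord c x))"
      by (subst compat[OF j(1) i(1) j(2) i(2)]) (rule refl)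
    also have "\<dots> = pull2 (\<sigma> i (coord (ch i) x)) (jacobian c (ch i) (coord c x))"
      by (rule pull2_cocycle[OF c ch[OF j(1)] ch[OF i(1)] x j(2) i(2)])
    finally show ?thesis .
  qed
  have "s \<in> H0_sym_cotangent_canonical M 1"
    unfolding H0_iff[OF dim]
  proof (intro conjI allI impI ballI)
    show "s c z = (\<lambda>\<xi>. 0)" if "\<not> (c \<in> atlas M \<and> z \<in> coord c ` chart_dom c)" for c z
      using that unfolding s_def by (rule if_not_P)
  next
    fix c d z assume c: "c \<in> atlas M" and d: "d \<in> atlas M" and "z \<in> coord c ` (chart_dom c \<inter> chart_dom d)"
    then obtain x where x: "x \<in> chart_dom c" "x \<in> chart_dom d" "z = coord c x" by blast
    note i = k[OF c x(1)]
    show "s c z = pull2 (s d (transition c d z)) (jacobian c d z)"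
      unfolding x(3) transition_coord[OF c x(1)] s[OF c x(1) i] s[OF d x(2) i]
      by (rule pull2_cocycle[symmetric, OF c d ch[OF i(1)] x(1,2) i(2)])
  next
    fix c assume c: "c \<in> atlas M"
    have loc: "\<exists>V. openC 2 V \<and> z \<in> V \<and> V \<subseteq> coord c ` chart_dom c \<and> holo_form (s c) V" if z: "z \<in> coord c ` chart_dom c" for z
    proof -
      obtain x where x: "x \<in> chart_dom c" "z = coord c x" using z by blast
      note i = k[OF c x(1)]
      let ?i = "k x"
      let ?V = "coord c ` (chart_dom c \<inter> chart_dom (ch ?i))"
      have "holo_form (\<lambda>z. pull2 (\<sigma> ?i (transition c (ch ?i) z)) (jacobian c (ch ?i) z)) ?V"
        by (rule pull2_holo_form[OF c ch[OF i(1)] \<sigma>[OF i(1)]])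
      moreover have "s c w = pull2 (\<sigma> ?i (transition c (ch ?i) w)) (jacobian c (ch ?i) w)" if w: "w \<in> ?V" for w
      proof -
        obtain y where y: "y \<in> chart_dom c" "y \<in> chart_dom (ch ?i)" "w = coord c y" using w by blast
        show ?thesis unfolding y(3) transition_coord[OF c y(1)] by (rule s[OF c y(1) i(1) y(2)])
      qed
      ultimately have "holo_form (s c) ?V" unfolding holo_form_def by simp
      then show ?thesis using overlap_open[OF c ch[OF i(1)]] x i(2) by blast
    qed
    let ?U = "coord c ` chart_dom c"
    have U: "openC 2 ?U" by (rule is_chart_image[OF chart[OF c]])
    have e: "holo_on 2 (\<lambda>z. s c z \<xi>) ?U" for \<xi>
      using openC_subset[OF U]
    proof (rule holo_on_openI)
      fix z assume "z \<in> ?U"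
      with loc obtain V where "openC 2 V" "z \<in> V" "holo_form (s c) V" by blast
      then show "\<exists>V. openC 2 V \<and> z \<in> V \<and> holo_on 2 (\<lambda>z. s c z \<xi>) V" using holo_form_at by blast
    qed
    have "s c z \<xi> = s c z (vec2 1 0) * \<xi> 0 + s c z (vec2 0 1) * \<xi> 1" if z: "z \<in> ?U" for z \<xi>
    proof -
      obtain V where "z \<in> V" "holo_form (s c) V" using loc[OF z] by blast
      then obtain a b where "\<And>\<xi>. s c z \<xi> = a * \<xi> 0 + b * \<xi> 1" unfolding holo_form_def by blast
      then show ?thesis by simp
    qed
    then show "holo_form (s c) ?U" unfolding holo_form_def using e[of "vec2 1 0"] e[of "vec2 0 1"]
      by (intro exI[of _ "\<lambda>z. s c z (vec2 1 0)"] exI[of _ "\<lambda>z. s c z (vec2 0 1)"] conjI ballI allI) assumption+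
  qed
  moreover have "s (ch i) (coord (ch i) x) = \<sigma> i (coord (ch i) x)" if "i \<in> I" "x \<in> chart_dom (ch i)" for i x
    unfolding s[OF ch[OF that(1)] that(2) that] by (rule pull2_refl[OF ch[OF that(1)] that(2) \<sigma>[OF that(1)]])
  ultimately show ?thesis by (rule that)
qed

end

section \<open>Charts of a fibre and their Jacobians\<close>

definition pt :: "bool \<Rightarrow> bool \<Rightarrow> complex \<Rightarrow> complex \<Rightarrow> complex \<Rightarrow> complex \<Rightarrow> point" where
  "pt \<mu> \<nu> t z v y = (t, proj_point (piece \<mu> \<nu> (tau t) z v y))"

definition good :: "bool \<Rightarrow> bool \<Rightarrow> nat \<Rightarrow> complex \<Rightarrow> point set \<Rightarrow> bool" where
  "good \<mu> \<nu> c t U \<longleftrightarrow> (\<exists>D \<psi>. ratio_chart (base \<mu> \<nu>) (idx1 \<mu> \<nu> c) (idx2 \<mu> \<nu> c) t U D \<psi>)"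

definition gch :: "bool \<Rightarrow> bool \<Rightarrow> nat \<Rightarrow> complex \<Rightarrow> point set \<Rightarrow> point chart" where
  "gch \<mu> \<nu> c t U = (U \<inter> fib t, fam_coord (base \<mu> \<nu>) (idx1 \<mu> \<nu> c) (idx2 \<mu> \<nu> c) t)"

definition pcoord :: "nat \<Rightarrow> complex \<Rightarrow> complex \<Rightarrow> complex \<Rightarrow> nat \<Rightarrow> complex" where
  "pcoord c z v y = vec2 (if c = 2 then v else z) (if c = 0 then v else y)"

lemma coord_gch_pt: "c < 3 \<Longrightarrow> coord (gch \<mu> \<nu> c t U) (pt \<mu> \<nu> t z v y) = pcoord c z v y"
  by (auto simp: gch_def pt_def fam_coord_def hom_coord_piece idx1_def idx2_def piece_simps pcoord_def vec2_def fun_eq_iff)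

lemma pt_param: "pt \<mu> \<nu> t z v y = pt \<mu> \<nu> t z' v' y' \<longleftrightarrow> z = z' \<and> v = v' \<and> y = y'"
proof
  assume "pt \<mu> \<nu> t z v y = pt \<mu> \<nu> t z' v' y'"
  then have "hom_coord (base \<mu> \<nu>) (proj_point (piece \<mu> \<nu> (tau t) z v y)) = hom_coord (base \<mu> \<nu>) (proj_point (piece \<mu> \<nu> (tau t) z' v' y'))"
    by (simp add: pt_def)
  then show "z = z' \<and> v = v' \<and> y = y'" unfolding hom_coord_piece by (metis piece_simps(2-4))
qed simp

locale fibre_surface =
  fixes t :: complex
  assumes t: "t \<in> ball 0 1"
begin

abbreviation X where "X \<equiv> fibre family fst t"
abbreviation \<tau> where "\<tau> \<equiv> tau t"

sublocale complex_surface X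
  by unfold_locales (simp_all add: complex_manifold_fibre, simp add: fibre_family)

lemma mtop_X: "mtop X = subtopology family_top (fib t)"
  by (simp add: fibre_family)

lemma topspace_X [simp]: "topspace (mtop X) = fib t"
  by (auto simp: mtop_X fib_def)

lemma openin_X:
  assumes "openin (mtop X) W"
  obtains Ob where "openin ambient Ob" "W = Ob \<inter> fib t"
proof -
  obtain Ob where "openin ambient Ob" "W = (Ob \<inter> family_points) \<inter> fib t"
    using assms by (auto simp: mtop_X family_top_def openin_subtopology)
  then show ?thesis using that by (auto simp: fib_def)
qed

lemma pt_in_fib: "y ^ 4 = pbranch \<nu> \<tau> z v \<Longrightarrow> pt \<mu> \<nu> t z v y \<in> fib t"
  using piece_surface t by (simp add: pt_def in_fib)

lemma gch_atlas: "good \<mu> \<nu> c t U \<Longrightarrow> gch \<mu> \<nu> c t U \<in> atlas X"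
  unfolding good_def gch_def using fib_atlasI by blast

lemma chart_dom_gch [simp]: "chart_dom (gch \<mu> \<nu> c t U) = U \<inter> fib t"
  by (simp add: gch_def)

lemma good_exists:
  assumes "y ^ 4 = pbranch \<nu> \<tau> z v" "c < 3" "solvable c \<nu> \<tau> z v y" and W: "openin (mtop X) W" "pt \<mu> \<nu> t z v y \<in> W"
  obtains U where "good \<mu> \<nu> c t U" "pt \<mu> \<nu> t z v y \<in> U" "U \<inter> fib t \<subseteq> W"
proof -
  obtain W' where W': "openin family_top W'" "W = W' \<inter> fib t" using W(1) by (auto simp: mtop_X openin_subtopology)
  have x: "(t, proj_point (piece \<mu> \<nu> \<tau> z v y)) \<in> W'" using W(2) W'(2) by (simp add: pt_def)
  have s: "solvable c \<nu> \<tau> (hom_coord (base \<mu> \<nu>) (proj_point (piece \<mu> \<nu> \<tau> z v y)) (iz \<mu> \<nu>))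
    (hom_coord (base \<mu> \<nu>) (proj_point (piece \<mu> \<nu> \<tau> z v y)) (iv \<mu> \<nu>)) (hom_coord (base \<mu> \<nu>) (proj_point (piece \<mu> \<nu> \<tau> z v y)) (iy \<mu>))"
    unfolding hom_coord_piece piece_simps by (rule assms(3))
  obtain U D \<psi> where "ratio_chart (base \<mu> \<nu>) (idx1 \<mu> \<nu> c) (idx2 \<mu> \<nu> c) t U D \<psi>" "pt \<mu> \<nu> t z v y \<in> U" "U \<subseteq> W'"
    unfolding pt_def by (rule ratio_chart_exists[OF assms(2) W'(1) x piece_aff s])
  then show ?thesis using that[of U] W'(2) unfolding good_def by blast
qed

lemma good_at:
  assumes "y ^ 4 = pbranch \<nu> \<tau> z v" "c < 3" "solvable c \<nu> \<tau> z v y"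
  obtains U where "good \<mu> \<nu> c t U" "pt \<mu> \<nu> t z v y \<in> U"
proof -
  have 1: "pt \<mu> \<nu> t z v y \<in> topspace (mtop X)" using pt_in_fib[OF assms(1)] by simp
  obtain U where "good \<mu> \<nu> c t U" "pt \<mu> \<nu> t z v y \<in> U"
    by (rule good_exists[OF assms openin_topspace 1])
  then show ?thesis by (rule that)
qed

lemma good_at_0:
  assumes "y ^ 4 = pbranch \<nu> \<tau> z v" "y \<noteq> 0"
  obtains U where "good \<mu> \<nu> 0 t U" "pt \<mu> \<nu> t z v y \<in> U"
  by (rule good_at[OF assms(1), of 0]) (use assms(2) in \<open>auto simp: solvable_def\<close>)

lemma good_pt:
  assumes g: "good \<mu> \<nu> c t U" and x: "x \<in> U" "x \<in> fib t"
  obtains z v y where "x = pt \<mu> \<nu> t z v y" "y ^ 4 = pbranch \<nu> \<tau> z v"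
proof -
  obtain L where L: "x = (t, L)" "L \<in> surface \<tau>" using x(2) t in_fib[OF t] by (cases x) auto
  obtain D \<psi> where "ratio_chart (base \<mu> \<nu>) (idx1 \<mu> \<nu> c) (idx2 \<mu> \<nu> c) t U D \<psi>" using g unfolding good_def by blast
  then have "\<forall>x\<in>U. snd x \<in> aff_dom 7 (base \<mu> \<nu>)" unfolding ratio_chart_def by blast
  then have La: "L \<in> aff_dom 7 (base \<mu> \<nu>)" using x(1) L(1) by force
  note sp = surface_piece[OF La L(2)]
  show ?thesis
    using that[OF _ sp(2)] sp(1) hom_coord_aff(3)[OF La] L(1) unfolding pt_def by metis
qed

lemma good_aff: "good \<mu> \<nu> c t U \<Longrightarrow> x \<in> U \<Longrightarrow> snd x \<in> aff_dom 7 (base \<mu> \<nu>)"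
  unfolding good_def ratio_chart_def by blast

text \<open>In a chart of kind \<open>c\<close> two of \<open>z\<close>, \<open>v\<close>, \<open>y\<close> are coordinates and the third one is a function of them.\<close>

lemma good_root:
  assumes g: "good \<mu> \<nu> c t U" and c: "c < 3"
  obtains Y where "holo_on 2 Y (coord (gch \<mu> \<nu> c t U) ` (U \<inter> fib t))"
    "\<And>w. w \<in> coord (gch \<mu> \<nu> c t U) ` (U \<inter> fib t) \<Longrightarrow>
       param (gch \<mu> \<nu> c t U) w = pt \<mu> \<nu> t (sel_z c w (Y w)) (sel_v c w (Y w)) (sel_y c w (Y w)) \<and>
       sel_y c w (Y w) ^ 4 = pbranch \<nu> \<tau> (sel_z c w (Y w)) (sel_v c w (Y w))"
proof -
  let ?c = "gch \<mu> \<nu> c t U"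
  obtain D \<psi> where r: "ratio_chart (base \<mu> \<nu>) (idx1 \<mu> \<nu> c) (idx2 \<mu> \<nu> c) t U D \<psi>" using g unfolding good_def by blast
  note cc = ratio_chart_is_chart[OF r]
  define Y where "Y w = \<psi> w (idx3 \<mu> \<nu> c)" for w
  have sub: "coord ?c ` (U \<inter> fib t) \<subseteq> D" using cc(2) by (auto simp: gch_def)
  have "holo_on 3 Y D" using r unfolding ratio_chart_def Y_def[abs_def] by blast
  then have Y: "holo_on 2 Y (coord ?c ` (U \<inter> fib t))" by (rule holo_on_dim_mono[OF _ _ sub]) simp
  show ?thesis
  proof (rule that[OF Y])
    fix w assume w: "w \<in> coord ?c ` (U \<inter> fib t)"
    then obtain x where x: "x \<in> U" "x \<in> fib t" "w = coord ?c x" by blast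
    obtain z v y where p: "x = pt \<mu> \<nu> t z v y" "y ^ 4 = pbranch \<nu> \<tau> z v" by (rule good_pt[OF g x(1,2)])
    have px: "param ?c w = x" using param_coord[OF chart[OF gch_atlas[OF g]], of x] x by simp
    have "hom_coord (base \<mu> \<nu>) (snd x) = \<psi> (fam_coord (base \<mu> \<nu>) (idx1 \<mu> \<nu> c) (idx2 \<mu> \<nu> c) t x)"
      by (rule ratio_chart_hom_coord[OF r x(1)])
    then have \<psi>: "\<psi> w = piece \<mu> \<nu> \<tau> z v y" using x(3) p(1) by (simp add: gch_def pt_def hom_coord_piece)
    have "w = pcoord c z v y" unfolding x(3) p(1) by (rule coord_gch_pt[OF c])
    then have "w 0 = piece \<mu> \<nu> \<tau> z v y (idx1 \<mu> \<nu> c)" "w 1 = piece \<mu> \<nu> \<tau> z v y (idx2 \<mu> \<nu> c)"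
      using c by (auto simp: pcoord_def idx1_def idx2_def piece_simps)
    from sel_reassemble[OF c Y_def[of w, unfolded \<psi>] this]
    show "param ?c w = pt \<mu> \<nu> t (sel_z c w (Y w)) (sel_v c w (Y w)) (sel_y c w (Y w)) \<and>
       sel_y c w (Y w) ^ 4 = pbranch \<nu> \<tau> (sel_z c w (Y w)) (sel_v c w (Y w))"
      unfolding px p(1) piece_simps using p(2) by simp
  qed
qed

text \<open>Implicit differentiation of \<open>Y ^ 4 = pbranch\<close>, where the coordinates are
  \<open>z\<close> and \<open>v\<close>.\<close>

lemma good_root_at:
  assumes g: "good \<mu> \<nu> 0 t U" "pt \<mu> \<nu> t z v y \<in> U" and eq: "y ^ 4 = pbranch \<nu> \<tau> z v" and y: "y \<noteq> 0"
  obtains Y where "holo_on 2 Y (coord (gch \<mu> \<nu> 0 t U) ` (U \<inter> fib t))"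
    "\<And>w. w \<in> coord (gch \<mu> \<nu> 0 t U) ` (U \<inter> fib t) \<Longrightarrow>
       param (gch \<mu> \<nu> 0 t U) w = pt \<mu> \<nu> t (w 0) (w 1) (Y w) \<and> Y w ^ 4 = pbranch \<nu> \<tau> (w 0) (w 1)"
    "vec2 z v \<in> coord (gch \<mu> \<nu> 0 t U) ` (U \<inter> fib t)" "Y (vec2 z v) = y"
    "partial 0 Y (vec2 z v) = pbranch_z \<nu> \<tau> z v / (4 * y ^ 3)"
    "partial 1 Y (vec2 z v) = pbranch_v \<nu> \<tau> z v / (4 * y ^ 3)"
proof -
  let ?c = "gch \<mu> \<nu> 0 t U" and ?p = "vec2 z v"
  let ?V = "coord ?c ` (U \<inter> fib t)"
  obtain Y where Y: "holo_on 2 Y ?V"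
    "\<And>w. w \<in> ?V \<Longrightarrow> param ?c w = pt \<mu> \<nu> t (w 0) (w 1) (Y w) \<and> Y w ^ 4 = pbranch \<nu> \<tau> (w 0) (w 1)"
    by (rule good_root[OF g(1)]) (simp_all add: sel_z_def sel_v_def sel_y_def)
  have V: "openC 2 ?V" using is_chart_image[OF chart[OF gch_atlas[OF g(1)]]] by simp
  have pU: "pt \<mu> \<nu> t z v y \<in> U \<inter> fib t" using g(2) pt_in_fib[OF eq] by simp
  have cp: "coord ?c (pt \<mu> \<nu> t z v y) = ?p" by (simp add: coord_gch_pt pcoord_def)
  have pV: "?p \<in> ?V" using imageI[OF pU, of "coord ?c"] unfolding cp .
  have "param ?c ?p = pt \<mu> \<nu> t z v y"
    using param_coord[OF chart[OF gch_atlas[OF g(1)]], of "pt \<mu> \<nu> t z v y"] pU unfolding cp by simp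
  then have Yp: "Y ?p = y" using Y(2)[OF pV] pt_param by simp
  have d: "4 * y ^ 3 * partial k Y ?p = D"
    if k: "k < 2" and D: "((\<lambda>w. pbranch \<nu> \<tau> ((?p(k := w)) 0) ((?p(k := w)) 1)) has_field_derivative D) (at (?p k))" for k D
  proof -
    have 1: "((\<lambda>w. Y (?p(k := w)) ^ 4) has_field_derivative of_nat 4 * Y (?p(k := ?p k)) ^ (4 - 1) * partial k Y ?p) (at (?p k))"
      by (rule DERIV_cong[OF DERIV_power[OF holo_on_partial[OF Y(1) pV k]]]) simp
    have "eventually (\<lambda>w. Y (?p(k := w)) ^ 4 = pbranch \<nu> \<tau> ((?p(k := w)) 0) ((?p(k := w)) 1)) (nhds (?p k))"
      by (rule eventually_mono[OF eventually_fun_upd[OF V pV k]]) (use Y(2) in blast)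
    from DERIV_cong_ev[OF refl this refl] 1
    have "((\<lambda>w. pbranch \<nu> \<tau> ((?p(k := w)) 0) ((?p(k := w)) 1)) has_field_derivative of_nat 4 * Y (?p(k := ?p k)) ^ (4 - 1) * partial k Y ?p) (at (?p k))"
      by simp
    from DERIV_unique[OF this D] show ?thesis using Yp by simp
  qed
  have "4 * y ^ 3 * partial 0 Y ?p = pbranch_z \<nu> \<tau> z v" using DERIV_pbranch(1) by (intro d) auto
  moreover have "4 * y ^ 3 * partial 1 Y ?p = pbranch_v \<nu> \<tau> z v" using DERIV_pbranch(2) by (intro d) auto
  ultimately have "partial 0 Y ?p = pbranch_z \<nu> \<tau> z v / (4 * y ^ 3)" "partial 1 Y ?p = pbranch_v \<nu> \<tau> z v / (4 * y ^ 3)"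
    using y by (auto simp: field_simps)
  then show ?thesis using that[OF Y pV Yp] by blast
qed

lemma jacobian_eq:
  assumes "c \<in> atlas X" "d \<in> atlas X" "x \<in> chart_dom c" "x \<in> chart_dom d" "k < 2"
    and "\<And>w. w \<in> coord c ` (chart_dom c \<inter> chart_dom d) \<Longrightarrow> coord d (param c w) i = F w"
  shows "jacobian c d (coord c x) i k = partial k F (coord c x)"
  unfolding jacobian_def
  by (rule partial_cong[OF overlap_open[OF assms(1,2)] _ assms(5)]) (use assms in \<open>auto simp: transition_def\<close>)

lemma partial_coord: "partial k (\<lambda>w. w i) z = (if i = k then 1 else 0)"
  unfolding partial_def by (rule DERIV_imp_deriv) (auto intro!: derivative_eq_intros)

lemma jacobian_same:
  assumes g: "good \<mu> \<nu> c t U" "good \<mu> \<nu> c t U'" and x: "x \<in> U" "x \<in> U'" "x \<in> fib t" and k: "k < 2"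
  shows "jacobian (gch \<mu> \<nu> c t U) (gch \<mu> \<nu> c t U') (coord (gch \<mu> \<nu> c t U) x) i k = (if i = k then 1 else 0)"
proof -
  let ?c = "gch \<mu> \<nu> c t U" and ?d = "gch \<mu> \<nu> c t U'"
  have "jacobian ?c ?d (coord ?c x) i k = partial k (\<lambda>w. w i) (coord ?c x)"
  proof (rule jacobian_eq[OF gch_atlas[OF g(1)] gch_atlas[OF g(2)] _ _ k])
    fix w assume "w \<in> coord ?c ` (chart_dom ?c \<inter> chart_dom ?d)"
    then have "coord ?c (param ?c w) = w" by (intro coord_param) auto
    then show "coord ?d (param ?c w) i = w i" by (simp add: gch_def)
  qed (use x in auto)
  then show ?thesis by (simp add: partial_coord)
qed

text \<open>Reduces a Jacobian to a formula \<open>F\<close> for the target coordinates in terms of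
  \<open>z\<close>, \<open>v\<close> and the local root \<open>Y\<close>.\<close>

lemma jacobian_root:
  assumes g: "good \<mu> \<nu> 0 t U" "good \<mu>' \<nu>' c t U'" and x: "pt \<mu> \<nu> t z v y \<in> U" "pt \<mu> \<nu> t z v y \<in> U'"
    and eq: "y ^ 4 = pbranch \<nu> \<tau> z v" and y: "y \<noteq> 0"
  obtains Y where "partial 0 Y (vec2 z v) = pbranch_z \<nu> \<tau> z v / (4 * y ^ 3)" "partial 1 Y (vec2 z v) = pbranch_v \<nu> \<tau> z v / (4 * y ^ 3)"
    "\<And>i k F. k < 2 \<Longrightarrow> (\<And>w. pt \<mu> \<nu> t (w 0) (w 1) (Y w) \<in> U' \<Longrightarrow> coord (gch \<mu>' \<nu>' c t U') (pt \<mu> \<nu> t (w 0) (w 1) (Y w)) i = F w) \<Longrightarrow>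
       jacobian (gch \<mu> \<nu> 0 t U) (gch \<mu>' \<nu>' c t U') (vec2 z v) i k = partial k F (vec2 z v)"
proof -
  let ?c = "gch \<mu> \<nu> 0 t U" and ?d = "gch \<mu>' \<nu>' c t U'"
  obtain Y where Y: "\<And>w. w \<in> coord ?c ` (U \<inter> fib t) \<Longrightarrow> param ?c w = pt \<mu> \<nu> t (w 0) (w 1) (Y w)"
    "partial 0 Y (vec2 z v) = pbranch_z \<nu> \<tau> z v / (4 * y ^ 3)" "partial 1 Y (vec2 z v) = pbranch_v \<nu> \<tau> z v / (4 * y ^ 3)"
    by (rule good_root_at[OF g(1) x(1) eq y]) blast
  have cp: "coord ?c (pt \<mu> \<nu> t z v y) = vec2 z v" by (simp add: coord_gch_pt pcoord_def)
  show ?thesis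
  proof (rule that[OF Y(2,3)])
    fix i k F assume k: "k < (2::nat)"
      and F: "\<And>w. pt \<mu> \<nu> t (w 0) (w 1) (Y w) \<in> U' \<Longrightarrow> coord ?d (pt \<mu> \<nu> t (w 0) (w 1) (Y w)) i = F w"
    have "jacobian ?c ?d (coord ?c (pt \<mu> \<nu> t z v y)) i k = partial k F (coord ?c (pt \<mu> \<nu> t z v y))"
    proof (rule jacobian_eq[OF gch_atlas[OF g(1)] gch_atlas[OF g(2)] _ _ k])
      show "pt \<mu> \<nu> t z v y \<in> chart_dom ?c" "pt \<mu> \<nu> t z v y \<in> chart_dom ?d" using x pt_in_fib[OF eq] by auto
      fix w assume w: "w \<in> coord ?c ` (chart_dom ?c \<inter> chart_dom ?d)"
      then have "param ?c w = pt \<mu> \<nu> t (w 0) (w 1) (Y w)" by (intro Y(1)) auto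
      moreover have "param ?c w \<in> U'" using w param_coord[OF chart[OF gch_atlas[OF g(1)]]] by auto
      ultimately show "coord ?d (param ?c w) i = F w" using F by simp
    qed
    then show "jacobian ?c ?d (vec2 z v) i k = partial k F (vec2 z v)" unfolding cp .
  qed
qed

text \<open>The map is \<open>(z, v) \<mapsto> (z, y)\<close> for \<open>c = 1\<close>, with
  determinant \<open>yv\<close>, and \<open>(z, v) \<mapsto> (v, y)\<close> for
  \<open>c = 2\<close>, with determinant \<open>- yz\<close>.\<close>

lemma pull2_solve:
  assumes g: "good \<mu> \<nu> 0 t U" "good \<mu> \<nu> c t U'" and c: "c = 1 \<or> c = 2"
    and x: "pt \<mu> \<nu> t z v y \<in> U" "pt \<mu> \<nu> t z v y \<in> U'"
    and eq: "y ^ 4 = pbranch \<nu> \<tau> z v" and y: "y \<noteq> 0"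
  defines "yz \<equiv> pbranch_z \<nu> \<tau> z v / (4 * y ^ 3)" and "yv \<equiv> pbranch_v \<nu> \<tau> z v / (4 * y ^ 3)"
  shows "pull2 \<phi> (jacobian (gch \<mu> \<nu> 0 t U) (gch \<mu> \<nu> c t U') (vec2 z v)) \<xi> =
    \<phi> (vec2 (if c = 1 then \<xi> 0 else \<xi> 1) (yz * \<xi> 0 + yv * \<xi> 1)) * (if c = 1 then yv else - yz)"
proof -
  let ?c = "gch \<mu> \<nu> 0 t U" and ?d = "gch \<mu> \<nu> c t U'" and ?p = "vec2 z v"
  obtain Y where Y: "partial 0 Y ?p = yz" "partial 1 Y ?p = yv"
    and J: "\<And>i k F. k < 2 \<Longrightarrow> (\<And>w. pt \<mu> \<nu> t (w 0) (w 1) (Y w) \<in> U' \<Longrightarrow> coord ?d (pt \<mu> \<nu> t (w 0) (w 1) (Y w)) i = F w) \<Longrightarrow>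
      jacobian ?c ?d ?p i k = partial k F ?p"
    unfolding yz_def yv_def by (rule jacobian_root[OF g x eq y]) blast
  have J0: "jacobian ?c ?d ?p 0 k = (if (if c = 1 then 0 else 1) = k then 1 else 0)" if "k < 2" for k
    using J[OF that, of 0 "\<lambda>w. w (if c = 1 then 0 else 1)"] c partial_coord by (auto simp: coord_gch_pt pcoord_def)
  have J1: "jacobian ?c ?d ?p 1 k = partial k Y ?p" if "k < 2" for k
    using J[OF that, of 1 Y] c by (auto simp: coord_gch_pt pcoord_def)
  show ?thesis
    unfolding pull2_def using c by (auto simp: J0 J1[of 0] J1[of 1] Y simp del: One_nat_def)
qed

text \<open>In coordinates the map is \<open>(z, v) \<mapsto> (z, 1 / v)\<close>; membership in the
  second chart forces \<open>v \<noteq> 0\<close>.\<close>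

lemma pull2_change_s:
  assumes g: "good \<mu> True 0 t U" "good \<mu> False 0 t U'" and x: "pt \<mu> True t z v y \<in> U" "pt \<mu> True t z v y \<in> U'"
    and eq: "y ^ 4 = pbranch True \<tau> z v" and y: "y \<noteq> 0"
  shows "v \<noteq> 0 \<and> pt \<mu> True t z v y = pt \<mu> False t z (1 / v) (y / v) \<and>
    pull2 \<phi> (jacobian (gch \<mu> True 0 t U) (gch \<mu> False 0 t U') (vec2 z v)) \<xi> = \<phi> (vec2 (\<xi> 0) (- (1 / v\<^sup>2) * \<xi> 1)) * - (1 / v\<^sup>2)"
proof -
  let ?c = "gch \<mu> True 0 t U" and ?d = "gch \<mu> False 0 t U'" and ?p = "vec2 z v"
  have nz: "w1 \<noteq> 0 \<and> pt \<mu> True t w0 w1 w = pt \<mu> False t w0 (1 / w1) (w / w1)" if "pt \<mu> True t w0 w1 w \<in> U'" for w0 w1 w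
  proof -
    have "proj_point (piece \<mu> True \<tau> w0 w1 w) \<in> aff_dom 7 (base \<mu> False)"
      using good_aff[OF g(2) that] by (simp add: pt_def)
    then have "piece \<mu> True \<tau> w0 w1 w (base \<mu> False) \<noteq> 0" using proj_point_in_aff_dom[OF piece_Cn] by blast
    moreover have "base \<mu> False = iv \<mu> True" by (simp add: base_def iv_def)
    ultimately have "w1 \<noteq> 0" by (simp add: piece_simps)
    then show ?thesis using piece_change_s(1)[of w1 \<mu> True \<tau> w0 w] by (simp add: pt_def)
  qed
  obtain Y where Y: "\<And>i k F. k < 2 \<Longrightarrow> (\<And>w. pt \<mu> True t (w 0) (w 1) (Y w) \<in> U' \<Longrightarrow> coord ?d (pt \<mu> True t (w 0) (w 1) (Y w)) i = F w) \<Longrightarrow>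
      jacobian ?c ?d ?p i k = partial k F ?p"
    by (rule jacobian_root[OF g x eq y]) blast
  have J: "jacobian ?c ?d ?p i k = partial k (\<lambda>w. vec2 (w 0) (1 / w 1) i) ?p" if k: "k < 2" for i k
    by (rule Y[OF k], subst nz[THEN conjunct2]) (assumption, simp add: coord_gch_pt pcoord_def)
  have v: "v \<noteq> 0" using nz[OF x(2)] by blast
  have "partial k (\<lambda>w. vec2 (w 0) (1 / w 1) 1) ?p = (if k = 1 then - (1 / v\<^sup>2) else 0)" if k: "k < 2" for k
    unfolding partial_def by (rule DERIV_imp_deriv)
      (use k v in \<open>auto intro!: derivative_eq_intros simp: less_2_cases_iff power2_eq_square\<close>)
  then show ?thesis
    using nz[OF x(2)] unfolding pull2_def by (simp add: J partial_coord)
qed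

text \<open>In coordinates the map is \<open>(z, v) \<mapsto> (1 / z, v / q)\<close>, with
  determinant \<open>1 / q\<^sup>2\<close>.\<close>

lemma pull2_change_z:
  assumes g: "good \<mu> True 0 t U" "good (\<not> \<mu>) True 0 t U'" and x: "pt \<mu> True t z v y \<in> U" "pt \<mu> True t z v y \<in> U'"
    and eq: "y ^ 4 = pbranch True \<tau> z v" and y: "y \<noteq> 0"
  defines "q \<equiv> qcoord \<tau> z 1 v"
  shows "z \<noteq> 0 \<and> q \<noteq> 0 \<and> pt \<mu> True t z v y = pt (\<not> \<mu>) True t (1 / z) (v / q) (y / q) \<and>
    pull2 \<phi> (jacobian (gch \<mu> True 0 t U) (gch (\<not> \<mu>) True 0 t U') (vec2 z v)) \<xi> =
      \<phi> (vec2 (- (1 / z\<^sup>2) * \<xi> 0) (- (v * (\<tau> * v - 2 * z) / q\<^sup>2) * \<xi> 0 + - (z\<^sup>2 / q\<^sup>2) * \<xi> 1)) * (1 / q\<^sup>2)"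
proof -
  let ?c = "gch \<mu> True 0 t U" and ?d = "gch (\<not> \<mu>) True 0 t U'" and ?p = "vec2 z v"
  let ?q = "\<lambda>w0 w1. qcoord \<tau> w0 1 w1"
  have nz: "w0 \<noteq> 0 \<and> ?q w0 w1 \<noteq> 0 \<and> pt \<mu> True t w0 w1 w = pt (\<not> \<mu>) True t (1 / w0) (w1 / ?q w0 w1) (w / ?q w0 w1)"
    if "pt \<mu> True t w0 w1 w \<in> U'" for w0 w1 w
  proof -
    have "proj_point (piece \<mu> True \<tau> w0 w1 w) \<in> aff_dom 7 (base (\<not> \<mu>) True)"
      using good_aff[OF g(2) that] by (simp add: pt_def)
    then have "piece \<mu> True \<tau> w0 w1 w (base (\<not> \<mu>) True) \<noteq> 0" using proj_point_in_aff_dom[OF piece_Cn] by blast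
    moreover have "piece \<mu> True \<tau> w0 w1 w (base (\<not> \<mu>) True) = w0 * ?q w0 w1"
      by (cases \<mu>) (simp_all add: piece_def base_def)
    ultimately have "w0 \<noteq> 0" "?q w0 w1 \<noteq> 0" by auto
    then show ?thesis using piece_change_z(1)[of w0 \<tau> w1 \<mu> w] by (simp add: pt_def)
  qed
  obtain Y where Y: "\<And>i k F. k < 2 \<Longrightarrow> (\<And>w. pt \<mu> True t (w 0) (w 1) (Y w) \<in> U' \<Longrightarrow> coord ?d (pt \<mu> True t (w 0) (w 1) (Y w)) i = F w) \<Longrightarrow>
      jacobian ?c ?d ?p i k = partial k F ?p"
    by (rule jacobian_root[OF g x eq y]) blast
  have J: "jacobian ?c ?d ?p i k = partial k (\<lambda>w. vec2 (1 / w 0) (w 1 / ?q (w 0) (w 1)) i) ?p" if k: "k < 2" for i k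
    by (rule Y[OF k], subst nz[THEN conjunct2, THEN conjunct2]) (assumption, simp add: coord_gch_pt pcoord_def)
  have z: "z \<noteq> 0" "q \<noteq> 0" using nz[OF x(2)] unfolding q_def by blast+
  have J0: "jacobian ?c ?d ?p 0 0 = - (1 / z\<^sup>2)" "jacobian ?c ?d ?p 0 1 = 0"
    using z by (auto simp: J partial_def power2_eq_square intro!: DERIV_imp_deriv derivative_eq_intros)
  have J1: "jacobian ?c ?d ?p 1 0 = - (v * (\<tau> * v - 2 * z) / q\<^sup>2)"
    using z unfolding q_def
    by (auto simp: J partial_def qcoord_def power2_eq_square intro!: DERIV_imp_deriv derivative_eq_intros)
  have "jacobian ?c ?d ?p 1 1 = (q - v * (\<tau> * z)) / q\<^sup>2"
    using z unfolding q_def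
    by (auto simp: J partial_def qcoord_def power2_eq_square intro!: DERIV_imp_deriv derivative_eq_intros)
  also have "q - v * (\<tau> * z) = - z\<^sup>2" by (simp add: q_def qcoord_def)
  finally have J2: "jacobian ?c ?d ?p 1 1 = - (z\<^sup>2 / q\<^sup>2)" by simp
  show ?thesis
    using nz[OF x(2)] z unfolding pull2_def J0 J1 J2 q_def[symmetric] by (simp add: q_def[symmetric])
qed

end

context fibre_surface
begin

lemma openin_X_pt:
  assumes W: "openin (mtop X) W" "pt \<mu> \<nu> t z0 v0 y0 \<in> W"
  obtains e where "e > 0" "\<And>z v y. dist z z0 < e \<Longrightarrow> dist v v0 < e \<Longrightarrow> dist y y0 < e \<Longrightarrow>
    y ^ 4 = pbranch \<nu> \<tau> z v \<Longrightarrow> pt \<mu> \<nu> t z v y \<in> W"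
proof -
  obtain Ob where Ob: "openin ambient Ob" "W = Ob \<inter> fib t" by (rule openin_X[OF W(1)])
  have c: "continuous_map euclidean ambient (\<lambda>x. pt \<mu> \<nu> t (fst x) (fst (snd x)) (snd (snd x)))"
    unfolding pt_def using t by (intro continuous_map_pairedI continuous_map_const[THEN iffD2] continuous_map_piece) auto
  have "open {x. pt \<mu> \<nu> t (fst x) (fst (snd x)) (snd (snd x)) \<in> Ob}"
    using openin_continuous_map_preimage[OF c Ob(1)] by simp
  moreover have "(z0, v0, y0) \<in> {x. pt \<mu> \<nu> t (fst x) (fst (snd x)) (snd (snd x)) \<in> Ob}" using W(2) Ob(2) by simp
  ultimately obtain e where e: "e > 0" "ball (z0, v0, y0) e \<subseteq> {x. pt \<mu> \<nu> t (fst x) (fst (snd x)) (snd (snd x)) \<in> Ob}"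
    using open_contains_ball by blast
  show ?thesis
  proof (rule that[of "e / 3"])
    fix z v y assume d: "dist z z0 < e / 3" "dist v v0 < e / 3" "dist y y0 < e / 3" and eq: "y ^ 4 = pbranch \<nu> \<tau> z v"
    have "dist (z, v, y) (z0, v0, y0) \<le> dist z z0 + dist (v, y) (v0, y0)" by (rule dist_Pair_le)
    also have "\<dots> \<le> dist z z0 + (dist v v0 + dist y y0)" by (intro add_left_mono dist_Pair_le)
    also have "\<dots> < e" using d by simp
    finally have "(z, v, y) \<in> ball (z0, v0, y0) e" by (simp add: dist_commute)
    then have "pt \<mu> \<nu> t z v y \<in> Ob" using e(2) by auto
    moreover have "pt \<mu> \<nu> t z v y \<in> fib t" by (rule pt_in_fib[OF eq])
    ultimately show "pt \<mu> \<nu> t z v y \<in> W" unfolding Ob(2) by (auto simp: fib_def)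
  qed (use e(1) in simp)
qed

lemma dense_pt:
  assumes W: "openin (mtop X) W" "W \<noteq> {}" and Z: "finite Z" "\<And>z. z \<notin> Z \<Longrightarrow> finite (B z)"
  obtains z v y where "z \<notin> Z" "v \<notin> B z" "y \<noteq> 0" "y ^ 4 = pbranch True \<tau> z v" "pt False True t z v y \<in> W"
proof -
  obtain Ob where Ob: "openin ambient Ob" "W = Ob \<inter> fib t" by (rule openin_X[OF W(1)])
  obtain x where "x \<in> W" using W(2) by blast
  then obtain L where L: "(t, L) \<in> Ob" "L \<in> surface \<tau>" unfolding Ob(2) by (auto simp: fib_def family_points_def)
  have c: "continuous_map (proj_topology 7) ambient (\<lambda>L. (t, L))"
    using t by (intro continuous_map_pairedI continuous_map_const[THEN iffD2] continuous_map_id[unfolded id_def]) auto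
  have o: "openin (proj_topology 7) {L \<in> proj_points 7. (t, L) \<in> Ob}"
    using openin_continuous_map_preimage[OF c Ob(1)] by simp
  have "L \<in> {L \<in> proj_points 7. (t, L) \<in> Ob}" using L surface_subset by auto
  obtain z v y where p: "z \<notin> Z" "v \<notin> B z" "y \<noteq> 0" "y ^ 4 = pbranch True \<tau> z v"
    "proj_point (piece False True \<tau> z v y) \<in> {L \<in> proj_points 7. (t, L) \<in> Ob}"
    by (rule surface_dense[OF L(2) o \<open>L \<in> {L \<in> proj_points 7. (t, L) \<in> Ob}\<close> Z])
  have "pt False True t z v y \<in> fib t" by (rule pt_in_fib[OF p(4)])
  then have "pt False True t z v y \<in> W" using p(5) unfolding Ob(2) by (auto simp: pt_def fib_def)
  then show ?thesis using that p by blast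
qed

lemma finite_fourth_roots: "finite {y :: complex. y ^ 4 = c}"
proof -
  obtain r where "r ^ 4 = c" using fourth_root_exists by blast
  then have "{y. y ^ 4 = c} = {r, - r, \<i> * r, - (\<i> * r)}" using fourth_root_cases[of _ r] by auto
  then show ?thesis by simp
qed

definition near where
  "near \<nu> z0 v0 y0 Q \<longleftrightarrow> (\<exists>e>0. \<forall>z v y. dist z z0 < e \<and> dist v v0 < e \<and> dist y y0 < e \<and> y ^ 4 = pbranch \<nu> \<tau> z v \<and> y \<noteq> 0 \<longrightarrow> Q z v y)"

definition near_fibre where
  "near_fibre \<nu> z0 v0 Q \<longleftrightarrow> (\<exists>e>0. \<forall>z v y. dist z z0 < e \<and> dist v v0 < e \<and> y ^ 4 = pbranch \<nu> \<tau> z v \<and> y \<noteq> 0 \<longrightarrow> Q z v y)"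

lemma near_mono: "near \<nu> z0 v0 y0 Q \<Longrightarrow> (\<And>z v y. y ^ 4 = pbranch \<nu> \<tau> z v \<Longrightarrow> y \<noteq> 0 \<Longrightarrow> Q z v y \<Longrightarrow> R z v y) \<Longrightarrow> near \<nu> z0 v0 y0 R"
  unfolding near_def by blast

text \<open>Only finitely many roots lie over \<open>(z0, v0)\<close>, and by
  \<open>fourth_root_near\<close> every root over a nearby point is close to one of them.\<close>

lemma bounded_near_fibre:
  fixes f :: "complex \<Rightarrow> complex \<Rightarrow> complex \<Rightarrow> real"
  assumes "\<And>y0. y0 ^ 4 = pbranch \<nu> \<tau> z0 v0 \<Longrightarrow> \<exists>K. near \<nu> z0 v0 y0 (\<lambda>z v y. f z v y \<le> K)"
  shows "\<exists>K. near_fibre \<nu> z0 v0 (\<lambda>z v y. f z v y \<le> K)"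
proof -
  let ?R = "{y. y ^ 4 = pbranch \<nu> \<tau> z0 v0}"
  have fin: "finite ?R" by (rule finite_fourth_roots)
  have ne: "?R \<noteq> {}" using fourth_root_exists by blast
  let ?b = "\<lambda>y0 e K. \<forall>z v y. dist z z0 < e \<and> dist v v0 < e \<and> dist y y0 < e \<and> y ^ 4 = pbranch \<nu> \<tau> z v \<and> y \<noteq> 0 \<longrightarrow> f z v y \<le> K"
  have "\<forall>y0\<in>?R. \<exists>K e. e > 0 \<and> ?b y0 e K" using assms unfolding near_def by blast
  from bchoice[OF this] obtain K where "\<forall>y0\<in>?R. \<exists>e. e > 0 \<and> ?b y0 e (K y0)" by blast
  from bchoice[OF this] obtain e where eK: "\<And>y0. y0 \<in> ?R \<Longrightarrow> e y0 > 0" "\<And>y0. y0 \<in> ?R \<Longrightarrow> ?b y0 (e y0) (K y0)" by blast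
  define E where "E = Min (e ` ?R)"
  have E: "E > 0" "\<And>y0. y0 \<in> ?R \<Longrightarrow> E \<le> e y0" unfolding E_def using fin ne eK(1) by (auto simp: Min_gr_iff)
  have K: "\<And>y0. y0 \<in> ?R \<Longrightarrow> K y0 \<le> Max (K ` ?R)" using fin by auto
  have "continuous (at (z0, v0)) (\<lambda>x. pbranch \<nu> \<tau> (fst x) (snd x))"
    using continuous_on_pbranch[unfolded continuous_on_eq_continuous_at[OF open_UNIV]] by blast
  then obtain d where d: "d > 0" "\<And>x. dist x (z0, v0) < d \<Longrightarrow> dist (pbranch \<nu> \<tau> (fst x) (snd x)) (pbranch \<nu> \<tau> z0 v0) < E ^ 4"
    unfolding continuous_at_eps_delta using E(1) zero_less_power[OF E(1), of 4] by (metis fst_conv snd_conv)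
  have "f z v y \<le> Max (K ` ?R)"
    if a: "dist z z0 < min E (d / 2) \<and> dist v v0 < min E (d / 2) \<and> y ^ 4 = pbranch \<nu> \<tau> z v \<and> y \<noteq> 0" for z v y
  proof -
    have "dist (z, v) (z0, v0) \<le> dist z z0 + dist v v0" by (rule dist_Pair_le)
    then have "dist (z, v) (z0, v0) < d" using a by linarith
    from d(2)[OF this] have "norm (y ^ 4 - pbranch \<nu> \<tau> z0 v0) < E ^ 4" using a by (simp add: dist_norm)
    then obtain r where r: "r ^ 4 = pbranch \<nu> \<tau> z0 v0" "dist y r < E" using fourth_root_near E(1) by blast
    then have rR: "r \<in> ?R" by simp
    have "dist z z0 < e r" "dist v v0 < e r" "dist y r < e r" using a r(2) E(2)[OF rR] by linarith+
    then show ?thesis using eK(2)[OF rR] a K[OF rR] by force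
  qed
  moreover have "min E (d / 2) > 0" using E(1) d(1) by simp
  ultimately show ?thesis unfolding near_fibre_def by blast
qed

end

section \<open>The coefficients of a section and their growth\<close>

locale fibre_section = fibre_surface +
  fixes s assumes s: "s \<in> H0_sym_cotangent_canonical X 1"
begin

lemmas s_props = s[unfolded H0_iff[OF dim]]

lemma s_compat:
  assumes "c \<in> atlas X" "d \<in> atlas X" "x \<in> chart_dom c" "x \<in> chart_dom d"
  shows "s c (coord c x) = pull2 (s d (coord d x)) (jacobian c d (coord c x))"
proof -
  have "s c (coord c x) = pull2 (s d (transition c d (coord c x))) (jacobian c d (coord c x))"
    using s_props assms by blast
  then show ?thesis unfolding transition_coord[OF assms(1,3)] .
qed

lemma s_holo_form: "c \<in> atlas X \<Longrightarrow> holo_form (s c) (coord c ` chart_dom c)"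
  using s_props by blast

text \<open>The chosen \<open>U\<close> is immaterial: charts of equal kind on a piece have the same
  coordinates, so the Jacobian between them is the identity (\<open>val_eq\<close>).\<close>

definition val where
  "val \<mu> \<nu> c z v y = s (gch \<mu> \<nu> c t (SOME U. good \<mu> \<nu> c t U \<and> pt \<mu> \<nu> t z v y \<in> U)) (pcoord c z v y)"

lemma val_eq:
  assumes c: "c < 3" and g: "good \<mu> \<nu> c t U" "pt \<mu> \<nu> t z v y \<in> U" and eq: "y ^ 4 = pbranch \<nu> \<tau> z v"
  shows "s (gch \<mu> \<nu> c t U) (pcoord c z v y) = val \<mu> \<nu> c z v y"
proof -
  define U' where "U' = (SOME U. good \<mu> \<nu> c t U \<and> pt \<mu> \<nu> t z v y \<in> U)"
  have g': "good \<mu> \<nu> c t U'" "pt \<mu> \<nu> t z v y \<in> U'"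
    using someI[of "\<lambda>U. good \<mu> \<nu> c t U \<and> pt \<mu> \<nu> t z v y \<in> U" U] g unfolding U'_def by blast+
  let ?c = "gch \<mu> \<nu> c t U" and ?d = "gch \<mu> \<nu> c t U'" and ?x = "pt \<mu> \<nu> t z v y"
  have x: "?x \<in> chart_dom ?c" "?x \<in> chart_dom ?d" using g(2) g'(2) pt_in_fib[OF eq] by auto
  have co: "coord ?c ?x = pcoord c z v y" "coord ?d ?x = pcoord c z v y" by (simp_all add: coord_gch_pt[OF c])
  have J: "jacobian ?c ?d (coord ?c ?x) i k = (if i = k then 1 else 0)" if "k < 2" for i k
    by (rule jacobian_same[OF g(1) g'(1) g(2) g'(2) pt_in_fib[OF eq] that])
  have "holo_form (s ?d) (coord ?d ` chart_dom ?d)" by (rule s_holo_form[OF gch_atlas[OF g'(1)]])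
  then obtain a b where ab: "\<And>\<xi>. s ?d (coord ?d ?x) \<xi> = a * \<xi> 0 + b * \<xi> 1" using x(2) unfolding holo_form_def by blast
  have "s ?c (coord ?c ?x) = s ?d (coord ?d ?x)"
    unfolding s_compat[OF gch_atlas[OF g(1)] gch_atlas[OF g'(1)] x] by (simp add: pull2_def J ab fun_eq_iff)
  then have "s ?c (pcoord c z v y) = s ?d (pcoord c z v y)" unfolding co .
  then show ?thesis unfolding val_def U'_def .
qed

lemma val_linear:
  assumes "y ^ 4 = pbranch \<nu> \<tau> z v" "c < 3" "solvable c \<nu> \<tau> z v y"
  shows "val \<mu> \<nu> c z v y \<xi> = val \<mu> \<nu> c z v y (vec2 1 0) * \<xi> 0 + val \<mu> \<nu> c z v y (vec2 0 1) * \<xi> 1"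
proof -
  obtain U where U: "good \<mu> \<nu> c t U" "pt \<mu> \<nu> t z v y \<in> U" by (rule good_at[OF assms])
  let ?c = "gch \<mu> \<nu> c t U" and ?x = "pt \<mu> \<nu> t z v y"
  have "?x \<in> chart_dom ?c" using U(2) pt_in_fib[OF assms(1)] by auto
  then obtain a b where ab: "\<And>\<xi>. s ?c (coord ?c ?x) \<xi> = a * \<xi> 0 + b * \<xi> 1"
    using s_holo_form[OF gch_atlas[OF U(1)]] unfolding holo_form_def by blast
  have "val \<mu> \<nu> c z v y \<xi> = a * \<xi> 0 + b * \<xi> 1" for \<xi>
    using ab unfolding val_eq[OF assms(2) U assms(1), symmetric] coord_gch_pt[OF assms(2)] .
  then show ?thesis by simp
qed

definition A where "A \<mu> \<nu> z v y = val \<mu> \<nu> 0 z v y (vec2 1 0)"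
definition B where "B \<mu> \<nu> z v y = val \<mu> \<nu> 0 z v y (vec2 0 1)"

lemma val_AB:
  assumes "y ^ 4 = pbranch \<nu> \<tau> z v" "y \<noteq> 0"
  shows "val \<mu> \<nu> 0 z v y \<xi> = A \<mu> \<nu> z v y * \<xi> 0 + B \<mu> \<nu> z v y * \<xi> 1"
  unfolding A_def B_def by (rule val_linear[OF assms(1)]) (use assms(2) in \<open>simp_all add: solvable_def\<close>)

lemma val_pull2:
  assumes g: "good \<mu> \<nu> 0 t U" "good \<mu>' \<nu>' c t U'" and c: "c < 3" and x: "pt \<mu> \<nu> t z v y \<in> U" "pt \<mu> \<nu> t z v y \<in> U'"
    and eq: "y ^ 4 = pbranch \<nu> \<tau> z v" "y' ^ 4 = pbranch \<nu>' \<tau> z' v'" and x': "pt \<mu> \<nu> t z v y = pt \<mu>' \<nu>' t z' v' y'"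
  shows "val \<mu> \<nu> 0 z v y = pull2 (val \<mu>' \<nu>' c z' v' y') (jacobian (gch \<mu> \<nu> 0 t U) (gch \<mu>' \<nu>' c t U') (vec2 z v))"
proof -
  let ?c = "gch \<mu> \<nu> 0 t U" and ?d = "gch \<mu>' \<nu>' c t U'" and ?x = "pt \<mu> \<nu> t z v y"
  have xx: "?x \<in> chart_dom ?c" "?x \<in> chart_dom ?d" using x pt_in_fib[OF eq(1)] by auto
  have 1: "coord ?c ?x = vec2 z v" by (simp add: coord_gch_pt pcoord_def)
  have 2: "coord ?d ?x = pcoord c z' v' y'" unfolding x' by (rule coord_gch_pt[OF c])
  have "s ?c (vec2 z v) = val \<mu> \<nu> 0 z v y"
    using val_eq[OF _ g(1) x(1) eq(1)] by (simp add: pcoord_def)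
  moreover have "s ?d (pcoord c z' v' y') = val \<mu>' \<nu>' c z' v' y'"
    by (rule val_eq[OF c g(2) x(2)[unfolded x'] eq(2)])
  ultimately show ?thesis using s_compat[OF gch_atlas[OF g(1)] gch_atlas[OF g(2)] xx] unfolding 1 2 by simp
qed

text \<open>Substitution of \<open>dy = yz dz + yv dv\<close> into
  \<open>(C dz + D dy) \<otimes> dz \<and> dy\<close> for \<open>c = 1\<close>, and into
  \<open>(C dv + D dy) \<otimes> dv \<and> dy\<close> for \<open>c = 2\<close>.\<close>

lemma AB_solve:
  fixes \<mu> :: bool
  assumes eq: "y ^ 4 = pbranch \<nu> \<tau> z v" and y: "y \<noteq> 0" and c: "c = 1 \<or> c = 2" and sol: "solvable c \<nu> \<tau> z v y"
  defines "C \<equiv> val \<mu> \<nu> c z v y (vec2 1 0)" and "D \<equiv> val \<mu> \<nu> c z v y (vec2 0 1)"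
    and "yz \<equiv> pbranch_z \<nu> \<tau> z v / (4 * y ^ 3)" and "yv \<equiv> pbranch_v \<nu> \<tau> z v / (4 * y ^ 3)"
  shows "A \<mu> \<nu> z v y = (if c = 1 then (C + D * yz) * yv else - (D * yz\<^sup>2))"
    and "B \<mu> \<nu> z v y = (if c = 1 then D * yv\<^sup>2 else - ((C + D * yv) * yz))"
proof -
  have c3: "c < 3" using c by auto
  obtain U where U: "good \<mu> \<nu> 0 t U" "pt \<mu> \<nu> t z v y \<in> U" by (rule good_at_0[OF eq y])
  obtain U' where U': "good \<mu> \<nu> c t U'" "pt \<mu> \<nu> t z v y \<in> U'" by (rule good_at[OF eq c3 sol])
  have "val \<mu> \<nu> c z v y \<xi> = C * \<xi> 0 + D * \<xi> 1" for \<xi>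
    unfolding C_def D_def by (rule val_linear[OF eq c3 sol])
  then have "val \<mu> \<nu> 0 z v y \<xi> = (C * (if c = 1 then \<xi> 0 else \<xi> 1) + D * (yz * \<xi> 0 + yv * \<xi> 1)) * (if c = 1 then yv else - yz)" for \<xi>
    unfolding val_pull2[OF U(1) U'(1) c3 U(2) U'(2) eq eq refl] pull2_solve[OF U(1) U'(1) c U(2) U'(2) eq y] yz_def yv_def by simp
  then show "A \<mu> \<nu> z v y = (if c = 1 then (C + D * yz) * yv else - (D * yz\<^sup>2))"
    "B \<mu> \<nu> z v y = (if c = 1 then D * yv\<^sup>2 else - ((C + D * yv) * yz))"
    unfolding A_def B_def by (simp_all add: vec2_def power2_eq_square)
qed

lemma AB_change_s:
  assumes eq: "y ^ 4 = pbranch True \<tau> z v" and y: "y \<noteq> 0" and v: "v \<noteq> 0"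
  shows "A \<mu> True z v y = - (A \<mu> False z (1 / v) (y / v) / v\<^sup>2)"
    and "B \<mu> True z v y = B \<mu> False z (1 / v) (y / v) / v ^ 4"
    and "(y / v) ^ 4 = pbranch False \<tau> z (1 / v)"
proof -
  show eq': "(y / v) ^ 4 = pbranch False \<tau> z (1 / v)"
    using piece_change_s(2)[OF v, of True \<tau> z] eq by (simp add: power_divide)
  have y': "y / v \<noteq> 0" using y v by simp
  obtain U where U: "good \<mu> True 0 t U" "pt \<mu> True t z v y \<in> U" by (rule good_at_0[OF eq y])
  obtain U' where U': "good \<mu> False 0 t U'" "pt \<mu> False t z (1 / v) (y / v) \<in> U'" by (rule good_at_0[OF eq' y'])
  have e: "pt \<mu> True t z v y = pt \<mu> False t z (1 / v) (y / v)"
    using piece_change_s(1)[OF v, of \<mu> True] by (simp add: pt_def)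
  have "val \<mu> True 0 z v y = pull2 (val \<mu> False 0 z (1 / v) (y / v)) (jacobian (gch \<mu> True 0 t U) (gch \<mu> False 0 t U') (vec2 z v))"
    by (rule val_pull2[OF U(1) U'(1) _ U(2) U'(2)[folded e] eq eq' e]) simp
  then have "val \<mu> True 0 z v y \<xi> = val \<mu> False 0 z (1 / v) (y / v) (vec2 (\<xi> 0) (- (1 / v\<^sup>2) * \<xi> 1)) * - (1 / v\<^sup>2)" for \<xi>
    using pull2_change_s[OF U(1) U'(1) U(2) U'(2)[folded e] eq y] by simp
  then have "val \<mu> True 0 z v y \<xi> = (A \<mu> False z (1 / v) (y / v) * \<xi> 0 + B \<mu> False z (1 / v) (y / v) * (- (1 / v\<^sup>2) * \<xi> 1)) * - (1 / v\<^sup>2)" for \<xi>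
    unfolding val_AB[OF eq' y'] by simp
  then show "A \<mu> True z v y = - (A \<mu> False z (1 / v) (y / v) / v\<^sup>2)"
    "B \<mu> True z v y = B \<mu> False z (1 / v) (y / v) / v ^ 4"
    unfolding A_def[of \<mu> True] B_def[of \<mu> True] by (simp_all add: vec2_def power2_eq_square power4_eq_xxxx)
qed

lemma AB_change_z:
  assumes eq: "y ^ 4 = pbranch True \<tau> z v" and y: "y \<noteq> 0" and z: "z \<noteq> 0" and q: "qcoord \<tau> z 1 v \<noteq> 0"
  defines "q \<equiv> qcoord \<tau> z 1 v"
  shows "A \<mu> True z v y = - (A (\<not> \<mu>) True (1 / z) (v / q) (y / q) / z\<^sup>2 + B (\<not> \<mu>) True (1 / z) (v / q) (y / q) * v * (\<tau> * v - 2 * z) / q\<^sup>2) / q\<^sup>2"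
    and "B \<mu> True z v y = - (B (\<not> \<mu>) True (1 / z) (v / q) (y / q) * z\<^sup>2 / q ^ 4)"
    and "(y / q) ^ 4 = pbranch True \<tau> (1 / z) (v / q)"
proof -
  have q0: "q \<noteq> 0" using q by (simp add: q_def)
  show eq': "(y / q) ^ 4 = pbranch True \<tau> (1 / z) (v / q)"
    using piece_change_z(2)[OF z q] eq by (simp add: q_def power_divide)
  have y': "y / q \<noteq> 0" using y q0 by simp
  obtain U where U: "good \<mu> True 0 t U" "pt \<mu> True t z v y \<in> U" by (rule good_at_0[OF eq y])
  obtain U' where U': "good (\<not> \<mu>) True 0 t U'" "pt (\<not> \<mu>) True t (1 / z) (v / q) (y / q) \<in> U'" by (rule good_at_0[OF eq' y'])
  have e: "pt \<mu> True t z v y = pt (\<not> \<mu>) True t (1 / z) (v / q) (y / q)"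
    using piece_change_z(1)[OF z q, of \<mu>] by (simp add: pt_def q_def)
  have "val \<mu> True 0 z v y = pull2 (val (\<not> \<mu>) True 0 (1 / z) (v / q) (y / q)) (jacobian (gch \<mu> True 0 t U) (gch (\<not> \<mu>) True 0 t U') (vec2 z v))"
    by (rule val_pull2[OF U(1) U'(1) _ U(2) U'(2)[folded e] eq eq' e]) simp
  then have "val \<mu> True 0 z v y \<xi> = val (\<not> \<mu>) True 0 (1 / z) (v / q) (y / q)
      (vec2 (- (1 / z\<^sup>2) * \<xi> 0) (- (v * (\<tau> * v - 2 * z) / q\<^sup>2) * \<xi> 0 + - (z\<^sup>2 / q\<^sup>2) * \<xi> 1)) * (1 / q\<^sup>2)" for \<xi>
    using pull2_change_z[OF U(1) U'(1) U(2) U'(2)[folded e] eq y] by (simp add: q_def)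
  then have "val \<mu> True 0 z v y \<xi> = (A (\<not> \<mu>) True (1 / z) (v / q) (y / q) * (- (1 / z\<^sup>2) * \<xi> 0) +
     B (\<not> \<mu>) True (1 / z) (v / q) (y / q) * (- (v * (\<tau> * v - 2 * z) / q\<^sup>2) * \<xi> 0 + - (z\<^sup>2 / q\<^sup>2) * \<xi> 1)) * (1 / q\<^sup>2)" for \<xi>
    unfolding val_AB[OF eq' y'] by simp
  then show "A \<mu> True z v y = - (A (\<not> \<mu>) True (1 / z) (v / q) (y / q) / z\<^sup>2 + B (\<not> \<mu>) True (1 / z) (v / q) (y / q) * v * (\<tau> * v - 2 * z) / q\<^sup>2) / q\<^sup>2"
    "B \<mu> True z v y = - (B (\<not> \<mu>) True (1 / z) (v / q) (y / q) * z\<^sup>2 / q ^ 4)"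
    unfolding A_def[of \<mu> True z v] B_def[of \<mu> True z v] by (simp_all add: vec2_def power2_eq_square power4_eq_xxxx)
qed

end

lemma continuous_on_pbranch_deriv:
  "continuous_on UNIV (\<lambda>x. pbranch_z \<nu> \<tau> (fst x) (snd x))" "continuous_on UNIV (\<lambda>x. pbranch_v \<nu> \<tau> (fst x) (snd x))"
  unfolding pbranch_z_def pbranch_v_def branch_simps by (cases \<nu>; simp; intro continuous_intros)+

context fibre_section
begin

text \<open>A common bound for everything that enters \<open>AB_solve\<close>.\<close>

definition bounds where
  "bounds \<mu> \<nu> c K z v y \<longleftrightarrow> solvable c \<nu> \<tau> z v y \<and> norm y \<le> K \<and> norm (pbranch_z \<nu> \<tau> z v) \<le> K \<and> norm (pbranch_v \<nu> \<tau> z v) \<le> K \<and>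
     norm (val \<mu> \<nu> c z v y (vec2 1 0)) \<le> K \<and> norm (val \<mu> \<nu> c z v y (vec2 0 1)) \<le> K"

lemma near_bounds:
  assumes eq: "y0 ^ 4 = pbranch \<nu> \<tau> z0 v0" and c: "c < 3" and sol: "solvable c \<nu> \<tau> z0 v0 y0"
  obtains K where "K \<ge> 0" "near \<nu> z0 v0 y0 (bounds \<mu> \<nu> c K)"
proof -
  obtain U where U: "good \<mu> \<nu> c t U" "pt \<mu> \<nu> t z0 v0 y0 \<in> U" by (rule good_at[OF eq c sol])
  let ?c = "gch \<mu> \<nu> c t U" and ?p = "pcoord c z0 v0 y0"
  let ?V = "coord ?c ` chart_dom ?c"
  have V: "openC 2 ?V" by (rule is_chart_image[OF chart[OF gch_atlas[OF U(1)]]])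
  obtain a b where ab: "holo_on 2 a ?V" "holo_on 2 b ?V" "\<And>z \<xi>. z \<in> ?V \<Longrightarrow> s ?c z \<xi> = a z * \<xi> 0 + b z * \<xi> 1"
    using s_holo_form[OF gch_atlas[OF U(1)]] unfolding holo_form_def by blast
  define N where "N = ?V \<inter> (\<lambda>w. (a w, b w)) -` ball (a ?p, b ?p) 1"
  have "continuous_on ?V (\<lambda>w. (a w, b w))"
    by (rule continuous_on_Pair[OF holo_on_imp_continuous_on[OF ab(1)] holo_on_imp_continuous_on[OF ab(2)]])
  then have "openin (top_of_set ?V) N" unfolding N_def by (rule continuous_openin_preimage_gen) (rule open_ball)
  then have N: "openC 2 N" using V openin_trans by blast
  let ?W = "{x \<in> chart_dom ?c. coord ?c x \<in> N}"
  have W: "openin (mtop X) ?W" by (rule is_chart_vimage[OF chart[OF gch_atlas[OF U(1)]] N])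
  have x0: "pt \<mu> \<nu> t z0 v0 y0 \<in> chart_dom ?c" using U(2) pt_in_fib[OF eq] by simp
  then have "?p \<in> ?V" by (rule rev_image_eqI) (simp add: coord_gch_pt[OF c])
  then have "pt \<mu> \<nu> t z0 v0 y0 \<in> ?W" using x0 by (simp add: coord_gch_pt[OF c] N_def)
  from W this obtain e where e: "e > 0" "\<And>z v y. dist z z0 < e \<Longrightarrow> dist v v0 < e \<Longrightarrow> dist y y0 < e \<Longrightarrow>
    y ^ 4 = pbranch \<nu> \<tau> z v \<Longrightarrow> pt \<mu> \<nu> t z v y \<in> ?W" by (rule openin_X_pt) blast
  let ?g = "\<lambda>x. (pbranch_z \<nu> \<tau> (fst x) (snd x), pbranch_v \<nu> \<tau> (fst x) (snd x))"
  \<comment> \<open>Closeness within \<open>\<delta>\<close> keeps the derivative required by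
    \<open>solvable\<close> away from zero; the \<open>min 1\<close> serves the norm bounds.\<close>
  define \<delta> where "\<delta> = min 1 (if c = 0 then 1 else if c = 1 then norm (pbranch_v \<nu> \<tau> z0 v0) else norm (pbranch_z \<nu> \<tau> z0 v0))"
  have "\<delta> > 0" using sol by (auto simp: \<delta>_def solvable_def split: if_splits)
  moreover have "continuous (at (z0, v0)) ?g"
    using continuous_on_Pair[OF continuous_on_pbranch_deriv] by (simp add: continuous_on_eq_continuous_at)
  ultimately obtain d where d: "d > 0" "\<And>x. dist x (z0, v0) < d \<Longrightarrow> dist (?g x) (?g (z0, v0)) < \<delta>"
    unfolding continuous_at_eps_delta by blast
  define K where "K = norm y0 + norm (?g (z0, v0)) + norm (a ?p, b ?p) + 1"
  have "bounds \<mu> \<nu> c K z v y"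
    if h: "dist z z0 < Min {1, e, d / 2} \<and> dist v v0 < Min {1, e, d / 2} \<and> dist y y0 < Min {1, e, d / 2} \<and> y ^ 4 = pbranch \<nu> \<tau> z v \<and> y \<noteq> 0" for z v y
  proof -
    have x: "pt \<mu> \<nu> t z v y \<in> ?W" using e(2)[of z v y] h by simp
    then have w: "pcoord c z v y \<in> N" by (simp add: coord_gch_pt[OF c])
    have n: "norm p \<le> norm q + 1" if "dist p q < 1" for p q :: "'z::real_normed_vector"
      using norm_triangle_ineq2[of p q] that by (simp add: dist_norm)
    have "norm (a (pcoord c z v y), b (pcoord c z v y)) \<le> norm (a ?p, b ?p) + 1" using w by (intro n) (simp add: N_def dist_commute)
    then have "norm (a (pcoord c z v y)) \<le> K" "norm (b (pcoord c z v y)) \<le> K"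
      using norm_fst_le[of "a (pcoord c z v y)" "b (pcoord c z v y)"] norm_snd_le[of "b (pcoord c z v y)" "a (pcoord c z v y)"]
        norm_ge_zero[of y0] norm_ge_zero[of "?g (z0, v0)"] unfolding K_def by linarith+
    moreover have "s ?c (pcoord c z v y) = val \<mu> \<nu> c z v y" by (rule val_eq[OF c U(1)]) (use x h in simp_all)
    moreover have "pcoord c z v y \<in> ?V" using w by (simp add: N_def)
    ultimately have 1: "norm (val \<mu> \<nu> c z v y (vec2 1 0)) \<le> K" "norm (val \<mu> \<nu> c z v y (vec2 0 1)) \<le> K"
      using ab(3)[of "pcoord c z v y" "vec2 1 0"] ab(3)[of "pcoord c z v y" "vec2 0 1"] by simp_all
    have "dist (z, v) (z0, v0) < d" using dist_Pair_le[of z v z0 v0] h by simp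
    note g = d(2)[OF this, unfolded fst_conv snd_conv]
    have "norm (pbranch_z \<nu> \<tau> z v, pbranch_v \<nu> \<tau> z v) \<le> norm (?g (z0, v0)) + 1"
      unfolding fst_conv snd_conv using g by (intro n) (simp add: \<delta>_def)
    then have 2: "norm (pbranch_z \<nu> \<tau> z v) \<le> K" "norm (pbranch_v \<nu> \<tau> z v) \<le> K"
      using norm_fst_le[of "pbranch_z \<nu> \<tau> z v" "pbranch_v \<nu> \<tau> z v"] norm_snd_le[of "pbranch_v \<nu> \<tau> z v" "pbranch_z \<nu> \<tau> z v"]
        norm_ge_zero[of y0] norm_ge_zero[of "(a ?p, b ?p)"] unfolding K_def by linarith+
    have "norm y \<le> norm y0 + 1" using h by (intro n) simp
    then have 3: "norm y \<le> K" using norm_ge_zero[of "?g (z0, v0)"] norm_ge_zero[of "(a ?p, b ?p)"] unfolding K_def by linarith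
    have "dist (pbranch_z \<nu> \<tau> z v) (pbranch_z \<nu> \<tau> z0 v0) < \<delta>" "dist (pbranch_v \<nu> \<tau> z v) (pbranch_v \<nu> \<tau> z0 v0) < \<delta>"
      using g dist_fst_le[of "(pbranch_z \<nu> \<tau> z v, pbranch_v \<nu> \<tau> z v)" "?g (z0, v0)"] dist_snd_le[of "(pbranch_z \<nu> \<tau> z v, pbranch_v \<nu> \<tau> z v)" "?g (z0, v0)"] by simp_all
    then have "c = 1 \<Longrightarrow> pbranch_v \<nu> \<tau> z v \<noteq> 0" "c \<noteq> 0 \<Longrightarrow> c \<noteq> 1 \<Longrightarrow> pbranch_z \<nu> \<tau> z v \<noteq> 0" unfolding \<delta>_def by auto
    then have "solvable c \<nu> \<tau> z v y" using h by (simp add: solvable_def)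
    then show ?thesis using 1 2 3 unfolding bounds_def by blast
  qed
  moreover have "Min {1, e, d / 2} > 0" using e(1) d(1) by simp
  ultimately have "near \<nu> z0 v0 y0 (bounds \<mu> \<nu> c K)" unfolding near_def by blast
  moreover have "K \<ge> 0" unfolding K_def by (intro add_nonneg_nonneg) simp_all
  ultimately show ?thesis by (intro that)
qed

text \<open>Off the branch curve \<open>z\<close> and \<open>v\<close> are themselves coordinates of
  a chart, and \<open>A\<close> and \<open>B\<close> are the coefficients in it.\<close>

lemma AB_bounded:
  assumes nz: "pbranch \<nu> \<tau> z0 v0 \<noteq> 0"
  shows "\<exists>K. near_fibre \<nu> z0 v0 (\<lambda>z v y. norm (A \<mu> \<nu> z v y) + norm (B \<mu> \<nu> z v y) \<le> K)"
proof (rule bounded_near_fibre)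
  fix y0 assume eq: "y0 ^ 4 = pbranch \<nu> \<tau> z0 v0"
  then have "solvable 0 \<nu> \<tau> z0 v0 y0" using nz by (auto simp: solvable_def)
  then obtain K where K: "near \<nu> z0 v0 y0 (bounds \<mu> \<nu> 0 K)" by (rule near_bounds[OF eq, of 0, rotated]) simp_all
  have h: "norm (A \<mu> \<nu> z v y) + norm (B \<mu> \<nu> z v y) \<le> K + K" if "bounds \<mu> \<nu> 0 K z v y" for z v y
    using that by (simp add: bounds_def A_def B_def)
  show "\<exists>K. near \<nu> z0 v0 y0 (\<lambda>z v y. norm (A \<mu> \<nu> z v y) + norm (B \<mu> \<nu> z v y) \<le> K)"
    by - (rule exI, rule near_mono[OF K], rule h; assumption)
qed

text \<open>\<open>a\<close> and \<open>b\<close> stand for derivatives of the branch polynomial.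
  Each of the two factors has a pole of order at most three in \<open>y\<close>.\<close>

lemma six_bound:
  fixes C D a b y :: complex
  assumes K: "norm C \<le> K" "norm D \<le> K" "norm a \<le> K" "norm b \<le> K" "norm y \<le> K" "y \<noteq> 0"
  shows "norm y ^ 6 * norm ((C + D * (a / (4 * y ^ 3))) * (b / (4 * y ^ 3))) \<le> (K * K ^ 3 + K * K) * K"
proof -
  have K0: "K \<ge> 0" using K(1) norm_ge_zero order_trans by blast
  have "norm y ^ 6 * norm ((C + D * (a / (4 * y ^ 3))) * (b / (4 * y ^ 3))) = norm (y ^ 6 * ((C + D * (a / (4 * y ^ 3))) * (b / (4 * y ^ 3))))"
    by (simp only: norm_mult norm_power)
  also have "y ^ 6 * ((C + D * (a / (4 * y ^ 3))) * (b / (4 * y ^ 3))) = (C * y ^ 3 + D * (a / 4)) * (b / 4)"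
    using K(6) by (simp add: field_simps eval_nat_numeral)
  also have "norm \<dots> = norm (C * y ^ 3 + D * (a / 4)) * norm (b / 4)" by (rule norm_mult)
  also have "\<dots> \<le> (K * K ^ 3 + K * K) * K"
  proof (rule mult_mono)
    have "norm (C * y ^ 3) \<le> K * K ^ 3" unfolding norm_mult norm_power using K K0 by (intro mult_mono power_mono) auto
    moreover have "norm (D * (a / 4)) \<le> K * K" unfolding norm_mult using K K0 by (intro mult_mono) auto
    ultimately show "norm (C * y ^ 3 + D * (a / 4)) \<le> K * K ^ 3 + K * K"
      using norm_triangle_ineq[of "C * y ^ 3" "D * (a / 4)"] by linarith
  qed (use K K0 in auto)
  finally show ?thesis .
qed

text \<open>Over the branch curve one of \<open>z\<close>, \<open>v\<close> is a function of the
  other and \<open>y\<close>. By \<open>AB_solve\<close> the coefficients are then at most quadratic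
  in \<open>yz\<close> and \<open>yv\<close>, each of which has denominator
  \<open>4 * y ^ 3\<close>.\<close>

lemma y6_bounded:
  "\<exists>K. near_fibre \<nu> z0 v0 (\<lambda>z v y. norm y ^ 6 * norm (A \<mu> \<nu> z v y) + norm y ^ 6 * norm (B \<mu> \<nu> z v y) \<le> K)"
proof (rule bounded_near_fibre)
  fix y0 assume eq: "y0 ^ 4 = pbranch \<nu> \<tau> z0 v0"
  obtain c where c: "c < 3" "solvable c \<nu> \<tau> z0 v0 y0" by (rule solvable_exists[OF norm_tau[OF t] eq])
  obtain K where K: "K \<ge> 0" "near \<nu> z0 v0 y0 (bounds \<mu> \<nu> c K)" by (rule near_bounds[OF eq c])
  let ?L = "(K * K ^ 3 + K * K) * K + K ^ 6 * K"
  have h: "norm y ^ 6 * norm (A \<mu> \<nu> z v y) + norm y ^ 6 * norm (B \<mu> \<nu> z v y) \<le> ?L + ?L"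
    if e: "y ^ 4 = pbranch \<nu> \<tau> z v" "y \<noteq> 0" and b: "bounds \<mu> \<nu> c K z v y" for z v y
  proof (rule add_mono)
    let ?C = "val \<mu> \<nu> c z v y (vec2 1 0)" and ?D = "val \<mu> \<nu> c z v y (vec2 0 1)"
    have b': "norm y \<le> K" "norm (pbranch_z \<nu> \<tau> z v) \<le> K" "norm (pbranch_v \<nu> \<tau> z v) \<le> K" "norm ?C \<le> K" "norm ?D \<le> K"
      and sol: "solvable c \<nu> \<tau> z v y" using b by (simp_all add: bounds_def)
    have 0: "norm (0 :: complex) \<le> K" using K(1) by simp
    have p: "0 \<le> K ^ 6 * K" "0 \<le> (K * K ^ 3 + K * K) * K" using K(1) by simp_all
    have y6: "norm y ^ 6 * norm w \<le> K ^ 6 * K" if "norm w \<le> K" for w :: complex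
      using b'(1) that K(1) by (intro mult_mono power_mono) auto
    note s = six_bound[OF b'(4,5,2,3,1) e(2)] six_bound[OF b'(4,5,3,2,1) e(2)]
      six_bound[OF 0 b'(5,2,2,1) e(2)] six_bound[OF 0 b'(5,3,3,1) e(2)]
    consider "c = 0" | "c = 1" | "c = 2" using c(1) by linarith
    then have "norm y ^ 6 * norm (A \<mu> \<nu> z v y) \<le> ?L \<and> norm y ^ 6 * norm (B \<mu> \<nu> z v y) \<le> ?L"
    proof cases
      case 1
      then show ?thesis using y6[OF b'(4)] y6[OF b'(5)] p unfolding A_def B_def 1 by linarith
    next
      case 2
      then show ?thesis using s(1,4) p unfolding AB_solve[OF e disjI1[OF 2] sol] power2_eq_square mult.assoc[symmetric] add_0 by simp
    next
      case 3
      then show ?thesis using s(2,3) p unfolding AB_solve[OF e disjI2[OF 3] sol] power2_eq_square mult.assoc[symmetric] add_0 by simp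
    qed
    then show "norm y ^ 6 * norm (A \<mu> \<nu> z v y) \<le> ?L" "norm y ^ 6 * norm (B \<mu> \<nu> z v y) \<le> ?L" by blast+
  qed
  show "\<exists>K. near \<nu> z0 v0 y0 (\<lambda>z v y. norm y ^ 6 * norm (A \<mu> \<nu> z v y) + norm y ^ 6 * norm (B \<mu> \<nu> z v y) \<le> K)"
    by - (rule exI, rule near_mono[OF K(2)], rule h; assumption)
qed

text \<open>The chain rule along a curve, in a chart with coordinates \<open>(z, v)\<close>. It
  opens the restriction of a section to a curve to one-variable arguments.\<close>

lemma val_holomorphic:
  assumes N: "open N" and f: "Zf holomorphic_on N" "Vf holomorphic_on N" "Yf holomorphic_on N"
    and eq: "\<And>w. w \<in> N \<Longrightarrow> Yf w \<noteq> 0 \<and> Yf w ^ 4 = pbranch \<nu> \<tau> (Zf w) (Vf w)"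
  shows "(\<lambda>w. val \<mu> \<nu> 0 (Zf w) (Vf w) (Yf w) \<xi>) holomorphic_on N"
proof (rule holomorphic_onI)
  fix w0 assume w0: "w0 \<in> N"
  obtain U where U: "good \<mu> \<nu> 0 t U" "pt \<mu> \<nu> t (Zf w0) (Vf w0) (Yf w0) \<in> U"
    by (rule good_at_0) (use eq[OF w0] in auto)
  let ?c = "gch \<mu> \<nu> 0 t U" and ?\<gamma> = "\<lambda>w. vec2 (Zf w) (Vf w)"
  let ?V = "coord ?c ` chart_dom ?c"
  have V: "openC 2 ?V" by (rule is_chart_image[OF chart[OF gch_atlas[OF U(1)]]])
  have W: "openin (mtop X) (chart_dom ?c)" by (rule is_chart_openin[OF chart[OF gch_atlas[OF U(1)]]])
  have x0: "pt \<mu> \<nu> t (Zf w0) (Vf w0) (Yf w0) \<in> chart_dom ?c" using U(2) pt_in_fib[OF eq[OF w0, THEN conjunct2]] by simp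
  obtain e where e: "e > 0" "\<And>z v y. dist z (Zf w0) < e \<Longrightarrow> dist v (Vf w0) < e \<Longrightarrow> dist y (Yf w0) < e \<Longrightarrow>
    y ^ 4 = pbranch \<nu> \<tau> z v \<Longrightarrow> pt \<mu> \<nu> t z v y \<in> chart_dom ?c" using W x0 by (rule openin_X_pt) blast
  have near: "eventually (\<lambda>w. dist (f w) (f w0) < e) (nhds w0)" if "f holomorphic_on N" for f :: "complex \<Rightarrow> complex"
  proof -
    have "isCont f w0" using holomorphic_on_imp_continuous_on[OF that] N w0 by (simp add: continuous_on_eq_continuous_at)
    then have "eventually (\<lambda>w. dist (f w) (f w0) < e) (at w0)" using e(1) by (auto simp: isCont_def tendsto_iff)
    then show ?thesis using e(1) by (simp add: eventually_nhds_conv_at)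
  qed
  have "eventually (\<lambda>w. w \<in> N) (nhds w0)" using N w0 by (rule eventually_nhds_in_open)
  with near[OF f(1)] near[OF f(2)] near[OF f(3)]
  have ev: "eventually (\<lambda>w. s ?c (?\<gamma> w) \<xi> = val \<mu> \<nu> 0 (Zf w) (Vf w) (Yf w) \<xi>) (nhds w0)"
  proof eventually_elim
    case (elim w)
    have "pt \<mu> \<nu> t (Zf w) (Vf w) (Yf w) \<in> U" using e(2)[OF elim(1-3)] eq[OF elim(4)] by simp
    from val_eq[OF _ U(1) this] eq[OF elim(4)] show ?case by (simp add: pcoord_def)
  qed
  have h: "holo_on 2 (\<lambda>z. s ?c z \<xi>) ?V" by (rule holo_form_at[OF V s_holo_form[OF gch_atlas[OF U(1)]]])
  have "?\<gamma> w0 \<in> ?V" using x0 by (rule rev_image_eqI) (simp add: coord_gch_pt pcoord_def)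
  moreover have "eventually (\<lambda>w. ?\<gamma> w \<in> Cn 2) (nhds w0)" by (simp add: vec2_Cn)
  moreover have "((\<lambda>w. ?\<gamma> w i) has_field_derivative (if i = 0 then deriv Zf w0 else deriv Vf w0)) (at w0)" if "i < 2" for i
    using that holomorphic_derivI[OF f(1) N w0] holomorphic_derivI[OF f(2) N w0] by (auto simp: less_2_cases_iff)
  ultimately have "((\<lambda>w. s ?c (?\<gamma> w) \<xi>) has_field_derivative (\<Sum>i<2. partial i (\<lambda>z. s ?c z \<xi>) (?\<gamma> w0) * (if i = 0 then deriv Zf w0 else deriv Vf w0))) (at w0)"
    by (rule holo_on_chain_curve[OF V h])
  then have "((\<lambda>w. val \<mu> \<nu> 0 (Zf w) (Vf w) (Yf w) \<xi>) has_field_derivative (\<Sum>i<2. partial i (\<lambda>z. s ?c z \<xi>) (?\<gamma> w0) * (if i = 0 then deriv Zf w0 else deriv Vf w0))) (at w0)"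
    using DERIV_cong_ev[OF refl ev refl] by simp
  then show "(\<lambda>w. val \<mu> \<nu> 0 (Zf w) (Vf w) (Yf w) \<xi>) field_differentiable at w0 within N"
    unfolding field_differentiable_def using has_field_derivative_at_within by blast
qed

end

section \<open>Functions on fourfold covers of the plane\<close>

text \<open>Riemann's removable singularity theorem, applied to one point of \<open>Z\<close> after
  the other.\<close>

lemma holomorphic_extend_finite:
  assumes "finite Z" "f holomorphic_on - Z"
    and "\<And>z. z \<in> Z \<Longrightarrow> \<exists>e>0. \<exists>K. \<forall>w. dist w z < e \<and> w \<notin> Z \<longrightarrow> norm (f w) \<le> K"
  obtains g :: "complex \<Rightarrow> complex" where "g holomorphic_on UNIV" "\<And>z. z \<notin> Z \<Longrightarrow> g z = f z"
  using assms
proof (induction Z arbitrary: f thesis rule: finite_induct)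
  case empty
  then show ?case by (auto simp: Compl_eq_Diff_UNIV)
next
  case (insert x Z)
  have o: "open (- Z)" using insert.hyps(1) by (simp add: finite_imp_closed open_Compl)
  have x: "x \<in> interior (- Z)" using insert.hyps(2) o by (simp add: interior_open)
  have h: "f holomorphic_on - Z - {x}" using insert.prems(2) by (simp only: Compl_insert)
  obtain e K where e: "e > 0" "\<forall>w. dist w x < e \<and> w \<notin> insert x Z \<longrightarrow> norm (f w) \<le> K" using insert.prems(3)[of x] by blast
  have "eventually (\<lambda>w. w \<in> - Z) (nhds x)" using o insert.hyps(2) by (intro eventually_nhds_in_open) auto
  then have "eventually (\<lambda>w. w \<in> - Z) (at x)" by (simp add: eventually_at_filter eventually_mono)
  moreover have "eventually (\<lambda>w. w \<noteq> x \<and> dist w x < e) (at x)" using e(1) by (auto simp: eventually_at)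
  ultimately have "eventually (\<lambda>w. norm (f w) \<le> K) (at x)"
    by eventually_elim (use e(2) in auto)
  then obtain g where g: "g holomorphic_on - Z" "\<And>z. z \<in> - Z - {x} \<Longrightarrow> g z = f z"
    using holomorphic_on_extend_bounded[OF h x] by blast
  have b: "\<exists>e>0. \<exists>K. \<forall>w. dist w z < e \<and> w \<notin> Z \<longrightarrow> norm (g w) \<le> K" if z: "z \<in> Z" for z
  proof -
    obtain e K where e: "e > 0" "\<forall>w. dist w z < e \<and> w \<notin> insert x Z \<longrightarrow> norm (f w) \<le> K" using insert.prems(3)[of z] z by blast
    have zx: "dist x z > 0" using z insert.hyps(2) by auto
    have "norm (g w) \<le> K" if w: "dist w z < min e (dist x z) \<and> w \<notin> Z" for w
    proof -
      have "w \<noteq> x" using w by auto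
      then show ?thesis using w g(2)[of w] e(2) by auto
    qed
    moreover have "min e (dist x z) > 0" using e(1) zx by simp
    ultimately show ?thesis by blast
  qed
  obtain g' where "g' holomorphic_on UNIV" "\<And>z. z \<notin> Z \<Longrightarrow> g' z = g z" using insert.IH[OF _ g(1) b] by blast
  then show ?case using g(2) by (intro insert.prems(1)[of g']) auto
qed

lemma sum_fourth_roots:
  fixes y c :: complex and h :: "complex \<Rightarrow> complex"
  assumes "y ^ 4 = c" "y \<noteq> 0"
  shows "(\<Sum>w\<in>{w. w ^ 4 = c}. h w) = h y + h (- y) + h (\<i> * y) + h (- (\<i> * y))"
proof -
  have d: "y \<noteq> - y" "y \<noteq> \<i> * y" "y \<noteq> - (\<i> * y)" "- y \<noteq> \<i> * y" "- y \<noteq> - (\<i> * y)" "\<i> * y \<noteq> - (\<i> * y)"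
  proof -
    have i: "(1::complex) \<noteq> \<i>" "(1::complex) \<noteq> - \<i>" "(1::complex) \<noteq> - 1" by (simp_all add: complex_eq_iff)
    have c: "a * y \<noteq> b * y" if "a \<noteq> b" for a b :: complex using that assms(2) by simp
    have j: "- 1 \<noteq> \<i>" "- 1 \<noteq> - \<i>" "\<i> \<noteq> - \<i>" by (simp_all add: complex_eq_iff)
    show "y \<noteq> - y" using c[OF i(3)] by simp
    show "y \<noteq> \<i> * y" using c[OF i(1)] by simp
    show "y \<noteq> - (\<i> * y)" using c[OF i(2)] by simp
    show "- y \<noteq> \<i> * y" using c[OF j(1)] by simp
    show "- y \<noteq> - (\<i> * y)" using c[OF j(2)] by simp
    show "\<i> * y \<noteq> - (\<i> * y)" using c[OF j(3)] by simp
  qed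
  have "{w. w ^ 4 = c} = {y, - y, \<i> * y, - (\<i> * y)}" unfolding assms(1)[symmetric] fourth_root_cases by auto
  then show ?thesis using d by (simp add: add.assoc)
qed

text \<open>Multiplying the \<open>j\<close>-th sum by \<open>y ^ (3 - j)\<close> and adding up
  isolates \<open>w = y\<close>: the weight of another root \<open>w\<close> becomes
  \<open>(y ^ 4 - w ^ 4) / (y - w) = 0\<close>, that of \<open>y\<close> is
  \<open>4 * y ^ 3\<close>.\<close>

lemma fourth_roots_zero:
  fixes y c :: complex and h :: "complex \<Rightarrow> complex"
  assumes y: "y ^ 4 = c" "y \<noteq> 0" and 0: "\<And>j. j < 4 \<Longrightarrow> (\<Sum>w\<in>{w. w ^ 4 = c}. w ^ j * h w) = 0"
  shows "h y = 0"
proof -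
  have "0 = (\<Sum>j<4. y ^ (3 - j) * (\<Sum>w\<in>{w. w ^ 4 = c}. w ^ j * h w))" using 0 by simp
  also have "\<dots> = 4 * y ^ 3 * h y"
    unfolding sum_fourth_roots[OF y] by (simp add: eval_nat_numeral algebra_simps)
  finally show ?thesis using y(2) by simp
qed

definition near_root where
  "near_root P z0 Q \<longleftrightarrow> (\<exists>e>0. \<forall>z y. dist z z0 < e \<and> y ^ 4 = P z \<and> y \<noteq> 0 \<longrightarrow> Q z y)"

lemma roots_bounded:
  fixes P :: "complex \<Rightarrow> complex"
  assumes "P holomorphic_on UNIV" "j \<le> 4"
  shows "\<exists>d>0. \<forall>z y. dist z z0 < d \<and> y ^ 4 = P z \<longrightarrow> norm y ^ j \<le> norm (P z0) + 2"
proof -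
  have "isCont P z0" using holomorphic_on_imp_continuous_on[OF assms(1)] by (simp add: continuous_on_eq_continuous_at)
  from this[unfolded continuous_at_eps_delta, rule_format, of 1]
  obtain d where d: "d > 0" "\<And>z. dist z z0 < d \<Longrightarrow> dist (P z) (P z0) < 1" by auto
  have "norm y ^ j \<le> norm (P z0) + 2" if a: "dist z z0 < d \<and> y ^ 4 = P z" for z y
  proof -
    have "norm (P z) \<le> norm (P z0) + 1" using d(2)[of z] a norm_triangle_ineq2[of "P z" "P z0"] by (simp add: dist_norm)
    then have y4: "norm y ^ 4 \<le> norm (P z0) + 1" using a by (metis norm_power)
    show ?thesis
    proof (cases "norm y \<le> 1")
      case True
      then have "norm y ^ j \<le> 1" by (simp add: power_le_one)
      then show ?thesis using norm_ge_zero[of "P z0"] by linarith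
    next
      case False
      then have "norm y ^ j \<le> norm y ^ 4" using assms(2) by (intro power_increasing) auto
      then show ?thesis using y4 by linarith
    qed
  qed
  then show ?thesis using d(1) by blast
qed

text \<open>The worst case is \<open>j = 3\<close>: the power \<open>k + 3\<close> of a root of size
  \<open>r ^ b\<close>, against a decay of \<open>w\<close> like \<open>1 / r ^ a\<close>.\<close>

lemma power_growth:
  fixes y w :: complex
  assumes y: "norm y \<le> M * r ^ b" and w: "r ^ a * norm w \<le> K" and j: "j < 4" and n: "b * (k + 3) \<le> n + a" and M: "M \<ge> 1" and r: "r \<ge> 1"
  shows "norm (y ^ j * (y ^ k * w)) \<le> M ^ (k + 3) * K * r ^ n"
proof -
  have r1: "1 \<le> r ^ m" for m using r by (rule one_le_power)
  have Mr: "1 \<le> M * r ^ b" using mult_mono[OF M r1[of b]] M by simp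
  have "norm (y ^ j * (y ^ k * w)) = norm y ^ (k + j) * norm w" by (simp add: norm_mult norm_power power_add)
  also have "\<dots> \<le> (M * r ^ b) ^ (k + 3) * norm w"
  proof (rule mult_right_mono)
    have "norm y ^ (k + j) \<le> (M * r ^ b) ^ (k + j)" using y by (intro power_mono) auto
    also have "\<dots> \<le> (M * r ^ b) ^ (k + 3)" using Mr j by (intro power_increasing) auto
    finally show "norm y ^ (k + j) \<le> (M * r ^ b) ^ (k + 3)" .
  qed simp
  also have "\<dots> = M ^ (k + 3) * (r ^ (b * (k + 3)) * norm w)" by (simp only: power_mult_distrib power_mult mult.assoc)
  also have "\<dots> \<le> M ^ (k + 3) * (r ^ (n + a) * norm w)"
    using M r n by (intro mult_left_mono mult_right_mono power_increasing) auto
  also have "r ^ (n + a) * norm w = r ^ n * (r ^ a * norm w)" by (simp add: power_add)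
  also have "M ^ (k + 3) * (r ^ n * (r ^ a * norm w)) \<le> M ^ (k + 3) * (r ^ n * K)"
    using M r w by (intro mult_left_mono) auto
  finally show ?thesis by (simp add: mult_ac)
qed

text \<open>\<open>M \<ge> 1\<close> gives \<open>M \<le> M ^ 4\<close>, which spares the fourth
  root of the constant.\<close>

lemma root_le:
  fixes y p :: complex
  assumes "y ^ 4 = p" "norm p \<le> M * r ^ 4" "M \<ge> 1" "r \<ge> 0"
  shows "norm y \<le> M * r"
proof -
  have "norm y ^ 4 = norm p" using assms(1) norm_power[of y 4] by simp
  also have "\<dots> \<le> M * r ^ 4" by (rule assms(2))
  also have "\<dots> \<le> M ^ 4 * r ^ 4" using assms(3,4) self_le_power[of M 4] by (intro mult_right_mono) auto
  also have "\<dots> = (M * r) ^ 4" by (rule power_mult_distrib[symmetric])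
  finally have "norm y ^ Suc 3 \<le> (M * r) ^ Suc 3" by simp
  moreover have "0 \<le> M * r" using assms(3,4) by (intro mult_nonneg_nonneg) linarith+
  ultimately show ?thesis by (rule power_le_imp_le_base)
qed

text \<open>A function on the curve y^4 = P(z) outside its branch points: holomorphic along each
  local branch \<open>f\<close> of the root, and locally bounded also near the zeros of
  \<open>P\<close>.\<close>

locale cover_function =
  fixes P :: "complex \<Rightarrow> complex" and h :: "complex \<Rightarrow> complex \<Rightarrow> complex"
  assumes P: "P holomorphic_on UNIV" "finite {z. P z = 0}"
    and hol: "\<And>N f. open N \<Longrightarrow> f holomorphic_on N \<Longrightarrow> (\<And>z. z \<in> N \<Longrightarrow> f z \<noteq> 0 \<and> f z ^ 4 = P z) \<Longrightarrow> (\<lambda>z. h z (f z)) holomorphic_on N"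
    and bounded: "\<And>z0. \<exists>K. near_root P z0 (\<lambda>z y. norm (h z y) \<le> K)"
begin

lemma norm_sum_roots_le:
  fixes f :: "complex \<Rightarrow> complex"
  assumes "\<And>y. y ^ 4 = P z \<Longrightarrow> norm (f y) \<le> K" "P z \<noteq> 0"
  shows "norm (\<Sum>y\<in>{y. y ^ 4 = P z}. f y) \<le> 4 * K"
proof -
  obtain y where y: "y ^ 4 = P z" using fourth_root_exists by blast
  then have y0: "y \<noteq> 0" using assms(2) by auto
  have r: "(- y) ^ 4 = P z" "(\<i> * y) ^ 4 = P z" "(- (\<i> * y)) ^ 4 = P z" using y by (simp_all add: power_mult_distrib)
  have "norm (f y) \<le> K" "norm (f (- y)) \<le> K" "norm (f (\<i> * y)) \<le> K" "norm (f (- (\<i> * y))) \<le> K"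
    using assms(1) y r by blast+
  then show ?thesis
    unfolding sum_fourth_roots[OF y y0]
    using norm_triangle_ineq[of "f y + f (- y) + f (\<i> * y)" "f (- (\<i> * y))"]
      norm_triangle_ineq[of "f y + f (- y)" "f (\<i> * y)"] norm_triangle_ineq[of "f y" "f (- y)"] by linarith
qed

text \<open>The sum over the four roots is single-valued in \<open>z\<close>. It extends over the
  zeros of \<open>P\<close> by local boundedness, and Liouville turns its growth into a degree
  bound.\<close>

lemma trace_polynomial:
  assumes growth: "\<And>z y. norm z \<ge> R \<Longrightarrow> y ^ 4 = P z \<Longrightarrow> y \<noteq> 0 \<Longrightarrow> norm (h z y) \<le> K * norm z ^ n"
  obtains p :: "complex poly" where "degree p \<le> n" "\<And>z. P z \<noteq> 0 \<Longrightarrow> poly p z = (\<Sum>y\<in>{y. y ^ 4 = P z}. h z y)"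
proof -
  define \<gamma> where "\<gamma> z = (\<Sum>y\<in>{y. y ^ 4 = P z}. h z y)" for z
  have \<gamma>h: "\<gamma> holomorphic_on - {z. P z = 0}"
  proof (rule holomorphic_onI)
    fix z0 assume z0: "z0 \<in> - {z. P z = 0}"
    obtain y0 where y0: "y0 ^ 4 = P z0" using fourth_root_exists by blast
    \<comment> \<open>On \<open>N\<close> the quotient \<open>P z / P z0\<close> stays in the unit
      disc around 1, where the principal logarithm yields a branch \<open>f\<close> of the
      root.\<close>
    define N where "N = (\<lambda>z. P z / P z0) -` ball 1 1"
    have cont: "continuous_on UNIV (\<lambda>z. P z / P z0)" 
      by (rule continuous_on_divide[OF holomorphic_on_imp_continuous_on[OF P(1)] continuous_on_const]) (use z0 in simp)
    have N: "open N" "z0 \<in> N" using open_vimage[OF open_ball cont] z0 by (simp_all add: N_def)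
    define f where "f z = y0 * exp (Ln (P z / P z0) / 4)" for z
    have npos: "P z / P z0 \<notin> \<real>\<^sub>\<le>\<^sub>0" if "z \<in> N" for z
    proof
      assume n: "P z / P z0 \<in> \<real>\<^sub>\<le>\<^sub>0"
      then have "Re (P z / P z0) \<le> 0" by (auto elim!: nonpos_Reals_cases)
      then have "1 \<le> norm (1 - P z / P z0)" using complex_Re_le_cmod[of "1 - P z / P z0"] by simp
      then show False using \<open>z \<in> N\<close> by (simp add: N_def dist_norm)
    qed
    have fh: "f holomorphic_on N"
      unfolding f_def by (intro holomorphic_intros holomorphic_on_subset[OF P(1)]) (use npos z0 in auto)
    have f4: "f z \<noteq> 0 \<and> f z ^ 4 = P z" if z: "z \<in> N" for z
    proof -
      have nz: "P z / P z0 \<noteq> 0" using npos[OF z] by auto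
      have "f z ^ 4 = y0 ^ 4 * exp (Ln (P z / P z0))" by (simp add: f_def power_mult_distrib exp_of_nat_mult[symmetric])
      also have "\<dots> = P z" using nz z0 by (simp add: y0)
      finally show ?thesis using nz by auto
    qed
    have k4: "f z \<noteq> 0 \<Longrightarrow> f z ^ 4 = P z \<Longrightarrow> k ^ 4 = 1 \<Longrightarrow> k * f z \<noteq> 0 \<and> (k * f z) ^ 4 = P z" for k z
      by (auto simp: power_mult_distrib)
    have "(\<lambda>z. h z (k * f z)) holomorphic_on N" if "k ^ 4 = 1" for k
      by (rule hol[OF N(1)]) (use fh f4 k4[OF _ _ that] in \<open>auto intro!: holomorphic_intros\<close>)
    from this[of 1] this[of "-1"] this[of \<i>] this[of "- \<i>"]
    have "(\<lambda>z. h z (f z) + h z (- f z) + h z (\<i> * f z) + h z (- (\<i> * f z))) holomorphic_on N"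
      by (intro holomorphic_on_add) simp_all
    moreover have "\<gamma> z = h z (f z) + h z (- f z) + h z (\<i> * f z) + h z (- (\<i> * f z))" if "z \<in> N" for z
      using sum_fourth_roots f4[OF that] unfolding \<gamma>_def by blast
    ultimately have "\<gamma> holomorphic_on N" by (simp cong: holomorphic_cong)
    then have "\<gamma> field_differentiable at z0" using N holomorphic_on_imp_differentiable_at by blast
    then show "\<gamma> field_differentiable at z0 within - {z. P z = 0}" by (rule field_differentiable_at_within)
  qed
  have "\<exists>e>0. \<exists>K. \<forall>w. dist w z < e \<and> w \<notin> {z. P z = 0} \<longrightarrow> norm (\<gamma> w) \<le> K" for z
  proof -
    obtain e K where e: "e > 0" "\<forall>w y. dist w z < e \<and> y ^ 4 = P w \<and> y \<noteq> 0 \<longrightarrow> norm (h w y) \<le> K" using bounded[unfolded near_root_def] by blast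
    have "norm (\<gamma> w) \<le> 4 * K" if "dist w z < e" "P w \<noteq> 0" for w
      unfolding \<gamma>_def
    proof (rule norm_sum_roots_le[OF _ that(2)])
      fix y assume "y ^ 4 = P w"
      moreover from this have "y \<noteq> 0" using that(2) by auto
      ultimately show "norm (h w y) \<le> K" using e(2) that(1) by blast
    qed
    then have "\<exists>K. \<forall>w. dist w z < e \<and> w \<notin> {z. P z = 0} \<longrightarrow> norm (\<gamma> w) \<le> K" by (intro exI[of _ "4 * K"]) simp
    with e(1) show ?thesis by - (rule exI[of _ e], rule conjI)
  qed
  note ext = this
  obtain g where g: "g holomorphic_on UNIV" "\<And>z. z \<notin> {z. P z = 0} \<Longrightarrow> g z = \<gamma> z"
    by (rule holomorphic_extend_finite[OF P(2) \<gamma>h ext]) (rule that; assumption)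
  have "bounded {z. P z = 0}" using P(2) by (rule finite_imp_bounded)
  then obtain S where S: "\<And>z. P z = 0 \<Longrightarrow> norm z \<le> S" unfolding bounded_iff by blast
  define p where "p = (\<Sum>k\<le>n. Polynomial.monom ((deriv ^^ k) g 0 / fact k) k)"
  have "g z = poly p z" for z
  proof -
    have "norm (g z) \<le> (4 * K) * norm z ^ n" if "max R (S + 1) \<le> norm z" for z
    proof -
      have nz: "P z \<noteq> 0" using S[of z] that by auto
      have "norm (\<gamma> z) \<le> 4 * (K * norm z ^ n)"
        unfolding \<gamma>_def by (rule norm_sum_roots_le[OF growth nz]) (use nz that in auto)
      then show ?thesis using g(2)[of z] nz by simp
    qed
    from Liouville_polynomial[OF g(1), of "max R (S + 1)" "4 * K" n z, OF this] show ?thesis by (simp add: p_def poly_sum poly_monom)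
  qed
  moreover have "degree p \<le> n"
    unfolding p_def by (rule degree_sum_le) (auto intro: order_trans[OF degree_monom_le])
  ultimately show ?thesis using that[of p] g(2) by (simp add: \<gamma>_def)
qed

text \<open>The four traces of \<open>y ^ j * h\<close>, \<open>j < 4\<close>, are polynomials of
  degree at most \<open>n\<close> with more than \<open>n\<close> zeros; once they vanish, so does
  \<open>h\<close> by \<open>fourth_roots_zero\<close>. At a zero of \<open>P\<close>, a bound by a
  multiple of \<open>norm y\<close> makes the traces tend to 0.\<close>

lemma zero_if_many_zeros:
  assumes growth: "\<And>j z y. j < 4 \<Longrightarrow> norm z \<ge> R \<Longrightarrow> y ^ 4 = P z \<Longrightarrow> y \<noteq> 0 \<Longrightarrow> norm (y ^ j * h z y) \<le> K * norm z ^ n"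
    and Z: "finite Z" "card Z > n"
    and zero: "\<And>z. z \<in> Z \<Longrightarrow> (P z \<noteq> 0 \<and> (\<forall>y. y ^ 4 = P z \<longrightarrow> h z y = 0)) \<or>
      (P z = 0 \<and> (\<exists>K. near_root P z (\<lambda>w y. norm (h w y) \<le> K * norm y)))"
    and y: "y ^ 4 = P z" "y \<noteq> 0"
  shows "h z y = 0"
proof -
  have "(\<Sum>w\<in>{w. w ^ 4 = P z}. w ^ j * h z w) = 0" if j: "j < 4" for j
  proof -
    interpret c: cover_function P "\<lambda>z y. y ^ j * h z y"
    proof
      show "P holomorphic_on UNIV" "finite {z. P z = 0}" by (fact P)+
      show "(\<lambda>z. f z ^ j * h z (f z)) holomorphic_on N"
        if "open N" "f holomorphic_on N" "\<And>z. z \<in> N \<Longrightarrow> f z \<noteq> 0 \<and> f z ^ 4 = P z" for N f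
        by (intro holomorphic_on_mult holomorphic_on_power hol that)
      show "\<exists>K. near_root P z0 (\<lambda>z y. norm (y ^ j * h z y) \<le> K)" for z0
      proof -
        obtain e K where e: "e > 0" "\<forall>z y. dist z z0 < e \<and> y ^ 4 = P z \<and> y \<noteq> 0 \<longrightarrow> norm (h z y) \<le> K" using bounded[unfolded near_root_def] by blast
        obtain d where d: "d > 0" "\<And>z y. dist z z0 < d \<Longrightarrow> y ^ 4 = P z \<Longrightarrow> norm y ^ j \<le> norm (P z0) + 2"
          using roots_bounded[OF P(1), of j z0] j by auto
        have "norm (y ^ j * h z y) \<le> (norm (P z0) + 2) * K" if a: "dist z z0 < min e d \<and> y ^ 4 = P z \<and> y \<noteq> 0" for z y
          unfolding norm_mult norm_power using d(2)[of z y] e(2) a by (intro mult_mono) auto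
        moreover have "min e d > 0" using e(1) d(1) by simp
        ultimately show ?thesis unfolding near_root_def by blast
      qed
    qed
    obtain p :: "complex poly" where p: "degree p \<le> n" "\<And>z. P z \<noteq> 0 \<Longrightarrow> poly p z = (\<Sum>y\<in>{y. y ^ 4 = P z}. y ^ j * h z y)"
      by (rule c.trace_polynomial[where R = R, OF growth[OF j]]) (assumption+, rule that)
    have root: "poly p z = 0" if z: "z \<in> Z" for z
    proof (cases "P z = 0")
      case False
      then have "\<forall>y. y ^ 4 = P z \<longrightarrow> h z y = 0" using zero[OF z] by blast
      then show ?thesis using p(2)[OF False] by simp
    next
      case True
      then obtain e K where e: "e > 0" "\<forall>w y. dist w z < e \<and> y ^ 4 = P w \<and> y \<noteq> 0 \<longrightarrow> norm (h w y) \<le> K * norm y"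
        using zero[OF z] unfolding near_root_def by blast
      have "(poly p \<longlongrightarrow> 0) (at z)"
      proof (rule tendsto_norm_zero_cancel, rule tendstoI)
        fix \<epsilon> :: real assume \<epsilon>: "\<epsilon> > 0"
        \<comment> \<open>The bound 1 gives \<open>norm y ^ j \<le> 1\<close>; the other one makes
          the four summands add up to less than \<open>\<epsilon>\<close>.\<close>
        define \<delta> where "\<delta> = min 1 (\<epsilon> / (4 * (\<bar>K\<bar> + 1)))"
        have \<delta>: "\<delta> > 0" "\<delta> \<le> 1" "4 * ((\<bar>K\<bar> + 1) * \<delta>) \<le> \<epsilon>"
        proof -
          show "\<delta> > 0" "\<delta> \<le> 1" using \<epsilon> by (auto simp: \<delta>_def)
          have "\<delta> \<le> \<epsilon> / (4 * (\<bar>K\<bar> + 1))" by (simp add: \<delta>_def)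
          then show "4 * ((\<bar>K\<bar> + 1) * \<delta>) \<le> \<epsilon>" by (simp add: field_simps)
        qed
        have "isCont P z" using holomorphic_on_imp_continuous_on[OF P(1)] by (simp add: continuous_on_eq_continuous_at)
        from this[unfolded continuous_at_eps_delta, rule_format, of "\<delta> ^ 4"]
        obtain d where d: "d > 0" "\<And>w. dist w z < d \<Longrightarrow> dist (P w) (P z) < \<delta> ^ 4" using \<delta>(1) by auto
        have "open (- ({z. P z = 0} - {z}))" by (rule open_Compl[OF finite_imp_closed[OF finite_Diff[OF P(2)]]])
        then have "eventually (\<lambda>w. w \<in> - ({z. P z = 0} - {z})) (nhds z)" by (rule eventually_nhds_in_open) simp
        then have "eventually (\<lambda>w. w \<in> - ({z. P z = 0} - {z})) (at z)" unfolding eventually_nhds_conv_at by blast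
        moreover have "eventually (\<lambda>w. w \<noteq> z \<and> dist w z < min d e) (at z)"
          unfolding eventually_at using d(1) e(1) by (intro exI[of _ "min d e"]) auto
        ultimately show "eventually (\<lambda>w. dist (norm (poly p w)) 0 < \<epsilon>) (at z)"
        proof eventually_elim
          case (elim w)
          then have Pw: "P w \<noteq> 0" by auto
          have "norm (y ^ j * h w y) \<le> \<bar>K\<bar> * \<delta>" if y4: "y ^ 4 = P w" for y
          proof -
            have y0: "y \<noteq> 0" using y4 Pw by auto
            have "norm y ^ 4 < \<delta> ^ 4" using d(2)[of w] elim True y4 by (simp add: dist_norm norm_power[symmetric])
            then have ny: "norm y < \<delta>" using \<delta>(1) by (simp add: power_less_imp_less_base)
            have "norm y ^ j \<le> 1" using ny \<delta>(2) by (intro power_le_one) auto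
            moreover have "norm (h w y) \<le> \<bar>K\<bar> * \<delta>"
            proof -
              have "norm (h w y) \<le> K * norm y" using e(2) elim y4 y0 by auto
              also have "\<dots> \<le> \<bar>K\<bar> * norm y" by (intro mult_right_mono) auto
              also have "\<dots> \<le> \<bar>K\<bar> * \<delta>" using ny by (intro mult_left_mono) auto
              finally show ?thesis .
            qed
            ultimately have "norm y ^ j * norm (h w y) \<le> 1 * (\<bar>K\<bar> * \<delta>)" by (intro mult_mono) auto
            then show ?thesis by (simp add: norm_mult norm_power)
          qed
          from c.norm_sum_roots_le[OF this Pw] have "norm (poly p w) \<le> 4 * (\<bar>K\<bar> * \<delta>)" unfolding p(2)[OF Pw] .
          also have "\<dots> < 4 * ((\<bar>K\<bar> + 1) * \<delta>)" using \<delta>(1) by (simp add: distrib_right)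
          finally show ?case using \<delta>(3) by simp
        qed
      qed
      moreover have "(poly p \<longlongrightarrow> poly p z) (at z)" using isCont_def poly_isCont by blast
      ultimately show ?thesis using LIM_unique by blast
    qed
    have "p = 0"
    proof (rule ccontr)
      assume "p \<noteq> 0"
      then have "card {z. poly p z = 0} \<le> degree p" "finite {z. poly p z = 0}" using card_poly_roots_bound poly_roots_finite by blast+
      moreover have "Z \<subseteq> {z. poly p z = 0}" using root by blast
      ultimately have "card Z \<le> degree p" using card_mono by (meson order_trans)
      then show False using Z(2) p(1) by simp
    qed
    moreover have "P z \<noteq> 0" using y by auto
    ultimately show ?thesis using p(2)[of z] by simp
  qed
  from fourth_roots_zero[OF y this] show ?thesis .
qed

end

section \<open>Restriction of a section to curves in the plane\<close>

definition E :: "(nat \<Rightarrow> complex) set" where "E = {vec2 1 0, vec2 0 1}"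

context fibre_section
begin

lemma near_curve:
  assumes Q: "near_fibre True (Zf w0) (Vf w0) Q" and f: "Zf holomorphic_on UNIV" "Vf holomorphic_on UNIV"
  shows "near_root (\<lambda>w. pbranch True \<tau> (Zf w) (Vf w)) w0 (\<lambda>w y. Q (Zf w) (Vf w) y)"
proof -
  obtain e where e: "e > 0" "\<And>z v y. dist z (Zf w0) < e \<and> dist v (Vf w0) < e \<and> y ^ 4 = pbranch True \<tau> z v \<and> y \<noteq> 0 \<longrightarrow> Q z v y"
    using Q unfolding near_fibre_def by blast
  have "\<exists>d>0. \<forall>w. dist w w0 < d \<longrightarrow> dist (g w) (g w0) < e" if "g holomorphic_on UNIV" for g :: "complex \<Rightarrow> complex"
    using holomorphic_on_imp_continuous_on[OF that] e(1)
    by (auto simp: continuous_on_eq_continuous_at continuous_at_eps_delta)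
  from this[OF f(1)] this[OF f(2)] obtain d1 d2 where d: "d1 > 0" "\<forall>w. dist w w0 < d1 \<longrightarrow> dist (Zf w) (Zf w0) < e"
    "d2 > 0" "\<forall>w. dist w w0 < d2 \<longrightarrow> dist (Vf w) (Vf w0) < e" by blast
  then show ?thesis unfolding near_root_def using e(2) by (intro exI[of _ "min d1 d2"]) simp
qed

text \<open>The weight \<open>y ^ n\<close> clears the poles over the branch curve:
  \<open>n = 6\<close> serves in general, and \<open>n = 4\<close> for \<open>A\<close> once
  \<open>B\<close> is known to vanish.\<close>

lemma cover_val:
  assumes f: "Zf holomorphic_on UNIV" "Vf holomorphic_on UNIV" and fin: "finite {w. pbranch True \<tau> (Zf w) (Vf w) = 0}"
    and b: "\<And>w0. \<exists>K. near_root (\<lambda>w. pbranch True \<tau> (Zf w) (Vf w)) w0 (\<lambda>w y. norm (y ^ n * val False True 0 (Zf w) (Vf w) y \<xi>) \<le> K)"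
  shows "cover_function (\<lambda>w. pbranch True \<tau> (Zf w) (Vf w)) (\<lambda>w y. y ^ n * val False True 0 (Zf w) (Vf w) y \<xi>)"
proof (rule cover_function.intro[OF _ fin _ b])
  show "(\<lambda>w. pbranch True \<tau> (Zf w) (Vf w)) holomorphic_on UNIV"
    unfolding pbranch_def branch_def quartic_def qcoord_def if_True by (intro holomorphic_intros f)
  show "(\<lambda>w. g w ^ n * val False True 0 (Zf w) (Vf w) (g w) \<xi>) holomorphic_on N"
    if "open N" "g holomorphic_on N" "\<And>w. w \<in> N \<Longrightarrow> g w \<noteq> 0 \<and> g w ^ 4 = pbranch True \<tau> (Zf w) (Vf w)" for N g
    using that holomorphic_on_subset[OF f(1)] holomorphic_on_subset[OF f(2)] by (intro holomorphic_intros val_holomorphic) auto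
qed

lemma cover_val_6:
  assumes f: "Zf holomorphic_on UNIV" "Vf holomorphic_on UNIV" and fin: "finite {w. pbranch True \<tau> (Zf w) (Vf w) = 0}"
    and \<xi>: "\<xi> \<in> E"
  shows "cover_function (\<lambda>w. pbranch True \<tau> (Zf w) (Vf w)) (\<lambda>w y. y ^ 6 * val False True 0 (Zf w) (Vf w) y \<xi>)"
proof (rule cover_val[OF f fin])
  fix w0
  obtain K where "near_fibre True (Zf w0) (Vf w0) (\<lambda>z v y. norm y ^ 6 * norm (A False True z v y) + norm y ^ 6 * norm (B False True z v y) \<le> K)"
    using y6_bounded by blast
  note n = near_curve[of Zf w0 Vf, OF this f]
  have "norm (y ^ 6 * val False True 0 z v y \<xi>) \<le> K"
    if "norm y ^ 6 * norm (A False True z v y) + norm y ^ 6 * norm (B False True z v y) \<le> K" for z v y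
  proof -
    have "0 \<le> norm y ^ 6 * norm (A False True z v y)" "0 \<le> norm y ^ 6 * norm (B False True z v y)" by simp_all
    then have "norm y ^ 6 * norm (A False True z v y) \<le> K" "norm y ^ 6 * norm (B False True z v y) \<le> K" using that by linarith+
    then show ?thesis using \<xi> unfolding A_def B_def E_def by (auto simp: norm_mult norm_power)
  qed
  then show "\<exists>K. near_root (\<lambda>w. pbranch True \<tau> (Zf w) (Vf w)) w0 (\<lambda>w y. norm (y ^ 6 * val False True 0 (Zf w) (Vf w) y \<xi>) \<le> K)"
    using n unfolding near_root_def by blast
qed

text \<open>The exceptional sets \<open>Z\<close> and \<open>Bd z\<close> let the curve arguments
  ignore finitely many curves.\<close>

lemma s_zeroI:
  assumes Z: "finite Z" "\<And>z. z \<notin> Z \<Longrightarrow> finite (Bd z)"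
    and 0: "\<And>z v y \<xi>. z \<notin> Z \<Longrightarrow> v \<notin> Bd z \<Longrightarrow> y \<noteq> 0 \<Longrightarrow> y ^ 4 = pbranch True \<tau> z v \<Longrightarrow> \<xi> \<in> E \<Longrightarrow> val False True 0 z v y \<xi> = 0"
  shows "s = (\<lambda>c z \<xi>. 0)"
proof (rule H0_eq_zeroI[OF s])
  fix W assume W: "openin (mtop X) W" "W \<noteq> {}"
  obtain z v y where p: "z \<notin> Z" "v \<notin> Bd z" "y \<noteq> 0" "y ^ 4 = pbranch True \<tau> z v" "pt False True t z v y \<in> W"
    by (rule dense_pt[OF W Z])
  obtain U where U: "good False True 0 t U" "pt False True t z v y \<in> U" by (rule good_at_0[OF p(4,3)])
  have "val False True 0 z v y = (\<lambda>\<xi>. 0)"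
    using val_AB[OF p(4,3), of False] 0[OF p(1-4)] by (simp add: fun_eq_iff A_def B_def E_def)
  then have "s (gch False True 0 t U) (coord (gch False True 0 t U) (pt False True t z v y)) = (\<lambda>\<xi>. 0)"
    using val_eq[OF _ U p(4)] by (simp add: coord_gch_pt)
  then show "\<exists>x\<in>W. \<exists>d\<in>atlas X. x \<in> chart_dom d \<and> s d (coord d x) = (\<lambda>\<xi>. 0)"
    using p(5) gch_atlas[OF U(1)] U(2) pt_in_fib[OF p(4)] by (intro bexI[of _ "pt False True t z v y"] bexI[of _ "gch False True 0 t U"] conjI) simp_all
qed

end

section \<open>The fibre without sections\<close>

lemma card_fourth_roots: "c \<noteq> 0 \<Longrightarrow> card {w::complex. w ^ 4 = c} = 4"
proof -
  assume c: "c \<noteq> 0"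
  obtain y where y: "y ^ 4 = c" using fourth_root_exists by blast
  then have "y \<noteq> 0" using c by auto
  from sum_fourth_roots[OF y this, of "\<lambda>_. 1"]
  have "of_nat (card {w. w ^ 4 = c}) = (of_nat 4 :: complex)" by simp
  then show ?thesis by (simp only: of_nat_eq_iff)
qed

locale section_1 = fibre_section +
  assumes one: "tau t = 1"
begin

definition g :: "complex \<Rightarrow> complex \<Rightarrow> complex" where "g u z = 1 + z ^ 4 * u ^ 4 + 4 * (z ^ 4 + u ^ 4)"

lemma branch_1: "pbranch True \<tau> z (z + u) = g u z"
  by (simp add: one g_def pbranch_def branch_def quartic_def qcoord_def algebra_simps eval_nat_numeral)

lemma branch_1_v: "pbranch_v True \<tau> z (z + u) = 4 * u ^ 3 * (z ^ 4 + 4)"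
  by (simp add: one pbranch_v_def branch_simps algebra_simps eval_nat_numeral)

lemma branch_1_z: "pbranch_z True \<tau> z z = 16 * z ^ 3"
  by (simp add: one pbranch_z_def branch_simps algebra_simps eval_nat_numeral)

lemma qcoord_1: "qcoord \<tau> z 1 (z + u) = z * u"
  by (simp add: one qcoord_def algebra_simps power2_eq_square)

text \<open>For \<open>z\<^sup>4 = -1/4\<close> the fibre over \<open>z\<close> splits into four lines \<open>y = k (v - z)\<close>, and
  \<open>(v - z)\<^sup>3 B\<close> extends to an entire function on each of them.\<close>

lemma B_lines:
  assumes z: "z ^ 4 = - 1 / 4" and eq: "y ^ 4 = g u0 z" and y: "y \<noteq> 0"
  shows "B \<mu> True z (z + u0) y = 0"
proof -
  have z0: "z \<noteq> 0" using z by auto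
  have P: "g u z = 15 / 4 * u ^ 4" for u unfolding g_def z by (simp add: field_simps)
  have u0: "u0 \<noteq> 0" using eq y unfolding P by auto
  define k where "k = y / u0"
  have k4: "k ^ 4 = 15 / 4" using eq u0 unfolding P by (simp add: k_def power_divide)
  then have k0: "k \<noteq> 0" by auto
  have keq: "(k * u) ^ 4 = pbranch True \<tau> z (z + u)" for u unfolding branch_1 P power_mult_distrib k4 ..
  define F :: "complex \<Rightarrow> complex" where "F u = u ^ 3 * B \<mu> True z (z + u) (k * u)" for u
  have "(\<lambda>u. val \<mu> True 0 z (z + u) (k * u) (vec2 0 1)) holomorphic_on - {0}"
    by (rule val_holomorphic) (use keq k0 in \<open>auto intro!: holomorphic_intros\<close>)
  then have Fh: "F holomorphic_on - {0}" unfolding F_def[abs_def] B_def by (intro holomorphic_intros)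
  have Fb: "\<exists>e>0. \<exists>K. \<forall>w. dist w x < e \<and> w \<notin> {0} \<longrightarrow> norm (F w) \<le> K" if x: "x \<in> {0}" for x
  proof -
    have p0: "0 ^ 4 = pbranch True \<tau> z z" using branch_1[of z 0] P[of 0] by simp
    \<comment> \<open>At \<open>u = 0\<close> the derivative by \<open>v\<close> vanishes but the
      derivative by \<open>z\<close> does not, so \<open>v\<close> and \<open>y\<close> are the
      coordinates there.\<close>
    have sol: "solvable 2 True \<tau> z z 0" using z0 by (simp add: solvable_def branch_1_z)
    obtain K where K: "K \<ge> 0" "near True z z 0 (bounds \<mu> True 2 K)" by (rule near_bounds[OF p0 _ sol]) simp
    from K(2) obtain e where e: "e > 0" "\<And>z' v y. dist z' z < e \<Longrightarrow> dist v z < e \<Longrightarrow> dist y 0 < e \<Longrightarrow> y ^ 4 = pbranch True \<tau> z' v \<Longrightarrow> y \<noteq> 0 \<Longrightarrow> bounds \<mu> True 2 K z' v y"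
      unfolding near_def by blast
    have nk: "norm k > 0" using k0 by simp
    define L where "L = (K + K * norm (15 / (4 * k ^ 3))) * (K / norm (4 * k ^ 3))"
    have "norm (F u) \<le> L" if u: "norm u < min e (e / norm k)" "u \<noteq> 0" for u
    proof -
      let ?C = "val \<mu> True 2 z (z + u) (k * u) (vec2 1 0)" and ?D = "val \<mu> True 2 z (z + u) (k * u) (vec2 0 1)" and ?z = "pbranch_z True \<tau> z (z + u)"
      have "norm (k * u) < e" using u(1) nk by (simp add: norm_mult field_simps)
      moreover have ku: "k * u \<noteq> 0" using k0 u(2) by simp
      ultimately have "bounds \<mu> True 2 K z (z + u) (k * u)" using u(1) e(1) keq by (intro e(2)) (simp_all add: dist_norm)
      then have b: "norm ?z \<le> K" "norm ?C \<le> K" "norm ?D \<le> K" and sol: "solvable 2 True \<tau> z (z + u) (k * u)" unfolding bounds_def by blast+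
      \<comment> \<open>On the line \<open>yv\<close> is constant, so only \<open>yz\<close>
        contributes a pole, of order three; therefore \<open>u ^ 3\<close> suffices in place of a
        sixth power.\<close>
      have "pbranch_v True \<tau> z (z + u) / (4 * (k * u) ^ 3) = 15 / (4 * k ^ 3)"
        unfolding branch_1_v z using u(2) by (simp add: power_mult_distrib)
      then have "F u = - ((?C + ?D * (15 / (4 * k ^ 3))) * (?z / (4 * k ^ 3)))"
        unfolding F_def AB_solve(2)[OF keq ku disjI2[OF refl] sol] using u(2) by (simp add: power_mult_distrib)
      then have "norm (F u) = norm (?C + ?D * (15 / (4 * k ^ 3))) * (norm ?z / norm (4 * k ^ 3))"
        by (simp only: norm_minus_cancel norm_mult[of "?C + ?D * (15 / (4 * k ^ 3))"] norm_divide)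
      also have "\<dots> \<le> L"
        unfolding L_def
      proof (rule mult_mono)
        have "norm (?D * (15 / (4 * k ^ 3))) \<le> K * norm (15 / (4 * k ^ 3))" unfolding norm_mult[of ?D] by (rule mult_right_mono[OF b(3)]) simp
        then show "norm (?C + ?D * (15 / (4 * k ^ 3))) \<le> K + K * norm (15 / (4 * k ^ 3))"
          using norm_triangle_ineq[of ?C "?D * (15 / (4 * k ^ 3))"] b(2) by linarith
        show "norm ?z / norm (4 * k ^ 3) \<le> K / norm (4 * k ^ 3)" by (rule divide_right_mono[OF b(1)]) simp
      qed (use K(1) in auto)
      finally show ?thesis .
    qed
    then have "\<forall>w. dist w x < min e (e / norm k) \<and> w \<notin> {0} \<longrightarrow> norm (F w) \<le> L" using x by auto
    moreover have "min e (e / norm k) > 0" using e(1) nk by simp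
    ultimately show ?thesis by - (rule exI, rule conjI, assumption, rule exI)
  qed
  obtain f where f: "f holomorphic_on UNIV" "\<And>u. u \<notin> {0} \<Longrightarrow> f u = F u"
    using holomorphic_extend_finite[OF _ Fh Fb] by blast
  have p1: "pbranch False \<tau> z 0 \<noteq> 0" using z by (simp add: one pbranch_def branch_def quartic_def qcoord_def)
  obtain e K where e: "e > 0" "\<And>z' v y. dist z' z < e \<Longrightarrow> dist v 0 < e \<Longrightarrow> y ^ 4 = pbranch False \<tau> z' v \<Longrightarrow> y \<noteq> 0 \<Longrightarrow>
    norm (A \<mu> False z' v y) + norm (B \<mu> False z' v y) \<le> K" using AB_bounded[OF p1, of \<mu>] unfolding near_fibre_def by blast
  \<comment> \<open>At infinity \<open>B\<close> decays like \<open>1 / v ^ 4\<close> by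
    \<open>AB_change_s\<close>, so \<open>u * f u\<close>, which is \<open>u ^ 4 * B\<close>, is
    bounded. By Liouville it is constant, and it vanishes at \<open>u = 0\<close>.\<close>
  have "u * f u = (\<Sum>k\<le>0. (deriv ^^ k) (\<lambda>u. u * f u) 0 / fact k * u ^ k)" for u
  proof (rule Liouville_polynomial)
    show "(\<lambda>u. u * f u) holomorphic_on UNIV" by (intro holomorphic_intros f)
    fix u :: complex assume u: "max 1 (max (2 * norm z) (4 / e)) \<le> norm u"
    have n1: "norm (z + u) \<ge> norm u / 2"
      using norm_diff_ineq[of u z] u by (simp add: add.commute)
    have u1: "u \<noteq> 0" "z + u \<noteq> 0" using u n1 by auto
    let ?v = "z + u" and ?y = "k * u"
    have y': "?y \<noteq> 0" using u1 k0 by simp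
    note c = AB_change_s(2,3)[OF keq y' u1(2)]
    have "4 / e \<le> norm u" using u by simp
    then have "norm u / 2 > 1 / e" using e(1) by (simp add: field_simps)
    then have "norm ?v > 1 / e" using n1 by linarith
    then have d: "dist (1 / ?v) 0 < e" using e(1) u1 by (simp add: norm_divide field_simps)
    have "dist z z < e" "?y / ?v \<noteq> 0" using e(1) y' u1 by simp_all
    from e(2)[OF this(1) d c(2) this(2)] have "norm (B \<mu> False z (1 / ?v) (?y / ?v)) \<le> K"
      using norm_ge_zero[of "A \<mu> False z (1 / ?v) (?y / ?v)"] by linarith
    moreover have "u * f u = (u / ?v) ^ 4 * B \<mu> False z (1 / ?v) (?y / ?v)"
      using u1 by (simp add: f(2) F_def c(1) power_divide eval_nat_numeral)
    moreover have "norm (u / ?v) \<le> 2" using n1 u1 by (simp add: norm_divide field_simps)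
    ultimately have "norm (u * f u) \<le> 2 ^ 4 * K"
      by (simp only: norm_mult[of "(u / ?v) ^ 4"] norm_power) (intro mult_mono power_mono; simp)
    then show "norm (u * f u) \<le> 2 ^ 4 * K * norm u ^ 0" by simp
  qed
  then have "u0 * f u0 = 0" by simp
  then have "F u0 = 0" using u0 f(2) by simp
  then show ?thesis using u0 unfolding F_def k_def by simp
qed

lemma root_growth:
  assumes "y ^ 4 = g u z" "norm z \<ge> 1"
  shows "norm y \<le> (5 + 5 * norm u ^ 4) * norm z ^ 1"
proof -
  have z4: "1 \<le> norm z ^ 4" using assms(2) by (rule one_le_power)
  have "norm (g u z) \<le> (1 + norm z ^ 4 * norm u ^ 4) + 4 * (norm z ^ 4 + norm u ^ 4)"
    unfolding g_def norm_mult[of 4] by (intro norm_triangle_le add_mono mult_mono) (simp_all add: norm_mult norm_power norm_triangle_le)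
  also have "\<dots> \<le> norm z ^ 4 + norm z ^ 4 * norm u ^ 4 + 4 * (norm z ^ 4 + norm z ^ 4 * norm u ^ 4)"
    using z4 mult_right_mono[OF z4 zero_le_power[OF norm_ge_zero], of u 4] unfolding distrib_left mult_1 by linarith
  also have "\<dots> = (5 + 5 * norm u ^ 4) * norm z ^ 4" by (simp add: algebra_simps)
  finally show ?thesis using root_le[OF assms(1)] by simp
qed

text \<open>Along \<open>s = z + u\<close> the branch polynomial is
  \<open>(u ^ 4 + 4) * z ^ 4 + (1 + 4 * u ^ 4)\<close>. The last two conditions give it four
  distinct zeros; the first one keeps \<open>qcoord\<close>, which is \<open>z * u\<close>, from
  vanishing identically.\<close>

definition generic :: "complex \<Rightarrow> bool" where "generic u \<longleftrightarrow> u \<noteq> 0 \<and> u ^ 4 \<noteq> - 4 \<and> u ^ 4 \<noteq> - 1 / 4"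

text \<open>Coefficients in the mirrored piece, where the end of the curve at infinite
  \<open>z\<close> becomes the point \<open>(0, 1 / u)\<close>.\<close>

abbreviation A' where "A' u z y \<equiv> A True True (1 / z) ((z + u) / (z * u)) (y / (z * u))"
abbreviation B' where "B' u z y \<equiv> B True True (1 / z) ((z + u) / (z * u)) (y / (z * u))"

lemma mirror:
  assumes "y ^ 4 = g u z" "y \<noteq> 0" "z \<noteq> 0" "u \<noteq> 0"
  shows "A False True z (z + u) y = - (A' u z y / z\<^sup>2 + B' u z y * (z + u) * (\<tau> * (z + u) - 2 * z) / (z * u)\<^sup>2) / (z * u)\<^sup>2"
    and "B False True z (z + u) y = - (B' u z y * z\<^sup>2 / (z * u) ^ 4)"
    and "(y / (z * u)) ^ 4 = pbranch True \<tau> (1 / z) ((z + u) / (z * u))"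
    and "(z + u) / (z * u) = 1 / z + 1 / u"
proof -
  have q0: "qcoord \<tau> z 1 (z + u) \<noteq> 0" unfolding qcoord_1 using assms by simp
  have eq: "y ^ 4 = pbranch True \<tau> z (z + u)" unfolding branch_1 by (rule assms(1))
  note ch = AB_change_z[OF eq assms(2,3) q0, unfolded qcoord_1]
  show "A False True z (z + u) y = - (A' u z y / z\<^sup>2 + B' u z y * (z + u) * (\<tau> * (z + u) - 2 * z) / (z * u)\<^sup>2) / (z * u)\<^sup>2"
    "B False True z (z + u) y = - (B' u z y * z\<^sup>2 / (z * u) ^ 4)" using ch(1,2)[of False] by simp_all
  show "(y / (z * u)) ^ 4 = pbranch True \<tau> (1 / z) ((z + u) / (z * u))" by (rule ch(3))
  show "(z + u) / (z * u) = 1 / z + 1 / u" using assms(3,4) by (simp add: field_simps)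
qed

text \<open>The limit point \<open>(0, 1 / u)\<close> lies off the branch curve because
  \<open>u ^ 4 \<noteq> - 4\<close>, so \<open>AB_bounded\<close> applies there.\<close>

lemma bounded_at_infinity:
  assumes u: "generic u"
  obtains R K where "R \<ge> 1" "\<And>z y. norm z \<ge> R \<Longrightarrow> y ^ 4 = g u z \<Longrightarrow> y \<noteq> 0 \<Longrightarrow> norm (A' u z y) + norm (B' u z y) \<le> K"
proof -
  have u0: "u \<noteq> 0" using u by (simp add: generic_def)
  have "g (1 / u) 0 \<noteq> 0"
  proof
    assume "g (1 / u) 0 = 0"
    then have "u ^ 4 + 4 = 0" using u0 by (simp add: g_def power_divide field_simps)
    then show False using u by (simp add: generic_def eq_neg_iff_add_eq_0)
  qed
  then have "pbranch True \<tau> 0 (1 / u) \<noteq> 0" using branch_1[of 0 "1 / u"] by simp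
  then obtain e K where e: "e > 0" "\<And>z v y. dist z 0 < e \<Longrightarrow> dist v (1 / u) < e \<Longrightarrow> y ^ 4 = pbranch True \<tau> z v \<Longrightarrow> y \<noteq> 0 \<Longrightarrow>
    norm (A True True z v y) + norm (B True True z v y) \<le> K" using AB_bounded[of True 0 "1 / u" True] unfolding near_fibre_def by blast
  show ?thesis
  proof (rule that[of "max 1 (2 / e)"])
    fix z y assume z: "max 1 (2 / e) \<le> norm z" and eq: "y ^ 4 = g u z" and y: "y \<noteq> 0"
    have z0: "z \<noteq> 0" using z by auto
    have "2 / e \<le> norm z" using z by simp
    then have "norm z > 1 / e" using e(1) by (simp add: field_simps)
    then have "norm (1 / z) < e" using e(1) z0 by (simp add: norm_divide field_simps)
    then show "norm (A' u z y) + norm (B' u z y) \<le> K"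
      using mirror(3,4)[OF eq y z0 u0] z0 u0 y by (intro e(2)) (simp_all add: dist_norm)
  qed simp
qed

lemma zeros_g:
  assumes u: "generic u"
  shows "finite {z. g u z = 0}" "card {z. g u z = 0} = 4"
proof -
  have a: "u ^ 4 + 4 \<noteq> 0" "1 + 4 * u ^ 4 \<noteq> 0"
    using u by (auto simp: generic_def eq_neg_iff_add_eq_0 add.commute field_simps)
  have "g u z = 0 \<longleftrightarrow> z ^ 4 = - (1 + 4 * u ^ 4) / (u ^ 4 + 4)" for z
  proof -
    have "g u z = z ^ 4 * (u ^ 4 + 4) + (1 + 4 * u ^ 4)" unfolding g_def by (simp add: algebra_simps)
    moreover have "z ^ 4 = - (1 + 4 * u ^ 4) / (u ^ 4 + 4) \<longleftrightarrow> z ^ 4 * (u ^ 4 + 4) = - (1 + 4 * u ^ 4)"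
      by (rule nonzero_eq_divide_eq[OF a(1)])
    ultimately show ?thesis by (simp only: eq_neg_iff_add_eq_0)
  qed
  then have e: "{z. g u z = 0} = {z. z ^ 4 = - (1 + 4 * u ^ 4) / (u ^ 4 + 4)}" by simp
  have nz: "- (1 + 4 * u ^ 4) / (u ^ 4 + 4) \<noteq> 0" using a by (simp del: minus_add_distrib)
  show "finite {z. g u z = 0}" unfolding e by (rule finite_fourth_roots)
  show "card {z. g u z = 0} = 4" unfolding e by (rule card_fourth_roots[OF nz])
qed

text \<open>\<open>y\<close> grows like \<open>z\<close> and \<open>B\<close> decays like
  \<open>1 / z\<^sup>2\<close>, so the traces of \<open>y ^ 6 * B\<close> have degree at most
  \<open>6 + 3 - 2 = 7\<close>. They vanish at the eight points with \<open>z ^ 4 = - 1 / 4\<close>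
  or \<open>z ^ 4 = - 4\<close>.\<close>

lemma B_zero:
  assumes u: "generic u" and eq: "y ^ 4 = g u z" and y: "y \<noteq> 0"
  shows "B False True z (z + u) y = 0"
proof -
  have u0: "u \<noteq> 0" using u by (simp add: generic_def)
  interpret c: cover_function "g u" "\<lambda>z y. y ^ 6 * val False True 0 z (z + u) y (vec2 0 1)"
    using cover_val_6[of "\<lambda>z. z" "\<lambda>z. z + u" "vec2 0 1"] zeros_g(1)[OF u] by (simp add: branch_1 E_def holomorphic_intros)
  obtain R K where R: "R \<ge> 1" "\<And>z y. norm z \<ge> R \<Longrightarrow> y ^ 4 = g u z \<Longrightarrow> y \<noteq> 0 \<Longrightarrow> norm (A' u z y) + norm (B' u z y) \<le> K"
    by (rule bounded_at_infinity[OF u]) blast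
  have "y ^ 6 * B False True z (z + u) y = 0"
    unfolding B_def
  proof (rule c.zero_if_many_zeros[OF _ _ _ _ eq y, where Z = "{z. z ^ 4 = - 1 / 4} \<union> {z. z ^ 4 = - 4}"])
    fix j :: nat and z y assume j: "j < 4" and z: "R \<le> norm z" and eq: "y ^ 4 = g u z" and y: "y \<noteq> 0"
    have z1: "norm z \<ge> 1" "z \<noteq> 0" using z R(1) by auto
    have "norm z ^ 2 * norm (B False True z (z + u) y) = norm (B' u z y) / norm u ^ 4"
      unfolding mirror(2)[OF eq y z1(2) u0] using z1(2) u0 by (simp add: norm_mult norm_divide norm_power power_mult_distrib field_simps eval_nat_numeral)
    also have "\<dots> \<le> K / norm u ^ 4" using R(2)[OF z eq y] norm_ge_zero[of "A' u z y"] by (intro divide_right_mono) (linarith, simp)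
    finally show "norm (y ^ j * (y ^ 6 * val False True 0 z (z + u) y (vec2 0 1))) \<le> (5 + 5 * norm u ^ 4) ^ (6 + 3) * (K / norm u ^ 4) * norm z ^ 7"
      by (intro power_growth[OF root_growth[OF eq z1(1)], where a = 2] j z1(1)) (simp_all add: B_def add_increasing2)
  next
    show "finite ({z :: complex. z ^ 4 = - 1 / 4} \<union> {z. z ^ 4 = - 4})" by (simp add: finite_fourth_roots)
    have "card ({z :: complex. z ^ 4 = - 1 / 4} \<union> {z. z ^ 4 = - 4}) = 4 + 4"
      by (subst card_Un_disjoint) (auto simp: finite_fourth_roots card_fourth_roots)
    then show "7 < card ({z :: complex. z ^ 4 = - 1 / 4} \<union> {z. z ^ 4 = - 4})" by simp
  next
    fix z :: complex assume "z \<in> {z. z ^ 4 = - 1 / 4} \<union> {z. z ^ 4 = - 4}"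
    then consider "z ^ 4 = - 1 / 4" | "z ^ 4 = - 4" by blast
    then have "g u z \<noteq> 0 \<and> (\<forall>y. y ^ 4 = g u z \<longrightarrow> y ^ 6 * B False True z (z + u) y = 0)"
    proof cases
      case 1
      have "g u z = 15 / 4 * u ^ 4" unfolding g_def 1 by (simp add: field_simps)
      also have "\<dots> \<noteq> 0" using u0 by simp
      finally have nz: "g u z \<noteq> 0" .
      have "y ^ 6 * B False True z (z + u) y = 0" if "y ^ 4 = g u z" for y
        using B_lines[OF 1 that] by (cases "y = 0") auto
      then show ?thesis using nz by blast
    next
      case 2
      have p: "g u z = - 15" unfolding g_def 2 by simp
      have z0: "z \<noteq> 0" using 2 by auto
      \<comment> \<open>In the mirrored piece the fibre lies over a value to which
        \<open>B_lines\<close> applies.\<close>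
      have 3: "(1 / z) ^ 4 = - 1 / 4" using 2 by (simp add: power_divide)
      have "B False True z (z + u) y = 0" if eq: "y ^ 4 = g u z" for y
      proof -
        have y: "y \<noteq> 0" using eq p by auto
        note m = mirror[OF eq y z0 u0]
        have "B' u z y = 0" unfolding m(4)
          by (rule B_lines[OF 3]) (use m(3) y z0 u0 in \<open>auto simp: m(4) branch_1\<close>)
        then show ?thesis using m(2) by simp
      qed
      then show ?thesis using p by simp
    qed
    then show "(g u z \<noteq> 0 \<and> (\<forall>y. y ^ 4 = g u z \<longrightarrow> y ^ 6 * val False True 0 z (z + u) y (vec2 0 1) = 0)) \<or>
      (g u z = 0 \<and> (\<exists>K. near_root (g u) z (\<lambda>w y. norm (y ^ 6 * val False True 0 w (w + u) y (vec2 0 1)) \<le> K * norm y)))"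
      unfolding B_def ..
  qed
  then show ?thesis using y by simp
qed

text \<open>In \<open>AB_solve\<close> with \<open>c = 1\<close>, \<open>B = D * yv\<^sup>2\<close>
  vanishes only if \<open>D\<close> does, and then \<open>A = C * yv\<close> has a pole of order
  three instead of six. The vanishing of \<open>B\<close> enters as a guard because
  \<open>B_zero\<close> covers generic \<open>u\<close> only.\<close>

lemma y3_A_bounded:
  assumes "pbranch_v True \<tau> z0 v0 \<noteq> 0 \<or> pbranch True \<tau> z0 v0 \<noteq> 0"
  shows "\<exists>K. near_fibre True z0 v0 (\<lambda>z v y. (if B \<mu> True z v y = 0 then norm y ^ 3 * norm (A \<mu> True z v y) else 0) \<le> K)"
proof (rule bounded_near_fibre)
  fix y0 assume eq: "y0 ^ 4 = pbranch True \<tau> z0 v0"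
  define c where "c = (if y0 = 0 then 1 else 0 :: nat)"
  have c: "c < 3" "solvable c True \<tau> z0 v0 y0" using assms eq by (auto simp: c_def solvable_def)
  obtain K where K: "K \<ge> 0" "near True z0 v0 y0 (bounds \<mu> True c K)" by (rule near_bounds[OF eq c])
  have h: "(if B \<mu> True z v y = 0 then norm y ^ 3 * norm (A \<mu> True z v y) else 0) \<le> K ^ 3 * K + K * K"
    if e: "y ^ 4 = pbranch True \<tau> z v" "y \<noteq> 0" and b: "bounds \<mu> True c K z v y" for z v y
  proof -
    have "norm y ^ 3 * norm (A \<mu> True z v y) \<le> K ^ 3 * K + K * K" if B: "B \<mu> True z v y = 0"
    proof (cases "c = 0")
      case True
      then have "norm y ^ 3 * norm (A \<mu> True z v y) \<le> K ^ 3 * K"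
        using b K(1) unfolding bounds_def A_def by (intro mult_mono power_mono) auto
      then show ?thesis using K(1) by (simp add: add_increasing2)
    next
      case False
      then have 1: "c = 1" by (simp add: c_def split: if_splits)
      have v: "pbranch_v True \<tau> z v \<noteq> 0" and sol: "solvable 1 True \<tau> z v y" using b 1 by (simp_all add: bounds_def solvable_def)
      note S = AB_solve[OF e disjI1[OF refl] sol, of \<mu>]
      have "val \<mu> True 1 z v y (vec2 0 1) = 0" using B v e(2) unfolding S(2) by simp
      then have "norm y ^ 3 * norm (A \<mu> True z v y) = norm (val \<mu> True 1 z v y (vec2 1 0)) * (norm (pbranch_v True \<tau> z v) / 4)"
        unfolding S(1) using e(2) by (simp add: norm_mult norm_divide norm_power)
      also have "\<dots> \<le> K * K" using b K(1) unfolding bounds_def 1 by (intro mult_mono) auto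
      finally show ?thesis using K(1) by (simp add: add_increasing)
    qed
    then show ?thesis using K(1) by simp
  qed
  show "\<exists>K. near True z0 v0 y0 (\<lambda>z v y. (if B \<mu> True z v y = 0 then norm y ^ 3 * norm (A \<mu> True z v y) else 0) \<le> K)"
    by - (rule exI, rule near_mono[OF K(2)], rule h; assumption)
qed

text \<open>With \<open>B = 0\<close> the function \<open>y ^ 4 * A\<close> is bounded by a multiple
  of \<open>y\<close>, so its traces vanish at the four zeros of \<open>g u\<close>. As
  \<open>A\<close> decays like \<open>1 / z ^ 4\<close>, their degree is at most
  \<open>4 + 3 - 4 = 3\<close>.\<close>

lemma A_zero:
  assumes u: "generic u" and eq: "y ^ 4 = g u z" and y: "y \<noteq> 0"
  shows "A False True z (z + u) y = 0"
proof -
  have u0: "u \<noteq> 0" using u by (simp add: generic_def)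
  have near: "\<exists>K. near_root (g u) z0 (\<lambda>z y. norm (y ^ 4 * A False True z (z + u) y) \<le> K * norm y)" for z0
  proof -
    \<comment> \<open>The derivative by \<open>v\<close> vanishes only for
      \<open>z0 ^ 4 = - 4\<close>, and there \<open>g u z0 = - 15\<close>.\<close>
    have nz: "pbranch_v True \<tau> z0 (z0 + u) \<noteq> 0 \<or> pbranch True \<tau> z0 (z0 + u) \<noteq> 0"
    proof (cases "z0 ^ 4 + 4 = 0")
      case True
      then have "z0 ^ 4 = - 4" by (simp add: eq_neg_iff_add_eq_0)
      then show ?thesis unfolding branch_1 by (simp add: g_def)
    next
      case False
      then show ?thesis using u0 by (simp add: branch_1_v)
    qed
    obtain K where "near_fibre True z0 (z0 + u) (\<lambda>z v y. (if B False True z v y = 0 then norm y ^ 3 * norm (A False True z v y) else 0) \<le> K)"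
      using y3_A_bounded[OF nz] by blast
    from near_curve[of "\<lambda>z. z" z0 "\<lambda>z. z + u", OF this]
    have n: "near_root (g u) z0 (\<lambda>z y. (if B False True z (z + u) y = 0 then norm y ^ 3 * norm (A False True z (z + u) y) else 0) \<le> K)"
      by (simp add: branch_1 holomorphic_intros)
    have "norm (y ^ 4 * A False True z (z + u) y) \<le> K * norm y"
      if e: "y ^ 4 = g u z" "y \<noteq> 0" and b: "(if B False True z (z + u) y = 0 then norm y ^ 3 * norm (A False True z (z + u) y) else 0) \<le> K" for z y
    proof -
      have "norm y ^ 3 * norm (A False True z (z + u) y) \<le> K" using b B_zero[OF u e] by simp
      from mult_right_mono[OF this norm_ge_zero[of y]] show ?thesis
        by (simp add: norm_mult norm_power eval_nat_numeral mult.commute mult.left_commute)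
    qed
    then show ?thesis using n unfolding near_root_def by meson
  qed
  interpret c: cover_function "g u" "\<lambda>z y. y ^ 4 * val False True 0 z (z + u) y (vec2 1 0)"
  proof -
    have "\<exists>K. near_root (g u) z0 (\<lambda>z y. norm (y ^ 4 * val False True 0 z (z + u) y (vec2 1 0)) \<le> K)" for z0
    proof -
      obtain e K where e: "e > 0" "\<forall>z y. dist z z0 < e \<and> y ^ 4 = g u z \<and> y \<noteq> 0 \<longrightarrow>
        norm (y ^ 4 * A False True z (z + u) y) \<le> K * norm y" using near unfolding near_root_def by blast
      have "g u holomorphic_on UNIV" unfolding g_def by (intro holomorphic_intros)
      then obtain d where d: "d > 0" "\<And>z y. dist z z0 < d \<Longrightarrow> y ^ 4 = g u z \<Longrightarrow> norm y \<le> norm (g u z0) + 2"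
        using roots_bounded[of "g u" 1 z0] by auto
      have "norm (y ^ 4 * A False True z (z + u) y) \<le> \<bar>K\<bar> * (norm (g u z0) + 2)"
        if h: "dist z z0 < min e d \<and> y ^ 4 = g u z \<and> y \<noteq> 0" for z y
      proof -
        have "norm (y ^ 4 * A False True z (z + u) y) \<le> K * norm y" using e(2) h by simp
        also have "\<dots> \<le> \<bar>K\<bar> * (norm (g u z0) + 2)" using d(2)[of z y] h by (intro mult_mono) auto
        finally show ?thesis .
      qed
      moreover have "min e d > 0" using e(1) d(1) by simp
      ultimately show ?thesis unfolding near_root_def A_def by blast
    qed
    then show "cover_function (g u) (\<lambda>z y. y ^ 4 * val False True 0 z (z + u) y (vec2 1 0))"
      using cover_val[of "\<lambda>z. z" "\<lambda>z. z + u"] zeros_g(1)[OF u] by (simp add: branch_1 holomorphic_intros)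
  qed
  obtain R K where R: "R \<ge> 1" "\<And>z y. norm z \<ge> R \<Longrightarrow> y ^ 4 = g u z \<Longrightarrow> y \<noteq> 0 \<Longrightarrow> norm (A' u z y) + norm (B' u z y) \<le> K"
    by (rule bounded_at_infinity[OF u]) blast
  have "y ^ 4 * A False True z (z + u) y = 0"
    unfolding A_def
  proof (rule c.zero_if_many_zeros[OF _ _ _ _ eq y, where Z = "{z. g u z = 0}"])
    fix j :: nat and z y assume j: "j < 4" and z: "R \<le> norm z" and eq: "y ^ 4 = g u z" and y: "y \<noteq> 0"
    have z1: "norm z \<ge> 1" "z \<noteq> 0" using z R(1) by auto
    note m = mirror[OF eq y z1(2) u0]
    have "B' u z y = 0" using m(2) B_zero[OF u eq y] z1(2) u0 by simp
    then have "norm z ^ 4 * norm (A False True z (z + u) y) = norm (A' u z y) / norm u ^ 2"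
      unfolding m(1) using z1(2) u0 by (simp add: norm_mult norm_divide norm_power power_mult_distrib field_simps eval_nat_numeral)
    also have "\<dots> \<le> K / norm u ^ 2" using R(2)[OF z eq y] norm_ge_zero[of "B' u z y"] by (intro divide_right_mono) (linarith, simp)
    finally show "norm (y ^ j * (y ^ 4 * val False True 0 z (z + u) y (vec2 1 0))) \<le> (5 + 5 * norm u ^ 4) ^ (4 + 3) * (K / norm u ^ 2) * norm z ^ 3"
      by (intro power_growth[OF root_growth[OF eq z1(1)], where a = 4] j z1(1)) (simp_all add: A_def add_increasing2)
  next
    fix z assume "z \<in> {z. g u z = 0}"
    then show "(g u z \<noteq> 0 \<and> (\<forall>y. y ^ 4 = g u z \<longrightarrow> y ^ 4 * val False True 0 z (z + u) y (vec2 1 0) = 0)) \<or>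
      (g u z = 0 \<and> (\<exists>K. near_root (g u) z (\<lambda>w y. norm (y ^ 4 * val False True 0 w (w + u) y (vec2 1 0)) \<le> K * norm y)))"
      using near[of z] unfolding A_def by simp
  qed (use zeros_g[OF u] in simp_all)
  then show ?thesis using y by simp
qed

lemma s_zero: "s = (\<lambda>c z \<xi>. 0)"
proof (rule s_zeroI[of "{}" "\<lambda>z. (\<lambda>u. z + u) ` {u. \<not> generic u}"])
  have "{u. \<not> generic u} \<subseteq> {0} \<union> {u. u ^ 4 = - 4} \<union> {u. u ^ 4 = - 1 / 4}" by (auto simp: generic_def)
  then have "finite {u. \<not> generic u}" by (rule finite_subset) (intro finite_UnI finite_fourth_roots finite.intros)
  then show "finite ((\<lambda>u. z + u) ` {u. \<not> generic u})" for z by (rule finite_imageI)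
  fix z v y \<xi> assume v: "v \<notin> (\<lambda>u. z + u) ` {u. \<not> generic u}" and y: "y \<noteq> 0" "y ^ 4 = pbranch True \<tau> z v" and \<xi>: "\<xi> \<in> E"
  have gen: "generic (v - z)" using v image_eqI[of v "\<lambda>u. z + u" "v - z" "{u. \<not> generic u}"] by auto
  have eq: "y ^ 4 = g (v - z) z" using y(2) branch_1[of z "v - z"] by simp
  show "val False True 0 z v y \<xi> = 0"
    using A_zero[OF gen eq y(1)] B_zero[OF gen eq y(1)] \<xi> unfolding A_def B_def E_def by auto
qed simp

end

section \<open>The section on the central fibre\<close>

text \<open>The form \<open>dz \<otimes> dz \<and> dv / y ^ 3\<close> in the coordinates of kind
  \<open>c\<close>, by means of \<open>4 y ^ 3 dy = P_z dz + P_v dv\<close> for the branch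
  polynomial \<open>P\<close>. On the piece \<open>s = 1\<close> the substitution of
  \<open>1 / v\<close> for \<open>v\<close> contributes the factor \<open>- v\<close>; the section
  vanishes on the preimage of the negative curve.\<close>

definition dform :: "bool \<Rightarrow> nat \<Rightarrow> complex \<Rightarrow> complex \<Rightarrow> complex \<Rightarrow> (nat \<Rightarrow> complex) \<Rightarrow> complex" where
  "dform \<nu> c z v y \<xi> = (if \<nu> then 1 else - v) *
     (if c = 0 then \<xi> 0 / y ^ 3 else if c = 1 then 4 * \<xi> 0 / pbranch_v \<nu> 0 z v
      else 4 * (pbranch_v \<nu> 0 z v * \<xi> 0 - 4 * y ^ 3 * \<xi> 1) / (pbranch_z \<nu> 0 z v)\<^sup>2)"

lemma holo_on_if: "(b \<Longrightarrow> holo_on n f U) \<Longrightarrow> (\<not> b \<Longrightarrow> holo_on n g U) \<Longrightarrow> holo_on n (\<lambda>w. if b then f w else g w) U"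
  by (cases b) simp_all

lemma holo_on_sel:
  assumes "holo_on n Y U"
  shows "holo_on n (\<lambda>w. sel_z c w (Y w)) U" "holo_on n (\<lambda>w. sel_v c w (Y w)) U" "holo_on n (\<lambda>w. sel_y c w (Y w)) U"
  unfolding sel_z_def sel_v_def sel_y_def by (intro holo_on_if holo_on_coord assms)+

locale fibre_0 = fibre_surface +
  assumes zero: "tau t = 0"
begin

text \<open>A chart of kind \<open>c\<close> as such need not satisfy \<open>solvable\<close>
  throughout, but the denominator of \<open>dform\<close> must not vanish on it.\<close>

definition charts where
  "charts = {(\<mu>, \<nu>, c, U). c < 3 \<and> good \<mu> \<nu> c t U \<and> (\<forall>z v y. y ^ 4 = pbranch \<nu> \<tau> z v \<longrightarrow> pt \<mu> \<nu> t z v y \<in> U \<longrightarrow> solvable c \<nu> \<tau> z v y)}"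

lemma charts_exists:
  assumes eq: "y ^ 4 = pbranch \<nu> \<tau> z v" and c: "c < 3" and sol: "solvable c \<nu> \<tau> z v y"
  obtains U where "(\<mu>, \<nu>, c, U) \<in> charts" "pt \<mu> \<nu> t z v y \<in> U"
proof -
  obtain U where U: "good \<mu> \<nu> c t U" "pt \<mu> \<nu> t z v y \<in> U"
    by (rule good_at[OF eq c sol])
  let ?c = "gch \<mu> \<nu> c t U"
  let ?V = "coord ?c ` (U \<inter> fib t)"
  note C = chart[OF gch_atlas[OF U(1)]]
  have V: "openC 2 ?V" using is_chart_image[OF C] by simp
  obtain Y where Y: "holo_on 2 Y ?V"
    "\<And>w. w \<in> ?V \<Longrightarrow> param ?c w = pt \<mu> \<nu> t (sel_z c w (Y w)) (sel_v c w (Y w)) (sel_y c w (Y w)) \<and>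
       sel_y c w (Y w) ^ 4 = pbranch \<nu> \<tau> (sel_z c w (Y w)) (sel_v c w (Y w))" by (rule good_root[OF U(1) c]) blast
  \<comment> \<open>The chart is shrunk to the open set where this function is nonzero, which is
    \<open>solvable\<close>.\<close>
  define G where "G w = (if c = 0 then sel_y c w (Y w) else if c = 1 then pbranch_v \<nu> \<tau> (sel_z c w (Y w)) (sel_v c w (Y w))
    else pbranch_z \<nu> \<tau> (sel_z c w (Y w)) (sel_v c w (Y w)))" for w
  note sel = holo_on_sel[OF Y(1), of c]
  have "continuous_on ?V G"
  proof -
    have p: "continuous_on ?V (\<lambda>w. (sel_z c w (Y w), sel_v c w (Y w)))"
      by (intro continuous_on_Pair holo_on_imp_continuous_on[OF sel(1)] holo_on_imp_continuous_on[OF sel(2)])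
    show ?thesis
      unfolding G_def[abs_def]
      using holo_on_imp_continuous_on[OF sel(3)] continuous_on_compose2[OF continuous_on_pbranch_deriv(1) p] continuous_on_compose2[OF continuous_on_pbranch_deriv(2) p]
      by (cases "c = 0"; cases "c = 1") simp_all
  qed
  then have "openin (top_of_set ?V) (?V \<inter> G -` (- {0}))" by (rule continuous_openin_preimage_gen) auto
  then have N: "openC 2 (?V \<inter> G -` (- {0}))" using V openin_trans by blast
  let ?W = "{x \<in> chart_dom ?c. coord ?c x \<in> ?V \<inter> G -` (- {0})}"
  have G: "G (coord ?c (pt \<mu> \<nu> t z' v' y')) \<noteq> 0 \<longleftrightarrow> solvable c \<nu> \<tau> z' v' y'" if x: "pt \<mu> \<nu> t z' v' y' \<in> U \<inter> fib t" for z' v' y'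
  proof -
    let ?w = "coord ?c (pt \<mu> \<nu> t z' v' y')"
    have "param ?c ?w = pt \<mu> \<nu> t z' v' y'" using param_coord[OF C, of "pt \<mu> \<nu> t z' v' y'"] x by simp
    then have e: "sel_z c ?w (Y ?w) = z'" "sel_v c ?w (Y ?w) = v'" "sel_y c ?w (Y ?w) = y'"
      using Y(2)[OF imageI[OF x]] pt_param by auto
    show ?thesis unfolding G_def solvable_def e by simp
  qed
  have x: "pt \<mu> \<nu> t z v y \<in> U \<inter> fib t" using U(2) pt_in_fib[OF eq] by simp
  have W: "openin (mtop X) ?W" by (rule is_chart_vimage[OF C N])
  have xW: "pt \<mu> \<nu> t z v y \<in> ?W" using x G[OF x] sol by simp
  obtain U' where U': "good \<mu> \<nu> c t U'" "pt \<mu> \<nu> t z v y \<in> U'" "U' \<inter> fib t \<subseteq> ?W"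
    by (rule good_exists[OF eq c sol W xW])
  have "solvable c \<nu> \<tau> z' v' y'" if "y' ^ 4 = pbranch \<nu> \<tau> z' v'" "pt \<mu> \<nu> t z' v' y' \<in> U'" for z' v' y'
  proof -
    have "pt \<mu> \<nu> t z' v' y' \<in> ?W" using that U'(3) pt_in_fib by blast
    then show ?thesis using G[of z' v' y'] by simp
  qed
  then have "(\<mu>, \<nu>, c, U') \<in> charts" using c U'(1) by (simp add: charts_def)
  then show ?thesis using U'(2) by (rule that)
qed

fun chart_of where "chart_of (\<mu>, \<nu>, c, U) = gch \<mu> \<nu> c t U"

fun local_form where
  "local_form (\<mu>, \<nu>, c, U) w = (let h = hom_coord (base \<mu> \<nu>) (snd (param (gch \<mu> \<nu> c t U) w))
     in dform \<nu> c (h (iz \<mu> \<nu>)) (h (iv \<mu> \<nu>)) (h (iy \<mu>)))"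

lemma local_form_pt:
  assumes "(\<mu>, \<nu>, c, U) \<in> charts" "pt \<mu> \<nu> t z v y \<in> U" "pt \<mu> \<nu> t z v y \<in> fib t"
  shows "local_form (\<mu>, \<nu>, c, U) (coord (gch \<mu> \<nu> c t U) (pt \<mu> \<nu> t z v y)) = dform \<nu> c z v y"
proof -
  have g: "good \<mu> \<nu> c t U" using assms(1) by (simp add: charts_def)
  have "param (gch \<mu> \<nu> c t U) (coord (gch \<mu> \<nu> c t U) (pt \<mu> \<nu> t z v y)) = pt \<mu> \<nu> t z v y"
    using param_coord[OF chart[OF gch_atlas[OF g]]] assms(2,3) by simp
  then show ?thesis by (simp add: pt_def hom_coord_piece piece_simps)
qed

lemma holo_local_form:
  assumes i: "(\<mu>, \<nu>, c, U) \<in> charts"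
  shows "holo_form (local_form (\<mu>, \<nu>, c, U)) (coord (gch \<mu> \<nu> c t U) ` (U \<inter> fib t))"
proof -
  have g: "good \<mu> \<nu> c t U" and c: "c < 3" using i by (simp_all add: charts_def)
  let ?c = "gch \<mu> \<nu> c t U"
  let ?V = "coord ?c ` (U \<inter> fib t)"
  obtain Y where Y: "holo_on 2 Y ?V"
    "\<And>w. w \<in> ?V \<Longrightarrow> param ?c w = pt \<mu> \<nu> t (sel_z c w (Y w)) (sel_v c w (Y w)) (sel_y c w (Y w)) \<and>
       sel_y c w (Y w) ^ 4 = pbranch \<nu> \<tau> (sel_z c w (Y w)) (sel_v c w (Y w))" by (rule good_root[OF g c]) blast
  let ?z = "\<lambda>w. sel_z c w (Y w)" and ?v = "\<lambda>w. sel_v c w (Y w)" and ?y = "\<lambda>w. sel_y c w (Y w)"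
  note sel = holo_on_sel[OF Y(1), of c]
  have P: "holo_on 2 (\<lambda>w. pbranch_z \<nu> 0 (?z w) (?v w)) ?V" "holo_on 2 (\<lambda>w. pbranch_v \<nu> 0 (?z w) (?v w)) ?V"
    unfolding pbranch_z_def pbranch_v_def branch_simps
    by (intro holo_on_if holo_on_add holo_on_diff holo_on_mult holo_on_power holo_on_const sel)+
  have sol: "solvable c \<nu> 0 (?z w) (?v w) (?y w)" if w: "w \<in> ?V" for w
  proof -
    have "param ?c w \<in> U" using param_in[of w ?c] w by simp
    then show ?thesis using i Y(2)[OF w] zero by (auto simp: charts_def)
  qed
  have h: "holo_on 2 (\<lambda>w. dform \<nu> c (?z w) (?v w) (?y w) \<xi>) ?V" for \<xi>
    unfolding dform_def
    by (intro holo_on_if holo_on_divide holo_on_diff holo_on_mult holo_on_power holo_on_uminus holo_on_const sel P)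
      (use sol c in \<open>auto simp: solvable_def\<close>)
  have "local_form (\<mu>, \<nu>, c, U) w \<xi> = dform \<nu> c (?z w) (?v w) (?y w) (vec2 1 0) * \<xi> 0 + dform \<nu> c (?z w) (?v w) (?y w) (vec2 0 1) * \<xi> 1" if "w \<in> ?V" for w \<xi>
  proof -
    have "local_form (\<mu>, \<nu>, c, U) w = dform \<nu> c (?z w) (?v w) (?y w)"
      using Y(2)[OF that] by (simp add: pt_def hom_coord_piece piece_simps)
    then show ?thesis by (simp add: dform_def algebra_simps diff_divide_distrib)
  qed
  then have "\<forall>w\<in>?V. \<forall>\<xi>. local_form (\<mu>, \<nu>, c, U) w \<xi> = dform \<nu> c (?z w) (?v w) (?y w) (vec2 1 0) * \<xi> 0 + dform \<nu> c (?z w) (?v w) (?y w) (vec2 0 1) * \<xi> 1" by blast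
  with h[of "vec2 1 0"] h[of "vec2 0 1"] show ?thesis unfolding holo_form_def by - (rule exI, rule exI, intro conjI)
qed

lemma dform_same:
  assumes "good \<mu> \<nu> 0 t U" "good \<mu> \<nu> 0 t U'" "pt \<mu> \<nu> t z v y \<in> U" "pt \<mu> \<nu> t z v y \<in> U'" "y ^ 4 = pbranch \<nu> \<tau> z v"
  shows "dform \<nu> 0 z v y = pull2 (dform \<nu> 0 z v y) (jacobian (gch \<mu> \<nu> 0 t U) (gch \<mu> \<nu> 0 t U') (coord (gch \<mu> \<nu> 0 t U) (pt \<mu> \<nu> t z v y)))"
  by (simp add: pull2_def fun_eq_iff jacobian_same[OF assms(1-4) pt_in_fib[OF assms(5)]] dform_def)

lemma dform_solve:
  assumes g: "good \<mu> \<nu> 0 t U" "(\<mu>, \<nu>, c, U') \<in> charts" and x: "pt \<mu> \<nu> t z v y \<in> U" "pt \<mu> \<nu> t z v y \<in> U'"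
    and eq: "y ^ 4 = pbranch \<nu> \<tau> z v" and y: "y \<noteq> 0"
  shows "dform \<nu> 0 z v y = pull2 (dform \<nu> c z v y) (jacobian (gch \<mu> \<nu> 0 t U) (gch \<mu> \<nu> c t U') (coord (gch \<mu> \<nu> 0 t U) (pt \<mu> \<nu> t z v y)))"
proof -
  have g': "good \<mu> \<nu> c t U'" "c < 3" and sol: "solvable c \<nu> 0 z v y" using g(2) x(2) eq zero by (auto simp: charts_def)
  have co: "coord (gch \<mu> \<nu> 0 t U) (pt \<mu> \<nu> t z v y) = vec2 z v" by (simp add: coord_gch_pt pcoord_def)
  consider "c = 0" | "c = 1" | "c = 2" using g'(2) by linarith
  then show ?thesis
  proof cases
    case 1
    then show ?thesis using dform_same[OF g(1) _ x eq] g'(1) by simp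
  next
    case 2
    then have "pbranch_v \<nu> 0 z v \<noteq> 0" using sol by (simp add: solvable_def)
    then show ?thesis using 2 zero y
      unfolding co fun_eq_iff pull2_solve[OF g(1) g'(1) disjI1[OF 2] x eq y] by (simp add: dform_def)
  next
    case 3
    then have "pbranch_z \<nu> 0 z v \<noteq> 0" using sol by (simp add: solvable_def)
    then show ?thesis using 3 zero y
      unfolding co fun_eq_iff pull2_solve[OF g(1) g'(1) disjI2[OF 3] x eq y] by (simp add: dform_def power2_eq_square field_simps)
  qed
qed

text \<open>Any chart is reached from the piece \<open>False True\<close> by at most three changes:
  mirroring, passage to \<open>s = 1\<close>, and solving for another unknown. Their pullbacks
  compose by \<open>pull2_cocycle\<close>.\<close>

lemma dform_compat:
  assumes eq: "y ^ 4 = pbranch True \<tau> z v" and nz: "y \<noteq> 0" "z \<noteq> 0" "v \<noteq> 0"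
    and o: "good False True 0 t U" "pt False True t z v y \<in> U" and i: "i \<in> charts" "pt False True t z v y \<in> chart_dom (chart_of i)"
  defines "x \<equiv> pt False True t z v y"
  shows "dform True 0 z v y = pull2 (local_form i (coord (chart_of i) x)) (jacobian (gch False True 0 t U) (chart_of i) (coord (gch False True 0 t U) x))"
proof -
  obtain \<mu> \<nu> c V where i': "i = (\<mu>, \<nu>, c, V)" by (cases i)
  have g: "good \<mu> \<nu> c t V" "c < 3" using i(1) by (auto simp: i' charts_def)
  have xV: "x \<in> V" "x \<in> fib t" using i(2) by (auto simp: i' x_def)
  \<comment> \<open>The special feature of \<tau> = 0: under mirroring,
    \<open>dz \<otimes> dz \<and> dv / y ^ 3\<close> acquires the factor
    \<open>- q / z\<^sup>2\<close>, which is 1 here.\<close>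
  have q: "qcoord \<tau> z 1 v = - z\<^sup>2" by (simp add: qcoord_def zero)
  have q0: "qcoord \<tau> z 1 v \<noteq> 0" unfolding q using nz(2) by simp
  have co: "coord (gch False True 0 t U) x = vec2 z v" unfolding x_def by (simp add: coord_gch_pt pcoord_def)
  obtain z1 v1 y1 U1 where 1: "x = pt \<mu> True t z1 v1 y1" "y1 ^ 4 = pbranch True \<tau> z1 v1" "y1 \<noteq> 0" "v1 \<noteq> 0"
    "good \<mu> True 0 t U1" "x \<in> U1"
    "dform True 0 z v y = pull2 (dform True 0 z1 v1 y1) (jacobian (gch False True 0 t U) (gch \<mu> True 0 t U1) (coord (gch False True 0 t U) x))"
  proof (cases \<mu>)
    case False
    then show ?thesis
      using that[of z v y U] eq nz o dform_same[OF o(1,1,2,2) eq] unfolding x_def by simp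
  next
    case True
    let ?q = "- z\<^sup>2"
    have e: "x = pt True True t (1 / z) (v / ?q) (y / ?q)" "(y / ?q) ^ 4 = pbranch True \<tau> (1 / z) (v / ?q)"
      using piece_change_z(1,2)[OF nz(2) q0] eq unfolding x_def pt_def q by (simp_all add: power_divide)
    have y': "y / ?q \<noteq> 0" using nz by simp
    obtain U1 where U1: "good True True 0 t U1" "pt True True t (1 / z) (v / ?q) (y / ?q) \<in> U1"
      by (rule good_at_0[OF e(2) y'])
    have pc: "pull2 \<phi> (jacobian (gch False True 0 t U) (gch True True 0 t U1) (vec2 z v)) \<xi> =
        \<phi> (vec2 (- (1 / z\<^sup>2) * \<xi> 0) (- (v * (\<tau> * v - 2 * z) / ?q\<^sup>2) * \<xi> 0 + - (z\<^sup>2 / ?q\<^sup>2) * \<xi> 1)) * (1 / ?q\<^sup>2)" for \<phi> \<xi>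
      using pull2_change_z[OF o(1), of U1 z v y \<phi> \<xi>] U1 o(2) eq nz e(1) unfolding q x_def by simp
    have "dform True 0 z v y = pull2 (dform True 0 (1 / z) (v / ?q) (y / ?q)) (jacobian (gch False True 0 t U) (gch True True 0 t U1) (vec2 z v))"
    proof
      fix \<xi>
      show "dform True 0 z v y \<xi> = pull2 (dform True 0 (1 / z) (v / ?q) (y / ?q)) (jacobian (gch False True 0 t U) (gch True True 0 t U1) (vec2 z v)) \<xi>"
        unfolding pc using nz by (simp add: dform_def field_simps eval_nat_numeral)
    qed
    then have d: "dform True 0 z v y = pull2 (dform True 0 (1 / z) (v / ?q) (y / ?q)) (jacobian (gch False True 0 t U) (gch \<mu> True 0 t U1) (coord (gch False True 0 t U) x))"
      unfolding co using True by simp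
    have "v / ?q \<noteq> 0" using nz by simp
    with e y' U1 d show ?thesis using True that[of "1 / z" "v / ?q" "y / ?q" U1] by simp
  qed
  obtain z2 v2 y2 U2 where 2: "x = pt \<mu> \<nu> t z2 v2 y2" "y2 ^ 4 = pbranch \<nu> \<tau> z2 v2" "y2 \<noteq> 0" "good \<mu> \<nu> 0 t U2" "x \<in> U2"
    "dform True 0 z1 v1 y1 = pull2 (dform \<nu> 0 z2 v2 y2) (jacobian (gch \<mu> True 0 t U1) (gch \<mu> \<nu> 0 t U2) (coord (gch \<mu> True 0 t U1) x))"
  proof (cases \<nu>)
    case True
    then show ?thesis using that[of z1 v1 y1 U1] 1 dform_same[OF 1(5,5) _ _ 1(2)] by simp
  next
    case False
    have e: "x = pt \<mu> False t z1 (1 / v1) (y1 / v1)" "(y1 / v1) ^ 4 = pbranch False \<tau> z1 (1 / v1)"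
      using piece_change_s(1)[OF 1(4), where \<mu> = \<mu> and \<nu> = True] piece_change_s(2)[OF 1(4), where \<nu> = True] 1(2)
      unfolding 1(1) pt_def by (simp_all add: power_divide)
    have y': "y1 / v1 \<noteq> 0" using 1(3,4) by simp
    obtain U2 where U2: "good \<mu> False 0 t U2" "pt \<mu> False t z1 (1 / v1) (y1 / v1) \<in> U2"
      by (rule good_at_0[OF e(2) y'])
    have "dform True 0 z1 v1 y1 = pull2 (dform False 0 z1 (1 / v1) (y1 / v1)) (jacobian (gch \<mu> True 0 t U1) (gch \<mu> False 0 t U2) (vec2 z1 v1))"
    proof
      fix \<xi>
      show "dform True 0 z1 v1 y1 \<xi> = pull2 (dform False 0 z1 (1 / v1) (y1 / v1)) (jacobian (gch \<mu> True 0 t U1) (gch \<mu> False 0 t U2) (vec2 z1 v1)) \<xi>"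
        using 1(3,4) by (subst pull2_change_s[OF 1(5) U2(1) 1(6)[unfolded 1(1)] _ 1(2,3), THEN conjunct2, THEN conjunct2])
          (use U2(2) e(1) 1(1) in \<open>simp_all add: dform_def field_simps eval_nat_numeral\<close>)
    qed
    moreover have "coord (gch \<mu> True 0 t U1) x = vec2 z1 v1" unfolding 1(1) by (simp add: coord_gch_pt pcoord_def)
    ultimately have d: "dform True 0 z1 v1 y1 = pull2 (dform \<nu> 0 z1 (1 / v1) (y1 / v1)) (jacobian (gch \<mu> True 0 t U1) (gch \<mu> \<nu> 0 t U2) (coord (gch \<mu> True 0 t U1) x))"
      using False by simp
    with e y' U2 show ?thesis using False that[of z1 "1 / v1" "y1 / v1" U2] by simp
  qed
  note A = gch_atlas[OF o(1)] gch_atlas[OF 1(5)] gch_atlas[OF 2(4)] gch_atlas[OF g(1)]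
  have D: "x \<in> chart_dom (gch False True 0 t U)" "x \<in> chart_dom (gch \<mu> True 0 t U1)" "x \<in> chart_dom (gch \<mu> \<nu> 0 t U2)"
    "x \<in> chart_dom (gch \<mu> \<nu> c t V)" using o(2) 1(6) 2(5) xV by (simp_all add: x_def)
  have "dform \<nu> 0 z2 v2 y2 = pull2 (dform \<nu> c z2 v2 y2) (jacobian (gch \<mu> \<nu> 0 t U2) (gch \<mu> \<nu> c t V) (coord (gch \<mu> \<nu> 0 t U2) x))"
    unfolding 2(1) by (rule dform_solve[OF 2(4) i(1)[unfolded i'] _ _ 2(2,3)]) (use 2(1,5) xV(1) in simp_all)
  then have "dform True 0 z v y = pull2 (dform \<nu> c z2 v2 y2) (jacobian (gch False True 0 t U) (gch \<mu> \<nu> c t V) (coord (gch False True 0 t U) x))"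
    unfolding 1(7) 2(6) by (simp only: pull2_cocycle[OF A(2,3,4) D(2,3,4)] pull2_cocycle[OF A(1,2,4) D(1,2,4)])
  moreover have "local_form i (coord (chart_of i) x) = dform \<nu> c z2 v2 y2"
    unfolding i' 2(1) chart_of.simps by (rule local_form_pt[OF i(1)[unfolded i']]) (use xV 2(1) in simp_all)
  ultimately show ?thesis by (simp add: i')
qed

text \<open>By continuity the local forms need to be compared only on the dense set of points of the
  piece \<open>False True\<close> with \<open>z\<close>, \<open>v\<close>, \<open>y\<close> nonzero,
  where \<open>dform_compat\<close> relates every chart to one reference chart.\<close>

lemma section_exists: "\<exists>s\<in>H0_sym_cotangent_canonical X 1. s \<noteq> (\<lambda>c z \<xi>. 0)"
proof -
  have ch: "chart_of i \<in> atlas X" if "i \<in> charts" for i using that gch_atlas by (cases i) (auto simp: charts_def)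
  have hf: "holo_form (local_form i) (coord (chart_of i) ` chart_dom (chart_of i))" if "i \<in> charts" for i
    using that holo_local_form by (cases i) auto
  let ?Q = "\<lambda>x. \<exists>z v y. y ^ 4 = pbranch True \<tau> z v \<and> y \<noteq> 0 \<and> z \<noteq> 0 \<and> v \<noteq> 0 \<and> x = pt False True t z v y"
  have dense: "\<exists>x\<in>W. ?Q x" if W: "openin (mtop X) W" "W \<noteq> {}" for W
  proof -
    obtain z v y where "z \<notin> {0}" "v \<notin> {0}" "y \<noteq> 0" "y ^ 4 = pbranch True \<tau> z v" "pt False True t z v y \<in> W"
      by (rule dense_pt[OF W, of "{0}" "\<lambda>_. {0}"]) auto
    then show ?thesis by blast
  qed
  obtain s where s: "s \<in> H0_sym_cotangent_canonical X 1"
    "\<And>i x. i \<in> charts \<Longrightarrow> x \<in> chart_dom (chart_of i) \<Longrightarrow> s (chart_of i) (coord (chart_of i) x) = local_form i (coord (chart_of i) x)"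
  proof (rule H0_glue[of charts chart_of local_form])
    fix x assume "x \<in> topspace (mtop X)"
    then have x: "x \<in> fib t" by simp
    then obtain L where L: "x = (t, L)" "L \<in> surface \<tau>" using in_fib[OF t] by (cases x) auto
    obtain \<mu> \<nu> z v y where p: "L = proj_point (piece \<mu> \<nu> \<tau> z v y)" "y ^ 4 = pbranch \<nu> \<tau> z v"
      using L(2) by (rule surface_pieceE)
    obtain c where "c < 3" "solvable c \<nu> \<tau> z v y" by (rule solvable_exists[OF norm_tau[OF t] p(2)])
    with p(2) obtain U where "(\<mu>, \<nu>, c, U) \<in> charts" "pt \<mu> \<nu> t z v y \<in> U" by (rule charts_exists)
    then show "\<exists>i\<in>charts. x \<in> chart_dom (chart_of i)" using x L(1) p(1)
      by (intro bexI[of _ "(\<mu>, \<nu>, c, U)"]) (simp_all add: pt_def)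
  next
    fix i j x assume i: "i \<in> charts" and j: "j \<in> charts" and x: "x \<in> chart_dom (chart_of i)" "x \<in> chart_dom (chart_of j)"
    let ?c = "chart_of i" and ?d = "chart_of j"
    let ?V = "coord ?c ` (chart_dom ?c \<inter> chart_dom ?d)"
    have "local_form i (coord ?c x) = (\<lambda>w. pull2 (local_form j (transition ?c ?d w)) (jacobian ?c ?d w)) (coord ?c x)"
    proof (rule dense_eq[OF ch[OF i] overlap_open[OF ch[OF i] ch[OF j]] _ holo_form_subset[OF hf[OF i]] pull2_holo_form[OF ch[OF i] ch[OF j] hf[OF j]] dense])
      fix x' assume x': "x' \<in> chart_dom ?c" "?Q x'" "coord ?c x' \<in> ?V"
      then obtain x'' where "x'' \<in> chart_dom ?c" "x'' \<in> chart_dom ?d" "coord ?c x' = coord ?c x''" by blast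
      then have xd: "x' \<in> chart_dom ?d" using is_chart_inj[OF chart[OF ch[OF i]]] x'(1) by (auto dest: inj_onD)
      obtain z v y where p: "y ^ 4 = pbranch True \<tau> z v" "y \<noteq> 0" "z \<noteq> 0" "v \<noteq> 0" "x' = pt False True t z v y" using x'(2) by blast
      obtain U where U: "good False True 0 t U" "pt False True t z v y \<in> U" by (rule good_at_0[OF p(1,2)])
      let ?o = "gch False True 0 t U"
      have xo: "x' \<in> chart_dom ?o" using U(2) pt_in_fib[OF p(1)] p(5) by simp
      note o = dform_compat[OF p(1-4) U, folded p(5)]
      note At = ch[OF i] gch_atlas[OF U(1)] ch[OF j]
      have "pull2 (dform True 0 z v y) (jacobian ?c ?o (coord ?c x')) = local_form i (coord ?c x')"
        unfolding o[OF i x'(1)] pull2_cocycle[OF At(1,2,1) x'(1) xo x'(1)] by (rule pull2_refl[OF At(1) x'(1) hf[OF i]])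
      moreover have "pull2 (dform True 0 z v y) (jacobian ?c ?o (coord ?c x')) = pull2 (local_form j (coord ?d x')) (jacobian ?c ?d (coord ?c x'))"
        unfolding o[OF j xd] by (rule pull2_cocycle[OF At x'(1) xo xd])
      ultimately show "local_form i (coord ?c x') = pull2 (local_form j (transition ?c ?d (coord ?c x'))) (jacobian ?c ?d (coord ?c x'))"
        unfolding transition_coord[OF ch[OF i] x'(1)] by simp
    qed (use x in auto)
    then show "local_form i (coord ?c x) = pull2 (local_form j (coord ?d x)) (jacobian ?c ?d (coord ?c x))"
      unfolding transition_coord[OF ch[OF i] x(1)] .
  qed (use ch hf in auto)
  have "fib t \<noteq> {}"
  proof -
    obtain y where "y ^ 4 = pbranch True \<tau> 0 0" using fourth_root_exists by blast
    then show ?thesis using pt_in_fib by blast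
  qed
  then obtain z v y where p: "y ^ 4 = pbranch True \<tau> z v" "y \<noteq> 0" using dense[OF openin_topspace] by auto
  have sol: "solvable 0 True \<tau> z v y" using p(2) by (simp add: solvable_def)
  obtain U where U: "(False, True, 0, U) \<in> charts" "pt False True t z v y \<in> U"
    by (rule charts_exists[OF p(1) _ sol]) simp
  have "s (gch False True 0 t U) (coord (gch False True 0 t U) (pt False True t z v y)) = dform True 0 z v y"
    using s(2)[OF U(1)] local_form_pt[OF U pt_in_fib[OF p(1)]] U(2) pt_in_fib[OF p(1)] by simp
  moreover have "dform True 0 z v y (vec2 1 0) \<noteq> 0" using p(2) by (simp add: dform_def)
  ultimately have "s (gch False True 0 t U) (coord (gch False True 0 t U) (pt False True t z v y)) (vec2 1 0) \<noteq> 0" by simp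
  then have "s \<noteq> (\<lambda>c z \<xi>. 0)" by metis
  then show ?thesis using s(1) by blast
qed

end

section \<open>Finiteness of the dimension\<close>

lemma finite_zeros_0: "finite {z. pbranch True 0 z v = 0}" "finite {v. pbranch True 0 z v = 0}"
proof -
  have e: "pbranch True 0 z v = poly [:1 + 4 * v ^ 4, 0, 16 * v\<^sup>2, 0, 8, 0, 0, 0, 1:] z"
    "pbranch True 0 z v = poly [:1 + z ^ 8 + 8 * z ^ 4, 0, 16 * z\<^sup>2, 0, 4:] v" for z v
    by (simp_all add: pbranch_def branch_def quartic_def qcoord_def algebra_simps eval_nat_numeral)
  show "finite {z. pbranch True 0 z v = 0}" unfolding e(1) by (rule poly_roots_finite) simp
  show "finite {v. pbranch True 0 z v = 0}" unfolding e(2) by (rule poly_roots_finite) simp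
qed

locale section_0 = fibre_section +
  assumes zero: "tau t = 0"
begin

lemma branch_0: "pbranch True 0 z v = 1 + z ^ 8 + 4 * v ^ 4 + 16 * v\<^sup>2 * z\<^sup>2 + 8 * z ^ 4"
  by (simp add: pbranch_def branch_def quartic_def qcoord_def flip: power_mult)

text \<open>30 is the sum of the coefficients in \<open>branch_0\<close>, and each monomial is at
  most \<open>r ^ 8 * q ^ 4\<close>.\<close>

lemma norm_branch_0:
  assumes "norm z \<le> r" "norm v \<le> q" "r \<ge> 1" "q \<ge> 1"
  shows "norm (pbranch True 0 z v) \<le> 30 * r ^ 8 * q ^ 4"
proof -
  have p: "norm z ^ i * norm v ^ j \<le> r ^ 8 * q ^ 4" if "i \<le> 8" "j \<le> 4" for i j
  proof (rule mult_mono)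
    show "norm z ^ i \<le> r ^ 8" using assms that by (intro order_trans[OF power_mono power_increasing]) auto
    show "norm v ^ j \<le> q ^ 4" using assms that by (intro order_trans[OF power_mono power_increasing]) auto
  qed (use assms in auto)
  have "norm (pbranch True 0 z v) \<le> 1 + norm z ^ 8 + 4 * norm v ^ 4 + 16 * (norm z ^ 2 * norm v ^ 2) + 8 * norm z ^ 4"
    unfolding branch_0 by (intro norm_triangle_le add_mono) (simp_all add: norm_mult norm_power)
  then show ?thesis using p[of 0 0] p[of 8 0] p[of 0 4] p[of 2 2] p[of 4 0] by simp
qed

text \<open>Along constant \<open>v\<close>, as \<open>z\<close> grows, the mirrored point tends to
  \<open>(0, 0)\<close>, off the branch curve. The coefficients decay like \<open>1 / z ^ 6\<close>
  and \<open>y\<close> grows like \<open>z\<^sup>2\<close>, so the traces have degree at most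
  \<open>2 * (6 + 3) - 6 = 12\<close>.\<close>

lemma horizontal_zero:
  assumes Z: "finite Z" "card Z > 12" and nz: "\<And>z. z \<in> Z \<Longrightarrow> pbranch True 0 z v \<noteq> 0"
    and 0: "\<And>z y. z \<in> Z \<Longrightarrow> y ^ 4 = pbranch True 0 z v \<Longrightarrow> val False True 0 z v y \<xi> = 0" and \<xi>: "\<xi> \<in> E"
    and eq: "y ^ 4 = pbranch True 0 z v" "y \<noteq> 0"
  shows "val False True 0 z v y \<xi> = 0"
proof -
  interpret c: cover_function "\<lambda>z. pbranch True \<tau> z v" "\<lambda>z y. y ^ 6 * val False True 0 z v y \<xi>"
    using finite_zeros_0 zero \<xi> by (intro cover_val_6) simp_all
  have "pbranch True \<tau> 0 0 \<noteq> 0" by (simp add: zero branch_0)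
  then obtain e K where e: "e > 0" "\<And>z v y. dist z 0 < e \<Longrightarrow> dist v 0 < e \<Longrightarrow> y ^ 4 = pbranch True \<tau> z v \<Longrightarrow> y \<noteq> 0 \<Longrightarrow>
    norm (A True True z v y) + norm (B True True z v y) \<le> K" using AB_bounded[of True 0 0 True] unfolding near_fibre_def by blast
  define q where "q = 1 + norm v"
  have M: "30 * q ^ 4 \<ge> 1" by (rule order_trans[OF one_le_power[of q 4]]) (simp_all add: q_def)
  have "y ^ 6 * val False True 0 z v y \<xi> = 0"
  proof (rule c.zero_if_many_zeros[OF _ Z _ eq(1)[folded zero] eq(2), of "max 1 (2 * q / e)" "(30 * q ^ 4) ^ (6 + 3) * (\<bar>K\<bar> + \<bar>K\<bar> * (2 * norm v))"])
    fix j :: nat and z y assume j: "j < 4" and z: "max 1 (2 * q / e) \<le> norm z" and eq: "y ^ 4 = pbranch True \<tau> z v" and y: "y \<noteq> 0"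
    have z1: "norm z \<ge> 1" and z0: "z \<noteq> 0" using z by auto
    have q: "qcoord \<tau> z 1 v = - z\<^sup>2" by (simp add: qcoord_def zero)
    have q0: "qcoord \<tau> z 1 v \<noteq> 0" unfolding q using z0 by simp
    have y': "y / - z\<^sup>2 \<noteq> 0" using y z0 by simp
    note ch = AB_change_z(1,2)[OF eq y z0 q0, unfolded q, of False] AB_change_z(3)[OF eq y z0 q0, unfolded q]
    let ?A = "A True True (1 / z) (v / - z\<^sup>2) (y / - z\<^sup>2)" and ?B = "B True True (1 / z) (v / - z\<^sup>2) (y / - z\<^sup>2)"
    have ez: "2 * q \<le> norm z * e" using z e(1) by (simp add: field_simps)
    moreover have "1 * (norm z * e) \<le> norm z * (norm z * e)" using z1 e(1) by (intro mult_right_mono) auto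
    ultimately have "1 < norm z * e" "norm v < norm z * (norm z * e)" using norm_ge_zero[of v] unfolding q_def by argo+
    then have "dist (1 / z) 0 < e" "dist (v / - z\<^sup>2) 0 < e"
      using z0 by (simp_all add: norm_divide norm_power norm_mult divide_less_eq power2_eq_square mult_ac)
    then have "norm ?A + norm ?B \<le> K" using ch(3) y' by (intro e(2)) simp_all
    then have AB: "norm ?A \<le> \<bar>K\<bar>" "norm ?B \<le> \<bar>K\<bar>" using norm_ge_zero[of ?A] norm_ge_zero[of ?B] by linarith+
    have "norm (z ^ 6 * val False True 0 z v y \<xi>) \<le> \<bar>K\<bar> + \<bar>K\<bar> * (2 * norm v)"
      using \<xi> unfolding E_def
    proof (elim insertE)
      assume "\<xi> = vec2 1 0"
      then have "z ^ 6 * val False True 0 z v y \<xi> = ?B * (2 * v / z) - ?A"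
        using ch(1) z0 by (simp add: A_def zero field_simps eval_nat_numeral)
      moreover have "norm (?B * (2 * v / z)) \<le> \<bar>K\<bar> * (2 * norm v)"
        unfolding norm_mult[of ?B] using AB z1 mult_left_mono[OF z1, of "2 * norm v"] by (intro mult_mono) (auto simp: norm_divide norm_mult divide_le_eq)
      ultimately show ?thesis using AB(1) norm_triangle_ineq4[of "?B * (2 * v / z)" ?A] by simp
    next
      assume "\<xi> = vec2 0 1"
      then have "z ^ 6 * val False True 0 z v y \<xi> = - ?B" using ch(2) z0 by (simp add: B_def field_simps eval_nat_numeral)
      then show ?thesis using AB(2) by (simp add: add_increasing2)
    qed simp
    moreover have "norm y \<le> (30 * q ^ 4) * norm z ^ 2"
      using norm_branch_0[of z "norm z" v q] z1 by (intro root_le[OF eq[unfolded zero] _ M]) (simp_all add: q_def mult_ac flip: power_mult)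
    ultimately show "norm (y ^ j * (y ^ 6 * val False True 0 z v y \<xi>)) \<le> (30 * q ^ 4) ^ (6 + 3) * (\<bar>K\<bar> + \<bar>K\<bar> * (2 * norm v)) * norm z ^ 12"
      using M z1 by (intro power_growth[where a = 6 and b = 2] j) (simp_all add: norm_mult norm_power)
  qed (use nz 0 zero in simp)
  then show ?thesis using eq(2) by simp
qed

text \<open>Along constant \<open>z\<close> the end is the point \<open>v = 0\<close> of the piece
  \<open>s = 1\<close>, off the branch curve. The coefficients decay at least like
  \<open>1 / v\<^sup>2\<close> and \<open>y\<close> grows like \<open>v\<close>, so the traces have
  degree at most \<open>6 + 3 - 2 = 7\<close>.\<close>

lemma vertical_zero:
  assumes V: "finite V" "card V > 7" and nz: "\<And>v. v \<in> V \<Longrightarrow> pbranch True 0 z v \<noteq> 0"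
    and 0: "\<And>v y. v \<in> V \<Longrightarrow> y ^ 4 = pbranch True 0 z v \<Longrightarrow> val False True 0 z v y \<xi> = 0" and \<xi>: "\<xi> \<in> E"
    and eq: "y ^ 4 = pbranch True 0 z v" "y \<noteq> 0"
  shows "val False True 0 z v y \<xi> = 0"
proof -
  interpret c: cover_function "\<lambda>v. pbranch True \<tau> z v" "\<lambda>v y. y ^ 6 * val False True 0 z v y \<xi>"
    using finite_zeros_0 zero \<xi> by (intro cover_val_6) simp_all
  have "pbranch False \<tau> z 0 \<noteq> 0" by (simp add: zero pbranch_def branch_def quartic_def qcoord_def)
  then obtain e K where e: "e > 0" "\<And>z' v y. dist z' z < e \<Longrightarrow> dist v 0 < e \<Longrightarrow> y ^ 4 = pbranch False \<tau> z' v \<Longrightarrow> y \<noteq> 0 \<Longrightarrow>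
    norm (A False False z' v y) + norm (B False False z' v y) \<le> K" using AB_bounded[of False z 0 False] unfolding near_fibre_def by blast
  define q where "q = 1 + norm z"
  have M: "30 * q ^ 8 \<ge> 1" by (rule order_trans[OF one_le_power[of q 8]]) (simp_all add: q_def)
  have "y ^ 6 * val False True 0 z v y \<xi> = 0"
  proof (rule c.zero_if_many_zeros[OF _ V _ eq(1)[folded zero] eq(2), of "max 1 (2 / e)" "(30 * q ^ 8) ^ (6 + 3) * \<bar>K\<bar>"])
    fix j :: nat and v y assume j: "j < 4" and v: "max 1 (2 / e) \<le> norm v" and eq: "y ^ 4 = pbranch True \<tau> z v" and y: "y \<noteq> 0"
    have v1: "norm v \<ge> 1" and v0: "v \<noteq> 0" using v by auto
    have y': "y / v \<noteq> 0" using y v0 by simp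
    note ch = AB_change_s(1,2)[OF eq y v0, of False] AB_change_s(3)[OF eq y v0]
    let ?A = "A False False z (1 / v) (y / v)" and ?B = "B False False z (1 / v) (y / v)"
    have "2 \<le> norm v * e" using v e(1) by (simp add: field_simps)
    then have "dist (1 / v) 0 < e" using v0 by (simp add: norm_divide divide_less_eq mult.commute)
    then have "norm ?A + norm ?B \<le> K" using e(1) ch(3) y' by (intro e(2)) simp_all
    then have AB: "norm ?A \<le> \<bar>K\<bar>" "norm ?B \<le> \<bar>K\<bar>" using norm_ge_zero[of ?A] norm_ge_zero[of ?B] by linarith+
    have "norm (v ^ 2 * val False True 0 z v y \<xi>) \<le> \<bar>K\<bar>"
      using \<xi> unfolding E_def
    proof (elim insertE)
      assume "\<xi> = vec2 1 0"
      then have "v ^ 2 * val False True 0 z v y \<xi> = - ?A" using ch(1) v0 by (simp add: A_def)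
      then show ?thesis using AB(1) by simp
    next
      assume "\<xi> = vec2 0 1"
      then have "v ^ 2 * val False True 0 z v y \<xi> = ?B / v ^ 2" using ch(2) v0 by (simp add: B_def field_simps eval_nat_numeral)
      then show ?thesis using AB(2) mult_mono[of "norm ?B" "\<bar>K\<bar>" 1 "norm v ^ 2"] one_le_power[OF v1, of 2] v0
        by (simp add: norm_divide norm_power divide_le_eq)
    qed simp
    moreover have "norm y \<le> (30 * q ^ 8) * norm v ^ 1"
      using norm_branch_0[of z q v "norm v"] v1 by (intro root_le[OF eq[unfolded zero] _ M]) (simp_all add: q_def)
    ultimately show "norm (y ^ j * (y ^ 6 * val False True 0 z v y \<xi>)) \<le> (30 * q ^ 8) ^ (6 + 3) * \<bar>K\<bar> * norm v ^ 7"
      using M v1 by (intro power_growth[where a = 2 and b = 1] j) (simp_all add: norm_mult norm_power)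
  qed (use nz 0 zero in simp)
  then show ?thesis using eq(2) by simp
qed

text \<open>\<open>horizontal_zero\<close> extends the vanishing along each row
  \<open>v \<in> V\<close>; for almost every \<open>z\<close> this provides enough zeros for
  \<open>vertical_zero\<close> on the column of \<open>z\<close>.\<close>

lemma grid_zero:
  assumes Z: "finite Z" "card Z > 12" and V: "finite V" "card V > 7"
    and nz: "\<And>z v. z \<in> Z \<Longrightarrow> v \<in> V \<Longrightarrow> pbranch True 0 z v \<noteq> 0"
    and 0: "\<And>z v y \<xi>. z \<in> Z \<Longrightarrow> v \<in> V \<Longrightarrow> y ^ 4 = pbranch True 0 z v \<Longrightarrow> \<xi> \<in> E \<Longrightarrow> val False True 0 z v y \<xi> = 0"
  shows "s = (\<lambda>c z \<xi>. 0)"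
proof (rule s_zeroI[of "\<Union>v\<in>V. {z. pbranch True 0 z v = 0}" "\<lambda>_. {}"])
  show "finite (\<Union>v\<in>V. {z. pbranch True 0 z v = 0})" using V(1) finite_zeros_0 by blast
  fix z v y \<xi> assume z: "z \<notin> (\<Union>v\<in>V. {z. pbranch True 0 z v = 0})" and y: "y \<noteq> 0" "y ^ 4 = pbranch True \<tau> z v" and \<xi>: "\<xi> \<in> E"
  have nz': "pbranch True 0 z v \<noteq> 0" if "v \<in> V" for v using z that by blast
  have "val False True 0 z v y \<xi> = 0" if v: "v \<in> V" and y: "y ^ 4 = pbranch True 0 z v" for v y
  proof -
    have "y \<noteq> 0" using y nz'[OF v] by auto
    then show ?thesis using horizontal_zero[OF Z nz 0 \<xi> y, OF _ v _ v _ \<xi>] by blast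
  qed
  then show "val False True 0 z v y \<xi> = 0"
    using vertical_zero[OF V nz' _ \<xi> y(2)[unfolded zero] y(1)] by blast
qed simp

end

text \<open>Induction on the number of functionals: \<open>V\<close> is spanned by the kernel of one
  of them together with at most one further vector.\<close>

lemma (in vector_space) finite_spanning_set:
  fixes e :: "'i \<Rightarrow> 'b \<Rightarrow> 'a"
  assumes "finite F" and lin: "\<And>i x y. e i (x + y) = e i x + e i y" "\<And>i r x. e i (scale r x) = r * e i x"
    and "subspace V" "\<And>x. x \<in> V \<Longrightarrow> (\<And>i. i \<in> F \<Longrightarrow> e i x = 0) \<Longrightarrow> x = 0"
  shows "\<exists>S. finite S \<and> V \<subseteq> span S"
  using assms(1,4,5)
proof (induction F arbitrary: V rule: finite_induct)
  case empty
  then have "V \<subseteq> span {}" by auto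
  then show ?case by blast
next
  case (insert i F)
  note lin0 = lin(2)[of _ 0 0, simplified]
  let ?V = "{x \<in> V. e i x = 0}"
  have "subspace ?V" using insert.prems(1) by (auto simp: subspace_def lin lin0)
  moreover have "x = 0" if "x \<in> ?V" "\<And>j. j \<in> F \<Longrightarrow> e j x = 0" for x using insert.prems(2)[of x] that by auto
  ultimately obtain S where S: "finite S" "?V \<subseteq> span S" using insert.IH[of ?V] by blast
  show ?case
  proof (cases "\<exists>a\<in>V. e i a \<noteq> 0")
    case True
    then obtain a where a: "a \<in> V" "e i a \<noteq> 0" by blast
    have "x \<in> span (insert a S)" if x: "x \<in> V" for x
    proof -
      let ?r = "e i x / e i a"
      have d: "x - scale ?r a \<in> V" using insert.prems(1) x a(1) by (intro subspace_diff subspace_scale)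
      have "e i (x - scale ?r a) + e i (scale ?r a) = e i x" by (simp flip: lin(1))
      then have "e i (x - scale ?r a) = 0" using a(2) by (simp add: lin(2))
      then have "x - scale ?r a \<in> span S" using d S(2) by blast
      then show ?thesis by (rule span_breakdown_eq[THEN iffD2, OF exI])
    qed
    then show ?thesis using S(1) by blast
  next
    case False
    then show ?thesis using S by blast
  qed
qed

interpretation sec: vector_space section_scale
  by (rule vector_space_section_scale)

text \<open>\<open>tau (20 / 21) = 1\<close>, so \<open>section_1\<close> applies.\<close>

lemma h0_special: "h0_sym_cotangent_canonical (fibre family fst (20 / 21)) 1 = 0"
proof -
  let ?H = "H0_sym_cotangent_canonical (fibre family fst (20 / 21)) 1"
  have "?H \<subseteq> {0}"
  proof
    fix s assume "s \<in> ?H"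
    then interpret section_1 "20 / 21" s by unfold_locales (simp_all add: tau_def)
    show "s \<in> {0}" using s_zero by (simp add: zero_fun_def)
  qed
  then have "?H \<subseteq> sec.span {}" by simp
  then have "sec.span {} = sec.span ?H" by (metis sec.span_mono sec.span_span empty_subsetI subset_antisym)
  from sec.dim_eq_card[OF this sec.independent_empty] show ?thesis by (simp add: h0_sym_cotangent_canonical_def)
qed

text \<open>Evaluation of the coefficients at all points over a 13 by 8 grid is injective by
  \<open>grid_zero\<close>, so every basis is finite; it is nonempty by
  \<open>section_exists\<close>. Both facts are needed for a nonzero \<open>dim\<close>.\<close>

lemma h0_central: "h0_sym_cotangent_canonical (fibre family fst 0) 1 \<noteq> 0"
proof -
  interpret f: fibre_0 0 by unfold_locales (simp_all add: tau_def)
  let ?H = "H0_sym_cotangent_canonical (fibre family fst 0) 1"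
  let ?P = "pbranch True 0"
  define V :: "complex set" where "V = of_nat ` {..<8}"
  have V: "finite V" "card V > 7" by (simp_all add: V_def card_image inj_on_def)
  \<comment> \<open>The columns are chosen so that the grid avoids the branch curve, as
    \<open>grid_zero\<close> requires.\<close>
  have "infinite (UNIV - (\<Union>v\<in>V. {z. ?P z v = 0}))"
    using V(1) finite_zeros_0(1) by (intro Diff_infinite_finite) (auto simp: infinite_UNIV_char_0)
  then obtain Z where Z: "finite Z" "card Z = 13" "Z \<subseteq> UNIV - (\<Union>v\<in>V. {z. ?P z v = 0})"
    using infinite_arbitrarily_large by blast
  \<comment> \<open>The same choice of chart as in \<open>val\<close>, made independently of the
    section, so that evaluation is a linear functional.\<close>
  define ch where "ch z v y = gch False True 0 0 (SOME U. good False True 0 0 U \<and> pt False True 0 z v y \<in> U)" for z v y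
  define F where "F = (SIGMA z:Z. SIGMA v:V. {y. y ^ 4 = ?P z v} \<times> E)"
  define e where "e i s = (case i of (z, v, y, \<xi>) \<Rightarrow> s (ch z v y) (pcoord 0 z v y) \<xi>)"
    for i and s :: "point local_expressions"
  have "\<exists>S. finite S \<and> ?H \<subseteq> sec.span S"
  proof (rule sec.finite_spanning_set[of F e])
    show "finite F" unfolding F_def E_def using Z(1) V(1) f.finite_fourth_roots by (intro finite_SigmaI finite_cartesian_product) auto
    show "e i (x + y) = e i x + e i y" "e i (section_scale r x) = r * e i x" for i x y r
      by (simp_all add: e_def section_scale_def split: prod.splits)
    show "sec.subspace ?H" by (rule subspace_H0_sym_cotangent_canonical)
    fix s assume s: "s \<in> ?H" and 0: "\<And>i. i \<in> F \<Longrightarrow> e i s = 0"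
    interpret s: section_0 0 s by unfold_locales (use s in \<open>simp_all add: tau_def\<close>)
    have "s = (\<lambda>c z \<xi>. 0)"
    proof (rule s.grid_zero[OF Z(1) _ V])
      show "12 < card Z" using Z(2) by simp
      show "?P z v \<noteq> 0" if "z \<in> Z" "v \<in> V" for z v using Z(3) that by blast
      show "s.val False True 0 z v y \<xi> = 0" if "z \<in> Z" "v \<in> V" "y ^ 4 = ?P z v" "\<xi> \<in> E" for z v y \<xi>
        using 0[of "(z, v, y, \<xi>)"] that by (simp add: F_def e_def ch_def s.val_def)
    qed
    then show "s = 0" by (simp add: zero_fun_def)
  qed
  then obtain S where S: "finite S" "?H \<subseteq> sec.span S" by blast
  obtain B where B: "B \<subseteq> ?H" "sec.independent B" "?H \<subseteq> sec.span B" "card B = sec.dim ?H"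
    by (rule sec.basis_exists)
  have "finite B" using sec.independent_span_bound[OF S(1) B(2)] B(1) S(2) by blast
  moreover obtain s where "s \<in> ?H" "s \<noteq> 0" using f.section_exists by (auto simp: zero_fun_def)
  then have "B \<noteq> {}" using B(3) by auto
  ultimately have "card B \<noteq> 0" by simp
  then show ?thesis unfolding h0_sym_cotangent_canonical_def B(4)[symmetric] .
qed

theorem theoremI:
  shows "\<exists>(Y :: (complex \<times> (nat \<Rightarrow> complex) set) manifold) \<pi> m.
    smooth_projective_family Y \<pi> \<and>
    \<not> (\<lambda>t. h0_sym_cotangent_canonical (fibre Y \<pi> t) m) constant_on ball 0 1"
proof (intro exI conjI)
  show "smooth_projective_family family fst" by (rule smooth_projective_family_family)
  show "\<not> (\<lambda>t. h0_sym_cotangent_canonical (fibre family fst t) 1) constant_on ball 0 1"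
  proof
    assume "(\<lambda>t. h0_sym_cotangent_canonical (fibre family fst t) 1) constant_on ball 0 1"
    then obtain c where "\<And>t. t \<in> ball 0 1 \<Longrightarrow> h0_sym_cotangent_canonical (fibre family fst t) 1 = c"
      unfolding constant_on_def by blast
    from this[of "20 / 21"] this[of 0] show False using h0_special h0_central by simp
  qed
qed

end
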